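(* (Mixed symmetric case.) Let $h$ be a positive integer, let $a_i+b_i=d_i$ with $a_i,b_i\ge0$ for $i=1,\dots,p$, let $V_A=\bigotimes_{i=1}^p\mathrm{Sym}^{a_i}V_i$, $V_B=\bigotimes_{i=1}^p\mathrm{Sym}^{b_i}V_i$, $\underline{b}=(b_1,\dots,b_p)$, and suppose $\dim(V_A^* )\ge h$. If $$N(\underline{n},\underline{b})>h+\dim(SV_{\underline{b}}^{\underline{n}}),$$ then the following $h$-identifiability criterion is effective: a tensor $T\in\bigotimes_{i=1}^p\mathrm{Sym}^{d_i}V_i$ admitting a rank-1 decomposition of length $h$ is $h$-identifiable whenever (i) $\dim\mathbb{P}(\widetilde{T}(V_A^* ))=h-1$, (ii) $\dim(\mathbb{P}(\widetilde{T}(V_A^* ))\cap SV_{\underline{b}}^{\underline{n}})=0$, and (iii) $\deg(\mathbb{P}(\widetilde{T}(V_A^* ))\cap SV_{\underline{b}}^{\underline{n}})=h$. That is, conditions (i), (ii), (iii) hold on a dense open subset of the set of tensors $T\in\bigotimes_{i=1}^p\mathrm{Sym}^{d_i}V_i$ admitting a rank-1 decomposition of length $h$. (Symmetric case.) In particular, let $s$ be an integer with $\binom{n+s}{n}\ge h>\binom{n+s-1}{n}$. If $\binom{n+d-s}{n}>h+n$, then the following criterion is effective: a polynomial $F\in k[x_0,\dots,x_n]_d$ admitting a rank-1 decomposition of length $h$ is $h$-identifiable whenever (i) $\dim H_{\partial,s}=h-1$, (ii) $\dim(H_{\partial,s}\cap V_{d-s}^n)=0$, and (iii) $\deg(H_{\partial,s}\cap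 V_{d-s}^n)=h$. That is, these three conditions hold on a dense open subset of the set of $F\in k[x_0,\dots,x_n]_d$ admitting a rank-1 decomposition of length $h$.
   Context: Here $k=\mathbb{R}$ or $k=\mathbb{C}$. $V_1,\dots,V_p$ are $k$-vector spaces with $\dim V_i=n_i+1$, $\underline{n}=(n_1,\dots,n_p)$, $d_1,\dots,d_p$ are positive integers, and $N(\underline{n},\underline{b})=\prod_{i=1}^p\binom{n_i+b_i}{n_i}=\dim V_B$. Rank one tensors in $\mathrm{Sym}^{d_1}V_1\otimes\cdots\otimes\mathrm{Sym}^{d_p}V_p$ are, up to nonzero scalar, those of the form $v_1^{d_1}\otimes\cdots\otimes v_p^{d_p}$ with $0\ne v_i\in V_i$. A rank-1 decomposition of $T$ of length $h$ is an expression $T=\lambda_1U_1+\cdots+\lambda_hU_h$ with $U_1,\dots,U_h$ linearly independent rank one tensors and $\lambda_i\in k^*$. $T$ is $h$-identifiable if it admits a rank-1 decomposition of length $h$ and this is unique up to permutation and scaling of the factors. In the symmetric case $p=1$, degree $d$ homogeneous polynomials $F\in k[x_0,\dots,x_n]_d$ are viewed as symmetric tensors; a rank-1 decomposition of length $h$ is $F=\sum_{i=1}^h\lambda_iL_i^d$ with $\lambda_i\in k^*$, $L_i$ linear forms and $L_1^d,\dots,L_h^d$ linearly independent. A criterion (sufficient condition) for $h$-identifiability is called effective if its constraints are satisfied on a dense open subset (Zariski topology) of the set of tensors admitting a rank-1 decomposition of length $h$. For $a_i+b_i=d_i$, the natural inclusion $\bigotimes_i\mathrm{Sym}^{d_i}V_i\hookrightarrow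 V_A\otimes V_B$ lets one view $T$ as a linear map $\widetilde{T}:V_A^*\to V_B$, called an $(A,B)$-flattening of $T$. $H_{\partial,s}\subseteq\mathbb{P}(k[x_0,\dots,x_n]_{d-s})$ is the linear space generated by the partial derivatives of order $s$ of $F$. $SV_{\underline{b}}^{\underline{n}}\subset\mathbb{P}(V_B)$ is the Segre-Veronese variety, the image of the map $([v_1],\dots,[v_p])\mapsto[v_1^{b_1}\otimes\cdots\otimes v_p^{b_p}]$. $V_{e}^n\subset\mathbb{P}(k[x_0,\dots,x_n]_{e})$ is the Veronese variety of $e$-th powers of linear forms. Intersections are scheme-theoretic, and $\deg$ of a zero-dimensional scheme is its length. *)

theory Defs
  imports
    "HOL-Analysis.Analysis"
    "HOL-Algebra.Ideal"
    "HOL-Library.Poly_Mapping"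
    "HOL-Library.Function_Algebras"
    "HOL-Library.Multiset"
    "HOL-Library.Extended_Real"
    "HOL-Combinatorics.Permutations"
begin

definition is_real_or_complex :: "'k::field_char_0 itself \<Rightarrow> bool" where
  "is_real_or_complex _ \<longleftrightarrow>
     (\<exists>\<phi> :: 'k \<Rightarrow> real. bij \<phi> \<and> (\<forall>x y. \<phi> (x + y) = \<phi> x + \<phi> y \<and> \<phi> (x * y) = \<phi> x * \<phi> y)) \<or>
     (\<exists>\<phi> :: 'k \<Rightarrow> complex. bij \<phi> \<and> (\<forall>x y. \<phi> (x + y) = \<phi> x + \<phi> y \<and> \<phi> (x * y) = \<phi> x * \<phi> y))"

subsection \<open>Coordinate vector spaces\<close>

text \<open>
  Every vector space below is given in coordinates: for a finite index set \<open>X\<close>, the space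
  \<open>k\<^sup>X\<close> consists of the functions that vanish outside \<open>X\<close>.
\<close>

definition coord_space :: "'x set \<Rightarrow> ('x \<Rightarrow> 'k::zero) set" where
  "coord_space X = {v. \<forall>x. x \<notin> X \<longrightarrow> v x = 0}"

definition fscale :: "'k::field \<Rightarrow> ('x \<Rightarrow> 'k) \<Rightarrow> ('x \<Rightarrow> 'k)" where
  "fscale c v = (\<lambda>x. c * v x)"

global_interpretation fvs: vector_space "fscale :: 'k::field \<Rightarrow> ('x \<Rightarrow> 'k) \<Rightarrow> ('x \<Rightarrow> 'k)"
  by unfold_locales (auto simp: fscale_def algebra_simps)

text \<open>The dimension of the projective space \<open>P(W)\<close>.\<close>

definition lin_pdim :: "('x \<Rightarrow> 'k::field) set \<Rightarrow> int" where
  "lin_pdim W = int (fvs.dim W) - 1"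

definition dual_space :: "('x \<Rightarrow> 'k::field) set \<Rightarrow> (('x \<Rightarrow> 'k) \<Rightarrow> 'k) set" where
  "dual_space V = {\<phi>. (\<forall>u\<in>V. \<forall>v\<in>V. \<phi> (u + v) = \<phi> u + \<phi> v) \<and>
                      (\<forall>c. \<forall>v\<in>V. \<phi> (fscale c v) = c * \<phi> v) \<and>
                      (\<forall>v. v \<notin> V \<longrightarrow> \<phi> v = 0)}"

subsection \<open>Polynomials and the Zariski topology\<close>

text \<open>
  A polynomial in variables of type \<open>'x\<close> maps exponent vectors (finitely supported
  functions \<open>'x \<Rightarrow>\<^sub>0 nat\<close>) to coefficients.
\<close>

type_synonym ('x, 'k) mpoly = "('x \<Rightarrow>\<^sub>0 nat) \<Rightarrow>\<^sub>0 'k"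

definition mdeg :: "('x \<Rightarrow>\<^sub>0 nat) \<Rightarrow> nat" where
  "mdeg m = (\<Sum>x\<in>Poly_Mapping.keys m. Poly_Mapping.lookup m x)"

definition polys :: "'x set \<Rightarrow> ('x, 'k::comm_ring_1) mpoly set" where
  "polys X = {f. \<forall>m\<in>Poly_Mapping.keys f. Poly_Mapping.keys m \<subseteq> X}"

definition forms :: "'x set \<Rightarrow> nat \<Rightarrow> ('x, 'k::comm_ring_1) mpoly set" where
  "forms X e = {f \<in> polys X. \<forall>m\<in>Poly_Mapping.keys f. mdeg m = e}"

definition pvar :: "'x \<Rightarrow> ('x, 'k::comm_ring_1) mpoly" where
  "pvar x = Poly_Mapping.single (Poly_Mapping.single x 1) 1"

definition pscale :: "'k::comm_ring_1 \<Rightarrow> ('x, 'k) mpoly \<Rightarrow> ('x, 'k) mpoly" where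
  "pscale c f = Poly_Mapping.single 0 c * f"

definition hom_component :: "nat \<Rightarrow> ('x, 'k::comm_ring_1) mpoly \<Rightarrow> ('x, 'k) mpoly" where
  "hom_component e f = (\<Sum>m | m \<in> Poly_Mapping.keys f \<and> mdeg m = e.
                          Poly_Mapping.single m (Poly_Mapping.lookup f m))"

definition peval :: "('x, 'k::comm_ring_1) mpoly \<Rightarrow> ('x \<Rightarrow> 'k) \<Rightarrow> 'k" where
  "peval f v = (\<Sum>m\<in>Poly_Mapping.keys f. Poly_Mapping.lookup f m *
                  (\<Prod>x\<in>Poly_Mapping.keys m. v x ^ Poly_Mapping.lookup m x))"

text \<open>The Zariski topology on \<open>k\<^sup>X\<close>, generated by the principal open sets.\<close>

definition zariski :: "'x set \<Rightarrow> ('x \<Rightarrow> 'k::field) topology" where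
  "zariski X = topology_generated_by {{v \<in> coord_space X. peval f v \<noteq> 0} | f. f \<in> polys X}"

definition dense_open_in :: "'a topology \<Rightarrow> 'a set \<Rightarrow> 'a set \<Rightarrow> bool" where
  "dense_open_in \<tau> A O' \<longleftrightarrow>
     openin (subtopology \<tau> A) O' \<and> (subtopology \<tau> A) closure_of O' = A"

subsection \<open>Closed subschemes of projective space\<close>

text \<open>
  The projective space \<open>P(k\<^sup>X)\<close> is \<open>Proj\<close> of the polynomial ring \<open>k[X]\<close>. A closed subscheme is
  given by a homogeneous ideal \<open>I\<close>, and its points are the homogeneous primes containing \<open>I\<close> but
  not the irrelevant ideal.
\<close>

definition coord_ring :: "'x set \<Rightarrow> ('x, 'k::comm_ring_1) mpoly ring" where
  "coord_ring X = \<lparr>carrier = polys X, mult = (*), one = 1, zero = 0, add = (+)\<rparr>"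

definition proj_points :: "'x set \<Rightarrow> ('x, 'k::field) mpoly set \<Rightarrow> ('x, 'k) mpoly set set" where
  "proj_points X I = {P. primeideal P (coord_ring X) \<and>
                         (\<forall>f\<in>P. \<forall>e. hom_component e f \<in> P) \<and>
                         I \<subseteq> P \<and> \<not> pvar ` X \<subseteq> P}"

text \<open>
  Krull dimension: irreducible closed subsets correspond to points of the scheme. The
  supremum over no chains at all gives the empty scheme dimension \<open>-\<infinity>\<close>.
\<close>

definition scheme_dim :: "'x set \<Rightarrow> ('x, 'k::field) mpoly set \<Rightarrow> ereal" where
  "scheme_dim X I = (SUP C \<in> {C. C \<subseteq> proj_points X I \<and> finite C \<and> C \<noteq> {} \<and> chain\<^sub>\<subseteq> C}.
                       ereal (real (card C) - 1))"

text \<open>\<open>quot_dim S J h\<close>: the vector space \<open>S / J\<close> has a basis of \<open>h\<close> elements.\<close>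

definition quot_dim :: "('x, 'k::field) mpoly set \<Rightarrow> ('x, 'k) mpoly set \<Rightarrow> nat \<Rightarrow> bool" where
  "quot_dim S J h \<longleftrightarrow>
     (\<exists>B. B \<subseteq> S \<and> finite B \<and> card B = h \<and>
          (\<forall>f\<in>S. \<exists>c. f - (\<Sum>b\<in>B. pscale (c b) b) \<in> J) \<and>
          (\<forall>c. (\<Sum>b\<in>B. pscale (c b) b) \<in> J \<longrightarrow> (\<forall>b\<in>B. c b = 0)))"

text \<open>
  The length of a zero-dimensional scheme \<open>Z\<close> is the dimension over \<open>k\<close> of its ring of global
  functions. As \<open>k\<close> is infinite, some hyperplane \<open>l = 0\<close> misses \<open>Z\<close>; then \<open>Z\<close> lies in the affine
  chart \<open>l \<noteq> 0\<close> and this ring is \<open>k[X] / (I + (l - 1))\<close>. A scheme of positive dimension meets every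
  hyperplane, so no \<open>h\<close> is its length.
\<close>

definition scheme_length :: "'x set \<Rightarrow> ('x, 'k::field) mpoly set \<Rightarrow> nat \<Rightarrow> bool" where
  "scheme_length X I h \<longleftrightarrow>
     (\<exists>l \<in> forms X 1. (\<forall>P \<in> proj_points X I. l \<notin> P) \<and>
        quot_dim (polys X) (Idl\<^bsub>coord_ring X\<^esub> (insert (l - 1) I)) h)"

text \<open>
  The homogeneous ideal of the projective variety whose affine cone is \<open>Z\<close>. For a linear
  subspace \<open>Z = W\<close> it is the ideal generated by the linear forms vanishing on \<open>W\<close>.
\<close>

definition van_ideal :: "'x set \<Rightarrow> ('x \<Rightarrow> 'k::field) set \<Rightarrow> ('x, 'k) mpoly set" where
  "van_ideal X Z = {f \<in> polys X. \<forall>v\<in>Z. peval f v = 0}"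

text \<open>The scheme-theoretic intersection of two varieties, given by the sum of their ideals.\<close>

definition inter_ideal ::
    "'x set \<Rightarrow> ('x \<Rightarrow> 'k::field) set \<Rightarrow> ('x \<Rightarrow> 'k) set \<Rightarrow> ('x, 'k) mpoly set" where
  "inter_ideal X Y Z = van_ideal X Y <+>\<^bsub>coord_ring X\<^esub> van_ideal X Z"

subsection \<open>Rank one decompositions and identifiability\<close>

text \<open>\<open>R\<close> is the set of rank one elements.\<close>

definition rank1_decomp ::
    "('x \<Rightarrow> 'k::field) set \<Rightarrow> nat \<Rightarrow> ('x \<Rightarrow> 'k) \<Rightarrow> (nat \<Rightarrow> 'k) \<Rightarrow> (nat \<Rightarrow> 'x \<Rightarrow> 'k) \<Rightarrow> bool" where
  "rank1_decomp R h T lam U \<longleftrightarrow>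
     (\<forall>i<h. lam i \<noteq> 0 \<and> U i \<in> R) \<and>
     inj_on U {..<h} \<and> \<not> fvs.dependent (U ` {..<h}) \<and>
     T = (\<Sum>i<h. fscale (lam i) (U i))"

definition has_rank1_decomp :: "('x \<Rightarrow> 'k::field) set \<Rightarrow> nat \<Rightarrow> ('x \<Rightarrow> 'k) \<Rightarrow> bool" where
  "has_rank1_decomp R h T \<longleftrightarrow> (\<exists>lam U. rank1_decomp R h T lam U)"

definition identifiable :: "('x \<Rightarrow> 'k::field) set \<Rightarrow> nat \<Rightarrow> ('x \<Rightarrow> 'k) \<Rightarrow> bool" where
  "identifiable R h T \<longleftrightarrow>
     has_rank1_decomp R h T \<and>
     (\<forall>lam U mu W. rank1_decomp R h T lam U \<and> rank1_decomp R h T mu W \<longrightarrow>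
        (\<exists>\<pi> c. \<pi> permutes {..<h} \<and>
           (\<forall>i<h. c i \<noteq> 0 \<and> W i = fscale (c i) (U (\<pi> i)) \<and> lam (\<pi> i) = mu i * c i)))"

subsection \<open>Mixed symmetric tensors\<close>

text \<open>
  The factors are numbered \<open>0, ..., p - 1\<close>, and \<open>V\<^sub>i\<close> is the space with coordinates \<open>0, ..., n i\<close>. An
  entry of a symmetric tensor depends on its index tuple only up to order, that is, on a
  multiset of indices. So an element of the tensor product of the \<open>Sym\<^sup>d\<^sup>i V\<^sub>i\<close> is a function on
  families of multisets, the \<open>i\<close>-th of which has \<open>d i\<close> elements taken from \<open>{0..n i}\<close>.
\<close>

definition midx :: "nat \<Rightarrow> (nat \<Rightarrow> nat) \<Rightarrow> (nat \<Rightarrow> nat) \<Rightarrow> (nat \<Rightarrow> nat multiset) set" where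
  "midx p n d = {J. (\<forall>i<p. size (J i) = d i \<and> set_mset (J i) \<subseteq> {..n i}) \<and> (\<forall>i\<ge>p. J i = {#})}"

definition sym_tensors ::
    "nat \<Rightarrow> (nat \<Rightarrow> nat) \<Rightarrow> (nat \<Rightarrow> nat) \<Rightarrow> ((nat \<Rightarrow> nat multiset) \<Rightarrow> 'k::field) set" where
  "sym_tensors p n d = coord_space (midx p n d)"

text \<open>The tensor with factors \<open>v\<^sub>i\<close> raised to the power \<open>d i\<close>; \<open>v i j\<close> is the \<open>j\<close>-th coordinate of \<open>v\<^sub>i\<close>.\<close>

definition power_tensor ::
    "nat \<Rightarrow> (nat \<Rightarrow> nat) \<Rightarrow> (nat \<Rightarrow> nat) \<Rightarrow> (nat \<Rightarrow> nat \<Rightarrow> 'k::field) \<Rightarrow> (nat \<Rightarrow> nat multiset) \<Rightarrow> 'k" where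
  "power_tensor p n d v = (\<lambda>J. if J \<in> midx p n d then \<Prod>i<p. \<Prod>j\<in>#J i. v i j else 0)"

definition rank1_tensors ::
    "nat \<Rightarrow> (nat \<Rightarrow> nat) \<Rightarrow> (nat \<Rightarrow> nat) \<Rightarrow> ((nat \<Rightarrow> nat multiset) \<Rightarrow> 'k::field) set" where
  "rank1_tensors p n d = {fscale c (power_tensor p n d v) | c v.
                            c \<noteq> 0 \<and> (\<forall>i<p. \<exists>j\<le>n i. v i j \<noteq> 0)}"

text \<open>The affine cone over the Segre-Veronese variety.\<close>

definition segre_veronese_cone ::
    "nat \<Rightarrow> (nat \<Rightarrow> nat) \<Rightarrow> (nat \<Rightarrow> nat) \<Rightarrow> ((nat \<Rightarrow> nat multiset) \<Rightarrow> 'k::field) set" where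
  "segre_veronese_cone p n b = {fscale c (power_tensor p n b v) | c v. \<forall>i<p. \<exists>j\<le>n i. v i j \<noteq> 0}"

text \<open>
  Under the inclusion of the tensors of degree \<open>a + b\<close> into \<open>V\<^sub>A \<otimes> V\<^sub>B\<close>, the entry at \<open>(I, J)\<close> is the
  entry of \<open>T\<close> at the concatenated index, whose multisets are the sums \<open>I i + J i\<close>. The flattening
  contracts the \<open>V\<^sub>A\<close> factor with a functional.
\<close>

definition flattening ::
    "nat \<Rightarrow> (nat \<Rightarrow> nat) \<Rightarrow> (nat \<Rightarrow> nat) \<Rightarrow> (nat \<Rightarrow> nat) \<Rightarrow> ((nat \<Rightarrow> nat multiset) \<Rightarrow> 'k::field) \<Rightarrow>
     (((nat \<Rightarrow> nat multiset) \<Rightarrow> 'k) \<Rightarrow> 'k) \<Rightarrow> (nat \<Rightarrow> nat multiset) \<Rightarrow> 'k" where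
  "flattening p n a b T \<phi> =
     (\<lambda>J. if J \<in> midx p n b
          then \<phi> (\<lambda>I. if I \<in> midx p n a then T (\<lambda>i. I i + J i) else 0) else 0)"

subsection \<open>Homogeneous polynomials\<close>

text \<open>
  \<open>k[x\<^sub>0, ..., x\<^sub>n]\<^sub>e\<close> is \<open>forms {..n} e\<close>. Its coordinates are the coefficients: the coordinate
  vector of \<open>F\<close> is its lookup function, supported on the monomials of degree \<open>e\<close>.
\<close>

definition mons :: "nat \<Rightarrow> nat \<Rightarrow> (nat \<Rightarrow>\<^sub>0 nat) set" where
  "mons n e = {m. Poly_Mapping.keys m \<subseteq> {..n} \<and> mdeg m = e}"

definition partial_deriv :: "nat \<Rightarrow> (nat, 'k::comm_ring_1) mpoly \<Rightarrow> (nat, 'k) mpoly" where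
  "partial_deriv i F = (\<Sum>m\<in>Poly_Mapping.keys F.
     Poly_Mapping.single (m - Poly_Mapping.single i 1)
       (of_nat (Poly_Mapping.lookup m i) * Poly_Mapping.lookup F m))"

fun partial_derivs :: "nat \<Rightarrow> nat \<Rightarrow> (nat, 'k::comm_ring_1) mpoly \<Rightarrow> (nat, 'k) mpoly set" where
  "partial_derivs n 0 F = {F}"
| "partial_derivs n (Suc s) F = (\<Union>i\<le>n. partial_deriv i ` partial_derivs n s F)"

text \<open>The linear space whose projectivization is the space \<open>H\<close> of partial derivatives of order \<open>s\<close>.\<close>

definition deriv_span :: "nat \<Rightarrow> nat \<Rightarrow> (nat, 'k::field) mpoly \<Rightarrow> ((nat \<Rightarrow>\<^sub>0 nat) \<Rightarrow> 'k) set" where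
  "deriv_span n s F = fvs.span (Poly_Mapping.lookup ` partial_derivs n s F)"

definition linear_powers :: "nat \<Rightarrow> nat \<Rightarrow> ((nat \<Rightarrow>\<^sub>0 nat) \<Rightarrow> 'k::field) set" where
  "linear_powers n d = {Poly_Mapping.lookup (L ^ d) | L. L \<in> forms {..n} 1 \<and> L \<noteq> 0}"

definition veronese_cone :: "nat \<Rightarrow> nat \<Rightarrow> ((nat \<Rightarrow>\<^sub>0 nat) \<Rightarrow> 'k::field) set" where
  "veronese_cone n e = {fscale c v | c v. v \<in> linear_powers n e}"

subsection \<open>Basic facts\<close>

lemma polys_mult:
  fixes f g :: "('x, 'k::comm_ring_1) mpoly"
  assumes f: "f \<in> polys X" and g: "g \<in> polys X"
  shows "f * g \<in> polys X"
proof -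
  have "Poly_Mapping.keys m \<subseteq> X" if m: "m \<in> Poly_Mapping.keys (f * g)" for m
  proof -
    obtain a b where "m = a + b" "a \<in> Poly_Mapping.keys f" "b \<in> Poly_Mapping.keys g"
      using m Poly_Mapping.keys_mult[of f g] by blast
    then show ?thesis
      using f g Poly_Mapping.keys_add[of a b] unfolding polys_def by blast
  qed
  then show ?thesis by (simp add: polys_def)
qed

lemma cring_coord_ring: "cring (coord_ring X :: ('x, 'k::comm_ring_1) mpoly ring)"
proof (rule cringI)
  show "abelian_group (coord_ring X :: ('x, 'k) mpoly ring)"
  proof (rule abelian_groupI)
    fix f :: "('x, 'k) mpoly"
    assume f: "f \<in> carrier (coord_ring X)"
    show "\<exists>y\<in>carrier (coord_ring X). y \<oplus>\<^bsub>coord_ring X\<^esub> f = \<zero>\<^bsub>coord_ring X\<^esub>"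
      using f by (intro bexI[of _ "- f"]) (auto simp: coord_ring_def polys_def)
  next
    fix f g :: "('x, 'k) mpoly"
    assume "f \<in> carrier (coord_ring X)" "g \<in> carrier (coord_ring X)"
    then show "f \<oplus>\<^bsub>coord_ring X\<^esub> g \<in> carrier (coord_ring X)"
      using Poly_Mapping.keys_add[of f g] by (auto simp: coord_ring_def polys_def)
  qed (auto simp: coord_ring_def polys_def add.assoc add.commute)
  show "comm_monoid (coord_ring X :: ('x, 'k) mpoly ring)"
    by (rule comm_monoidI) (auto simp: coord_ring_def polys_mult algebra_simps, simp add: polys_def)
qed (auto simp: coord_ring_def algebra_simps)

end

theory Submission
  imports Defs "HOL-Computational_Algebra.Fundamental_Theorem_Algebra"
begin

text \<open>
  Suppose that (i)-(iii) hold for \<open>T\<close>. The powers \<open>v\<^sup>b\<close> belonging to a decomposition of \<open>T\<close> with \<open>h\<close> terms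
  are \<open>h\<close> nonproportional vectors in the intersection, whose length is \<open>h\<close>, so any two decompositions
  involve the same points; comparing the rows of the flattening then identifies the summands.

  For effectivity it is enough to find points \<open>v\<^sub>l\<close>, \<open>l < h\<close>, such that the quadrics of the
  Segre-Veronese cone, restricted to the span of the \<open>P\<^sub>l = v\<^sub>l\<^sup>b\<close> with coordinates \<open>z\<^sub>l\<close>, generate all
  monomials of some degree \<open>m\<close> in at least two of the \<open>z\<^sub>l\<close>: this forces the intersection to be the
  reduced scheme of the \<open>[P\<^sub>l]\<close>. The condition is open in \<open>T\<close>, since the image of the flattening
  depends linearly on \<open>T\<close>, and it is dense because the decompositions are joined by rational curves.

  The points are chosen over the complex numbers with coordinates \<open>x\<^sub>e\<close> that admit derivations \<open>D\<^sub>e\<close>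
  of the field with \<open>D\<^sub>e x\<^sub>e = 1\<close> and \<open>D\<^sub>e x\<^sub>f = 0\<close> for \<open>f \<noteq> e\<close>. Let \<open>N\<close> be the dimension of the Segre-Veronese
  variety. If \<open>q = \<Sum> z\<^sub>l P\<^sub>l\<close> with \<open>r \<ge> 2\<close> nonzero coefficients lay on the cone, applying the derivations
  would place the tangent spaces at these \<open>P\<^sub>l\<close> in the sum of the tangent space at \<open>q\<close> and the span of
  the \<open>P\<^sub>l\<close>, of dimension at most \<open>N + r\<close>; by specialisation they span more. The same argument
  shows that the intersection is transversal. Hilbert's Nullstellensatz turns both facts into ideal
  membership, which a linear retraction from the complex numbers to \<open>k\<close> carries over to \<open>k\<close>.
\<close>

subsection \<open>Independent families and polynomial functions\<close>

text \<open>The geometric content is a trisecant-type statement: the span of \<open>h\<close>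
  general points of the Segre-Veronese variety meets it in these points only, each with multiplicity
  one. Derivations replace Bertini and generic smoothness: algebraically independent coordinates can
  be varied one at a time, even if they are taken from the image of the reals. The dimension count
  is this. The affine tangent space at \<open>q\<close> has dimension at most N + 1, and since
  \<open>q\<close> is a combination of the points, r - 1 of them suffice beside it, which gives N +
  r. Against this, one full tangent space contributes N + 1, a second point with one of its tangent
  directions 2, and the other points r - 2, in total N + r + 1. For r = h this configuration needs
  an ambient space of dimension at least N + h + 1, which is the numerical hypothesis. The degree m
  is fixed because in a single degree the generation of all mixed monomials becomes the independence
  of finitely many forms, which is an open condition.\<close>

definition findep :: "('i \<Rightarrow> 'x \<Rightarrow> 'k::field) \<Rightarrow> 'i set \<Rightarrow> bool" where
  "findep u S \<longleftrightarrow> (\<forall>c. (\<forall>x. (\<Sum>i\<in>S. c i * u i x) = 0) \<longrightarrow> (\<forall>i\<in>S. c i = 0))"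

lemma findepI:
  assumes "\<And>c i. (\<And>x. (\<Sum>i\<in>S. c i * u i x) = 0) \<Longrightarrow> i \<in> S \<Longrightarrow> c i = 0"
  shows "findep u S"
  using assms unfolding findep_def by blast

lemma findepD:
  assumes "findep u S" "\<And>x. (\<Sum>i\<in>S. c i * u i x) = 0" "i \<in> S"
  shows "c i = 0"
  using assms unfolding findep_def by blast

lemma findep_subset:
  assumes "findep u S" "R \<subseteq> S" "finite S"
  shows "findep u R"
proof (rule findepI)
  fix c i assume c: "\<And>x. (\<Sum>i\<in>R. c i * u i x) = 0" and i: "i \<in> R"
  have "(\<Sum>i\<in>S. (if i \<in> R then c i else 0) * u i x) = 0" for x
  proof -
    have "(\<Sum>i\<in>S. (if i \<in> R then c i else 0) * u i x) = (\<Sum>i\<in>R. c i * u i x)"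
      using assms by (intro sum.mono_neutral_cong_right) auto
    then show ?thesis using c by simp
  qed
  from findepD[OF assms(1) this, of i] i assms(2) show "c i = 0" by auto
qed

lemma findep_nonzero:
  assumes "findep u S" "i \<in> S" "finite S"
  shows "\<exists>x. u i x \<noteq> 0"
proof (rule ccontr)
  assume "\<not> ?thesis"
  then have z: "\<And>x. u i x = 0" by blast
  have "(\<Sum>j\<in>S. (if j = i then 1 else 0) * u j x) = 0" for x
    by (rule sum.neutral) (auto simp: z)
  from findepD[OF assms(1) this assms(2)] show False by simp
qed

lemma sum_fun_apply: "(\<Sum>i\<in>S. f i) x = (\<Sum>i\<in>S. f i x)"
  for f :: "'i \<Rightarrow> 'x \<Rightarrow> 'k::comm_monoid_add"
  by (induction S rule: infinite_finite_induct) auto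

lemma fvs_dim_le_card: "W \<subseteq> fvs.span B \<Longrightarrow> finite B \<Longrightarrow> fvs.dim W \<le> card B"
  by (rule fvs.dim_le_card)

lemma fvs_span_family:
  assumes "finite S"
  shows "fvs.span (u ` S) = {y. \<exists>c. \<forall>x. y x = (\<Sum>i\<in>S. c i * u i x)}" (is "_ = ?R")
proof
  have "fvs.subspace ?R"
  proof (unfold fvs.subspace_def, intro conjI ballI allI)
    show "0 \<in> ?R" by (auto intro!: exI[of _ "\<lambda>_. 0"])
  next
    fix x y assume "x \<in> ?R" "y \<in> ?R"
    then obtain c d where "\<forall>t. x t = (\<Sum>i\<in>S. c i * u i t)" "\<forall>t. y t = (\<Sum>i\<in>S. d i * u i t)" by auto
    then show "x + y \<in> ?R"
      by (auto intro!: exI[of _ "\<lambda>i. c i + d i"] simp: distrib_right sum.distrib)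
  next
    fix a x assume "x \<in> ?R"
    then obtain c where "\<forall>t. x t = (\<Sum>i\<in>S. c i * u i t)" by auto
    then show "fscale a x \<in> ?R"
      by (auto intro!: exI[of _ "\<lambda>i. a * c i"] simp: fscale_def sum_distrib_left mult.assoc)
  qed
  moreover have "u ` S \<subseteq> ?R"
  proof
    fix y assume "y \<in> u ` S"
    then obtain i where i: "i \<in> S" "y = u i" by auto
    show "y \<in> ?R"
      using i assms by (auto intro!: exI[of _ "\<lambda>j. if j = i then 1 else 0"] simp: if_distrib[of "\<lambda>z. z * _"] cong: if_cong)
  qed
  ultimately show "fvs.span (u ` S) \<subseteq> ?R" by (intro fvs.span_minimal)
next
  show "?R \<subseteq> fvs.span (u ` S)"
  proof
    fix y assume "y \<in> ?R"
    then obtain c where c: "\<forall>x. y x = (\<Sum>i\<in>S. c i * u i x)" by auto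
    then have "y = (\<Sum>i\<in>S. fscale (c i) (u i))"
      by (auto simp: fun_eq_iff sum_fun_apply fscale_def)
    then show "y \<in> fvs.span (u ` S)"
      by (simp add: fvs.span_sum fvs.span_scale fvs.span_base)
  qed
qed

text \<open>An indexed family that repeats a vector is dependent although its image may be
  independent, whence the injectivity. The translation gives access to the dimension theory of
  \<open>fvs\<close>.\<close>

lemma findep_iff:
  assumes "finite S"
  shows "findep u S \<longleftrightarrow> inj_on u S \<and> \<not> fvs.dependent (u ` S)"
proof
  assume f: "findep u S"
  have inj: "inj_on u S"
  proof (rule inj_onI, rule ccontr)
    fix i j assume ij: "i \<in> S" "j \<in> S" "u i = u j" "i \<noteq> j"
    have "(\<Sum>l\<in>S. (if l = i then 1 else if l = j then -1 else 0) * u l x) = 0" for x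
    proof -
      have "(\<Sum>l\<in>S. (if l = i then 1 else if l = j then -1 else 0) * u l x)
          = (\<Sum>l\<in>{i,j}. (if l = i then 1 else if l = j then -1 else 0) * u l x)"
        using ij assms by (intro sum.mono_neutral_right) auto
      then show ?thesis using ij by auto
    qed
    from findepD[OF f this ij(1)] show False by simp
  qed
  have "\<not> fvs.dependent (u ` S)"
  proof
    assume "fvs.dependent (u ` S)"
    then obtain q where q: "\<exists>v\<in>u ` S. q v \<noteq> 0" "(\<Sum>v\<in>u ` S. fscale (q v) v) = 0"
      using assms by (auto simp: fvs.dependent_finite)
    have "(\<Sum>i\<in>S. q (u i) * u i x) = 0" for x
      using fun_cong[OF q(2), of x] inj by (simp add: sum.reindex sum_fun_apply fscale_def)
    from findepD[OF f this] q(1) show False by auto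
  qed
  then show "inj_on u S \<and> \<not> fvs.dependent (u ` S)" using inj by simp
next
  assume a: "inj_on u S \<and> \<not> fvs.dependent (u ` S)"
  show "findep u S"
  proof (rule findepI)
    fix c i assume c: "\<And>x. (\<Sum>i\<in>S. c i * u i x) = 0" and i: "i \<in> S"
    define q where "q = (\<lambda>v. c (the_inv_into S u v))"
    have q: "q (u j) = c j" if "j \<in> S" for j
      using that a by (simp add: q_def the_inv_into_f_f)
    have "(\<Sum>v\<in>u ` S. fscale (q v) v) = 0"
      using c a by (auto simp: sum.reindex sum_fun_apply fscale_def fun_eq_iff q)
    moreover have "\<And>r. (\<Sum>v\<in>u ` S. fscale (r v) v) = 0 \<Longrightarrow> \<forall>v\<in>u ` S. r v = 0"
      using a assms by (simp add: fvs.dependent_finite) blast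
    ultimately have "\<forall>v\<in>u ` S. q v = 0" by blast
    then have "q (u i) = 0" using i by blast
    then show "c i = 0" using i q by simp
  qed
qed

lemma findep_card_le:
  assumes "findep u S" "finite S" "finite B" "u ` S \<subseteq> fvs.span B"
  shows "card S \<le> card B"
proof -
  have *: "inj_on u S" "\<not> fvs.dependent (u ` S)" using assms findep_iff by blast+
  have "card S = card (u ` S)" using * by (simp add: card_image)
  also have "\<dots> \<le> card B" using fvs.independent_span_bound[OF assms(3) *(2) assms(4)] by simp
  finally show ?thesis .
qed

lemma findep_dim_span:
  assumes "findep u S" "finite S"
  shows "fvs.dim (fvs.span (u ` S)) = card S"
proof -
  have *: "inj_on u S" "\<not> fvs.dependent (u ` S)" using assms findep_iff by blast+
  show ?thesis using fvs.dim_span_eq_card_independent[OF *(2)] *(1) by (simp add: card_image)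
qed

section \<open>Linear functionals and dual families\<close>

definition lfun :: "'x set \<Rightarrow> ('x \<Rightarrow> 'k::field) \<Rightarrow> ('x \<Rightarrow> 'k) \<Rightarrow> 'k" where
  "lfun X c y = (\<Sum>x\<in>X. c x * y x)"

lemma lfun_linear:
  "lfun X c (\<lambda>x. \<Sum>i\<in>S. a i * u i x) = (\<Sum>i\<in>S. a i * lfun X c (u i))"
  "lfun X c (\<lambda>x. y x + z x) = lfun X c y + lfun X c z"
  "lfun X c (\<lambda>x. b * y x) = b * lfun X c y"
  "lfun X c (\<lambda>x. y x - z x) = lfun X c y - lfun X c z"
proof -
  show "lfun X c (\<lambda>x. \<Sum>i\<in>S. a i * u i x) = (\<Sum>i\<in>S. a i * lfun X c (u i))"
    unfolding lfun_def sum_distrib_left by (subst sum.swap) (simp add: mult_ac)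
qed (simp_all add: lfun_def sum_distrib_left distrib_left right_diff_distrib sum.distrib
      sum_subtractf mult_ac)

text \<open>Gram-Schmidt without an inner product: the functionals found so far subtract from
  \<open>u s\<close> its part along the earlier vectors, and a coordinate in which the remainder is
  nonzero yields the new functional.\<close>

lemma findep_dual:
  assumes "finite S" "finite X" "findep u S" "\<forall>i\<in>S. u i \<in> coord_space X"
  shows "\<exists>\<xi>. \<forall>i\<in>S. \<forall>j\<in>S. lfun X (\<xi> i) (u j) = (if i = j then 1 else 0)"
  using assms(1,3,4)
proof (induction S rule: finite_induct)
  case empty
  then show ?case by simp
next
  case (insert s S)
  have "findep u S" using insert.prems(1) by (rule findep_subset) (use insert in auto)
  with insert obtain \<xi> where \<xi>: "\<forall>i\<in>S. \<forall>j\<in>S. lfun X (\<xi> i) (u j) = (if i = j then 1 else 0)" by auto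
  define r where "r = (\<lambda>y x. y x - (\<Sum>i\<in>S. lfun X (\<xi> i) y * u i x))"
  have "\<exists>x. r (u s) x \<noteq> 0"
  proof (rule ccontr)
    assume neg: "\<not> ?thesis"
    have "(\<Sum>i\<in>insert s S. (if i = s then 1 else - lfun X (\<xi> i) (u s)) * u i x) = 0" for x
    proof -
      have "(\<Sum>i\<in>S. (if i = s then 1 else - lfun X (\<xi> i) (u s)) * u i x)
          = - (\<Sum>i\<in>S. lfun X (\<xi> i) (u s) * u i x)"
        unfolding sum_negf[symmetric] using insert(2) by (intro sum.cong) auto
      moreover have "u s x = (\<Sum>i\<in>S. lfun X (\<xi> i) (u s) * u i x)"
        using neg by (simp add: r_def)
      ultimately show ?thesis using insert(1,2) by simp
    qed
    from findepD[OF insert.prems(1) this, of s] show False by simp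
  qed
  then obtain x1 where x1: "r (u s) x1 \<noteq> 0" by blast
  have x1X: "x1 \<in> X"
  proof (rule ccontr)
    assume "x1 \<notin> X"
    then have "u i x1 = 0" if "i \<in> insert s S" for i
      using insert.prems(2) that by (auto simp: coord_space_def)
    then show False using x1 by (simp add: r_def)
  qed
  define e where "e = r (u s) x1"
  define \<eta> where "\<eta> = (\<lambda>x. ((if x = x1 then 1 else 0) - (\<Sum>i\<in>S. \<xi> i x * u i x1)) / e)"
  have \<eta>: "lfun X \<eta> y = r y x1 / e" for y
  proof -
    have "lfun X \<eta> y = (\<Sum>x\<in>X. ((if x = x1 then y x else 0) - (\<Sum>i\<in>S. \<xi> i x * y x * u i x1)) / e)"
      unfolding lfun_def \<eta>_def by (rule sum.cong) (auto simp: field_simps sum_distrib_left)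
    also have "\<dots> = ((\<Sum>x\<in>X. if x = x1 then y x else 0) - (\<Sum>x\<in>X. \<Sum>i\<in>S. \<xi> i x * y x * u i x1)) / e"
      by (simp only: sum_divide_distrib[symmetric] sum_subtractf)
    also have "(\<Sum>x\<in>X. \<Sum>i\<in>S. \<xi> i x * y x * u i x1) = (\<Sum>i\<in>S. lfun X (\<xi> i) y * u i x1)"
      unfolding lfun_def by (subst sum.swap) (simp add: sum_distrib_right)
    finally show ?thesis using x1X assms(2) by (simp add: r_def)
  qed
  have rS: "r (u j) x1 = 0" if "j \<in> S" for j
  proof -
    have "(\<Sum>i\<in>S. lfun X (\<xi> i) (u j) * u i x1) = (\<Sum>i\<in>S. (if i = j then u i x1 else 0))"
      using \<xi> that by (intro sum.cong) auto
    then show ?thesis using that insert(1) by (simp add: r_def)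
  qed
  \<comment> \<open>The new functional \<eta> vanishes on the earlier vectors, so subtracting
    multiples of it corrects the old functionals at \<open>u s\<close> and changes nothing
    elsewhere.\<close>
  define \<xi>' where "\<xi>' = (\<lambda>i x. if i = s then \<eta> x else \<xi> i x - lfun X (\<xi> i) (u s) * \<eta> x)"
  have lin: "lfun X (\<xi>' i) y = lfun X (\<xi> i) y - lfun X (\<xi> i) (u s) * lfun X \<eta> y" if "i \<noteq> s" for i y
    using that unfolding \<xi>'_def lfun_def
    by (simp add: left_diff_distrib sum_subtractf sum_distrib_left mult.assoc)
  have lin': "lfun X (\<xi>' s) y = lfun X \<eta> y" for y
    unfolding \<xi>'_def by (simp add: lfun_def)
  show ?case
  proof (intro exI[of _ \<xi>'] ballI)
    fix i j assume ij: "i \<in> insert s S" "j \<in> insert s S"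
    have es: "lfun X \<eta> (u s) = 1" using x1 by (simp add: \<eta> e_def)
    have eS: "lfun X \<eta> (u j) = 0" if "j \<in> S" for j using rS[OF that] by (simp add: \<eta>)
    show "lfun X (\<xi>' i) (u j) = (if i = j then 1 else 0)"
    proof (cases "i = s")
      case True
      then show ?thesis using ij insert(2) es eS by (auto simp: lin')
    next
      case False
      then show ?thesis using ij insert(2) es eS \<xi> by (auto simp: lin)
    qed
  qed
qed

lemma findep_unit_vectors: "finite X \<Longrightarrow> findep (\<lambda>i x. if x = i then 1 else 0) X"
proof (rule findepI)
  fix c :: "'a \<Rightarrow> 'b" and i
  assume X: "finite X" and c: "\<And>x. (\<Sum>i\<in>X. c i * (if x = i then 1 else 0)) = 0" and i: "i \<in> X"
  from c[of i] show "c i = 0" using X i by (simp add: if_distrib cong: if_cong)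
qed

text \<open>The functionals \<open>c x1\<close> are the coordinates of a projection that kills the
  span of the family. If all of them vanished, every unit vector would lie in that span, against the
  cardinality.\<close>

lemma findep_annihilator:
  assumes "finite S" "finite X" "findep u S" "\<forall>i\<in>S. u i \<in> coord_space X" "card S < card X"
  shows "\<exists>c. (\<exists>x\<in>X. c x \<noteq> 0) \<and> (\<forall>i\<in>S. lfun X c (u i) = 0)"
proof -
  obtain \<xi> where \<xi>: "\<forall>i\<in>S. \<forall>j\<in>S. lfun X (\<xi> i) (u j) = (if i = j then 1 else 0)"
    using findep_dual[OF assms(1-4)] by blast
  define c where "c = (\<lambda>x1 x. (if x = x1 then 1 else 0) - (\<Sum>i\<in>S. \<xi> i x * u i x1))"
  have "\<exists>x0\<in>X. \<exists>x1\<in>X. c x1 x0 \<noteq> 0"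
  proof (rule ccontr)
    assume neg: "\<not> ?thesis"
    have "(\<lambda>i x. if x = i then 1 else 0) ` X \<subseteq> fvs.span (u ` S)"
    proof safe
      fix x0 assume x0: "x0 \<in> X"
      have "(if x = x0 then 1 else 0) = (\<Sum>i\<in>S. \<xi> i x0 * u i x)" for x
      proof (cases "x \<in> X")
        case True
        then show ?thesis using neg x0 by (auto simp: c_def) (metis)+
      next
        case False
        then have "u i x = 0" if "i \<in> S" for i using assms(4) that by (auto simp: coord_space_def)
        then show ?thesis using False x0 by auto
      qed
      then show "(\<lambda>x. if x = x0 then 1 else 0) \<in> fvs.span (u ` S)"
        unfolding fvs_span_family[OF assms(1)] by (auto intro!: exI[of _ "\<lambda>i. \<xi> i x0"])
    qed
    from findep_card_le[OF findep_unit_vectors[OF assms(2)] assms(2) _ this] assms(1)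
    have "card X \<le> card (u ` S)" by simp
    also have "\<dots> \<le> card S" using assms(1) by (rule card_image_le)
    finally show False using assms(5) by simp
  qed
  then obtain x0 x1 where x01: "x0 \<in> X" "x1 \<in> X" "c x1 x0 \<noteq> 0" by blast
  have "lfun X (c x1) (u j) = 0" if j: "j \<in> S" for j
  proof -
    have "lfun X (c x1) (u j) = (\<Sum>x\<in>X. (if x = x1 then u j x else 0)) - (\<Sum>x\<in>X. \<Sum>i\<in>S. \<xi> i x * u j x * u i x1)"
      unfolding lfun_def c_def sum_subtractf[symmetric]
      by (intro sum.cong) (auto simp: left_diff_distrib right_diff_distrib sum_distrib_right sum_distrib_left mult_ac)
    also have "(\<Sum>x\<in>X. \<Sum>i\<in>S. \<xi> i x * u j x * u i x1) = (\<Sum>i\<in>S. lfun X (\<xi> i) (u j) * u i x1)"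
      unfolding lfun_def by (subst sum.swap) (simp add: sum_distrib_right)
    also have "\<dots> = (\<Sum>i\<in>S. if i = j then u i x1 else 0)" using \<xi> j by (intro sum.cong) auto
    finally show ?thesis using x01 j assms by simp
  qed
  then show ?thesis using x01 by blast
qed

lemma findep_insert:
  assumes "finite S" "s \<notin> S" "findep u S" "\<forall>i\<in>S. lfun X c (u i) = 0" "lfun X c (u s) \<noteq> 0"
  shows "findep u (insert s S)"
proof (rule findepI)
  fix b i assume b: "\<And>x. (\<Sum>i\<in>insert s S. b i * u i x) = 0" and i: "i \<in> insert s S"
  have "0 = lfun X c (\<lambda>x. \<Sum>j\<in>insert s S. b j * u j x)" by (simp only: b) (simp add: lfun_def)
  also have "\<dots> = (\<Sum>j\<in>insert s S. b j * lfun X c (u j))" by (rule lfun_linear)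
  also have "\<dots> = b s * lfun X c (u s)" using assms by simp
  finally have bs: "b s = 0" using assms by simp
  have "(\<Sum>i\<in>S. b i * u i x) = 0" for x using b[of x] assms bs by simp
  from findepD[OF assms(3) this] bs i show "b i = 0" by auto
qed

lemma findep_cong: "(\<And>i. i \<in> S \<Longrightarrow> u i = v i) \<Longrightarrow> findep u S \<longleftrightarrow> findep v S"
  unfolding findep_def by (simp cong: sum.cong)

text \<open>Artin's argument, for a set closed under a multiplication instead of a group:
  translating the relation by \<open>g0\<close> and subtracting \<open>ch s g0\<close> times the
  relation removes the summand \<open>s\<close> and keeps the coefficient of \<open>j\<close> up to
  a nonzero factor.\<close>

lemma characters_independent:
  fixes ch :: "'i \<Rightarrow> 'g \<Rightarrow> 'k::field"
  assumes "finite S"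
    and mult: "\<And>i g g'. i \<in> S \<Longrightarrow> g \<in> G \<Longrightarrow> g' \<in> G \<Longrightarrow> ch i (m g g') = ch i g * ch i g'"
    and closed: "\<And>g g'. g \<in> G \<Longrightarrow> g' \<in> G \<Longrightarrow> m g g' \<in> G"
    and e: "e \<in> G" "\<And>i. i \<in> S \<Longrightarrow> ch i e = 1"
    and dist: "\<And>i j. i \<in> S \<Longrightarrow> j \<in> S \<Longrightarrow> i \<noteq> j \<Longrightarrow> \<exists>g\<in>G. ch i g \<noteq> ch j g"
    and zero: "\<And>g. g \<in> G \<Longrightarrow> (\<Sum>i\<in>S. c i * ch i g) = 0"
    and "i \<in> S"
  shows "c i = 0"
  using assms(1,2) e(2) dist zero \<open>i \<in> S\<close>
proof (induction S arbitrary: c i rule: finite_induct)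
  case empty
  then show ?case by simp
next
  case (insert s S)
  have S0: "c j = 0" if j: "j \<in> S" for j
  proof -
    have js: "j \<noteq> s" using j insert by auto
    obtain g0 where g0: "g0 \<in> G" "ch j g0 \<noteq> ch s g0" using insert.prems(3)[of j s] j js by auto
    have "(\<Sum>i\<in>S. (c i * (ch i g0 - ch s g0)) * ch i g) = 0" if g: "g \<in> G" for g
    proof -
      have 1: "c s * ch s g + (\<Sum>i\<in>S. c i * ch i g) = 0" using insert.prems(4)[OF g] insert by simp
      have 2: "c s * (ch s g0 * ch s g) + (\<Sum>i\<in>S. c i * (ch i g0 * ch i g)) = 0"
        using insert.prems(4)[OF closed[OF g0(1) g]] insert g g0 by simp
      have "(\<Sum>i\<in>S. (c i * (ch i g0 - ch s g0)) * ch i g)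
          = (\<Sum>i\<in>S. c i * (ch i g0 * ch i g)) - ch s g0 * (\<Sum>i\<in>S. c i * ch i g)"
        by (simp add: sum_distrib_left sum_subtractf[symmetric] algebra_simps)
      also have "\<dots> = - (c s * (ch s g0 * ch s g)) - ch s g0 * (- (c s * ch s g))"
        using 1 2 by (simp add: add_eq_0_iff2 add_eq_0_iff)
      finally show ?thesis by (simp add: algebra_simps)
    qed
    from insert.IH[OF _ _ _ this j] insert.prems have "c j * (ch j g0 - ch s g0) = 0" by auto
    then show ?thesis using g0 by simp
  qed
  have "c s * ch s e + (\<Sum>i\<in>S. c i * ch i e) = 0" using insert.prems(4)[OF e(1)] insert by simp
  then have "c s = 0" using S0 insert.prems(2)[of s] by simp
  then show ?case using S0 insert.prems by auto
qed

section \<open>Polynomial functions of one variable and open conditions\<close>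

definition polyfun :: "('k::comm_ring_1 \<Rightarrow> 'k) \<Rightarrow> bool" where
  "polyfun f \<longleftrightarrow> (\<exists>p. \<forall>t. f t = poly p t)"

lemma polyfun_const [simp]: "polyfun (\<lambda>t. c)"
  unfolding polyfun_def by (rule exI[of _ "[:c:]"]) simp

lemma polyfun_id [simp]: "polyfun (\<lambda>t. t)"
  unfolding polyfun_def by (rule exI[of _ "[:0,1:]"]) simp

lemma polyfun_add: "polyfun f \<Longrightarrow> polyfun g \<Longrightarrow> polyfun (\<lambda>t. f t + g t)"
  unfolding polyfun_def by (metis poly_add)

lemma polyfun_diff: "polyfun f \<Longrightarrow> polyfun g \<Longrightarrow> polyfun (\<lambda>t. f t - g t)"
  unfolding polyfun_def by (metis poly_diff)

lemma polyfun_mult: "polyfun f \<Longrightarrow> polyfun g \<Longrightarrow> polyfun (\<lambda>t. f t * g t)"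
  unfolding polyfun_def by (metis poly_mult)

lemma polyfun_power: "polyfun f \<Longrightarrow> polyfun (\<lambda>t. f t ^ n)"
  by (induction n) (auto intro: polyfun_mult)

lemma polyfun_sum: "(\<And>i. i \<in> S \<Longrightarrow> polyfun (f i)) \<Longrightarrow> polyfun (\<lambda>t. \<Sum>i\<in>S. f i t)"
  by (induction S rule: infinite_finite_induct) (auto intro: polyfun_add)

lemma polyfun_prod: "(\<And>i. i \<in> S \<Longrightarrow> polyfun (f i)) \<Longrightarrow> polyfun (\<lambda>t. \<Prod>i\<in>S. f i t)"
  by (induction S rule: infinite_finite_induct) (auto intro: polyfun_mult)

lemma polyfun_prod_mset: "(\<And>i. i \<in># M \<Longrightarrow> polyfun (f i)) \<Longrightarrow> polyfun (\<lambda>t. \<Prod>i\<in>#M. f i t)"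
  by (induction M) (auto intro: polyfun_mult)

lemma polyfun_if: "(P \<Longrightarrow> polyfun f) \<Longrightarrow> (\<not> P \<Longrightarrow> polyfun g) \<Longrightarrow> polyfun (\<lambda>t. if P then f t else g t)"
  by (cases P) auto

lemmas polyfun_intros = polyfun_const polyfun_id polyfun_add polyfun_diff polyfun_mult
  polyfun_power polyfun_sum polyfun_prod polyfun_prod_mset polyfun_if

lemma polyfun_finite_zeros:
  fixes f :: "'k::idom \<Rightarrow> 'k"
  assumes "polyfun f" "f a \<noteq> 0"
  shows "finite {t. f t = 0}"
proof -
  obtain p where p: "\<And>t. f t = poly p t" using assms(1) by (auto simp: polyfun_def)
  then have "p \<noteq> 0" using assms(2) by auto
  then show ?thesis using p by (simp add: poly_roots_finite)
qed

text \<open>The irreducibility of the affine line: finitely many nonzero polynomials have finitely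
  many zeros altogether. Choosing the parameter in a prescribed infinite set \<open>A\<close> makes
  it possible to keep it a natural number.\<close>

lemma polyfun_common_nonzero:
  fixes f :: "'i \<Rightarrow> 'k::idom \<Rightarrow> 'k"
  assumes "finite S" "infinite A" "\<And>i. i \<in> S \<Longrightarrow> polyfun (f i)" "\<And>i. i \<in> S \<Longrightarrow> \<exists>a. f i a \<noteq> 0"
  shows "\<exists>t\<in>A. \<forall>i\<in>S. f i t \<noteq> 0"
proof -
  have "finite (\<Union>i\<in>S. {t. f i t = 0})"
  proof (rule finite_UN_I[OF assms(1)])
    fix i assume "i \<in> S"
    then obtain a where "f i a \<noteq> 0" using assms(4) by blast
    then show "finite {t. f i t = 0}" using polyfun_finite_zeros assms(3) \<open>i \<in> S\<close> by blast
  qed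
  then have "\<not> A \<subseteq> (\<Union>i\<in>S. {t. f i t = 0})"
    using assms(2) finite_subset by blast
  then show ?thesis by auto
qed

text \<open>
  Invertibility of a matrix near the identity, as the nonvanishing of a polynomial expression in
  its entries: Gaussian elimination without divisions.
\<close>

lemma open_injective:
  fixes a :: "'i \<Rightarrow> 'i \<Rightarrow> 'p \<Rightarrow> 'k::field"
  assumes "finite S"
    and one: "(\<lambda>_. 1) \<in> F"
    and mult: "\<And>f g. f \<in> F \<Longrightarrow> g \<in> F \<Longrightarrow> (\<lambda>x. f x * g x) \<in> F"
    and diff: "\<And>f g. f \<in> F \<Longrightarrow> g \<in> F \<Longrightarrow> (\<lambda>x. f x - g x) \<in> F"
    and a: "\<And>i j. i \<in> S \<Longrightarrow> j \<in> S \<Longrightarrow> a i j \<in> F"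
    and unit: "\<And>i j. i \<in> S \<Longrightarrow> j \<in> S \<Longrightarrow> a i j x0 = (if i = j then 1 else 0)"
  shows "\<exists>\<Phi>\<in>F. \<Phi> x0 \<noteq> 0 \<and> (\<forall>x. \<Phi> x \<noteq> 0 \<longrightarrow>
           (\<forall>\<theta>. (\<forall>i\<in>S. (\<Sum>j\<in>S. a i j x * \<theta> j) = 0) \<longrightarrow> (\<forall>j\<in>S. \<theta> j = 0)))"
  using assms(1) a unit
proof (induction S arbitrary: a rule: finite_induct)
  case empty
  then show ?case using one by (intro bexI[of _ "\<lambda>_. 1"]) auto
next
  case (insert s S)
  \<comment> \<open>The Schur complement of the pivot \<open>a s s\<close>, multiplied by the pivot;
    at \<open>x0\<close> it is again the identity matrix.\<close>
  define b where "b = (\<lambda>i j x. a s s x * a i j x - a i s x * a s j x)"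
  have bF: "b i j \<in> F" if "i \<in> S" "j \<in> S" for i j
    unfolding b_def using that insert.prems(1) by (intro diff mult) auto
  have b0: "b i j x0 = (if i = j then 1 else 0)" if "i \<in> S" "j \<in> S" for i j
    unfolding b_def using that insert by (subst (1 2 3 4) insert.prems(2)) auto
  obtain \<Phi> where \<Phi>: "\<Phi> \<in> F" "\<Phi> x0 \<noteq> 0"
    "\<And>x \<theta>. \<Phi> x \<noteq> 0 \<Longrightarrow> (\<And>i. i\<in>S \<Longrightarrow> (\<Sum>j\<in>S. b i j x * \<theta> j) = 0) \<Longrightarrow> (\<forall>j\<in>S. \<theta> j = 0)"
    using insert.IH[of b] bF b0 by blast
  show ?case
  proof (intro bexI[of _ "\<lambda>x. a s s x * \<Phi> x"] conjI allI impI)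
    show "(\<lambda>x. a s s x * \<Phi> x) \<in> F" using \<Phi> insert.prems by (intro mult) auto
    show "a s s x0 * \<Phi> x0 \<noteq> 0" using \<Phi> insert.prems(2)[of s s] by simp
    fix x \<theta>
    assume x: "a s s x * \<Phi> x \<noteq> 0" and \<theta>: "\<forall>i\<in>insert s S. (\<Sum>j\<in>insert s S. a i j x * \<theta> j) = 0"
    have row: "(\<Sum>j\<in>S. a i j x * \<theta> j) = - (a i s x * \<theta> s)" if "i \<in> insert s S" for i
      using \<theta> that insert by (auto simp: eq_neg_iff_add_eq_0 add.commute)
    have "(\<Sum>j\<in>S. b i j x * \<theta> j) = 0" if i: "i \<in> S" for i
    proof -
      have "(\<Sum>j\<in>S. b i j x * \<theta> j)
          = a s s x * (\<Sum>j\<in>S. a i j x * \<theta> j) - a i s x * (\<Sum>j\<in>S. a s j x * \<theta> j)"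
        unfolding b_def by (simp add: sum_distrib_left sum_subtractf[symmetric] algebra_simps)
      then show ?thesis using row[of i] row[of s] i by (simp add: algebra_simps)
    qed
    from \<Phi>(3)[OF _ this] x have S0: "\<forall>j\<in>S. \<theta> j = 0" by auto
    then have "a s s x * \<theta> s = 0" using row[of s] by simp
    then show "\<forall>j\<in>insert s S. \<theta> j = 0" using S0 x by auto
  qed
qed

text \<open>The functionals dual to the family at \<open>x0\<close>, kept fixed, produce a square
  matrix with entries in \<open>F\<close> that is the identity at \<open>x0\<close>; its injectivity
  forces independence. \<open>F\<close> is abstract because it will be both \<open>LP\<close> and
  \<open>FY\<close>.\<close>

lemma findep_open:
  fixes u :: "'p \<Rightarrow> 'i \<Rightarrow> 'x \<Rightarrow> 'k::field"
  assumes "finite S" "finite X"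
    and const: "\<And>c. (\<lambda>_. c) \<in> F"
    and mult: "\<And>f g. f \<in> F \<Longrightarrow> g \<in> F \<Longrightarrow> (\<lambda>x. f x * g x) \<in> F"
    and diff: "\<And>f g. f \<in> F \<Longrightarrow> g \<in> F \<Longrightarrow> (\<lambda>x. f x - g x) \<in> F"
    and u: "\<And>i y. i \<in> S \<Longrightarrow> y \<in> X \<Longrightarrow> (\<lambda>x. u x i y) \<in> F"
    and indep: "findep (u x0) S" "\<forall>i\<in>S. u x0 i \<in> coord_space X"
  shows "\<exists>\<Phi>\<in>F. \<Phi> x0 \<noteq> 0 \<and> (\<forall>x. \<Phi> x \<noteq> 0 \<longrightarrow> findep (u x) S)"
proof -
  obtain \<xi> where \<xi>: "\<forall>i\<in>S. \<forall>j\<in>S. lfun X (\<xi> i) (u x0 j) = (if i = j then 1 else 0)"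
    using findep_dual[OF assms(1,2) indep] by blast
  define a where "a = (\<lambda>i j x. lfun X (\<xi> i) (u x j))"
  have add: "(\<lambda>x. f x + g x) \<in> F" if "f \<in> F" "g \<in> F" for f g
  proof -
    have "(\<lambda>x. f x - (0 - g x)) \<in> F" using that const by (intro diff) auto
    then show ?thesis by simp
  qed
  have sum: "(\<lambda>x. \<Sum>y\<in>Y. f y x) \<in> F" if "\<And>y. y \<in> Y \<Longrightarrow> f y \<in> F" for Y and f :: "'x \<Rightarrow> 'p \<Rightarrow> 'k"
    using that by (induction Y rule: infinite_finite_induct) (auto intro: const add)
  have aF: "a i j \<in> F" if "i \<in> S" "j \<in> S" for i j
    unfolding a_def lfun_def using that by (intro sum mult const u) auto
  obtain \<Phi> where \<Phi>: "\<Phi> \<in> F" "\<Phi> x0 \<noteq> 0"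
    "\<And>x \<theta>. \<Phi> x \<noteq> 0 \<Longrightarrow> (\<And>i. i\<in>S \<Longrightarrow> (\<Sum>j\<in>S. a i j x * \<theta> j) = 0) \<Longrightarrow> (\<forall>j\<in>S. \<theta> j = 0)"
    using open_injective[of S F a x0, OF assms(1) const mult diff] aF \<xi> unfolding a_def by blast
  show ?thesis
  proof (intro bexI[of _ \<Phi>] conjI allI impI)
    fix x assume x: "\<Phi> x \<noteq> 0"
    show "findep (u x) S"
    proof (rule findepI)
      fix c i assume c: "\<And>y. (\<Sum>i\<in>S. c i * u x i y) = 0" and i: "i \<in> S"
      have "(\<Sum>j\<in>S. a i j x * c j) = 0" if "i \<in> S" for i
      proof -
        have "0 = lfun X (\<xi> i) (\<lambda>y. \<Sum>j\<in>S. c j * u x j y)" by (simp only: c) (simp add: lfun_def)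
        also have "\<dots> = (\<Sum>j\<in>S. c j * a i j x)" unfolding a_def by (rule lfun_linear)
        finally show ?thesis by (simp add: mult.commute)
      qed
      from \<Phi>(3)[OF x this] i show "c i = 0" by auto
    qed
  qed (use \<Phi> in auto)
qed

subsection \<open>A Nullstellensatz over the complex numbers\<close>

text \<open>Exponents are multisets so that the same monomials serve for the variables of the
  quadrics and for the entries of power tensors, whose indices are multisets.\<close>

definition mmono :: "'i multiset \<Rightarrow> ('i \<Rightarrow> 'k::comm_ring_1) \<Rightarrow> 'k" where
  "mmono \<mu> z = (\<Prod>j\<in>#\<mu>. z j)"

lemma mmono_empty [simp]: "mmono {#} z = 1"
  and mmono_add_mset [simp]: "mmono (add_mset j \<mu>) z = z j * mmono \<mu> z"
  and mmono_plus: "mmono (\<mu> + \<nu>) z = mmono \<mu> z * mmono \<nu> z"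
  by (auto simp: mmono_def)

lemma mmono_scale: "mmono \<mu> (\<lambda>j. s * z j) = s ^ size \<mu> * mmono \<mu> z"
  by (induction \<mu>) (auto simp: algebra_simps)

text \<open>Polynomials appear as functions, which loses nothing over an infinite field. With
  variables numbered by the natural numbers there are only countably many monomials, on which the
  counting in \<open>nullstellensatz\<close> relies.\<close>

definition PF :: "((nat \<Rightarrow> 'k::field) \<Rightarrow> 'k) set" where
  "PF = fvs.span (range mmono)"

definition pideal :: "((nat \<Rightarrow> 'k::field) \<Rightarrow> 'k) set \<Rightarrow> bool" where
  "pideal I \<longleftrightarrow> fvs.subspace I \<and> (\<forall>\<mu>. \<forall>f\<in>I. (\<lambda>z. mmono \<mu> z * f z) \<in> I)"

definition pgen :: "((nat \<Rightarrow> 'k::field) \<Rightarrow> 'k) set \<Rightarrow> ((nat \<Rightarrow> 'k) \<Rightarrow> 'k) set" where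
  "pgen G = fvs.span {(\<lambda>z. mmono \<mu> z * g z) | \<mu> g. g \<in> G}"

lemma subspace_addI: "fvs.subspace I \<Longrightarrow> f \<in> I \<Longrightarrow> g \<in> I \<Longrightarrow> (\<lambda>z. f z + g z) \<in> I"
  using fvs.subspace_add[of I f g] by (simp add: plus_fun_def)

lemma subspace_diffI: "fvs.subspace I \<Longrightarrow> f \<in> I \<Longrightarrow> g \<in> I \<Longrightarrow> (\<lambda>z. f z - g z) \<in> I"
  using fvs.subspace_diff[of I f g] by (simp add: fun_diff_def)

lemma subspace_scaleI: "fvs.subspace I \<Longrightarrow> f \<in> I \<Longrightarrow> (\<lambda>z. c * f z) \<in> I"
  using fvs.subspace_scale[of I f c] by (simp add: fscale_def)

lemma subspace_zeroI: "fvs.subspace I \<Longrightarrow> (\<lambda>z. 0) \<in> I"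
  using fvs.subspace_0[of I] by (simp add: zero_fun_def)

lemma subspace_sumI:
  "fvs.subspace I \<Longrightarrow> (\<And>i. i \<in> S \<Longrightarrow> f i \<in> I) \<Longrightarrow> (\<lambda>z. \<Sum>i\<in>S. f i z) \<in> I"
  by (induction S rule: infinite_finite_induct) (auto intro: subspace_addI subspace_zeroI)

lemma fvs_span_induct [consumes 1, case_names zero base add scale]:
  assumes "f \<in> fvs.span B" "P (\<lambda>_. 0)" "\<And>b. b \<in> B \<Longrightarrow> P b"
    and "\<And>f g. P f \<Longrightarrow> P g \<Longrightarrow> P (\<lambda>z. f z + g z)" "\<And>c f. P f \<Longrightarrow> P (\<lambda>z. c * f z)"
  shows "P f"
proof -
  have "fvs.subspace {f. P f}"
    using assms(2,4,5) unfolding fvs.subspace_def by (auto simp: zero_fun_def plus_fun_def fscale_def)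
  then have "fvs.span B \<subseteq> {f. P f}" using assms(3) by (intro fvs.span_minimal) auto
  then show ?thesis using assms(1) by auto
qed

lemma PF_subspace: "fvs.subspace PF"
  unfolding PF_def by (rule fvs.subspace_span)

lemma PF_mmono [simp]: "mmono \<mu> \<in> PF"
  unfolding PF_def by (auto intro: fvs.span_base)

lemma PF_const [simp]: "(\<lambda>z. c) \<in> PF"
proof -
  have "(\<lambda>z. c * mmono {#} z) \<in> PF" by (rule subspace_scaleI[OF PF_subspace PF_mmono])
  then show ?thesis by simp
qed

lemma PF_var [simp]: "(\<lambda>z. z i) \<in> PF"
proof -
  have "mmono {#i#} \<in> PF" by (rule PF_mmono)
  also have "mmono {#i#} = (\<lambda>z. z i)" by (auto simp: fun_eq_iff)
  finally show ?thesis .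
qed

lemmas PF_add = subspace_addI[OF PF_subspace]
  and PF_diff = subspace_diffI[OF PF_subspace]
  and PF_scale = subspace_scaleI[OF PF_subspace]
  and PF_sum = subspace_sumI[OF PF_subspace]

lemma pideal_subspace: "pideal I \<Longrightarrow> fvs.subspace I"
  by (simp add: pideal_def)

lemma pideal_PF_mult:
  assumes "pideal I" "f \<in> I" "p \<in> PF"
  shows "(\<lambda>z. p z * f z) \<in> I"
  using assms(3) unfolding PF_def
proof (induction p rule: fvs_span_induct)
  case zero
  show ?case using subspace_zeroI[OF pideal_subspace[OF assms(1)]] by simp
next
  case (base b)
  then show ?case using assms by (auto simp: pideal_def)
next
  case (add f g)
  from subspace_addI[OF pideal_subspace[OF assms(1)] this] show ?case by (simp add: distrib_right)
next
  case (scale c f)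
  from subspace_scaleI[OF pideal_subspace[OF assms(1)] this, of c] show ?case by (simp add: mult.assoc)
qed

lemma pideal_PF: "pideal PF"
  unfolding pideal_def
proof (intro conjI allI ballI)
  show "fvs.subspace PF" by (rule PF_subspace)
  fix \<mu> :: "nat multiset" and f :: "(nat \<Rightarrow> 'a) \<Rightarrow> 'a" assume "f \<in> PF"
  then show "(\<lambda>z. mmono \<mu> z * f z) \<in> PF"
    unfolding PF_def
  proof (induction f rule: fvs_span_induct)
    case zero
    show ?case using PF_const[of 0] by (simp add: PF_def)
  next
    case (base b)
    then obtain \<nu> where "b = mmono \<nu>" by auto
    then have "(\<lambda>z. mmono \<mu> z * b z) = mmono (\<mu> + \<nu>)" by (auto simp: fun_eq_iff mmono_plus)
    then show ?case by (auto intro: fvs.span_base)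
  next
    case (add f g)
    from PF_add[unfolded PF_def, OF this] show ?case by (simp add: distrib_left)
  next
    case (scale c f)
    from PF_scale[unfolded PF_def, OF this, of c] show ?case by (simp add: mult.left_commute)
  qed
qed

lemma PF_mult: "f \<in> PF \<Longrightarrow> g \<in> PF \<Longrightarrow> (\<lambda>z. f z * g z) \<in> PF"
  by (rule pideal_PF_mult[OF pideal_PF])

lemma PF_power: "f \<in> PF \<Longrightarrow> (\<lambda>z. f z ^ n) \<in> PF"
  by (induction n) (auto intro: PF_mult)

lemma PF_prod: "(\<And>i. i \<in> S \<Longrightarrow> f i \<in> PF) \<Longrightarrow> (\<lambda>z. \<Prod>i\<in>S. f i z) \<in> PF"
  by (induction S rule: infinite_finite_induct) (auto intro: PF_mult)

lemma pideal_pgen: "pideal (pgen G)"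
  unfolding pideal_def
proof (intro conjI allI ballI)
  show "fvs.subspace (pgen G)" unfolding pgen_def by (rule fvs.subspace_span)
  fix \<mu> :: "nat multiset" and f assume "f \<in> pgen G"
  then show "(\<lambda>z. mmono \<mu> z * f z) \<in> pgen G"
    unfolding pgen_def
  proof (induction f rule: fvs_span_induct)
    case zero
    show ?case using subspace_zeroI[OF fvs.subspace_span] by simp
  next
    case (base b)
    then obtain \<nu> g where b: "b = (\<lambda>z. mmono \<nu> z * g z)" "g \<in> G" by auto
    then have "(\<lambda>z. mmono \<mu> z * b z) = (\<lambda>z. mmono (\<mu> + \<nu>) z * g z)"
      by (auto simp: fun_eq_iff mmono_plus)
    then show ?case using b by (auto intro!: fvs.span_base)
  next
    case (add f g)
    from subspace_addI[OF fvs.subspace_span this] show ?case by (simp add: distrib_left)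
  next
    case (scale c f)
    from subspace_scaleI[OF fvs.subspace_span this, of c] show ?case by (simp add: mult.left_commute)
  qed
qed

lemma pgen_base: "g \<in> G \<Longrightarrow> g \<in> pgen G"
proof -
  assume "g \<in> G"
  then have "(\<lambda>z. mmono {#} z * g z) \<in> pgen G" unfolding pgen_def by (intro fvs.span_base) blast
  then show ?thesis by simp
qed

definition padjoin :: "((nat \<Rightarrow> 'k::field) \<Rightarrow> 'k) set \<Rightarrow> ((nat \<Rightarrow> 'k) \<Rightarrow> 'k) \<Rightarrow> ((nat \<Rightarrow> 'k) \<Rightarrow> 'k) set" where
  "padjoin N g = {(\<lambda>z. n z + p z * g z) | n p. n \<in> N \<and> p \<in> PF}"

lemma padjoinI: "n \<in> N \<Longrightarrow> p \<in> PF \<Longrightarrow> x = (\<lambda>z. n z + p z * g z) \<Longrightarrow> x \<in> padjoin N g"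
  unfolding padjoin_def by (intro CollectI exI[of _ n] exI[of _ p]) simp

lemma pideal_padjoin:
  assumes N: "pideal N"
  shows "pideal (padjoin N g)" "N \<subseteq> padjoin N g" "g \<in> padjoin N g"
proof -
  note S = pideal_subspace[OF N]
  show "pideal (padjoin N g)"
    unfolding pideal_def fvs.subspace_def
  proof (intro conjI ballI allI)
    show "0 \<in> padjoin N g"
      unfolding padjoin_def
      by (intro CollectI exI[of _ "\<lambda>_. 0"] conjI subspace_zeroI S PF_const) (simp add: fun_eq_iff)
  next
    fix x y assume "x \<in> padjoin N g" "y \<in> padjoin N g"
    then obtain n p m q where *: "n \<in> N" "p \<in> PF" "m \<in> N" "q \<in> PF"
      "x = (\<lambda>z. n z + p z * g z)" "y = (\<lambda>z. m z + q z * g z)" unfolding padjoin_def by auto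
    have "x + y = (\<lambda>z. (n z + m z) + (p z + q z) * g z)" using * by (auto simp: fun_eq_iff algebra_simps)
    then show "x + y \<in> padjoin N g"
      by (rule padjoinI[OF subspace_addI[OF S *(1,3)] PF_add[OF *(2,4)]])
  next
    fix c x assume "x \<in> padjoin N g"
    then obtain n p where *: "n \<in> N" "p \<in> PF" "x = (\<lambda>z. n z + p z * g z)" unfolding padjoin_def by auto
    have "fscale c x = (\<lambda>z. (c * n z) + (c * p z) * g z)" using * by (auto simp: fun_eq_iff algebra_simps fscale_def)
    then show "fscale c x \<in> padjoin N g"
      by (rule padjoinI[OF subspace_scaleI[OF S *(1)] PF_scale[OF *(2)]])
  next
    fix \<mu> x assume "x \<in> padjoin N g"
    then obtain n p where *: "n \<in> N" "p \<in> PF" "x = (\<lambda>z. n z + p z * g z)" unfolding padjoin_def by auto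
    have "(\<lambda>z. mmono \<mu> z * x z) = (\<lambda>z. (mmono \<mu> z * n z) + (mmono \<mu> z * p z) * g z)" using * by (auto simp: fun_eq_iff algebra_simps)
    then show "(\<lambda>z. mmono \<mu> z * x z) \<in> padjoin N g"
      by (rule padjoinI[OF pideal_PF_mult[OF N *(1) PF_mmono] PF_mult[OF PF_mmono *(2)]])
  qed
  show "N \<subseteq> padjoin N g"
  proof
    fix n assume "n \<in> N"
    moreover have "n = (\<lambda>z. n z + 0 * g z)" by simp
    ultimately show "n \<in> padjoin N g" by (rule padjoinI[OF _ PF_const])
  qed
  have "g = (\<lambda>z. 0 + 1 * g z)" by simp
  then show "g \<in> padjoin N g" by (rule padjoinI[OF subspace_zeroI[OF S] PF_const])
qed

lemma pideal_Union_chain: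
  assumes "C \<noteq> {}" "\<And>I. I \<in> C \<Longrightarrow> pideal I" "subset.chain A C"
  shows "pideal (\<Union>C)"
proof -
  have two: "\<exists>I\<in>C. x \<in> I \<and> y \<in> I" if "x \<in> \<Union>C" "y \<in> \<Union>C" for x y
    using that assms(3) unfolding subset.chain_def by blast
  show ?thesis
    unfolding pideal_def fvs.subspace_def
  proof (intro conjI ballI allI)
    show "0 \<in> \<Union>C" using assms(1,2) fvs.subspace_0[OF pideal_subspace] by blast
  next
    fix x y assume "x \<in> \<Union>C" "y \<in> \<Union>C"
    then obtain I where "I \<in> C" "x \<in> I" "y \<in> I" using two by blast
    then show "x + y \<in> \<Union>C" using fvs.subspace_add[OF pideal_subspace] assms(2) by blast
  next
    fix c x assume "x \<in> \<Union>C"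
    then show "fscale c x \<in> \<Union>C" using fvs.subspace_scale[OF pideal_subspace] assms(2) by blast
  next
    fix \<mu> x assume "x \<in> \<Union>C"
    then show "(\<lambda>z. mmono \<mu> z * x z) \<in> \<Union>C" using assms(2) unfolding pideal_def by blast
  qed
qed

text \<open>
  Instead of Rabinowitsch's extra variable: an ideal that is maximal among those avoiding the
  powers of \<open>f\<close> is prime, and a counting argument over the uncountable field finds an element
  \<open>z i - b\<close> in it for every variable.
\<close>

lemma nullstellensatz:
  fixes G :: "((nat \<Rightarrow> complex) \<Rightarrow> complex) set"
  assumes GP: "G \<subseteq> PF" and fP: "f \<in> PF"
    and van: "\<And>z. (\<And>g. g \<in> G \<Longrightarrow> g z = 0) \<Longrightarrow> f z = 0"
  shows "\<exists>M. (\<lambda>z. f z ^ M) \<in> pgen G"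
proof (rule ccontr)
  assume neg: "\<not> ?thesis"
  \<comment> \<open>The exponent 0 is included, so the members of \<open>A\<close> are proper
    ideals.\<close>
  define A where "A = {I. pideal I \<and> G \<subseteq> I \<and> (\<forall>M. (\<lambda>z. f z ^ M) \<notin> I)}"
  have "pgen G \<in> A"
    using neg pideal_pgen pgen_base unfolding A_def by blast
  then have "A \<noteq> {}" by blast
  moreover have "\<Union>C \<in> A" if C: "C \<noteq> {}" "subset.chain A C" for C
  proof -
    have CA: "C \<subseteq> A" using C by (auto simp: subset.chain_def)
    have "pideal (\<Union>C)" using C CA by (intro pideal_Union_chain) (auto simp: A_def)
    then show ?thesis using CA C(1) unfolding A_def by blast
  qed
  ultimately obtain N where NA: "N \<in> A" and max: "\<And>I. I \<in> A \<Longrightarrow> N \<subseteq> I \<Longrightarrow> I = N"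
    using subset_Zorn_nonempty[of A] by metis
  have N: "pideal N" and GN: "G \<subseteq> N" and fN: "\<And>M. (\<lambda>z. f z ^ M) \<notin> N"
    using NA by (auto simp: A_def)
  note S = pideal_subspace[OF N]
  have adj: "\<exists>M n p. n \<in> N \<and> p \<in> PF \<and> (\<lambda>z. f z ^ M) = (\<lambda>z. n z + p z * g z)" if g: "g \<notin> N" for g
  proof -
    have "padjoin N g \<notin> A"
      using max[of "padjoin N g"] pideal_padjoin[OF N, of g] g by blast
    then obtain M where "(\<lambda>z. f z ^ M) \<in> padjoin N g"
      using pideal_padjoin[OF N, of g] GN unfolding A_def by blast
    then show ?thesis unfolding padjoin_def by blast
  qed
  have prime: "g \<in> N \<or> h \<in> N" if gh: "(\<lambda>z. g z * h z) \<in> N" "g \<in> PF" "h \<in> PF" for g h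
  proof (rule ccontr)
    assume "\<not> ?thesis"
    then obtain M n p L m q where *: "n \<in> N" "p \<in> PF" "(\<lambda>z. f z ^ M) = (\<lambda>z. n z + p z * g z)"
      "m \<in> N" "q \<in> PF" "(\<lambda>z. f z ^ L) = (\<lambda>z. m z + q z * h z)"
      using adj[of g] adj[of h] by blast
    have "(\<lambda>z. f z ^ (M + L)) = (\<lambda>z. (m z + q z * h z) * n z + ((p z * g z) * m z + (p z * q z) * (g z * h z)))"
      using fun_cong[OF *(3)] fun_cong[OF *(6)] by (auto simp: fun_eq_iff power_add algebra_simps)
    moreover have "(\<lambda>z. (m z + q z * h z) * n z) \<in> N"
    proof -
      have "(\<lambda>z. f z ^ L * n z) \<in> N" by (intro pideal_PF_mult N * PF_power fP)
      then show ?thesis using fun_cong[OF *(6)] by simp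
    qed
    moreover have "(\<lambda>z. (p z * g z) * m z) \<in> N" "(\<lambda>z. (p z * q z) * (g z * h z)) \<in> N"
      by (intro pideal_PF_mult N * PF_mult gh)+
    ultimately have "(\<lambda>z. f z ^ (M + L)) \<in> N"
      by (simp add: subspace_addI[OF S])
    then show False using fN by blast
  qed
  have const: "c = 0" if "(\<lambda>z. c) \<in> N" for c
  proof (rule ccontr)
    assume "c \<noteq> 0"
    then have "(\<lambda>z. 1) \<in> N" using subspace_scaleI[OF S that, of "1 / c"] by simp
    then show False using fN[of 0] by simp
  qed
  \<comment> \<open>The polynomial splits by the fundamental theorem of algebra, and primality of
    \<open>N\<close> passes to one of its factors; a constant factor is excluded because
    \<open>N\<close> contains no nonzero constant.\<close>
  have root: "\<exists>b. (\<lambda>z. z i - b) \<in> N" if "(\<lambda>z. poly q (z i)) \<in> N" "q \<noteq> 0" for q i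
    using that
  proof (induction "degree q" arbitrary: q)
    case 0
    then obtain c where "q = [:c:]" by (metis degree_eq_zeroE)
    then show ?case using 0 const by auto
  next
    case (Suc d)
    then obtain b where "poly q b = 0"
      using fundamental_theorem_of_algebra[of q] constant_degree[of q] by auto
    then obtain r where r: "q = [:-b, 1:] * r" by (auto simp: poly_eq_0_iff_dvd)
    then have r0: "r \<noteq> 0" using Suc by auto
    have polyPF: "(\<lambda>z. poly s (z i)) \<in> PF" for s
    proof (induction s)
      case 0
      then show ?case by simp
    next
      case (pCons c s)
      then show ?case by (simp add: PF_add PF_mult)
    qed
    have "(\<lambda>z. z i - b) \<in> N \<or> (\<lambda>z. poly r (z i)) \<in> N"
    proof (rule prime)
      have "(\<lambda>z. poly q (z i)) = (\<lambda>z. (z i - b) * poly r (z i))"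
        unfolding r by (auto simp: fun_eq_iff algebra_simps)
      then show "(\<lambda>z. (z i - b) * poly r (z i)) \<in> N" using Suc by simp
    qed (auto intro: PF_diff polyPF)
    moreover have "d = degree r" using Suc(2) r r0 degree_mult_eq[of "[:-b, 1:]" r] by simp
    ultimately show ?case using Suc(1)[of r] r0 by auto
  qed
  have "\<exists>b. (\<lambda>z. z i - b) \<in> N" for i
  proof (rule ccontr)
    assume no: "\<not> ?thesis"
    then have "\<forall>a. \<exists>M n p. n \<in> N \<and> p \<in> PF \<and> (\<lambda>z. f z ^ M) = (\<lambda>z. n z + p z * (z i - a))"
      using adj by blast
    from choice[OF this] obtain M where
      "\<forall>a. \<exists>n p. n \<in> N \<and> p \<in> PF \<and> (\<lambda>z. f z ^ M a) = (\<lambda>z. n z + p z * (z i - a))" ..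
    from choice[OF this] obtain n where
      "\<forall>a. \<exists>p. n a \<in> N \<and> p \<in> PF \<and> (\<lambda>z. f z ^ M a) = (\<lambda>z. n a z + p z * (z i - a))" ..
    from choice[OF this] obtain p where
      "\<forall>a. n a \<in> N \<and> p a \<in> PF \<and> (\<lambda>z. f z ^ M a) = (\<lambda>z. n a z + p a z * (z i - a))" ..
    then have Mnp: "\<And>a. n a \<in> N" "\<And>a. p a \<in> PF"
      "\<And>a. (\<lambda>z. f z ^ M a) = (\<lambda>z. n a z + p a z * (z i - a))" by simp_all
    \<comment> \<open>\<open>e\<close> enumerates all exponents, so each \<open>p a\<close> involves
      only monomials numbered below some \<open>D a\<close>.\<close>
    define e :: "nat \<Rightarrow> nat multiset" where "e = (\<lambda>i. mset (from_nat i))"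
    have e: "range e = UNIV"
    proof -
      have "\<mu> \<in> range e" for \<mu>
      proof -
        obtain xs where "mset xs = \<mu>" using ex_mset by blast
        then have "e (to_nat xs) = \<mu>" by (simp add: e_def)
        then show ?thesis by blast
      qed
      then show ?thesis by blast
    qed
    have "\<exists>D. p a \<in> fvs.span ((\<lambda>i. mmono (e i)) ` {..<D})" for a
    proof -
      have "range (\<lambda>i. mmono (e i)) = (mmono ` range e :: ((nat \<Rightarrow> complex) \<Rightarrow> complex) set)"
        by (simp only: image_image)
      then have "p a \<in> fvs.span (range (\<lambda>i. mmono (e i)))"
        using Mnp(2)[of a] e unfolding PF_def by simp
      then obtain T r where T: "finite T" "T \<subseteq> range (\<lambda>i. mmono (e i))"
          "p a = (\<Sum>x\<in>T. fscale (r x) x)"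
        unfolding fvs.span_explicit by auto
      have pT: "p a \<in> fvs.span T"
        unfolding T(3) by (intro fvs.span_sum fvs.span_scale fvs.span_base)
      obtain J where J: "finite J" "T = (\<lambda>i. mmono (e i)) ` J"
        using finite_subset_image[OF T(1,2)] by blast
      then have "J \<subseteq> {..<Suc (Max (insert 0 J))}" by (auto simp: less_Suc_eq_le)
      then have "T \<subseteq> (\<lambda>i. mmono (e i)) ` {..<Suc (Max (insert 0 J))}" using J by blast
      then show ?thesis using pT fvs.span_mono by blast
    qed
    then obtain D where D: "\<And>a. p a \<in> fvs.span ((\<lambda>i. mmono (e i)) ` {..<D a})" by metis
    \<comment> \<open>Uncountably many \<open>a\<close> are distributed over countably many pairs,
      so infinitely many share one. Then \<open>D0 + 1\<close> of the functions \<open>p a\<close>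
      lie in a space of dimension at most \<open>D0\<close>.\<close>
    have "\<exists>MD. infinite {a. (M a, D a) = MD}"
    proof (rule ccontr)
      assume "\<not> ?thesis"
      then have "countable (\<Union>MD\<in>(UNIV::(nat\<times>nat) set). {a. (M a, D a) = MD})"
        by (intro countable_UN) (auto intro: countable_finite)
      moreover have "(\<Union>MD\<in>(UNIV::(nat\<times>nat) set). {a. (M a, D a) = MD}) = UNIV" by auto
      ultimately show False using uncountable_UNIV_complex by simp
    qed
    then obtain M0 D0 where "infinite {a. (M a, D a) = (M0, D0)}" by auto
    then obtain T where T: "finite T" "card T = Suc D0" "T \<subseteq> {a. (M a, D a) = (M0, D0)}"
      using infinite_arbitrarily_large by blast
    have "\<not> findep p T"
    proof
      assume "findep p T"
      moreover have "p ` T \<subseteq> fvs.span ((\<lambda>i. mmono (e i)) ` {..<D0})" using T D by fastforce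
      ultimately have "card T \<le> card ((\<lambda>i. mmono (e i) :: (nat \<Rightarrow> complex) \<Rightarrow> complex) ` {..<D0})"
        using T by (intro findep_card_le) auto
      also have "\<dots> \<le> D0" using card_image_le[of "{..<D0}"] by fastforce
      finally show False using T by simp
    qed
    then obtain c a0 where c: "\<And>z. (\<Sum>a\<in>T. c a * p a z) = 0" and a0: "a0 \<in> T" "c a0 \<noteq> 0"
      unfolding findep_def by blast
    \<comment> \<open>Dividing \<open>n a = f ^ M0 - p a * (z i - a)\<close> by
      \<open>z i - a\<close> and summing with weights \<open>c a\<close> eliminates the
      \<open>p a\<close>. Clearing denominators shows that \<open>f ^ M0\<close> times
      \<open>q\<close> at \<open>z i\<close> lies in \<open>N\<close>; at \<open>a0\<close> only the
      summand of \<open>a0\<close> survives, so \<open>q\<close> is nonzero.\<close>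
    define q where "q = (\<Sum>a\<in>T. Polynomial.smult (c a) (\<Prod>l\<in>T - {a}. [:-l, 1:]))"
    have polyq: "poly q y = (\<Sum>a\<in>T. c a * (\<Prod>l\<in>T - {a}. y - l))" for y
      unfolding q_def by (simp add: poly_sum poly_prod)
    have "poly q a0 = c a0 * (\<Prod>l\<in>T - {a0}. a0 - l)"
    proof -
      have "(\<Sum>a\<in>T. c a * (\<Prod>l\<in>T - {a}. a0 - l)) = (\<Sum>a\<in>{a0}. c a * (\<Prod>l\<in>T - {a}. a0 - l))"
        using T a0 by (intro sum.mono_neutral_right) auto
      then show ?thesis by (simp add: polyq)
    qed
    then have q0: "q \<noteq> 0" using T a0 by auto
    have "(\<lambda>z. \<Sum>a\<in>T. (c a * (\<Prod>l\<in>T - {a}. z i - l)) * n a z) \<in> N"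
      by (intro subspace_sumI S pideal_PF_mult N Mnp PF_mult PF_prod PF_diff) auto
    moreover have "(\<Sum>a\<in>T. (c a * (\<Prod>l\<in>T - {a}. z i - l)) * n a z) = f z ^ M0 * poly q (z i)" for z
    proof -
      have "(c a * (\<Prod>l\<in>T - {a}. z i - l)) * n a z
          = f z ^ M0 * (c a * (\<Prod>l\<in>T - {a}. z i - l)) - (\<Prod>l\<in>T. z i - l) * (c a * p a z)" if a: "a \<in> T" for a
      proof -
        have "n a z = f z ^ M0 - p a z * (z i - a)"
          using fun_cong[OF Mnp(3)[of a], of z] a T by (auto simp: algebra_simps)
        moreover have "(\<Prod>l\<in>T. z i - l) = (z i - a) * (\<Prod>l\<in>T - {a}. z i - l)"
          using T a by (simp add: prod.remove)
        ultimately show ?thesis by (simp only:) (simp add: algebra_simps)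
      qed
      then have "(\<Sum>a\<in>T. (c a * (\<Prod>l\<in>T - {a}. z i - l)) * n a z)
          = (\<Sum>a\<in>T. f z ^ M0 * (c a * (\<Prod>l\<in>T - {a}. z i - l)) - (\<Prod>l\<in>T. z i - l) * (c a * p a z))"
        by (intro sum.cong) auto
      also have "\<dots> = f z ^ M0 * poly q (z i) - (\<Prod>l\<in>T. z i - l) * (\<Sum>a\<in>T. c a * p a z)"
        by (simp only: sum_subtractf sum_distrib_left[symmetric] polyq)
      finally show ?thesis using c by simp
    qed
    ultimately have "(\<lambda>z. f z ^ M0 * poly q (z i)) \<in> N" by simp
    moreover have "(\<lambda>z. poly q (z i)) \<in> PF"
      unfolding polyq by (intro PF_sum PF_mult PF_const PF_prod PF_diff PF_var)
    ultimately have "(\<lambda>z. f z ^ M0) \<in> N \<or> (\<lambda>z. poly q (z i)) \<in> N" by (intro prime PF_power fP)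
    then have "(\<lambda>z. poly q (z i)) \<in> N" using fN by blast
    from root[OF this q0] no show False by blast
  qed
  then obtain b where b: "\<And>i. (\<lambda>z. z i - b i) \<in> N" by metis
  \<comment> \<open>So \<open>N\<close> is the ideal of the point \<open>b\<close>: modulo
    \<open>N\<close> every polynomial is congruent to its value there.\<close>
  have ev: "(\<lambda>z. g z - g b) \<in> N" if "g \<in> PF" for g
    using that unfolding PF_def
  proof (induction g rule: fvs_span_induct)
    case zero
    then show ?case using subspace_zeroI[OF S] by simp
  next
    case (base g)
    then obtain \<mu> where g: "g = mmono \<mu>" by auto
    show ?case unfolding g
    proof (induction \<mu>)
      case empty
      then show ?case using subspace_zeroI[OF S] by simp
    next
      case (add j \<mu>)
      have "(\<lambda>z. mmono \<mu> z * (z j - b j) + b j * (mmono \<mu> z - mmono \<mu> b)) \<in> N"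
        by (intro subspace_addI S pideal_PF_mult N PF_mmono b subspace_scaleI add)
      then show ?case by (simp add: algebra_simps)
    qed
  next
    case (add f g)
    from subspace_addI[OF S this] show ?case by (simp add: algebra_simps)
  next
    case (scale c f)
    from subspace_scaleI[OF S this, of c] show ?case by (simp add: algebra_simps)
  qed
  have "g b = 0" if g: "g \<in> G" for g
  proof (rule const)
    have gN: "g \<in> N" and gP: "g \<in> PF" using g GN GP by auto
    have "(\<lambda>z. g z - (g z - g b)) \<in> N" by (rule subspace_diffI[OF S gN ev[OF gP]])
    then show "(\<lambda>z. g b) \<in> N" by simp
  qed
  then have "f b = 0" by (rule van)
  then show False using ev[OF fP] fN[of 1] by simp
qed

subsection \<open>Derivations of the complex numbers\<close>

text \<open>
  A derivation on a subring is represented by its graph, a single-valued subring of the dual numbers.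
\<close>

definition dgraph :: "(complex \<times> complex) set \<Rightarrow> bool" where
  "dgraph S \<longleftrightarrow> (1, 0) \<in> S \<and>
     (\<forall>a a' b b'. (a, a') \<in> S \<longrightarrow> (b, b') \<in> S \<longrightarrow> (a + b, a' + b') \<in> S \<and> (a * b, a * b' + a' * b) \<in> S) \<and>
     (\<forall>a a'. (a, a') \<in> S \<longrightarrow> (- a, - a') \<in> S) \<and>
     (\<forall>a a' a''. (a, a') \<in> S \<longrightarrow> (a, a'') \<in> S \<longrightarrow> a' = a'')"

context
  fixes S :: "(complex \<times> complex) set"
  assumes S: "dgraph S"
begin

lemma dg_one: "(1, 0) \<in> S"
  and dg_add: "(a, a') \<in> S \<Longrightarrow> (b, b') \<in> S \<Longrightarrow> (a + b, a' + b') \<in> S"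
  and dg_mult: "(a, a') \<in> S \<Longrightarrow> (b, b') \<in> S \<Longrightarrow> (a * b, a * b' + a' * b) \<in> S"
  and dg_neg: "(a, a') \<in> S \<Longrightarrow> (- a, - a') \<in> S"
  and dg_unique: "(a, a') \<in> S \<Longrightarrow> (a, a'') \<in> S \<Longrightarrow> a' = a''"
  using S unfolding dgraph_def by blast+

lemma dg_zero: "(0, 0) \<in> S"
  using dg_add[OF dg_one dg_neg[OF dg_one]] by simp

lemma dg_zero_unique: "(0, a) \<in> S \<Longrightarrow> a = 0"
  using dg_unique[OF _ dg_zero] by blast

lemma dg_sum: "(\<And>i. i \<in> I \<Longrightarrow> (a i, b i) \<in> S) \<Longrightarrow> (\<Sum>i\<in>I. a i, \<Sum>i\<in>I. b i) \<in> S"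
  by (induction I rule: infinite_finite_induct) (auto intro: dg_zero dg_add)

lemma dg_of_nat: "(of_nat n, 0) \<in> S"
proof (induction n)
  case 0
  then show ?case using dg_zero by simp
next
  case (Suc n)
  from dg_add[OF dg_one this] show ?case by simp
qed

text \<open>\<open>g\<close> stands for the result of applying the derivation to the coefficients of
  \<open>f\<close>; the pair is a polynomial over the dual numbers.\<close>

definition dpol :: "complex poly \<Rightarrow> complex poly \<Rightarrow> bool" where
  "dpol f g \<longleftrightarrow> (\<forall>i. (coeff f i, coeff g i) \<in> S)"

lemma dpol_zero: "dpol 0 g \<Longrightarrow> g = 0"
  unfolding dpol_def using dg_zero_unique by (auto simp: poly_eq_iff)

lemma dpol_const: "(a, a') \<in> S \<Longrightarrow> dpol [:a:] [:a':]"
  unfolding dpol_def by (auto simp: coeff_pCons dg_zero split: nat.split)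

lemma dpol_X: "dpol [:0, 1:] 0"
  unfolding dpol_def by (auto simp: coeff_pCons dg_zero dg_one split: nat.split)

lemma dpol_add: "dpol f g \<Longrightarrow> dpol f' g' \<Longrightarrow> dpol (f + f') (g + g')"
  unfolding dpol_def by (auto intro: dg_add)

lemma dpol_neg: "dpol f g \<Longrightarrow> dpol (- f) (- g)"
  unfolding dpol_def by (auto intro: dg_neg)

lemma dpol_diff: "dpol f g \<Longrightarrow> dpol f' g' \<Longrightarrow> dpol (f - f') (g - g')"
  using dpol_add[OF _ dpol_neg] by force

lemma dpol_mult:
  assumes "dpol f g" "dpol f' g'"
  shows "dpol (f * f') (f * g' + g * f')"
  unfolding dpol_def
proof
  fix i
  have "(\<Sum>j\<le>i. coeff f j * coeff f' (i - j), \<Sum>j\<le>i. coeff f j * coeff g' (i - j) + coeff g j * coeff f' (i - j)) \<in> S"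
    using assms unfolding dpol_def by (intro dg_sum dg_mult) auto
  then show "(coeff (f * f') i, coeff (f * g' + g * f') i) \<in> S"
    by (simp add: coeff_mult sum.distrib)
qed

lemma dpol_X_power: "dpol ([:0, 1:] ^ n) 0"
proof (induction n)
  case 0
  show ?case using dpol_const[OF dg_one] by (simp add: one_pCons)
next
  case (Suc n)
  from dpol_mult[OF dpol_X this] show ?case by simp
qed

lemma dpol_pderiv: "dpol f g \<Longrightarrow> dpol (pderiv f) (pderiv g)"
  unfolding dpol_def
proof
  fix i assume "\<forall>i. (coeff f i, coeff g i) \<in> S"
  then have "(of_nat (Suc i) * coeff f (Suc i), of_nat (Suc i) * coeff g (Suc i) + 0 * coeff f (Suc i)) \<in> S"
    by (intro dg_mult dg_of_nat) auto
  then show "(coeff (pderiv f) i, coeff (pderiv g) i) \<in> S" by (simp add: coeff_pderiv)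
qed

text \<open>The chain rule: if an extended derivation takes the value \<open>u\<close> at
  \<open>x\<close>, this is the value that it must take at \<open>poly f x\<close>.\<close>

definition dval :: "complex \<Rightarrow> complex \<Rightarrow> complex poly \<Rightarrow> complex poly \<Rightarrow> complex" where
  "dval x u f g = poly g x + poly (pderiv f) x * u"

lemma dval_add: "dval x u (f + f') (g + g') = dval x u f g + dval x u f' g'"
  by (simp add: dval_def pderiv_add algebra_simps)

lemma dval_diff: "dval x u (f - f') (g - g') = dval x u f g - dval x u f' g'"
  by (simp add: dval_def pderiv_diff algebra_simps)

lemma dval_mult: "dval x u (f * f') (f * g' + g * f') = poly f x * dval x u f' g' + dval x u f g * poly f' x"
  by (simp add: dval_def pderiv_mult algebra_simps)

definition dext :: "complex \<Rightarrow> complex \<Rightarrow> (complex \<times> complex) set" where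
  "dext x u = {(poly f x, dval x u f g) | f g. dpol f g}"

lemma dext_intro: "dpol f g \<Longrightarrow> a = poly f x \<Longrightarrow> b = dval x u f g \<Longrightarrow> (a, b) \<in> dext x u"
  unfolding dext_def by blast

text \<open>The sum and product rules give the closure properties; the hypothesis is what
  single-valuedness amounts to after subtracting two representations of the same element.\<close>

lemma dgraph_dext:
  assumes "\<And>f g. dpol f g \<Longrightarrow> poly f x = 0 \<Longrightarrow> dval x u f g = 0"
  shows "dgraph (dext x u)" "S \<subseteq> dext x u" "(x, u) \<in> dext x u"
proof -
  show "dgraph (dext x u)"
    unfolding dgraph_def
  proof (intro conjI allI impI)
    show "(1, 0) \<in> dext x u"
      by (rule dext_intro[OF dpol_const[OF dg_one]]) (auto simp: dval_def pderiv_pCons)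
  next
    fix a a' b b' assume "(a, a') \<in> dext x u" "(b, b') \<in> dext x u"
    then obtain f g f' g' where *: "dpol f g" "a = poly f x" "a' = dval x u f g"
      "dpol f' g'" "b = poly f' x" "b' = dval x u f' g'" unfolding dext_def by auto
    show "(a + b, a' + b') \<in> dext x u"
      by (rule dext_intro[OF dpol_add[OF *(1,4)]]) (simp_all add: * dval_add)
    show "(a * b, a * b' + a' * b) \<in> dext x u"
      by (rule dext_intro[OF dpol_mult[OF *(1,4)]]) (simp_all add: * dval_mult)
  next
    fix a a' assume "(a, a') \<in> dext x u"
    then obtain f g where *: "dpol f g" "a = poly f x" "a' = dval x u f g" unfolding dext_def by auto
    show "(- a, - a') \<in> dext x u"
      by (rule dext_intro[OF dpol_neg[OF *(1)]]) (simp_all add: * dval_def pderiv_minus)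
  next
    fix a a' a'' assume "(a, a') \<in> dext x u" "(a, a'') \<in> dext x u"
    then obtain f g f' g' where *: "dpol f g" "a = poly f x" "a' = dval x u f g"
      "dpol f' g'" "a = poly f' x" "a'' = dval x u f' g'" unfolding dext_def by auto
    have "dval x u (f - f') (g - g') = 0"
      by (rule assms[OF dpol_diff[OF *(1,4)]]) (use * in simp)
    then show "a' = a''" using * by (simp add: dval_diff)
  qed
  show "S \<subseteq> dext x u"
  proof
    fix p assume "p \<in> S"
    then obtain a a' where p: "p = (a, a')" "(a, a') \<in> S" by (cases p) auto
    show "p \<in> dext x u" unfolding p(1)
      by (rule dext_intro[OF dpol_const[OF p(2)]]) (simp_all add: dval_def pderiv_pCons)
  qed
  show "(x, u) \<in> dext x u"
    by (rule dext_intro[OF dpol_X]) (simp_all add: dval_def pderiv_pCons)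
qed

lemma dext_transcendental:
  assumes "\<forall>f g. dpol f g \<longrightarrow> poly f x = 0 \<longrightarrow> f = 0"
  shows "dgraph (dext x u)" "S \<subseteq> dext x u" "(x, u) \<in> dext x u"
proof -
  have "dval x u f g = 0" if "dpol f g" "poly f x = 0" for f g
  proof -
    have f: "f = 0" using assms that by blast
    then have "g = 0" using that(1) dpol_zero by blast
    then show ?thesis using f by (simp add: dval_def)
  qed
  from dgraph_dext[of x u, OF this] show "dgraph (dext x u)" "S \<subseteq> dext x u" "(x, u) \<in> dext x u" by blast+
qed

text \<open>For an algebraic \<open>x\<close> the value \<open>u\<close> is forced by an equation
  \<open>f0\<close> of least degree. In characteristic 0 the derivative of \<open>f0\<close> is
  nonzero of smaller degree, so it does not vanish at \<open>x\<close> and one can solve for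
  \<open>u\<close>. All other relations are reduced to \<open>f0\<close> by pseudo-division.\<close>

lemma dext_algebraic:
  assumes "dpol f g" "poly f x = 0" "f \<noteq> 0"
  shows "\<exists>u. dgraph (dext x u) \<and> S \<subseteq> dext x u \<and> (x, u) \<in> dext x u"
proof -
  define P where "P = (\<lambda>n. \<exists>f g. dpol f g \<and> poly f x = 0 \<and> f \<noteq> 0 \<and> degree f = n)"
  have "P (degree f)" using assms by (auto simp: P_def)
  then have "P (LEAST n. P n)" by (rule LeastI)
  then obtain f0 g0 where f0: "dpol f0 g0" "poly f0 x = 0" "f0 \<noteq> 0" "degree f0 = (LEAST n. P n)"
    unfolding P_def by blast
  have min: "f = 0" if "dpol f g" "poly f x = 0" "degree f < degree f0" for f g
    using not_less_Least[of "degree f" P] that f0(4) unfolding P_def by metis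
  have deg: "degree f0 > 0"
  proof (rule ccontr)
    assume "\<not> ?thesis"
    then obtain c where "f0 = [:c:]" by (metis degree_eq_zeroE neq0_conv)
    then show False using f0 by simp
  qed
  have p0: "poly (pderiv f0) x \<noteq> 0"
  proof
    assume "poly (pderiv f0) x = 0"
    then have "pderiv f0 = 0" using min[OF dpol_pderiv[OF f0(1)]] deg by (simp add: degree_pderiv)
    then show False using deg by (simp add: pderiv_eq_0_iff)
  qed
  define u where "u = - poly g0 x / poly (pderiv f0) x"
  have u0: "dval x u f0 g0 = 0" using p0 by (simp add: u_def dval_def)
  have "dval x u f g = 0" if "dpol f g" "poly f x = 0" for f g
    using that
  proof (induction "degree f" arbitrary: f g rule: less_induct)
    case less
    show ?case
    proof (cases "f = 0")
      case True
      then have "g = 0" using less.prems(1) dpol_zero by blast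
      then show ?thesis using True by (simp add: dval_def)
    next
      case False
      then have ge: "degree f \<ge> degree f0" using min less.prems by (meson not_le_imp_less)
      define m where "m = degree f - degree f0"
      define c c' where "c = lead_coeff f0" and "c' = coeff g0 (degree f0)"
      define l l' where "l = lead_coeff f" and "l' = coeff g (degree f)"
      have S1: "(c, c') \<in> S" "(l, l') \<in> S" using f0(1) less.prems(1)
        unfolding dpol_def c_def c'_def l_def l'_def by blast+
      have d1: "dpol ([:l:] * [:0,1:] ^ m) ([:l:] * 0 + [:l':] * [:0,1:] ^ m)" (is "dpol ?a ?a'")
        by (intro dpol_mult dpol_const S1 dpol_X_power)
      have d2: "dpol (?a * f0) (?a * g0 + ?a' * f0)" by (intro dpol_mult d1 f0)
      have d3: "dpol ([:c:] * f) ([:c:] * g + [:c':] * f)" by (intro dpol_mult dpol_const S1 less.prems)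
      \<comment> \<open>The domain of \<open>S\<close> is a ring and perhaps not a field, so
        \<open>f\<close> is multiplied by the leading coefficient \<open>c\<close> before its
        leading term is cancelled.\<close>
      let ?f1 = "[:c:] * f - ?a * f0"
      have d4: "dpol ?f1 (([:c:] * g + [:c':] * f) - (?a * g0 + ?a' * f0))" by (rule dpol_diff[OF d3 d2])
      \<comment> \<open>All other terms of the product rule contain \<open>poly f x\<close>,
        \<open>poly f0 x\<close> or \<open>dval x u f0 g0\<close>, which are 0.\<close>
      have v: "dval x u ?f1 (([:c:] * g + [:c':] * f) - (?a * g0 + ?a' * f0)) = c * dval x u f g"
        unfolding dval_diff dval_mult using less.prems f0 u0 by simp
      have z: "poly ?f1 x = 0" using less.prems f0 by simp
      have a0: "?a * f0 = Polynomial.smult l (monom 1 m * f0)"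
        by (simp add: monom_altdef)
      have "?f1 = 0 \<or> degree ?f1 < degree f"
      proof -
        have da: "degree (?a * f0) \<le> degree f"
        proof -
          have "degree (monom 1 m * f0) \<le> m + degree f0"
            by (rule order_trans[OF degree_mult_le]) (simp add: degree_monom_eq)
          then show ?thesis unfolding a0 using ge degree_smult_le[of l "monom 1 m * f0"] by (simp add: m_def)
        qed
        have "coeff ?f1 (degree f) = 0"
        proof -
          have "coeff (monom 1 m * f0) (degree f) = c"
            using ge by (simp add: coeff_monom_mult m_def c_def)
          then show ?thesis unfolding coeff_diff a0 by (simp add: l_def)
        qed
        moreover have "degree ?f1 \<le> degree f"
          by (intro degree_diff_le da) (simp add: degree_smult_le)
        ultimately show ?thesis
          by (metis eq_zero_or_degree_less)
      qed
      then have "dval x u ?f1 (([:c:] * g + [:c':] * f) - (?a * g0 + ?a' * f0)) = 0"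
      proof
        assume "degree ?f1 < degree f"
        from less.hyps[OF this d4 z] show ?thesis .
      next
        assume 0: "?f1 = 0"
        have "([:c:] * g + [:c':] * f) - (?a * g0 + ?a' * f0) = 0"
          using d4 unfolding 0 by (rule dpol_zero)
        then show ?thesis unfolding 0 by (simp add: dval_def)
      qed
      then show ?thesis using v f0(3) by (simp add: c_def)
    qed
  qed
  from dgraph_dext[of x u, OF this] show ?thesis by blast
qed

end

section \<open>Extending derivations to all complex numbers\<close>

lemma dgraph_Union_chain:
  assumes "C \<noteq> {}" "\<And>S. S \<in> C \<Longrightarrow> dgraph S" "subset.chain A C"
  shows "dgraph (\<Union>C)"
proof -
  have two: "\<exists>S\<in>C. x \<in> S \<and> y \<in> S" if "x \<in> \<Union>C" "y \<in> \<Union>C" for x y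
    using that assms(3) unfolding subset.chain_def by blast
  show ?thesis
    unfolding dgraph_def
  proof (intro conjI allI impI)
    show "(1, 0) \<in> \<Union>C" using assms(1,2) dg_one by blast
    fix a a' b b' assume "(a, a') \<in> \<Union>C" "(b, b') \<in> \<Union>C"
    then obtain S where S: "S \<in> C" "(a, a') \<in> S" "(b, b') \<in> S" using two by blast
    show "(a + b, a' + b') \<in> \<Union>C" using dg_add[OF assms(2)] S by blast
    show "(a * b, a * b' + a' * b) \<in> \<Union>C" using dg_mult[OF assms(2)] S by blast
  next
    fix a a' assume "(a, a') \<in> \<Union>C"
    then show "(- a, - a') \<in> \<Union>C" using dg_neg[OF assms(2)] by blast
  next
    fix a a' a'' assume "(a, a') \<in> \<Union>C" "(a, a'') \<in> \<Union>C"
    then obtain S where S: "S \<in> C" "(a, a') \<in> S" "(a, a'') \<in> S" using two by blast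
    then show "a' = a''" using dg_unique[OF assms(2)] by blast
  qed
qed

definition derivation :: "(complex \<Rightarrow> complex) \<Rightarrow> bool" where
  "derivation D \<longleftrightarrow> (\<forall>a b. D (a + b) = D a + D b \<and> D (a * b) = a * D b + D a * b)"

text \<open>A maximal extension has full domain since every \<open>x\<close> can be adjoined: a
  transcendental one with any value, here 0, an algebraic one with the value forced by its
  equation.\<close>

lemma dgraph_total:
  assumes "dgraph S0"
  shows "\<exists>D. derivation D \<and> (\<forall>(a, b)\<in>S0. D a = b)"
proof -
  define A where "A = {S. dgraph S \<and> S0 \<subseteq> S}"
  have "A \<noteq> {}" using assms by (auto simp: A_def)
  moreover have "\<Union>C \<in> A" if C: "C \<noteq> {}" "subset.chain A C" for C
  proof -
    have CA: "C \<subseteq> A" using C by (auto simp: subset.chain_def)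
    have "dgraph (\<Union>C)" using C CA by (intro dgraph_Union_chain) (auto simp: A_def)
    then show ?thesis using CA C(1) unfolding A_def by blast
  qed
  ultimately obtain S where SA: "S \<in> A" and max: "\<And>T. T \<in> A \<Longrightarrow> S \<subseteq> T \<Longrightarrow> T = S"
    using subset_Zorn_nonempty[of A] by metis
  have S: "dgraph S" "S0 \<subseteq> S" using SA by (auto simp: A_def)
  have "\<exists>u. (x, u) \<in> S" for x
  proof -
    have "\<exists>u. dgraph (dext S x u) \<and> S \<subseteq> dext S x u \<and> (x, u) \<in> dext S x u"
    proof (cases "\<exists>f g. dpol S f g \<and> poly f x = 0 \<and> f \<noteq> 0")
      case True
      then show ?thesis using dext_algebraic[OF S(1)] by blast
    next
      case False
      then have "\<forall>f g. dpol S f g \<longrightarrow> poly f x = 0 \<longrightarrow> f = 0" by blast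
      from dext_transcendental[OF S(1) this, of 0] show ?thesis by blast
    qed
    then obtain u where u: "dgraph (dext S x u)" "S \<subseteq> dext S x u" "(x, u) \<in> dext S x u" by blast
    then have "dext S x u = S" using S by (intro max) (auto simp: A_def)
    then show ?thesis using u by blast
  qed
  then obtain D where D: "\<And>x. (x, D x) \<in> S" by metis
  have "derivation D"
    unfolding derivation_def
  proof (intro allI conjI)
    fix a b
    show "D (a + b) = D a + D b" by (rule dg_unique[OF S(1) D dg_add[OF S(1) D D]])
    show "D (a * b) = a * D b + D a * b" by (rule dg_unique[OF S(1) D dg_mult[OF S(1) D D]])
  qed
  moreover have "\<forall>(a, b)\<in>S0. D a = b" using dg_unique[OF S(1) D] S(2) by blast
  ultimately show ?thesis by blast
qed

lemma countable_polys_over: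
  assumes "countable R" "(0::complex) \<in> R"
  shows "countable {f. \<forall>i. coeff f i \<in> R}"
proof -
  have "{f. \<forall>i. coeff f i \<in> R} \<subseteq> Poly ` lists R"
  proof
    fix f assume "f \<in> {f. \<forall>i. coeff f i \<in> R}"
    then have "set (coeffs f) \<subseteq> R" by (auto simp: coeffs_def)
    then have "f = Poly (coeffs f)" "coeffs f \<in> lists R" by auto
    then show "f \<in> Poly ` lists R" by blast
  qed
  then show ?thesis using assms by (meson countable_image countable_lists countable_subset)
qed

text \<open>The domain \<open>R\<close> is the same for all prescriptions \<open>u\<close>, so the
  next coordinate can be chosen before the values of the derivation are known. It avoids the
  countably many roots of polynomials over \<open>R\<close>, for which an uncountable
  \<open>A\<close> leaves room. The tower starts with the integers, on which every derivation
  vanishes.\<close>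

lemma generic_tower:
  assumes "finite E" "uncountable A"
  shows "\<exists>x R. (\<forall>e\<in>E. x e \<in> A) \<and> countable R \<and>
           (\<forall>u. \<exists>S. dgraph S \<and> Domain S = R \<and> (\<forall>e\<in>E. (x e, u e) \<in> S))"
  using assms(1)
proof (induction E rule: finite_induct)
  case empty
  have "dgraph ((\<lambda>n. (of_int n, 0)) ` UNIV)"
    unfolding dgraph_def
  proof (intro conjI allI impI)
    show "(1, 0) \<in> range (\<lambda>n. (of_int n :: complex, 0 :: complex))"
      by (rule range_eqI[of _ _ 1]) simp
    fix a a' b b' :: complex
    assume "(a, a') \<in> range (\<lambda>n. (of_int n, 0))" "(b, b') \<in> range (\<lambda>n. (of_int n, 0))"
    then obtain m n where *: "a = of_int m" "b = of_int n" "a' = 0" "b' = 0" by auto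
    show "(a + b, a' + b') \<in> range (\<lambda>n. (of_int n, 0))"
      by (rule range_eqI[of _ _ "m + n"]) (simp add: *)
    show "(a * b, a * b' + a' * b) \<in> range (\<lambda>n. (of_int n, 0))"
      by (rule range_eqI[of _ _ "m * n"]) (simp add: *)
  next
    fix a a' :: complex
    assume "(a, a') \<in> range (\<lambda>n. (of_int n, 0))"
    then obtain m where *: "a = of_int m" "a' = 0" by auto
    show "(- a, - a') \<in> range (\<lambda>n. (of_int n, 0))"
      by (rule range_eqI[of _ _ "- m"]) (simp add: *)
  qed auto
  moreover have "Domain ((\<lambda>n. (of_int n :: complex, 0 :: complex)) ` UNIV) = range of_int" by auto
  ultimately show ?case
    by (intro exI[of _ "\<lambda>_. 0"] exI[of _ "range of_int"]) (auto intro!: exI[of _ "(\<lambda>n. (of_int n, 0)) ` UNIV"])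
next
  case (insert e E)
  then obtain x R where x: "\<forall>e\<in>E. x e \<in> A" "countable R"
    and ext: "\<And>u. \<exists>S. dgraph S \<and> Domain S = R \<and> (\<forall>e\<in>E. (x e, u e) \<in> S)" by blast
  have R0: "0 \<in> R" using ext[of "\<lambda>_. 0"] dg_zero by blast
  let ?P = "{f. \<forall>i. coeff f i \<in> R}"
  have cP: "countable ?P" using countable_polys_over[OF x(2) R0] .
  have "countable (\<Union>f\<in>?P - {0}. {a. poly f a = 0})"
    using cP by (intro countable_UN) (auto intro: countable_finite poly_roots_finite)
  then have "\<not> A \<subseteq> (\<Union>f\<in>?P - {0}. {a. poly f a = 0})"
    using assms(2) countable_subset by blast
  then obtain a where aA: "a \<in> A" and "a \<notin> (\<Union>f\<in>?P - {0}. {a. poly f a = 0})" by blast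
  then have "f = 0" if "f \<in> ?P" "poly f a = 0" for f using that by blast
  note a = aA this
  define x' where "x' = (\<lambda>i. if i = e then a else x i)"
  define R' where "R' = (\<lambda>f. poly f a) ` ?P"
  have "\<exists>S. dgraph S \<and> Domain S = R' \<and> (\<forall>i\<in>insert e E. (x' i, u i) \<in> S)" for u
  proof -
    obtain S where S: "dgraph S" "Domain S = R" "\<forall>i\<in>E. (x i, u i) \<in> S" using ext[of u] by blast
    have inP: "f \<in> ?P" if "dpol S f g" for f g using that S(2) unfolding dpol_def[OF S(1)] by blast
    have "\<forall>f g. dpol S f g \<longrightarrow> poly f a = 0 \<longrightarrow> f = 0" using a(2) inP by blast
    note ex = dext_transcendental[OF S(1) this, of "u e"]
    have lift: "\<exists>g. dpol S f g" if f: "f \<in> ?P" for f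
    proof -
      have "\<forall>i. \<exists>d. (coeff f i, d) \<in> S" using f S(2) by blast
      then obtain d where d: "\<And>i. (coeff f i, d i) \<in> S" by metis
      have "d i = 0" if "i > degree f" for i
        using d[of i] that dg_zero_unique[OF S(1)] by (simp add: coeff_eq_0)
      then have "dpol S f (\<Sum>i\<le>degree f. monom (d i) i)"
        unfolding dpol_def[OF S(1)] using d by (auto simp: coeff_sum)
          (metis (no_types, lifting) d linorder_not_le)
      then show ?thesis by blast
    qed
    have "Domain (dext S a (u e)) = R'"
    proof (intro equalityI subsetI)
      fix y assume "y \<in> Domain (dext S a (u e))"
      then obtain f g where "dpol S f g" "y = poly f a" unfolding dext_def[OF S(1)] by blast
      then show "y \<in> R'" unfolding R'_def using inP by (intro image_eqI)
    next
      fix y assume "y \<in> R'"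
      then obtain f where f: "f \<in> ?P" "y = poly f a" unfolding R'_def by (elim imageE)
      obtain g where "dpol S f g" using lift[OF f(1)] ..
      from dext_intro[OF S(1) this f(2) refl] show "y \<in> Domain (dext S a (u e))" by (rule DomainI)
    qed
    then show ?thesis using ex S(3) insert(2) by (intro exI[of _ "dext S a (u e)"]) (auto simp: x'_def)
  qed
  moreover have "countable R'" unfolding R'_def using cP by blast
  moreover have "\<forall>i\<in>insert e E. x' i \<in> A" using x(1) a(1) by (auto simp: x'_def)
  ultimately show ?case by blast
qed

lemma generic_derivations:
  assumes "finite E" "uncountable A"
  shows "\<exists>x. (\<forall>e\<in>E. x e \<in> A) \<and>
           (\<forall>e\<in>E. \<exists>D. derivation D \<and> (\<forall>i\<in>E. D (x i) = (if i = e then 1 else 0)))"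
proof -
  obtain x R where x: "\<forall>e\<in>E. x e \<in> A"
    "\<And>u. \<exists>S. dgraph S \<and> Domain S = R \<and> (\<forall>e\<in>E. (x e, u e) \<in> S)"
    using generic_tower[OF assms] by blast
  have "\<exists>D. derivation D \<and> (\<forall>i\<in>E. D (x i) = (if i = e then 1 else 0))" for e
  proof -
    obtain S where S: "dgraph S" "\<forall>i\<in>E. (x i, if i = e then 1 else 0) \<in> S"
      using x(2)[of "\<lambda>i. if i = e then 1 else 0"] by blast
    from dgraph_total[OF S(1)] S(2) show ?thesis by fast
  qed
  then show ?thesis using x(1) by blast
qed

lemma derivation_add: "derivation D \<Longrightarrow> D (a + b) = D a + D b"
  and derivation_mult: "derivation D \<Longrightarrow> D (a * b) = a * D b + D a * b"
  by (simp_all add: derivation_def)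

lemma derivation_0: "derivation D \<Longrightarrow> D 0 = 0"
  using derivation_add[of D 0 0] by simp

lemma derivation_1: "derivation D \<Longrightarrow> D 1 = 0"
  using derivation_mult[of D 1 1] by simp

lemma derivation_minus: "derivation D \<Longrightarrow> D (- a) = - D a"
  using derivation_add[of D a "- a"] derivation_0[of D] by (simp add: eq_neg_iff_add_eq_0 add.commute)

lemma derivation_sum: "derivation D \<Longrightarrow> D (\<Sum>i\<in>S. f i) = (\<Sum>i\<in>S. D (f i))"
  by (induction S rule: infinite_finite_induct) (auto simp: derivation_0 derivation_add)

lemma derivation_of_nat: "derivation D \<Longrightarrow> D (of_nat n) = 0"
  by (induction n) (auto simp: derivation_0 derivation_1 derivation_add)

subsection \<open>Power tensors and the quadrics of the Segre-Veronese cone\<close>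

text \<open>Tagging the indices with their factor turns an entry of a power tensor into a single
  monomial, in variables indexed by a factor and a coordinate.\<close>

definition flat_idx :: "nat \<Rightarrow> (nat \<Rightarrow> nat multiset) \<Rightarrow> (nat \<times> nat) multiset" where
  "flat_idx p K = (\<Sum>a<p. image_mset (Pair a) (K a))"

lemma count_image_Pair: "count (image_mset (Pair a) M) (a', j) = (if a' = a then count M j else 0)"
  by (induction M) auto

lemma count_flat_idx: "count (flat_idx p K) (a, j) = (if a < p then count (K a) j else 0)"
  unfolding flat_idx_def by (simp add: count_sum count_image_Pair)

lemma flat_idx_plus: "flat_idx p (\<lambda>a. K a + L a) = flat_idx p K + flat_idx p L"
  by (simp add: flat_idx_def sum.distrib)

lemma mmono_sum: "finite S \<Longrightarrow> mmono (\<Sum>a\<in>S. M a) z = (\<Prod>a\<in>S. mmono (M a) z)"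
  by (induction S rule: finite_induct) (auto simp: mmono_plus)

lemma mmono_image: "mmono (image_mset f M) z = mmono M (\<lambda>j. z (f j))"
  by (simp add: mmono_def image_mset.compositionality comp_def)

lemma mmono_flat_idx: "mmono (flat_idx p K) z = (\<Prod>a<p. mmono (K a) (\<lambda>j. z (a, j)))"
  by (simp add: flat_idx_def mmono_sum mmono_image)

lemma eq_replicate_mset: "(\<And>j. j \<in># M \<Longrightarrow> j = i) \<Longrightarrow> M = replicate_mset (size M) i"
  by (induction M) auto

lemma power_tensor_mmono:
  "power_tensor p n b v = (\<lambda>K. if K \<in> midx p n b then mmono (flat_idx p K) (\<lambda>(a, j). v a j) else 0)"
  unfolding power_tensor_def mmono_flat_idx by (auto simp: mmono_def)

lemma midxD:
  assumes "K \<in> midx p n b"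
  shows "a < p \<Longrightarrow> size (K a) = b a" "a < p \<Longrightarrow> j \<in># K a \<Longrightarrow> j \<le> n a" "\<not> a < p \<Longrightarrow> K a = {#}"
  using assms unfolding midx_def by auto

lemma finite_multisets_le: "finite {M. size M = k \<and> set_mset M \<subseteq> A}" if "finite A"
proof -
  have "{M. size M = k \<and> set_mset M \<subseteq> A} \<subseteq> mset ` {xs. set xs \<subseteq> A \<and> length xs = k}"
  proof
    fix M assume M: "M \<in> {M. size M = k \<and> set_mset M \<subseteq> A}"
    obtain xs where "mset xs = M" using ex_mset by blast
    then show "M \<in> mset ` {xs. set xs \<subseteq> A \<and> length xs = k}" using M by (intro image_eqI[of _ _ xs]) auto
  qed
  then show ?thesis using finite_lists_length_eq[OF that] finite_surj by blast
qed

lemma finite_midx: "finite (midx p n b)"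
proof -
  let ?F = "\<lambda>f :: nat \<Rightarrow> nat multiset. \<lambda>a. if a < p then f a else {#}"
  have "midx p n b \<subseteq> ?F ` (PiE {..<p} (\<lambda>a. {M. size M = b a \<and> set_mset M \<subseteq> {..n a}}))"
  proof
    fix K assume K: "K \<in> midx p n b"
    then show "K \<in> ?F ` (PiE {..<p} (\<lambda>a. {M. size M = b a \<and> set_mset M \<subseteq> {..n a}}))"
      by (intro image_eqI[of _ _ "restrict K {..<p}"]) (auto simp: midx_def fun_eq_iff)
  qed
  moreover have "finite (PiE {..<p} (\<lambda>a. {M. size M = b a \<and> set_mset M \<subseteq> {..n a}}))"
    by (intro finite_PiE finite_multisets_le) auto
  ultimately show ?thesis using finite_surj by blast
qed

definition pure_idx :: "nat \<Rightarrow> (nat \<Rightarrow> nat) \<Rightarrow> (nat \<Rightarrow> nat) \<Rightarrow> nat \<Rightarrow> nat multiset" where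
  "pure_idx p b i = (\<lambda>a. if a < p then replicate_mset (b a) (i a) else {#})"

definition repl_idx :: "(nat \<Rightarrow> nat multiset) \<Rightarrow> nat \<Rightarrow> nat \<Rightarrow> nat \<Rightarrow> nat \<Rightarrow> nat multiset" where
  "repl_idx K a i j = K(a := add_mset j (K a - {#i#}))"

lemma pure_idx_midx: "(\<And>a. a < p \<Longrightarrow> i a \<le> n a) \<Longrightarrow> pure_idx p b i \<in> midx p n b"
  by (auto simp: pure_idx_def midx_def split: if_splits)

lemma repl_idx_midx:
  assumes "K \<in> midx p n b" "a < p" "i \<in># K a" "j \<le> n a"
  shows "repl_idx K a i j \<in> midx p n b"
proof -
  have "size (add_mset j (K a - {#i#})) = size (K a)"
    using assms(3) by (metis insert_DiffM size_add_mset)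
  moreover have "set_mset (add_mset j (K a - {#i#})) \<subseteq> {..n a}"
    using assms midxD(2)[OF assms(1,2)] by (auto dest: in_diffD)
  ultimately show ?thesis using assms unfolding midx_def repl_idx_def by auto
qed

lemma flat_repl_idx:
  assumes "a < p" "i \<in># K a"
  shows "add_mset (a, i) (flat_idx p (repl_idx K a i j)) = add_mset (a, j) (flat_idx p K)"
proof (rule multiset_eqI)
  fix e :: "nat \<times> nat"
  obtain a' j' where e: "e = (a', j')" by (cases e)
  have "count (K a) i > 0" using assms(2) by simp
  then show "count (add_mset (a, i) (flat_idx p (repl_idx K a i j))) e = count (add_mset (a, j) (flat_idx p K)) e"
    using assms(1) unfolding e by (auto simp: count_flat_idx repl_idx_def)
qed

lemma repl_idx_back:
  assumes "i \<in># K a" 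
  shows "repl_idx (repl_idx K a i j) a j i = K"
  using assms by (auto simp: repl_idx_def fun_eq_iff)

text \<open>Every index arises from the pure index of \<open>i\<close> by exchanging single entries;
  the induction is on the number of entries that differ from \<open>i a\<close>. This reduces
  statements about all entries of a tensor to one quadric per exchange.\<close>

lemma midx_reduce_induct [consumes 2, case_names pure repl]:
  assumes "K \<in> midx p n b" "\<forall>a<p. i a \<le> n a"
    and pure: "Q (pure_idx p b i)"
    and repl: "\<And>K a j. K \<in> midx p n b \<Longrightarrow> a < p \<Longrightarrow> i a \<in># K a \<Longrightarrow> j \<le> n a \<Longrightarrow> j \<noteq> i a \<Longrightarrow> Q K
            \<Longrightarrow> Q (repl_idx K a (i a) j)"
  shows "Q K"
  using assms(1)
proof (induction "\<Sum>a<p. size (filter_mset (\<lambda>j. j \<noteq> i a) (K a))" arbitrary: K rule: less_induct)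
  case less
  show ?case
  proof (cases "\<exists>a<p. \<exists>j\<in>#K a. j \<noteq> i a")
    case False
    have "K = pure_idx p b i"
    proof
      fix a show "K a = pure_idx p b i a"
      proof (cases "a < p")
        case True
        then have "K a = replicate_mset (size (K a)) (i a)"
          using False by (intro eq_replicate_mset) auto
        then show ?thesis using True midxD(1)[OF less.prems True] by (simp add: pure_idx_def)
      qed (use midxD(3)[OF less.prems] in \<open>simp add: pure_idx_def\<close>)
    qed
    then show ?thesis using pure by simp
  next
    case True
    then obtain a j where a: "a < p" "j \<in># K a" "j \<noteq> i a" by blast
    let ?L = "repl_idx K a j (i a)"
    have L: "?L \<in> midx p n b" using a assms(2) less.prems by (intro repl_idx_midx) auto
    have "filter_mset (\<lambda>j. j \<noteq> i a) (?L a) \<subset># filter_mset (\<lambda>j. j \<noteq> i a) (K a)"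
    proof -
      obtain R where R: "K a = add_mset j R" using a(2) by (metis multi_member_split)
      show ?thesis using a(3) by (simp add: repl_idx_def R)
    qed
    then have "size (filter_mset (\<lambda>j. j \<noteq> i a) (?L a)) < size (filter_mset (\<lambda>j. j \<noteq> i a) (K a))"
      by (rule mset_subset_size)
    moreover have "?L a' = K a'" if "a' \<noteq> a" for a' using that by (simp add: repl_idx_def)
    ultimately have "(\<Sum>a<p. size (filter_mset (\<lambda>j. j \<noteq> i a) (?L a))) < (\<Sum>a<p. size (filter_mset (\<lambda>j. j \<noteq> i a) (K a)))"
      using a(1) by (intro sum_strict_mono_ex1) (auto, metis less_or_eq_imp_le)
    from less.hyps[OF this L] have "Q ?L" .
    moreover have "i a \<in># ?L a" by (simp add: repl_idx_def)
    moreover have "j \<le> n a" using midxD(2)[OF less.prems a(1,2)] .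
    ultimately have "Q (repl_idx ?L a (i a) j)" using L a by (intro repl) auto
    then show ?thesis using a(2) by (simp add: repl_idx_back)
  qed
qed

text \<open>The binomial equations \<open>y K * y L = y K' * y L'\<close> of the cone: both products
  have the same total exponent in every factor.\<close>

definition seg_quad :: "(nat \<Rightarrow> nat multiset) set \<Rightarrow> ((nat \<Rightarrow> nat multiset) \<times> (nat \<Rightarrow> nat multiset) \<times> (nat \<Rightarrow> nat multiset) \<times> (nat \<Rightarrow> nat multiset)) set" where
  "seg_quad X = {(K, L, K', L'). K \<in> X \<and> L \<in> X \<and> K' \<in> X \<and> L' \<in> X \<and> (\<forall>a. K a + L a = K' a + L' a)}"

lemma finite_seg_quad: "finite X \<Longrightarrow> finite (seg_quad X)"
  by (rule finite_subset[of _ "X \<times> X \<times> X \<times> X"]) (auto simp: seg_quad_def)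

lemma mmono_seg_quad:
  assumes "(K, L, K', L') \<in> seg_quad X"
  shows "mmono (flat_idx p K) z * mmono (flat_idx p L) z = mmono (flat_idx p K') z * mmono (flat_idx p L') z"
proof -
  have "(\<lambda>a. K a + L a) = (\<lambda>a. K' a + L' a)" using assms by (auto simp: seg_quad_def fun_eq_iff)
  then have "flat_idx p K + flat_idx p L = flat_idx p K' + flat_idx p L'"
    by (simp only: flat_idx_plus[symmetric])
  then show ?thesis by (simp only: mmono_plus[symmetric])
qed

lemma seg_quad_repl:
  assumes "K \<in> midx p n b" "a < p" "i \<in># K a" "j \<le> n a" "L \<in> midx p n b" "i \<in># L a"
  shows "(repl_idx K a i j, L, K, repl_idx L a i j) \<in> seg_quad (midx p n b)"
  using assms repl_idx_midx[of K p n b a i j] repl_idx_midx[of L p n b a i j]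
  unfolding seg_quad_def by (auto simp: repl_idx_def)

text \<open>Around a nonzero pure entry \<open>y K\<close> the ratios
  \<open>y (repl_idx K a (i a) j) / y K\<close> serve as affine coordinates, and by the quadrics
  each exchange of an entry multiplies by such a ratio. The value 1 of \<open>z\<close> covers the
  normalised coordinates and the factors of degree 0.\<close>

lemma seg_cone_of_quadrics:
  fixes y :: "(nat \<Rightarrow> nat multiset) \<Rightarrow> 'k::field"
  assumes q: "\<And>K L K' L'. (K, L, K', L') \<in> seg_quad (midx p n b) \<Longrightarrow> y K * y L = y K' * y L'"
    and K0: "K0 \<in> midx p n b" "y K0 \<noteq> 0"
  shows "\<exists>c i z. c \<noteq> 0 \<and> (\<forall>a. a < p \<longrightarrow> i a \<le> n a) \<and> (\<forall>a. z (a, i a) = 1) \<and>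
           (\<forall>K\<in>midx p n b. y K = c * mmono (flat_idx p K) z)"
proof -
  let ?X = "midx p n b"
  define i where "i = (\<lambda>a. if a < p \<and> 0 < b a then (SOME j. j \<in># K0 a) else 0)"
  have i0: "i a \<in># K0 a" if "a < p" "0 < b a" for a
  proof -
    have "K0 a \<noteq> {#}" using midxD(1)[OF K0(1) that(1)] that(2) by auto
    then show ?thesis using that someI_ex[of "\<lambda>j. j \<in># K0 a"] by (auto simp: i_def)
  qed
  have il: "i a \<le> n a" if "a < p" for a
    using i0[OF that] midxD(2)[OF K0(1) that] by (cases "0 < b a") (auto simp: i_def)
  define A where "A = {K \<in> ?X. y K \<noteq> 0 \<and> (\<forall>a<p. 0 < b a \<longrightarrow> i a \<in># K a)}"
  have "finite A" "A \<noteq> {}" using K0 i0 finite_midx by (auto simp: A_def)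
  \<comment> \<open>\<open>K\<close> is a nonzero entry with as many \<open>i a\<close> as possible.
    If it contained another \<open>j\<close>, the quadric \<open>y K * y K = y L * y N\<close>,
    where \<open>L\<close> trades this \<open>j\<close> for \<open>i a\<close> and \<open>N\<close>
    does the opposite, would make \<open>y L\<close> nonzero, against maximality.\<close>
  then obtain K where KA: "K \<in> A" and max: "\<And>L. L \<in> A \<Longrightarrow> (\<Sum>a<p. count (L a) (i a)) \<le> (\<Sum>a<p. count (K a) (i a))"
    using Max_in[of "(\<lambda>K. \<Sum>a<p. count (K a) (i a)) ` A"] Max_ge[of "(\<lambda>K. \<Sum>a<p. count (K a) (i a)) ` A"]
    by fastforce
  have KX: "K \<in> ?X" and yK: "y K \<noteq> 0" and iK: "\<And>a. a < p \<Longrightarrow> 0 < b a \<Longrightarrow> i a \<in># K a"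
    using KA by (auto simp: A_def)
  have Kpure: "K = pure_idx p b i"
  proof -
    have all: "j = i a" if aj: "a < p" "j \<in># K a" for a j
    proof (rule ccontr)
      assume ne: "j \<noteq> i a"
      have ba: "0 < b a" using midxD(1)[OF KX aj(1)] aj(2) by (cases "K a") auto
      let ?L = "repl_idx K a j (i a)" and ?N = "repl_idx K a (i a) j"
      have jn: "j \<le> n a" using midxD(2)[OF KX aj] .
      have "?L \<in> ?X" "?N \<in> ?X"
        using repl_idx_midx[OF KX aj il[OF aj(1)]] repl_idx_midx[OF KX aj(1) iK[OF aj(1) ba] jn] by auto
      moreover have "K a' + K a' = ?L a' + ?N a'" for a'
      proof (cases "a' = a")
        case True
        obtain R where R: "K a = add_mset j R" using aj(2) by (metis multi_member_split)
        then have "i a \<in># R" using iK[OF aj(1) ba] ne by auto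
        then obtain R' where R': "R = add_mset (i a) R'" by (metis multi_member_split)
        show ?thesis using True by (simp add: repl_idx_def R R')
      qed (simp add: repl_idx_def)
      ultimately have "(K, K, ?L, ?N) \<in> seg_quad ?X" using KX by (auto simp: seg_quad_def)
      from q[OF this] have yL: "y ?L \<noteq> 0" using yK by auto
      have "?L \<in> A"
        unfolding A_def using \<open>?L \<in> ?X\<close> yL iK by (auto simp: repl_idx_def)
      from max[OF this] have le: "(\<Sum>a<p. count (?L a) (i a)) \<le> (\<Sum>a<p. count (K a) (i a))" .
      have "(\<Sum>a<p. count (K a) (i a)) < (\<Sum>a<p. count (?L a) (i a))"
        using aj(1) ne by (intro sum_strict_mono_ex1) (auto simp: repl_idx_def intro!: bexI[of _ a])
      then show False using le by simp
    qed
    show ?thesis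
    proof
      fix a show "K a = pure_idx p b i a"
      proof (cases "a < p")
        case True
        then have "K a = replicate_mset (size (K a)) (i a)"
          using all[OF True] by (intro eq_replicate_mset) auto
        then show ?thesis using True midxD(1)[OF KX True] by (simp add: pure_idx_def)
      qed (use midxD(3)[OF KX] in \<open>simp add: pure_idx_def\<close>)
    qed
  qed
  define z where "z = (\<lambda>(a, j). if a < p \<and> 0 < b a \<and> j \<noteq> i a then y (repl_idx K a (i a) j) / y K else 1)"
  have "y L = y K * mmono (flat_idx p L) z" if "L \<in> ?X" for L
  proof -
    have "\<forall>a<p. i a \<le> n a" using il by blast
    with that show ?thesis
  proof (induction L rule: midx_reduce_induct)
    case pure
    have "mmono (flat_idx p K) z = 1"
      unfolding Kpure mmono_flat_idx by (simp add: mmono_def pure_idx_def z_def)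
    then show ?case by (simp add: Kpure)
  next
    case (repl L a j)
    have ba: "0 < b a" using midxD(1)[OF repl(1,2)] repl(3) by (cases "L a") auto
    have "(repl_idx L a (i a) j, K, L, repl_idx K a (i a) j) \<in> seg_quad ?X"
      using seg_quad_repl[OF repl(1-4) KX iK[OF repl(2) ba]] .
    from q[OF this] have "y (repl_idx L a (i a) j) = y L * (y (repl_idx K a (i a) j) / y K)"
      using yK by (simp add: field_simps)
    also have "y (repl_idx K a (i a) j) / y K = z (a, j)" using repl ba by (simp add: z_def)
    finally have 1: "y (repl_idx L a (i a) j) = y K * (mmono (flat_idx p L) z * z (a, j))" using repl by simp
    have "mmono (add_mset (a, i a) (flat_idx p (repl_idx L a (i a) j))) z = mmono (add_mset (a, j) (flat_idx p L)) z"
      using flat_repl_idx[of a p "i a" L j] repl by simp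
    then have "mmono (flat_idx p (repl_idx L a (i a) j)) z = mmono (flat_idx p L) z * z (a, j)"
      by (simp add: z_def mult.commute)
    then show ?case using 1 by simp
  qed
  qed
  then show ?thesis using yK il by (intro exI[of _ "y K"] exI[of _ i] exI[of _ z]) (auto simp: z_def)
qed

text \<open>The partial derivative of the monomial by the variable \<open>e\<close>. If
  \<open>e\<close> does not occur, the factor \<open>count\<close> is 0 and the truncated difference
  does no harm.\<close>

definition dmono :: "'i \<Rightarrow> 'i multiset \<Rightarrow> ('i \<Rightarrow> 'k::comm_ring_1) \<Rightarrow> 'k" where
  "dmono e \<mu> z = of_nat (count \<mu> e) * mmono (\<mu> - {#e#}) z"

lemma derivation_mmono:
  assumes D: "derivation D" and "finite E" "set_mset \<mu> \<subseteq> E"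
  shows "D (mmono \<mu> z) = (\<Sum>e\<in>E. dmono e \<mu> z * D (z e))"
  using assms(3)
proof (induction \<mu>)
  case empty
  then show ?case using D by (simp add: derivation_1 dmono_def)
next
  case (add x \<mu>)
  have "D (mmono (add_mset x \<mu>) z) = z x * D (mmono \<mu> z) + D (z x) * mmono \<mu> z"
    using D by (simp add: derivation_mult)
  also have "\<dots> = (\<Sum>e\<in>E. z x * (dmono e \<mu> z * D (z e))) + (\<Sum>e\<in>E. if e = x then D (z x) * mmono \<mu> z else 0)"
    using add assms(2) by (simp add: sum_distrib_left)
  also have "\<dots> = (\<Sum>e\<in>E. dmono e (add_mset x \<mu>) z * D (z e))"
    unfolding sum.distrib[symmetric]
  proof (rule sum.cong)
    fix e assume "e \<in> E"
    show "z x * (dmono e \<mu> z * D (z e)) + (if e = x then D (z x) * mmono \<mu> z else 0) = dmono e (add_mset x \<mu>) z * D (z e)"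
    proof (cases "e = x")
      case True
      have "of_nat (count \<mu> x) * (z x * mmono (\<mu> - {#x#}) z) = of_nat (count \<mu> x) * mmono \<mu> z"
        by (cases "x \<in># \<mu>") (auto simp: mmono_add_mset[symmetric] not_in_iff simp del: mmono_add_mset)
      then show ?thesis using True by (simp add: dmono_def algebra_simps)
    next
      case False
      have "of_nat (count \<mu> e) * mmono (add_mset x \<mu> - {#e#}) z = of_nat (count \<mu> e) * (z x * mmono (\<mu> - {#e#}) z)"
        using False by (cases "e \<in># \<mu>") (auto simp: not_in_iff)
      then show ?thesis using False by (simp add: dmono_def algebra_simps)
    qed
  qed simp
  finally show ?case .
qed

text \<open>The free coordinates in the affine chart where the \<open>i a\<close>-th coordinate of
  each factor is 1. A factor with \<open>b a = 0\<close> does not move the tensor, so the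
  cardinality is the dimension of the variety.\<close>

definition tan_idx :: "nat \<Rightarrow> (nat \<Rightarrow> nat) \<Rightarrow> (nat \<Rightarrow> nat) \<Rightarrow> (nat \<Rightarrow> nat) \<Rightarrow> (nat \<times> nat) set" where
  "tan_idx p n b i = {(a, j). a < p \<and> 0 < b a \<and> j \<le> n a \<and> j \<noteq> i a}"

lemma finite_tan_idx: "finite (tan_idx p n b i)"
proof -
  have "tan_idx p n b i \<subseteq> (\<Union>a<p. {a} \<times> {..n a})" by (auto simp: tan_idx_def)
  then show ?thesis by (rule finite_subset) auto
qed

lemma card_tan_idx:
  assumes "\<And>a. a < p \<Longrightarrow> i a \<le> n a"
  shows "card (tan_idx p n b i) = (\<Sum>a<p. if 0 < b a then n a else 0)"
proof -
  have "tan_idx p n b i = (SIGMA a:{a. a < p \<and> 0 < b a}. {..n a} - {i a})" by (auto simp: tan_idx_def)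
  then have "card (tan_idx p n b i) = (\<Sum>a\<in>{a. a < p \<and> 0 < b a}. card ({..n a} - {i a}))" by simp
  also have "\<dots> = (\<Sum>a\<in>{a. a < p \<and> 0 < b a}. n a)" using assms by (intro sum.cong) auto
  also have "\<dots> = (\<Sum>a<p. if 0 < b a then n a else 0)"
    by (intro sum.mono_neutral_cong_left) auto
  finally show ?thesis .
qed

lemma set_flat_idx:
  assumes "K \<in> midx p n b"
  shows "set_mset (flat_idx p K) \<subseteq> insert (a0, i a0) (tan_idx p n b i) \<union> {(a, i a) | a. a < p}"
proof
  fix e assume e: "e \<in># flat_idx p K"
  obtain a j where [simp]: "e = (a, j)" by (cases e)
  have aj: "a < p" "j \<in># K a" using e by (simp_all add: count_greater_zero_iff[symmetric] count_flat_idx del: count_greater_zero_iff split: if_splits)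
  then have "0 < b a" using midxD(1)[OF assms aj(1)] by (cases "K a") auto
  then show "e \<in> insert (a0, i a0) (tan_idx p n b i) \<union> {(a, i a) | a. a < p}"
    using aj midxD(2)[OF assms aj] by (auto simp: tan_idx_def)
qed

text \<open>
  The equations of the tangent space become additive after dividing by the coordinates of the
  point, which are nonzero.
\<close>

lemma seg_tangent_of_quadrics:
  fixes y :: "(nat \<Rightarrow> nat multiset) \<Rightarrow> 'k::field"
  assumes z0: "\<And>e. z e \<noteq> 0"
    and q: "\<And>K L K' L'. (K, L, K', L') \<in> seg_quad (midx p n b) \<Longrightarrow>
        mmono (flat_idx p K) z * y L + mmono (flat_idx p L) z * y K
        = mmono (flat_idx p K') z * y L' + mmono (flat_idx p L') z * y K'"
  shows "\<exists>c0 c. \<forall>K\<in>midx p n b. y K = c0 * mmono (flat_idx p K) z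
           + (\<Sum>e\<in>tan_idx p n b (\<lambda>_. 0). c e * dmono e (flat_idx p K) z)"
proof -
  let ?X = "midx p n b" and ?E = "tan_idx p n b (\<lambda>_. 0)"
  define u where "u = (\<lambda>K. y K / mmono (flat_idx p K) z)"
  have P0: "mmono \<mu> z \<noteq> 0" for \<mu> by (induction \<mu>) (auto simp: z0)
  have uq: "u K + u L = u K' + u L'" if "(K, L, K', L') \<in> seg_quad ?X" for K L K' L'
  proof -
    let ?P = "\<lambda>K. mmono (flat_idx p K) z"
    have "?P K * ?P L * (u K + u L) = ?P K * y L + ?P L * y K"
      using P0[of "flat_idx p K"] P0[of "flat_idx p L"] by (simp add: u_def field_simps)
    also have "\<dots> = ?P K' * y L' + ?P L' * y K'" by (rule q[OF that])
    also have "\<dots> = ?P K' * ?P L' * (u K' + u L')"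
      using P0[of "flat_idx p K'"] P0[of "flat_idx p L'"] by (simp add: u_def field_simps)
    also have "?P K' * ?P L' = ?P K * ?P L" using mmono_seg_quad[OF that, of p z] by simp
    finally show ?thesis using P0 by simp
  qed
  define J where "J = pure_idx p b (\<lambda>_. 0)"
  define \<tau> where "\<tau> = (\<lambda>(a, j). u (repl_idx J a 0 j) - u J)"
  have JX: "J \<in> ?X" unfolding J_def by (rule pure_idx_midx) simp
  \<comment> \<open>For the quotients \<open>u\<close> the tangent equations read
    \<open>u K + u L = u K' + u L'\<close>. So exchanging a 0 for \<open>j\<close> in the factor
    \<open>a\<close> always changes \<open>u\<close> by the same amount
    \<open>\<tau> (a, j)\<close>.\<close>
  have uK: "u K = u J + (\<Sum>e\<in>?E. of_nat (count (flat_idx p K) e) * \<tau> e)" if "K \<in> ?X" for K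
  proof -
    have "\<forall>a<p. 0 \<le> n a" by simp
    with that show ?thesis
  proof (induction K rule: midx_reduce_induct[where i = "\<lambda>_. 0"])
    case pure
    have "count (flat_idx p J) e = 0" if "e \<in> ?E" for e
      using that by (auto simp: tan_idx_def J_def pure_idx_def count_flat_idx)
    then show ?case by (simp add: J_def)
  next
    case (repl K a j)
    have ba: "0 < b a" using midxD(1)[OF repl(1,2)] repl(3) by (cases "K a") auto
    have "0 \<in># J a" using repl(2) ba by (simp add: J_def pure_idx_def)
    then have "u (repl_idx K a 0 j) + u J = u K + u (repl_idx J a 0 j)"
      by (intro uq seg_quad_repl repl JX) auto
    then have 1: "u (repl_idx K a 0 j) = u K + \<tau> (a, j)" by (simp add: \<tau>_def algebra_simps)
    have "count (flat_idx p (repl_idx K a 0 j)) e = count (flat_idx p K) e + (if e = (a, j) then 1 else 0)"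
      if "e \<in> ?E" for e
      using arg_cong[OF flat_repl_idx[of a p 0 K j], of "\<lambda>M. count M e"] that repl
      by (auto simp: tan_idx_def split: if_splits)
    then have "(\<Sum>e\<in>?E. of_nat (count (flat_idx p (repl_idx K a 0 j)) e) * \<tau> e)
        = (\<Sum>e\<in>?E. of_nat (count (flat_idx p K) e) * \<tau> e + (if e = (a, j) then \<tau> (a, j) else 0))"
      by (intro sum.cong) (auto simp: distrib_right)
    also have "\<dots> = (\<Sum>e\<in>?E. of_nat (count (flat_idx p K) e) * \<tau> e) + \<tau> (a, j)"
      using repl ba finite_tan_idx[of p n b "\<lambda>_. 0"] by (simp add: sum.distrib tan_idx_def)
    finally show ?case using 1 repl by simp
  qed
  qed
  have "y K = u J * mmono (flat_idx p K) z + (\<Sum>e\<in>?E. (\<tau> e * z e) * dmono e (flat_idx p K) z)"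
    if K: "K \<in> ?X" for K
  proof -
    have d: "of_nat (count (flat_idx p K) e) * mmono (flat_idx p K) z = z e * dmono e (flat_idx p K) z" for e
    proof (cases "e \<in># flat_idx p K")
      case True
      then have "mmono (flat_idx p K) z = z e * mmono (flat_idx p K - {#e#}) z"
        by (metis insert_DiffM mmono_add_mset)
      then show ?thesis by (simp add: dmono_def)
    qed (simp add: dmono_def not_in_iff)
    have "y K = mmono (flat_idx p K) z * u K" using P0 by (simp add: u_def)
    also have "\<dots> = u J * mmono (flat_idx p K) z
        + (\<Sum>e\<in>?E. \<tau> e * (of_nat (count (flat_idx p K) e) * mmono (flat_idx p K) z))"
      using uK[OF K] by (simp add: algebra_simps sum_distrib_left)
    finally show ?thesis by (simp add: d mult.assoc)
  qed
  then show ?thesis by (intro exI[of _ "u J"] exI[of _ "\<lambda>e. \<tau> e * z e"]) blast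
qed

subsection \<open>Generic tangent spaces\<close>

text \<open>These functions are only ever restricted to lines, so polynomiality along lines suffices
  and the index type of the coordinates may be arbitrary.\<close>

definition LP :: "(('e \<Rightarrow> complex) \<Rightarrow> complex) set" where
  "LP = {f. \<forall>x w. polyfun (\<lambda>t. f (\<lambda>e. x e + t * w e))}"

lemma LP_const: "(\<lambda>x. c) \<in> LP"
  and LP_var: "(\<lambda>x. x e) \<in> LP"
  and LP_diff: "f \<in> LP \<Longrightarrow> g \<in> LP \<Longrightarrow> (\<lambda>x. f x - g x) \<in> LP"
  and LP_mult: "f \<in> LP \<Longrightarrow> g \<in> LP \<Longrightarrow> (\<lambda>x. f x * g x) \<in> LP"
  unfolding LP_def by (auto intro!: polyfun_intros)

lemma LP_mmono: "(\<And>j. (\<lambda>x. f x j) \<in> LP) \<Longrightarrow> (\<lambda>x. mmono \<mu> (f x)) \<in> LP"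
  by (induction \<mu>) (auto intro: LP_const LP_mult)

text \<open>The witness has integral coordinates because derivations vanish on them: it can then be
  moved in the direction of a vector with prescribed derivatives without disturbing these.\<close>

definition gen :: "(('e \<Rightarrow> complex) \<Rightarrow> bool) \<Rightarrow> bool" where
  "gen Q \<longleftrightarrow> (\<exists>\<Phi>\<in>LP. (\<exists>x. (\<forall>e. x e \<in> \<int>) \<and> \<Phi> x \<noteq> 0) \<and> (\<forall>x. \<Phi> x \<noteq> 0 \<longrightarrow> Q x))"

text \<open>On the line through the two witnesses both conditions hold for almost all parameters,
  and a natural number as parameter keeps the coordinates integral.\<close>

lemma gen_conj:
  assumes "gen P" "gen Q"
  shows "gen (\<lambda>x. P x \<and> Q x)"
proof -
  obtain \<Phi> x where \<Phi>: "\<Phi> \<in> LP" "\<forall>e. x e \<in> \<int>" "\<Phi> x \<noteq> 0" "\<forall>x. \<Phi> x \<noteq> 0 \<longrightarrow> P x"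
    using assms(1) by (auto simp: gen_def)
  obtain \<Psi> y where \<Psi>: "\<Psi> \<in> LP" "\<forall>e. y e \<in> \<int>" "\<Psi> y \<noteq> 0" "\<forall>x. \<Psi> x \<noteq> 0 \<longrightarrow> Q x"
    using assms(2) by (auto simp: gen_def)
  define L where "L = (\<lambda>t e. x e + t * (y e - x e))"
  have "\<exists>t\<in>\<nat>. \<forall>i\<in>{False, True}. (if i then \<Phi> (L t) else \<Psi> (L t)) \<noteq> 0"
  proof (rule polyfun_common_nonzero)
    show "infinite (\<nat> :: complex set)"
      unfolding Nats_def by (rule range_inj_infinite) (rule inj_of_nat)
    fix i :: bool
    show "polyfun (\<lambda>t. if i then \<Phi> (L t) else \<Psi> (L t))"
      using \<Phi>(1) \<Psi>(1) unfolding L_def LP_def by (intro polyfun_if) auto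
    have "L 0 = x" "L 1 = y" by (auto simp: L_def)
    then show "\<exists>t. (if i then \<Phi> (L t) else \<Psi> (L t)) \<noteq> 0" using \<Phi>(3) \<Psi>(3) by (cases i) metis+
  qed simp
  then obtain t where t: "t \<in> \<nat>" "\<Phi> (L t) \<noteq> 0" "\<Psi> (L t) \<noteq> 0" by auto
  have "L t e \<in> \<int>" for e
    unfolding L_def using \<Phi>(2) \<Psi>(2) t(1) by (intro Ints_add Ints_mult Ints_diff) (auto simp: Nats_subset_Ints[THEN subsetD])
  then show ?thesis
    unfolding gen_def using \<Phi> \<Psi> t
    by (intro bexI[of _ "\<lambda>x. \<Phi> x * \<Psi> x"] conjI exI[of _ "L t"]) (auto intro: LP_mult)
qed

lemma gen_mono: "gen P \<Longrightarrow> (\<And>x. P x \<Longrightarrow> Q x) \<Longrightarrow> gen Q"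
  unfolding gen_def by meson

lemma gen_finite: "finite S \<Longrightarrow> (\<And>i. i \<in> S \<Longrightarrow> gen (P i)) \<Longrightarrow> gen (\<lambda>x. \<forall>i\<in>S. P i x)"
proof (induction S rule: finite_induct)
  case empty
  show ?case unfolding gen_def by (intro bexI[of _ "\<lambda>_. 1"] conjI exI[of _ "\<lambda>_. 0"]) (auto intro: LP_const)
next
  case (insert i S)
  have "gen (\<lambda>x. P i x \<and> (\<forall>i\<in>S. P i x))" using insert by (intro gen_conj) auto
  then show ?case by (rule gen_mono) auto
qed

lemma gen_findep:
  assumes "finite S" "finite X" "\<And>i y. i \<in> S \<Longrightarrow> y \<in> X \<Longrightarrow> (\<lambda>x. u x i y) \<in> LP"
    and "\<forall>e. x0 e \<in> \<int>" "findep (u x0) S" "\<forall>i\<in>S. u x0 i \<in> coord_space X"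
  shows "gen (\<lambda>x. findep (u x) S)"
proof -
  from findep_open[where F = LP and u = u and ?x0.0 = x0 and S = S and X = X, OF assms(1,2) LP_const LP_mult LP_diff assms(3,5,6)]
  show ?thesis unfolding gen_def using assms(4) by blast
qed

text \<open>The zeroth coordinate of each factor is normalised to 1. The value 1 outside the index
  range ensures that at generic points all values are nonzero, as
  \<open>seg_tangent_of_quadrics\<close> requires.\<close>

definition npt :: "nat \<Rightarrow> (nat \<Rightarrow> nat) \<Rightarrow> (nat \<times> nat \<Rightarrow> 'k::comm_ring_1) \<Rightarrow> nat \<times> nat \<Rightarrow> 'k" where
  "npt p n x = (\<lambda>(c, j). if c < p \<and> 0 < j \<and> j \<le> n c then x (c, j) else 1)"

lemma mmono_update: "mmono \<mu> (\<lambda>e. if e = e0 then s else 1) = s ^ count \<mu> e0"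
  by (induction \<mu>) auto

lemma size_eq_sum_count: "set_mset M \<subseteq> {..n::nat} \<Longrightarrow> size M = (\<Sum>j\<le>n. count M j)"
  by (simp add: size_multiset_overloaded_eq) (rule sum.mono_neutral_left, auto simp: not_in_iff)

text \<open>The multiplicity of 0 is determined by the size and the other multiplicities, so the
  free coordinates separate the indices.\<close>

lemma midx_distinct:
  assumes "K \<in> midx p n b" "L \<in> midx p n b" "K \<noteq> L"
  shows "\<exists>c j. c < p \<and> 0 < j \<and> j \<le> n c \<and> count (K c) j \<noteq> count (L c) j"
proof (rule ccontr)
  assume neg: "\<not> ?thesis"
  have "K c = L c" for c
  proof (cases "c < p")
    case True
    have sub: "set_mset (K c) \<subseteq> {..n c}" "set_mset (L c) \<subseteq> {..n c}"
      using assms(1,2) True by (auto simp: midx_def)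
    have pos: "count (K c) j = count (L c) j" if "0 < j" for j
    proof (cases "j \<le> n c")
      case True
      then show ?thesis using neg that \<open>c < p\<close> by blast
    next
      case False
      then have "j \<notin># K c" "j \<notin># L c" using sub by auto
      then show ?thesis by (simp add: not_in_iff)
    qed
    have "(\<Sum>j\<le>n c. count (K c) j) = (\<Sum>j\<le>n c. count (L c) j)"
      using midxD(1)[OF assms(1) True] midxD(1)[OF assms(2) True] size_eq_sum_count[OF sub(1)] size_eq_sum_count[OF sub(2)] by simp
    moreover have "(\<Sum>j\<le>n c. count M j) = count M 0 + (\<Sum>j\<in>{0<..n c}. count M j)" for M
      by (subst sum.remove[of _ 0]) (auto intro!: arg_cong2[where f = "(+)"] sum.cong)
    moreover have "(\<Sum>j\<in>{0<..n c}. count (K c) j) = (\<Sum>j\<in>{0<..n c}. count (L c) j)"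
      by (intro sum.cong pos) auto
    ultimately have "count (K c) 0 = count (L c) 0" by simp
    then show ?thesis using pos by (intro multiset_eqI) (metis gr0I)
  qed (use assms in \<open>simp add: midxD\<close>)
  then show False using assms(3) by blast
qed

text \<open>The entries are distinct characters of the multiplicative monoid of integral points; a
  point with one coordinate 2 and all others 1 separates two of them. Hence the integral points of
  the variety lie on no hyperplane.\<close>

lemma segre_veronese_nondegenerate:
  assumes "\<exists>K\<in>midx p n b. c K \<noteq> 0"
  shows "\<exists>x::nat \<times> nat \<Rightarrow> complex. (\<forall>e. x e \<in> \<int>) \<and>
           (\<Sum>K\<in>midx p n b. c K * mmono (flat_idx p K) (npt p n x)) \<noteq> 0"
proof (rule ccontr)
  assume neg: "\<not> ?thesis"
  have "c K = 0" if K: "K \<in> midx p n b" for K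
  proof (rule characters_independent[where S = "midx p n b" and G = "{x. \<forall>e. x e \<in> \<int>}"
        and ch = "\<lambda>K x. mmono (flat_idx p K) (npt p n x)" and m = "\<lambda>x y e. x e * y e" and e = "\<lambda>_. 1"])
    show "finite (midx p n b)" by (rule finite_midx)
    fix K and x y :: "nat \<times> nat \<Rightarrow> complex"
    have "npt p n (\<lambda>e. x e * y e) = (\<lambda>e. npt p n x e * npt p n y e)" by (auto simp: npt_def fun_eq_iff)
    moreover have "mmono \<mu> (\<lambda>e. u e * v e) = mmono \<mu> u * mmono \<mu> v" for \<mu> and u v :: "nat \<times> nat \<Rightarrow> complex"
      by (induction \<mu>) (auto simp: algebra_simps)
    ultimately show "mmono (flat_idx p K) (npt p n (\<lambda>e. x e * y e))
        = mmono (flat_idx p K) (npt p n x) * mmono (flat_idx p K) (npt p n y)" by simp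
  next
    fix K
    have "npt p n (\<lambda>_. 1 :: complex) = (\<lambda>_. 1)" by (auto simp: npt_def fun_eq_iff)
    then show "mmono (flat_idx p K) (npt p n (\<lambda>_. 1 :: complex)) = 1" by (simp add: mmono_def)
  next
    fix K L assume KL: "K \<in> midx p n b" "L \<in> midx p n b" "K \<noteq> L"
    obtain c j where cj: "c < p" "0 < j" "j \<le> n c" "count (K c) j \<noteq> count (L c) j"
      using midx_distinct[OF KL] by blast
    let ?x = "\<lambda>e. if e = (c, j) then 2 else 1 :: complex"
    have "npt p n ?x = ?x" using cj by (auto simp: npt_def fun_eq_iff)
    moreover have "(2::complex) ^ count (K c) j \<noteq> 2 ^ count (L c) j"
    proof
      assume "(2::complex) ^ count (K c) j = 2 ^ count (L c) j"
      then have "of_nat (2 ^ count (K c) j) = (of_nat (2 ^ count (L c) j) :: complex)" by simp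
      then have "2 ^ count (K c) j = (2 ^ count (L c) j :: nat)" by (simp only: of_nat_eq_iff)
      then show False using cj(4) by simp
    qed
    ultimately have "mmono (flat_idx p K) (npt p n ?x) \<noteq> mmono (flat_idx p L) (npt p n ?x)"
      using cj by (simp add: mmono_update count_flat_idx)
    moreover have "?x \<in> {x. \<forall>e. x e \<in> \<int>}" by simp
    ultimately show "\<exists>x\<in>{x :: nat \<times> nat \<Rightarrow> complex. \<forall>e. x e \<in> \<int>}. mmono (flat_idx p K) (npt p n x) \<noteq> mmono (flat_idx p L) (npt p n x)"
      by (rule rev_bexI[rotated])
  next
    fix x :: "nat \<times> nat \<Rightarrow> complex" assume "x \<in> {x. \<forall>e. x e \<in> \<int>}"
    then have "\<forall>e. x e \<in> \<int>" by blast
    then show "(\<Sum>K\<in>midx p n b. c K * mmono (flat_idx p K) (npt p n x)) = 0" using neg by blast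
  qed (use K in simp_all)
  then show False using assms by blast
qed

text \<open>\<open>None\<close> selects the point number \<open>l\<close> and \<open>Some e\<close>
  its derivative in the direction \<open>e\<close>; for \<open>e\<close> among the free coordinates
  these span the tangent space of the cone. A common index type allows families that mix points and
  tangent vectors.\<close>

definition pvec :: "nat \<Rightarrow> (nat \<Rightarrow> nat) \<Rightarrow> (nat \<Rightarrow> nat) \<Rightarrow> (nat \<times> nat \<times> nat \<Rightarrow> complex)
    \<Rightarrow> nat \<times> (nat \<times> nat) option \<Rightarrow> (nat \<Rightarrow> nat multiset) \<Rightarrow> complex" where
  "pvec p n b x = (\<lambda>(l, d) K. if K \<in> midx p n b then
     (case d of None \<Rightarrow> mmono (flat_idx p K) (npt p n (\<lambda>e. x (l, e)))
              | Some e \<Rightarrow> dmono e (flat_idx p K) (npt p n (\<lambda>e. x (l, e)))) else 0)"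

lemma pvec_coord: "pvec p n b x i \<in> coord_space (midx p n b)"
  by (auto simp: pvec_def coord_space_def split: prod.splits)

lemma pvec_LP: "(\<lambda>x. pvec p n b x i K) \<in> LP"
proof (cases i)
  case (Pair l d)
  have "(\<lambda>x. npt p n (\<lambda>e. x (l, e)) e) \<in> LP" for e
    unfolding npt_def by (cases "fst e < p \<and> 0 < snd e \<and> snd e \<le> n (fst e)"; cases e) (simp_all add: LP_const LP_var del: de_Morgan_conj)
  then have m: "(\<lambda>x. mmono \<mu> (npt p n (\<lambda>e. x (l, e)))) \<in> LP" for \<mu> by (rule LP_mmono)
  show ?thesis
    using m LP_mult[OF LP_const m] by (cases d; cases "K \<in> midx p n b") (auto simp: pvec_def Pair dmono_def intro: LP_const)
qed

text \<open>As long as the family does not fill the ambient space, some linear form annihilates it,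
  and by nondegeneracy there is a point where this form is nonzero. The number \<open>l\<close> of
  the new point is fresh, so its coordinates can be set without changing the old vectors.\<close>

lemma extend_by_points:
  assumes "finite T" "finite S" "\<And>l d. (l, d) \<in> S \<Longrightarrow> l \<notin> T"
    and "\<forall>e. x e \<in> \<int>" "findep (pvec p n b x) S" "card S + card T \<le> card (midx p n b)"
  shows "\<exists>x'. (\<forall>e. x' e \<in> \<int>) \<and> findep (pvec p n b x') (S \<union> T \<times> {None})"
  using assms(1,3,6)
proof (induction T rule: finite_induct)
  case empty
  then show ?case using assms(4,5) by auto
next
  case (insert l T)
  obtain x' where x': "\<forall>e. x' e \<in> \<int>" "findep (pvec p n b x') (S \<union> T \<times> {None})"
    using insert.IH insert.prems insert(1,2) by force
  let ?S = "S \<union> T \<times> {None}"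
  have fin: "finite ?S" using assms(2) insert(1) by simp
  have notin: "(l, None) \<notin> ?S" using insert by auto
  have "card ?S \<le> card S + card T"
    using card_Un_le[of S "T \<times> {None}"] by (simp add: card_cartesian_product)
  also have "\<dots> < card (midx p n b)" using insert by simp
  finally obtain c where c: "\<exists>K\<in>midx p n b. c K \<noteq> 0" "\<forall>i\<in>?S. lfun (midx p n b) c (pvec p n b x' i) = 0"
    using findep_annihilator[OF fin finite_midx x'(2)] pvec_coord by blast
  obtain y :: "nat \<times> nat \<Rightarrow> complex" where y: "\<forall>e. y e \<in> \<int>"
    "(\<Sum>K\<in>midx p n b. c K * mmono (flat_idx p K) (npt p n y)) \<noteq> 0"
    using segre_veronese_nondegenerate[OF c(1)] by blast
  define x'' where "x'' = (\<lambda>(l', e). if l' = l then y e else x' (l', e))"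
  have same: "pvec p n b x'' i = pvec p n b x' i" if "i \<in> ?S" for i
  proof -
    have "fst i \<noteq> l" using that insert by (cases i) auto
    then show ?thesis by (cases i) (auto simp: pvec_def x''_def fun_eq_iff split: option.splits)
  qed
  have "findep (pvec p n b x'') (insert (l, None) ?S)"
  proof (rule findep_insert[OF fin notin])
    show "findep (pvec p n b x'') ?S" using x'(2) same findep_cong[of ?S "pvec p n b x''"] by blast
    show "\<forall>i\<in>?S. lfun (midx p n b) c (pvec p n b x'' i) = 0" using c(2) same by simp
    show "lfun (midx p n b) c (pvec p n b x'' (l, None)) \<noteq> 0"
      using y(2) by (simp add: lfun_def pvec_def x''_def)
  qed
  moreover have "\<forall>e. x'' e \<in> \<int>" using x'(1) y(1) by (auto simp: x''_def)
  moreover have "insert (l, None) ?S = S \<union> insert l T \<times> {None}" by auto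
  ultimately show ?case by metis
qed

lemma two_elements:
  assumes "2 \<le> card A"
  obtains x y where "x \<in> A" "y \<in> A" "x \<noteq> y"
proof -
  have "finite A" using assms by (metis card.infinite not_numeral_le_zero)
  then show ?thesis using that assms by (metis card_le_Suc0_iff_eq not_less_eq_eq numeral_2_eq_2)
qed

lemma gen_points_indep:
  assumes "h \<le> card (midx p n b)"
  shows "gen (\<lambda>x. findep (pvec p n b x) ({..<h} \<times> {None}))"
proof -
  have "findep (pvec p n b (\<lambda>_. 0)) {}" by (simp add: findep_def)
  then obtain x' where x': "\<forall>e. x' e \<in> \<int>" "findep (pvec p n b x') ({..<h} \<times> {None})"
    using extend_by_points[of "{..<h}" "{}" "\<lambda>_. 0" p n b] assms by auto
  show ?thesis
    by (rule gen_findep[where X = "midx p n b" and u = "pvec p n b", OF _ finite_midx pvec_LP x']) (auto simp: pvec_coord)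
qed

abbreviation "ztan p n b \<equiv> tan_idx p n b (\<lambda>_. 0)"

text \<open>
  Two tangent spaces in general position: at a coordinate point the tangent space is spanned by
  unit vectors, and the point with all coordinates 1 is separated from it by two further entries.
\<close>

lemma gen_tangent_rank:
  assumes R: "R \<subseteq> {..<h}" "2 \<le> card R"
    and N: "card (ztan p n b) + h + 1 \<le> card (midx p n b)"
  shows "gen (\<lambda>x. \<exists>S. finite S \<and> card S = card (ztan p n b) + card R + 1 \<and>
           S \<subseteq> R \<times> (insert None (Some ` ztan p n b)) \<and> findep (pvec p n b x) S)"
proof -
  let ?X = "midx p n b" and ?E = "ztan p n b"
  have finR: "finite R" using R(1) finite_subset by blast
  obtain l1 l2 where l12: "l1 \<in> R" "l2 \<in> R" "l1 \<noteq> l2"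
    using R(2) by (metis card_le_Suc0_iff_eq finR not_less_eq_eq numeral_2_eq_2)
  have cR: "card R \<le> h" using card_mono[OF _ R(1)] by simp
  define J where "J = pure_idx p b (\<lambda>_. 0)"
  have JX: "J \<in> ?X" unfolding J_def by (rule pure_idx_midx) simp
  define Je where "Je = (\<lambda>(a, j). repl_idx J a 0 j)"
  have J0: "0 \<in># J a" if "a < p" "0 < b a" for a using that by (simp add: J_def pure_idx_def)
  have countJ: "count (flat_idx p J) (a, j) = 0" if "0 < j" for a j
    using that by (simp add: count_flat_idx J_def pure_idx_def)
  have JeX: "Je e \<in> ?X" if "e \<in> ?E" for e
    using that JX J0 unfolding Je_def tan_idx_def by (auto intro!: repl_idx_midx)
  have flatJe: "add_mset (fst e, 0) (flat_idx p (Je e)) = add_mset e (flat_idx p J)" if "e \<in> ?E" for e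
    using that flat_repl_idx[of "fst e" p 0 J "snd e"] J0 unfolding Je_def tan_idx_def by auto
  have countJe: "count (flat_idx p (Je e)) (a, j) = (if (a, j) = e then 1 else 0)" if "e \<in> ?E" "0 < j" for e a j
    using arg_cong[OF flatJe[OF that(1)], of "\<lambda>M. count M (a, j)"] that(2) countJ by (cases e) (auto split: if_splits)
  let ?B = "insert J (Je ` ?E)"
  have finB: "finite ?B" using finite_tan_idx by blast
  have "card ?B \<le> card ?E + 1"
    using card_image_le[OF finite_tan_idx, of Je] card_insert_le_m1 by (metis Suc_eq_plus1 card_insert_if finite_imageI finite_tan_idx le_SucI not_less_eq_eq)
  \<comment> \<open>The coordinate point and its tangent directions occupy at most
    \<open>card ?E + 1\<close> entries. Since \<open>h\<close> is at least 2, two entries are left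
    over.\<close>
  then have "2 \<le> card (?X - ?B)"
    using N R(2) cR diff_card_le_card_Diff[OF finB, of ?X] by linarith
  then obtain K1 K2 where K12: "K1 \<in> ?X - ?B" "K2 \<in> ?X - ?B" "K1 \<noteq> K2"
    using two_elements by metis
  obtain c j where cj: "c < p" "0 < j" "j \<le> n c" "count (K1 c) j \<noteq> count (K2 c) j"
    using midx_distinct[of K1 p n b K2] K12 by blast
  let ?e = "(c, j)"
  have eE: "?e \<in> ?E"
  proof -
    have "K1 c \<noteq> {#} \<or> K2 c \<noteq> {#}" using cj(4) by auto
    then have "0 < b c" using midxD(1)[of K1 p n b c] midxD(1)[of K2 p n b c] K12 cj(1) by auto
    then show ?thesis using cj by (simp add: tan_idx_def)
  qed
  \<comment> \<open>The point \<open>l1\<close> is the coordinate point of the entry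
    \<open>J\<close>; all other points have all coordinates 1.\<close>
  define x0 where "x0 = (\<lambda>(l::nat, e::nat \<times> nat). if l = l1 then 0 else 1 :: complex)"
  \<comment> \<open>\<open>card ?E + 1\<close> vectors at \<open>l1\<close> and two at
    \<open>l2\<close>: the point itself and its derivative by a coordinate whose multiplicity
    differs between \<open>K1\<close> and \<open>K2\<close>.\<close>
  define S0 where "S0 = {l1} \<times> insert None (Some ` ?E) \<union> {(l2, None), (l2, Some ?e)}"
  have finS0: "finite S0" unfolding S0_def using finite_tan_idx[of p n b "\<lambda>_. 0"] by auto
  have card1: "card ({l1} \<times> insert None (Some ` ?E)) = card ?E + 1"
    using finite_tan_idx[of p n b "\<lambda>_. 0"] by (simp add: card_cartesian_product card_image)
  have cardS0: "card S0 = card ?E + 3"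
    unfolding S0_def using l12(3) finite_tan_idx[of p n b "\<lambda>_. 0"]
    by (subst card_Un_disjoint) (auto simp: card1 simp del: insert_Times_insert)
  define z1 :: "nat \<times> nat \<Rightarrow> complex" where "z1 = npt p n (\<lambda>e. x0 (l1, e))"
  have z1: "z1 (a, j) = (if a < p \<and> 0 < j \<and> j \<le> n a then 0 else 1)" for a j
    by (simp add: z1_def npt_def x0_def)
  have mz1: "mmono \<mu> z1 = (if \<exists>a j. (a, j) \<in># \<mu> \<and> a < p \<and> 0 < j \<and> j \<le> n a then 0 else 1)" for \<mu>
    by (induction \<mu>) (auto simp: z1 split_paired_all)
  have v1: "pvec p n b x0 (l1, None) K = (if K = J then 1 else 0)" if K: "K \<in> ?X" for K
  proof (cases "K = J")
    case True
    have "\<not> (\<exists>a j. (a, j) \<in># flat_idx p J \<and> a < p \<and> 0 < j \<and> j \<le> n a)"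
      using countJ by (metis not_in_iff)
    then show ?thesis using True JX by (simp add: pvec_def z1_def[symmetric] mz1)
  next
    case False
    obtain a j where "a < p" "0 < j" "j \<le> n a" "count (K a) j \<noteq> count (J a) j"
      using midx_distinct[OF K JX False] by blast
    moreover have "count (J a) j = 0" using \<open>0 < j\<close> by (simp add: J_def pure_idx_def)
    ultimately have "(a, j) \<in># flat_idx p K" by (simp add: count_greater_zero_iff[symmetric] count_flat_idx del: count_greater_zero_iff)
    then show ?thesis using False K \<open>a < p\<close> \<open>0 < j\<close> \<open>j \<le> n a\<close> by (auto simp: pvec_def z1_def[symmetric] mz1)
  qed
  have v2: "pvec p n b x0 (l1, Some e) K = (if K = Je e then 1 else 0)" if K: "K \<in> ?X" and e: "e \<in> ?E" for K e
  proof (cases "K = Je e")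
    case True
    obtain a0 j0 where e': "e = (a0, j0)" by (cases e)
    have j0: "0 < j0" using e e' by (simp add: tan_idx_def)
    have "count (flat_idx p (Je e) - {#e#}) (a, j) = 0" if "0 < j" for a j
      using countJe[OF e that, of a] by auto
    then have "mmono (flat_idx p (Je e) - {#e#}) z1 = 1" unfolding mz1 by (metis not_in_iff)
    moreover have "count (flat_idx p (Je e)) e = 1" using countJe[OF e j0, of a0] e' by simp
    ultimately show ?thesis using True JeX[OF e] by (simp add: pvec_def z1_def[symmetric] dmono_def)
  next
    case False
    obtain a0 j0 where e': "e = (a0, j0)" by (cases e)
    have j0: "0 < j0" using e e' by (simp add: tan_idx_def)
    obtain a j where aj: "a < p" "0 < j" "j \<le> n a" "count (K a) j \<noteq> count (Je e a) j"
      using midx_distinct[OF K JeX[OF e] False] by blast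
    have ne: "count (flat_idx p K) (a, j) \<noteq> count (flat_idx p (Je e)) (a, j)" using aj by (simp add: count_flat_idx)
    have "dmono e (flat_idx p K) z1 = 0"
    proof (cases "count (flat_idx p K) e = 0")
      case True
      then show ?thesis by (simp add: dmono_def)
    next
      case False
      have "(a, j) \<in># flat_idx p K - {#e#}"
        using ne False countJe[OF e aj(2), of a] by (auto simp: count_greater_zero_iff[symmetric] simp del: count_greater_zero_iff split: if_splits)
      then show ?thesis using aj by (auto simp: dmono_def mz1)
    qed
    then show ?thesis using False K by (simp add: pvec_def z1_def[symmetric])
  qed
  have one: "npt p n (\<lambda>e. x0 (l2, e)) = (\<lambda>_. 1)" using l12(3) by (auto simp: npt_def x0_def fun_eq_iff)
  have m1: "mmono \<mu> (\<lambda>_. 1 :: complex) = 1" for \<mu> :: "(nat \<times> nat) multiset" by (simp add: mmono_def)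
  have v3: "pvec p n b x0 (l2, None) K = 1" and v4: "pvec p n b x0 (l2, Some ?e) K = of_nat (count (K c) j)" if "K \<in> ?X" for K
    using that cj(1) by (simp_all add: pvec_def one m1 dmono_def count_flat_idx)
  have "findep (pvec p n b x0) S0"
  proof (rule findepI)
    fix f i assume f: "\<And>K. (\<Sum>i\<in>S0. f i * pvec p n b x0 i K) = 0" and i: "i \<in> S0"
    have split: "(\<Sum>i\<in>S0. f i * pvec p n b x0 i K) = f (l1, None) * pvec p n b x0 (l1, None) K
        + (\<Sum>e\<in>?E. f (l1, Some e) * pvec p n b x0 (l1, Some e) K)
        + (f (l2, None) * pvec p n b x0 (l2, None) K + f (l2, Some ?e) * pvec p n b x0 (l2, Some ?e) K)" for K
    proof -
      have S0': "S0 = (insert (l1, None) ((\<lambda>e. (l1, Some e)) ` ?E)) \<union> {(l2, None), (l2, Some ?e)}"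
        unfolding S0_def by auto
      show ?thesis unfolding S0' using l12(3) finite_tan_idx[of p n b "\<lambda>_. 0"]
        by (subst sum.union_disjoint) (auto simp: sum.reindex inj_on_def image_iff)
    qed
    have val: "(if K = J then f (l1, None) else 0) + (\<Sum>e\<in>?E. if K = Je e then f (l1, Some e) else 0)
        + (f (l2, None) + f (l2, Some ?e) * of_nat (count (K c) j)) = 0" if K: "K \<in> ?X" for K
      using f[of K] unfolding split v1[OF K] v3[OF K] v4[OF K]
      by (simp add: v2[OF K] if_distrib cong: sum.cong if_cong)
    \<comment> \<open>Outside \<open>?B\<close> only the vectors at \<open>l2\<close> are visible.
      The entries \<open>K1\<close> and \<open>K2\<close> give two equations for their coefficients,
      with determinant \<open>count (K2 c) j - count (K1 c) j\<close>.\<close>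
    have "f (l2, None) + f (l2, Some ?e) * of_nat (count (K c) j) = 0" if "K \<in> ?X - ?B" for K
    proof -
      have "(\<Sum>e\<in>?E. if K = Je e then f (l1, Some e) else 0) = 0"
        using that by (intro sum.neutral) auto
      then show ?thesis using val[of K] that by auto
    qed
    note e12 = this[OF K12(1)] this[OF K12(2)]
    have "f (l2, Some ?e) * (of_nat (count (K1 c) j) - of_nat (count (K2 c) j))
        = (f (l2, None) + f (l2, Some ?e) * of_nat (count (K1 c) j))
        - (f (l2, None) + f (l2, Some ?e) * of_nat (count (K2 c) j))"
      by (simp add: right_diff_distrib)
    then have "f (l2, Some ?e) * (of_nat (count (K1 c) j) - of_nat (count (K2 c) j)) = 0"
      "f (l2, None) + f (l2, Some ?e) * of_nat (count (K1 c) j) = 0"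
      using e12 by simp_all
    then have f2: "f (l2, Some ?e) = 0" "f (l2, None) = 0" using cj(4) by auto
    have JJe: "J \<noteq> Je e" if "e \<in> ?E" for e
    proof
      assume "J = Je e"
      obtain a0 j0 where e': "e = (a0, j0)" by (cases e)
      then have "0 < j0" using that by (simp add: tan_idx_def)
      then show False using countJe[OF that \<open>0 < j0\<close>, of a0] countJ[OF \<open>0 < j0\<close>, of a0] \<open>J = Je e\<close> e' by simp
    qed
    have Jeinj: "e = e'" if "e \<in> ?E" "e' \<in> ?E" "Je e = Je e'" for e e'
    proof -
      obtain a0 j0 where e0: "e = (a0, j0)" by (cases e)
      then have "0 < j0" using that by (simp add: tan_idx_def)
      have "(if (a0, j0) = e then 1 else 0) = (if (a0, j0) = e' then 1 else (0::nat))"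
        unfolding countJe[OF that(1) \<open>0 < j0\<close>, symmetric] countJe[OF that(2) \<open>0 < j0\<close>, symmetric] that(3) ..
      then show ?thesis using e0 by (simp split: if_splits)
    qed
    have f1: "f (l1, None) = 0"
    proof -
      have "(\<Sum>e\<in>?E. if J = Je e then f (l1, Some e) else 0) = 0" using JJe by (intro sum.neutral) auto
      then show ?thesis using val[OF JX] f2 by simp
    qed
    have f3: "f (l1, Some e) = 0" if e: "e \<in> ?E" for e
    proof -
      have "(\<Sum>e'\<in>?E. if Je e = Je e' then f (l1, Some e') else 0) = (\<Sum>e'\<in>?E. if e' = e then f (l1, Some e) else 0)"
        using Jeinj e by (intro sum.cong) auto
      then show ?thesis using val[OF JeX[OF e]] f2 JJe[OF e] e finite_tan_idx[of p n b "\<lambda>_. 0"] f1 by simp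
    qed
    show "f i = 0" using i f1 f2 f3 unfolding S0_def by auto
  qed
  moreover have "\<forall>e. x0 e \<in> \<int>" by (auto simp: x0_def)
  \<comment> \<open>The remaining points of \<open>R\<close> are added one by one, which brings the
    total to \<open>card ?E + 3 + (card R - 2)\<close>.\<close>
  moreover have "card (R - {l1, l2}) = card R - 2" using l12 finR by (simp add: card_Diff_subset)
  ultimately obtain x' where x': "\<forall>e. x' e \<in> \<int>" "findep (pvec p n b x') (S0 \<union> (R - {l1, l2}) \<times> {None})"
    using extend_by_points[of "R - {l1, l2}" S0 x0 p n b] finR finS0 N cR R(2) by (auto simp: S0_def[symmetric] cardS0) (auto simp: S0_def)
  let ?S = "S0 \<union> (R - {l1, l2}) \<times> {None}"
  have finS: "finite ?S" using finS0 finR by simp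
  have "S0 \<inter> (R - {l1, l2}) \<times> {None} = {}" unfolding S0_def by auto
  then have "card ?S = card ?E + 3 + (card R - 2)"
    using finS0 finR \<open>card (R - {l1, l2}) = card R - 2\<close> by (simp add: card_Un_disjoint cardS0 card_cartesian_product)
  then have cS: "card ?S = card ?E + card R + 1" using R(2) by simp
  have sub: "?S \<subseteq> R \<times> insert None (Some ` ?E)" unfolding S0_def using l12 eE by auto
  have "gen (\<lambda>x. findep (pvec p n b x) ?S)"
    by (rule gen_findep[where X = "midx p n b" and u = "pvec p n b", OF finS finite_midx pvec_LP x']) (simp add: pvec_coord)
  then show ?thesis by (rule gen_mono) (use finS cS sub in blast)
qed

definition par_idx :: "nat \<Rightarrow> (nat \<Rightarrow> nat) \<Rightarrow> nat \<Rightarrow> (nat \<times> nat \<times> nat) set" where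
  "par_idx p n h = {(l, c, j). l < h \<and> c < p \<and> 0 < j \<and> j \<le> n c}"

lemma finite_par_idx: "finite (par_idx p n h)"
proof -
  have "par_idx p n h \<subseteq> {..<h} \<times> (\<Union>c<p. {c} \<times> {..n c})" by (auto simp: par_idx_def)
  then show ?thesis by (rule finite_subset) auto
qed

definition generic_at :: "nat \<Rightarrow> (nat \<Rightarrow> nat) \<Rightarrow> (nat \<Rightarrow> nat) \<Rightarrow> nat \<Rightarrow> (nat \<times> nat \<times> nat \<Rightarrow> complex) \<Rightarrow> bool" where
  "generic_at p n b h x \<longleftrightarrow>
     findep (pvec p n b x) ({..<h} \<times> {None}) \<and>
     (\<forall>R. R \<subseteq> {..<h} \<longrightarrow> 2 \<le> card R \<longrightarrow>
        (\<exists>S. finite S \<and> card S = card (ztan p n b) + card R + 1 \<and>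
           S \<subseteq> R \<times> (insert None (Some ` ztan p n b)) \<and> findep (pvec p n b x) S)) \<and>
     (\<forall>e\<in>par_idx p n h. \<exists>D. derivation D \<and> (\<forall>i\<in>par_idx p n h. D (x i) = (if i = e then 1 else 0)))"

lemma derivation_Ints: "derivation D \<Longrightarrow> m \<in> \<int> \<Longrightarrow> D m = 0"
proof -
  assume D: "derivation D" and "m \<in> \<int>"
  then obtain k where "m = of_int k" by (auto elim: Ints_cases)
  then have "m = of_nat (nat k) \<or> m = - of_nat (nat (- k))" by (cases "k \<ge> 0") auto
  then show ?thesis using derivation_of_nat[OF D] derivation_minus[OF D] by auto
qed

text \<open>\<open>A\<close> will be the image of \<open>k\<close>. The point is sought on the line
  from an integral \<open>x0\<close> in the direction of a vector \<open>w\<close> with dual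
  derivations. As derivations kill \<open>x0\<close> and the natural number \<open>t\<close>,
  dividing them by \<open>t\<close> makes them dual to the coordinates of
  \<open>x0 + t * w\<close>.\<close>

lemma exists_generic:
  assumes "h \<le> card (midx p n a)" "card (ztan p n b) + h + 1 \<le> card (midx p n b)"
    and A: "uncountable A" "\<And>m t x. m \<in> \<int> \<Longrightarrow> t \<in> \<nat> \<Longrightarrow> x \<in> A \<Longrightarrow> m + t * x \<in> A" "\<int> \<subseteq> A"
  shows "\<exists>x. (\<forall>e. x e \<in> A) \<and> generic_at p n b h x \<and> findep (pvec p n a x) ({..<h} \<times> {None})"
proof -
  let ?R = "\<lambda>R x. \<exists>S. finite S \<and> card S = card (ztan p n b) + card R + 1 \<and>
           S \<subseteq> R \<times> (insert None (Some ` ztan p n b)) \<and> findep (pvec p n b x) S"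
  obtain x1 where x1: "\<forall>e\<in>par_idx p n h. x1 e \<in> A"
    "\<forall>e\<in>par_idx p n h. \<exists>D. derivation D \<and> (\<forall>i\<in>par_idx p n h. D (x1 i) = (if i = e then 1 else 0))"
    using generic_derivations[OF finite_par_idx A(1)] by blast
  define w where "w = (\<lambda>e. if e \<in> par_idx p n h then x1 e else 0)"
  have "gen (\<lambda>x. (findep (pvec p n a x) ({..<h} \<times> {None}) \<and> findep (pvec p n b x) ({..<h} \<times> {None})) \<and>
      (\<forall>R\<in>{R. R \<subseteq> {..<h} \<and> 2 \<le> card R}. ?R R x))"
    using assms(1,2) by (intro gen_conj gen_finite gen_points_indep gen_tangent_rank) auto
  then obtain \<Phi> x0 where \<Phi>: "\<Phi> \<in> LP" "\<forall>e. x0 e \<in> \<int>" "\<Phi> x0 \<noteq> 0"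
    "\<And>x. \<Phi> x \<noteq> 0 \<Longrightarrow> (findep (pvec p n a x) ({..<h} \<times> {None}) \<and> findep (pvec p n b x) ({..<h} \<times> {None})) \<and>
      (\<forall>R\<in>{R. R \<subseteq> {..<h} \<and> 2 \<le> card R}. ?R R x)"
    unfolding gen_def by blast
  have "\<exists>t\<in>\<nat> - {0}. \<forall>i\<in>{()}. \<Phi> (\<lambda>e. x0 e + t * w e) \<noteq> 0"
  proof (rule polyfun_common_nonzero)
    have "infinite (\<nat> :: complex set)"
      unfolding Nats_def by (rule range_inj_infinite) (rule inj_of_nat)
    then show "infinite (\<nat> - {0} :: complex set)" by simp
    show "polyfun (\<lambda>t. \<Phi> (\<lambda>e. x0 e + t * w e))" using \<Phi>(1) by (simp add: LP_def)
    show "\<exists>t. \<Phi> (\<lambda>e. x0 e + t * w e) \<noteq> 0" using \<Phi>(3) by (intro exI[of _ 0]) simp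
  qed simp
  then obtain t where t: "t \<in> \<nat>" "t \<noteq> 0" "\<Phi> (\<lambda>e. x0 e + t * w e) \<noteq> 0" by auto
  define x where "x = (\<lambda>e. x0 e + t * w e)"
  have tZ: "t \<in> \<int>" using t(1) Nats_subset_Ints by blast
  have "\<exists>D. derivation D \<and> (\<forall>i\<in>par_idx p n h. D (x i) = (if i = e then 1 else 0))" if e: "e \<in> par_idx p n h" for e
  proof -
    obtain D where D: "derivation D" "\<forall>i\<in>par_idx p n h. D (x1 i) = (if i = e then 1 else 0)"
      using x1(2) e by blast
    have "derivation (\<lambda>y. D y / t)"
      using D(1) by (simp add: derivation_def add_divide_distrib)
    moreover have "D (x i) / t = (if i = e then 1 else 0)" if i: "i \<in> par_idx p n h" for i
    proof -
      have "D (x0 i) = 0" "D t = 0" using derivation_Ints[OF D(1)] \<Phi>(2) tZ by blast+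
      then show ?thesis
        using i D(2) t(2) by (simp add: x_def w_def derivation_add[OF D(1)] derivation_mult[OF D(1)])
    qed
    ultimately show ?thesis by (intro exI[of _ "\<lambda>y. D y / t"]) auto
  qed
  moreover have "x e \<in> A" for e
  proof -
    have "w e \<in> A" using x1(1) A(3) by (auto simp: w_def)
    then show ?thesis unfolding x_def using \<Phi>(2) t(1) by (intro A(2)) blast+
  qed
  ultimately show ?thesis
    using \<Phi>(4)[OF t(3)] unfolding generic_at_def x_def[symmetric] by blast
qed

section \<open>The span of generic points against the cone\<close>

context
  fixes p h :: nat and n b :: "nat \<Rightarrow> nat" and x :: "nat \<times> nat \<times> nat \<Rightarrow> complex"
  assumes gx: "generic_at p n b h x"
begin

abbreviation (input) "XX \<equiv> midx p n b"
abbreviation (input) "EE \<equiv> ztan p n b"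

definition zpt :: "nat \<Rightarrow> nat \<times> nat \<Rightarrow> complex" where
  "zpt l = npt p n (\<lambda>e. x (l, e))"

definition ppt :: "nat \<Rightarrow> (nat \<Rightarrow> nat multiset) \<Rightarrow> complex" where
  "ppt l = pvec p n b x (l, None)"

definition dpt :: "nat \<Rightarrow> nat \<times> nat \<Rightarrow> (nat \<Rightarrow> nat multiset) \<Rightarrow> complex" where
  "dpt l e = pvec p n b x (l, Some e)"

lemma ppt: "ppt l K = (if K \<in> XX then mmono (flat_idx p K) (zpt l) else 0)"
  and dpt: "dpt l e K = (if K \<in> XX then dmono e (flat_idx p K) (zpt l) else 0)"
  by (simp_all add: ppt_def dpt_def pvec_def zpt_def)

lemma ppt_indep: "findep ppt {..<h}"
proof (rule findepI)
  fix c i assume c: "\<And>K. (\<Sum>i<h. c i * ppt i K) = 0" and i: "i \<in> {..<h}"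
  have f: "findep (pvec p n b x) ({..<h} \<times> {None})" using gx by (simp add: generic_at_def)
  have "{..<h} \<times> {None} = (\<lambda>l. (l, None :: (nat \<times> nat) option)) ` {..<h}" by auto
  then have "(\<Sum>i\<in>{..<h} \<times> {None}. c (fst i) * pvec p n b x i K) = 0" for K
    using c[of K] by (simp add: sum.reindex inj_on_def ppt_def)
  from findepD[OF f this, of "(i, None)"] i show "c i = 0" by auto
qed

lemma zpt_derivation:
  assumes "l0 < h" "e0 \<in> EE"
  obtains D where "derivation D" "\<And>l e. l < h \<Longrightarrow> D (zpt l e) = (if l = l0 \<and> e = e0 then 1 else 0)"
proof -
  obtain c0 j0 where e0: "e0 = (c0, j0)" by (cases e0)
  have "(l0, c0, j0) \<in> par_idx p n h" using assms by (auto simp: e0 par_idx_def tan_idx_def)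
  then obtain D where D: "derivation D" "\<forall>i\<in>par_idx p n h. D (x i) = (if i = (l0, c0, j0) then 1 else 0)"
    using gx unfolding generic_at_def by blast
  have "D (zpt l e) = (if l = l0 \<and> e = e0 then 1 else 0)" if l: "l < h" for l e
  proof -
    obtain c j where e: "e = (c, j)" by (cases e)
    show ?thesis
    proof (cases "(l, c, j) \<in> par_idx p n h")
      case True
      then have "zpt l e = x (l, c, j)" by (simp add: zpt_def npt_def e par_idx_def)
      then show ?thesis using D(2) True by (auto simp: e e0)
    next
      case False
      then have "zpt l e = 1" using l by (auto simp: zpt_def npt_def e par_idx_def)
      moreover have "\<not> (l = l0 \<and> e = e0)" using False \<open>(l0, c0, j0) \<in> par_idx p n h\<close> e e0 by auto
      ultimately show ?thesis using derivation_1[OF D(1)] by simp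
    qed
  qed
  then show ?thesis using that D(1) by blast
qed

lemma zpt_nonzero:
  assumes "l < h"
  shows "zpt l e \<noteq> 0"
proof
  assume z: "zpt l e = 0"
  obtain c j where e: "e = (c, j)" by (cases e)
  have "(l, c, j) \<in> par_idx p n h" using z assms by (auto simp: zpt_def npt_def e par_idx_def split: if_splits)
  then obtain D where D: "derivation D" "D (x (l, c, j)) = 1"
    using gx unfolding generic_at_def by fastforce
  moreover have "x (l, c, j) = 0" using z by (auto simp: zpt_def npt_def e split: if_splits)
  ultimately show False using derivation_0[OF D(1)] by simp
qed

lemma derivation_mmono_zpt:
  assumes D: "derivation D" "\<And>l e. l < h \<Longrightarrow> D (zpt l e) = (if l = l0 \<and> e = e0 then 1 else 0)" and "l < h"
  shows "D (mmono \<mu> (zpt l)) = (if l = l0 then dmono e0 \<mu> (zpt l) else 0)"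
proof -
  have "D (mmono \<mu> (zpt l)) = (\<Sum>e\<in>insert e0 (set_mset \<mu>). dmono e \<mu> (zpt l) * D (zpt l e))"
    by (rule derivation_mmono[OF D(1)]) auto
  also have "\<dots> = (\<Sum>e\<in>insert e0 (set_mset \<mu>). if e = e0 then (if l = l0 then dmono e0 \<mu> (zpt l) else 0) else 0)"
    using D(2)[OF assms(3)] by (intro sum.cong) auto
  finally show ?thesis by simp
qed

lemma D_ppt:
  assumes D: "derivation D" "\<And>l e. l < h \<Longrightarrow> D (zpt l e) = (if l = l0 \<and> e = e0 then 1 else 0)" and l: "l < h"
  shows "D (ppt l K) = (if l = l0 then dpt l0 e0 K else 0)"
  using derivation_mmono_zpt[OF D l] derivation_0[OF D(1)] by (auto simp: ppt dpt)

lemma D_dpt: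
  assumes D: "derivation D" "\<And>l e. l < h \<Longrightarrow> D (zpt l e) = (if l = l0 \<and> e = e0 then 1 else 0)"
    and l: "l < h" "l \<noteq> l0"
  shows "D (dpt l e K) = 0"
  using l derivation_mmono_zpt[OF D l(1)] derivation_0[OF D(1)] derivation_of_nat[OF D(1)]
  by (simp add: dpt dmono_def derivation_mult[OF D(1)])

lemma tangent_rank_contradiction:
  assumes R: "R \<subseteq> {..<h}" "2 \<le> card R" and M: "finite M" "card M \<le> card EE + card R"
    and sub: "\<And>l. l \<in> R \<Longrightarrow> ppt l \<in> fvs.span M" "\<And>l e. l \<in> R \<Longrightarrow> e \<in> EE \<Longrightarrow> dpt l e \<in> fvs.span M"
  shows False
proof -
  obtain S where S: "finite S" "card S = card EE + card R + 1"
    "S \<subseteq> R \<times> (insert None (Some ` EE))" "findep (pvec p n b x) S"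
    using gx R unfolding generic_at_def by blast
  have "pvec p n b x ` S \<subseteq> fvs.span M"
    using S(3) sub unfolding ppt_def dpt_def by auto
  from findep_card_le[OF S(4,1) M(1) this] show False using M(2) S(2) by simp
qed

text \<open>Let \<open>R\<close> be the support of \<open>c\<close> and \<open>y\<close> the point
  of the cone. The span of the tangent space at \<open>y\<close> and of all points of
  \<open>R\<close> but one contains the last point as well, and, after differentiating the two
  expressions of \<open>y\<close>, all tangent vectors at points of \<open>R\<close>. Its dimension
  is at most \<open>card EE + card R\<close>, which is one too small.\<close>

lemma support_on_cone:
  assumes q: "\<And>K L K' L'. (K, L, K', L') \<in> seg_quad XX \<Longrightarrow>
      (\<Sum>l<h. c l * ppt l K) * (\<Sum>l<h. c l * ppt l L) = (\<Sum>l<h. c l * ppt l K') * (\<Sum>l<h. c l * ppt l L')"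
    and ij: "i < h" "j < h" "i \<noteq> j"
  shows "c i * c j = 0"
proof (rule ccontr)
  assume cij: "c i * c j \<noteq> 0"
  define R where "R = {l. l < h \<and> c l \<noteq> 0}"
  have finR: "finite R" and Rh: "R \<subseteq> {..<h}" by (auto simp: R_def)
  have ijR: "{i, j} \<subseteq> R" using cij ij by (auto simp: R_def)
  then have cR: "2 \<le> card R" using card_mono[OF finR ijR] ij(3) by simp
  define y where "y = (\<lambda>K. \<Sum>l<h. c l * ppt l K)"
  have yR: "y K = (\<Sum>l\<in>R. c l * ppt l K)" for K
    unfolding y_def by (rule sum.mono_neutral_right) (auto simp: R_def)
  have y0: "y K = 0" if "K \<notin> XX" for K using that by (simp add: y_def ppt)
  obtain K0 where K0: "y K0 \<noteq> 0"
    using findepD[OF ppt_indep, of c i] cij ij(1) by (auto simp: y_def)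
  have K0X: "K0 \<in> XX" using K0 y0 by blast
  obtain \<gamma> i0 w where g: "\<gamma> \<noteq> 0" "\<And>a. a < p \<Longrightarrow> i0 a \<le> n a" "\<And>a. w (a, i0 a) = 1"
    "\<And>K. K \<in> XX \<Longrightarrow> y K = \<gamma> * mmono (flat_idx p K) w"
  proof -
    have "y K * y L = y K' * y L'" if "(K, L, K', L') \<in> seg_quad XX" for K L K' L'
      unfolding y_def by (rule q[OF that])
    from seg_cone_of_quadrics[where y = y, OF this K0X K0] show ?thesis using that by blast
  qed
  let ?F = "tan_idx p n b i0"
  define tN where "tN = (\<lambda>K. if K \<in> XX then mmono (flat_idx p K) w else 0)"
  define tS where "tS = (\<lambda>e K. if K \<in> XX then dmono e (flat_idx p K) w else 0)"
  define M where "M = insert tN (tS ` ?F) \<union> ppt ` (R - {i})"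
  have finM: "finite M" unfolding M_def using finR finite_tan_idx[of p n b i0] by simp
  have "card M \<le> card (insert tN (tS ` ?F)) + card (ppt ` (R - {i}))" unfolding M_def by (rule card_Un_le)
  also have "card (insert tN (tS ` ?F)) \<le> Suc (card ?F)"
    using card_insert_le_m1[of "Suc (card ?F)" "tS ` ?F" tN] card_image_le[OF finite_tan_idx, of tS p n b i0] by simp
  also have "card (ppt ` (R - {i})) \<le> card R - 1"
    using card_image_le[of "R - {i}" ppt] finR ijR by simp
  \<comment> \<open>The chart around \<open>y\<close> may differ from the one of the given points,
    but both have the same number of free coordinates.\<close>
  also have "card ?F = card EE" using card_tan_idx[of p i0 n b] card_tan_idx[of p "\<lambda>_. 0" n b] g(2) by simp
  finally have cM: "card M \<le> card EE + card R" using cR by simp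
  let ?V = "fvs.span M"
  note S = fvs.subspace_span[of M]
  have tV: "tN \<in> ?V" "\<And>e. e \<in> ?F \<Longrightarrow> tS e \<in> ?V" "\<And>l. l \<in> R - {i} \<Longrightarrow> ppt l \<in> ?V"
    by (auto simp: M_def intro: fvs.span_base)
  have ytN: "y K = \<gamma> * tN K" for K using g(4) y0 by (simp add: tN_def)
  have pV: "ppt l \<in> ?V" if l: "l \<in> R" for l
  proof (cases "l = i")
    case True
    have "(\<lambda>K. (1 / c i) * (\<gamma> * tN K - (\<Sum>l\<in>R - {i}. c l * ppt l K))) \<in> ?V"
      by (intro subspace_scaleI subspace_diffI subspace_sumI S tV)
    moreover have "(1 / c i) * (\<gamma> * tN K - (\<Sum>l\<in>R - {i}. c l * ppt l K)) = ppt i K" for K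
    proof -
      have "\<gamma> * tN K = c i * ppt i K + (\<Sum>l\<in>R - {i}. c l * ppt l K)"
        using ytN[of K] yR[of K] finR ijR by (simp add: sum.remove[of R i])
      then show ?thesis using cij by simp
    qed
    ultimately show ?thesis using True by simp
  qed (use tV l in auto)
  have dV: "dpt l0 e0 \<in> ?V" if l0: "l0 \<in> R" and e0: "e0 \<in> EE" for l0 e0
  proof -
    have l0h: "l0 < h" "c l0 \<noteq> 0" using l0 by (auto simp: R_def)
    obtain D where D: "derivation D" "\<And>l e. l < h \<Longrightarrow> D (zpt l e) = (if l = l0 \<and> e = e0 then 1 else 0)"
      using zpt_derivation[OF l0h(1) e0] by blast
    \<comment> \<open>\<open>D\<close> is dual to the coordinate \<open>e0\<close> of the point
      \<open>l0\<close>, so it moves no other point; the derivatives of the coefficients contribute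
      only multiples of points.\<close>
    have 1: "D (y K) = (\<Sum>l\<in>R. D (c l) * ppt l K) + c l0 * dpt l0 e0 K" for K
    proof -
      have "D (y K) = (\<Sum>l\<in>R. D (c l) * ppt l K + (if l = l0 then c l0 * dpt l0 e0 K else 0))"
        unfolding yR derivation_sum[OF D(1)] using Rh D_ppt[OF D]
        by (intro sum.cong) (auto simp: derivation_mult[OF D(1)])
      then show ?thesis using l0 finR by (simp add: sum.distrib)
    qed
    \<comment> \<open>The derivative of a point of the cone is tangent to the cone at this point;
      the normalised coordinates of \<open>w\<close> have derivative 0.\<close>
    have 2: "D (y K) = D \<gamma> * tN K + (\<Sum>e\<in>?F. (\<gamma> * D (w e)) * tS e K)" for K
    proof (cases "K \<in> XX")
      case True
      let ?G = "?F \<union> set_mset (flat_idx p K)"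
      have "D (mmono (flat_idx p K) w) = (\<Sum>e\<in>?G. dmono e (flat_idx p K) w * D (w e))"
        using finite_tan_idx by (intro derivation_mmono D(1)) auto
      also have "\<dots> = (\<Sum>e\<in>?F. dmono e (flat_idx p K) w * D (w e))"
      proof (rule sum.mono_neutral_right)
        show "\<forall>e\<in>?G - ?F. dmono e (flat_idx p K) w * D (w e) = 0"
        proof
          fix e assume "e \<in> ?G - ?F"
          then obtain a where "e = (a, i0 a)" using set_flat_idx[OF True, of 0 i0] by auto
          then have "D (w e) = 0" using g(3) derivation_1[OF D(1)] by simp
          then show "dmono e (flat_idx p K) w * D (w e) = 0" by simp
        qed
      qed (use finite_tan_idx in auto)
      finally show ?thesis using True g(4)[OF True]
        by (simp add: derivation_mult[OF D(1)] tN_def tS_def sum_distrib_left mult_ac)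
    qed (simp add: y0 derivation_0[OF D(1)] tN_def tS_def)
    have "(\<lambda>K. (1 / c l0) * (D \<gamma> * tN K + (\<Sum>e\<in>?F. (\<gamma> * D (w e)) * tS e K) - (\<Sum>l\<in>R. D (c l) * ppt l K))) \<in> ?V"
      by (intro subspace_scaleI subspace_diffI subspace_addI subspace_sumI S tV pV)
    moreover have "(1 / c l0) * (D \<gamma> * tN K + (\<Sum>e\<in>?F. (\<gamma> * D (w e)) * tS e K) - (\<Sum>l\<in>R. D (c l) * ppt l K)) = dpt l0 e0 K" for K
      unfolding 2[symmetric] 1 using l0h by simp
    ultimately show ?thesis by simp
  qed
  show False by (rule tangent_rank_contradiction[OF Rh cR finM cM pV dV])
qed

text \<open>The quadrics linearised at \<open>ppt i\<close> describe the tangent space there.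
  Derivations of the coordinates of the other points annihilate the tangent vectors at
  \<open>i\<close>. So a combination of the points of \<open>R'\<close> inside this space would
  place all tangent vectors at the points of \<open>R\<close> in a span of dimension at most
  \<open>card EE + 1 + (card R' - 1)\<close>.\<close>

lemma support_of_tangent:
  assumes i: "i < h"
    and q: "\<And>K L K' L'. (K, L, K', L') \<in> seg_quad XX \<Longrightarrow>
      ppt i K * (\<Sum>l<h. c l * ppt l L) + ppt i L * (\<Sum>l<h. c l * ppt l K)
      = ppt i K' * (\<Sum>l<h. c l * ppt l L') + ppt i L' * (\<Sum>l<h. c l * ppt l K')"
    and j: "j < h" "j \<noteq> i"
  shows "c j = 0"
proof (rule ccontr)
  assume cj: "c j \<noteq> 0"
  define R' where "R' = {l. l < h \<and> l \<noteq> i \<and> c l \<noteq> 0}"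
  define R where "R = insert i R'"
  have finR: "finite R'" "finite R" and Rh: "R \<subseteq> {..<h}" using i by (auto simp: R_def R'_def)
  have jR: "j \<in> R'" using cj j by (auto simp: R'_def)
  have iR: "i \<notin> R'" by (simp add: R'_def)
  have cR: "card R = card R' + 1" using finR iR by (simp add: R_def)
  have cR': "card R' \<ge> 1" using jR finR by (metis One_nat_def Suc_leI card_gt_0_iff empty_iff)
  define y where "y = (\<lambda>K. \<Sum>l<h. c l * ppt l K)"
  have "\<exists>c0 g. \<forall>K\<in>XX. y K = c0 * mmono (flat_idx p K) (zpt i)
           + (\<Sum>e\<in>EE. g e * dmono e (flat_idx p K) (zpt i))"
  proof (rule seg_tangent_of_quadrics[OF zpt_nonzero[OF i]])
    fix K L K' L' assume s: "(K, L, K', L') \<in> seg_quad XX"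
    then have "K \<in> XX" "L \<in> XX" "K' \<in> XX" "L' \<in> XX" by (auto simp: seg_quad_def)
    then show "mmono (flat_idx p K) (zpt i) * y L + mmono (flat_idx p L) (zpt i) * y K
        = mmono (flat_idx p K') (zpt i) * y L' + mmono (flat_idx p L') (zpt i) * y K'"
      using q[OF s] by (simp add: y_def ppt)
  qed
  then obtain c0 g where g: "\<And>K. K \<in> XX \<Longrightarrow> y K = c0 * mmono (flat_idx p K) (zpt i)
           + (\<Sum>e\<in>EE. g e * dmono e (flat_idx p K) (zpt i))" by blast
  have y1: "y K = c0 * ppt i K + (\<Sum>e\<in>EE. g e * dpt i e K)" for K
    using g[of K] by (cases "K \<in> XX") (auto simp: ppt dpt y_def)
  have y2: "y K = c i * ppt i K + (\<Sum>l\<in>R'. c l * ppt l K)" for K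
  proof -
    have "y K = (\<Sum>l\<in>R. c l * ppt l K)"
      unfolding y_def using i by (intro sum.mono_neutral_right) (auto simp: R_def R'_def)
    then show ?thesis using finR iR by (simp add: R_def)
  qed
  define d where "d = c0 - c i"
  have y3: "(\<Sum>l\<in>R'. c l * ppt l K) = d * ppt i K + (\<Sum>e\<in>EE. g e * dpt i e K)" for K
    using y1[of K] y2[of K] by (simp add: d_def algebra_simps)
  define M where "M = insert (ppt i) (dpt i ` EE) \<union> ppt ` (R' - {j})"
  have finM: "finite M" unfolding M_def using finR finite_tan_idx[of p n b "\<lambda>_. 0"] by simp
  have "card M \<le> card (insert (ppt i) (dpt i ` EE)) + card (ppt ` (R' - {j}))" unfolding M_def by (rule card_Un_le)
  also have "card (insert (ppt i) (dpt i ` EE)) \<le> Suc (card EE)"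
    using card_insert_le_m1[of "Suc (card EE)" "dpt i ` EE" "ppt i"] card_image_le[OF finite_tan_idx, of "dpt i" p n b "\<lambda>_. 0"] by simp
  also have "card (ppt ` (R' - {j})) \<le> card R' - 1"
    using card_image_le[of "R' - {j}" ppt] finR jR by simp
  finally have cM: "card M \<le> card EE + card R" using cR cR' by simp
  let ?V = "fvs.span M"
  note S = fvs.subspace_span[of M]
  have tV: "ppt i \<in> ?V" "\<And>e. e \<in> EE \<Longrightarrow> dpt i e \<in> ?V" "\<And>l. l \<in> R' - {j} \<Longrightarrow> ppt l \<in> ?V"
    by (auto simp: M_def intro: fvs.span_base)
  have pV: "ppt l \<in> ?V" if l: "l \<in> R" for l
  proof (cases "l = j")
    case True
    have "(\<lambda>K. (1 / c j) * (d * ppt i K + (\<Sum>e\<in>EE. g e * dpt i e K) - (\<Sum>l\<in>R' - {j}. c l * ppt l K))) \<in> ?V"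
      by (intro subspace_scaleI subspace_diffI subspace_addI subspace_sumI S tV)
    moreover have "(1 / c j) * (d * ppt i K + (\<Sum>e\<in>EE. g e * dpt i e K) - (\<Sum>l\<in>R' - {j}. c l * ppt l K)) = ppt j K" for K
      unfolding y3[symmetric] sum.remove[OF finR(1) jR] using cj by simp
    ultimately show ?thesis using True by simp
  next
    case False
    then show ?thesis using l tV by (cases "l = i") (auto simp: R_def)
  qed
  have dV: "dpt l0 e0 \<in> ?V" if l0: "l0 \<in> R" and e0: "e0 \<in> EE" for l0 e0
  proof (cases "l0 = i")
    case True
    then show ?thesis using tV e0 by simp
  next
    case False
    then have l0R: "l0 \<in> R'" and l0h: "l0 < h" "c l0 \<noteq> 0" using l0 by (auto simp: R_def R'_def)
    obtain D where D: "derivation D" "\<And>l e. l < h \<Longrightarrow> D (zpt l e) = (if l = l0 \<and> e = e0 then 1 else 0)"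
      using zpt_derivation[OF l0h(1) e0] by blast
    have 1: "D (\<Sum>l\<in>R'. c l * ppt l K) = (\<Sum>l\<in>R'. D (c l) * ppt l K) + c l0 * dpt l0 e0 K" for K
    proof -
      have "D (\<Sum>l\<in>R'. c l * ppt l K) = (\<Sum>l\<in>R'. D (c l) * ppt l K + (if l = l0 then c l0 * dpt l0 e0 K else 0))"
        unfolding derivation_sum[OF D(1)] using Rh D_ppt[OF D]
        by (intro sum.cong) (auto simp: derivation_mult[OF D(1)] R_def)
      then show ?thesis using l0R finR by (simp add: sum.distrib)
    qed
    have 2: "D (d * ppt i K + (\<Sum>e\<in>EE. g e * dpt i e K)) = D d * ppt i K + (\<Sum>e\<in>EE. D (g e) * dpt i e K)" for K
      using False D_ppt[OF D i] D_dpt[OF D i]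
      by (simp add: derivation_add[OF D(1)] derivation_sum[OF D(1)] derivation_mult[OF D(1)])
    have "(\<lambda>K. (1 / c l0) * (D d * ppt i K + (\<Sum>e\<in>EE. D (g e) * dpt i e K) - (\<Sum>l\<in>R'. D (c l) * ppt l K))) \<in> ?V"
      by (intro subspace_scaleI subspace_diffI subspace_addI subspace_sumI S tV pV) (auto simp: R_def)
    moreover have "(1 / c l0) * (D d * ppt i K + (\<Sum>e\<in>EE. D (g e) * dpt i e K) - (\<Sum>l\<in>R'. D (c l) * ppt l K)) = dpt l0 e0 K" for K
      unfolding 2[symmetric] y3[symmetric] 1 using l0h by simp
    ultimately show ?thesis by simp
  qed
  show False by (rule tangent_rank_contradiction[OF Rh _ finM cM pV dV]) (use cR cR' in simp_all)
qed

end

subsection \<open>The quadrics on the span of generic points\<close>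

definition msets :: "nat \<Rightarrow> nat \<Rightarrow> nat multiset set" where
  "msets h m = {\<mu>. size \<mu> = m \<and> set_mset \<mu> \<subseteq> {..<h}}"

definition mixed :: "nat multiset \<Rightarrow> bool" where
  "mixed \<mu> \<longleftrightarrow> (\<exists>i j. i \<noteq> j \<and> i \<in># \<mu> \<and> j \<in># \<mu>)"

definition quadf :: "nat \<Rightarrow> (nat \<Rightarrow> nat \<Rightarrow> 'k::comm_ring_1) \<Rightarrow> (nat \<Rightarrow> 'k) \<Rightarrow> 'k" where
  "quadf h q c = (\<Sum>k<h. \<Sum>l<h. q k l * (c k * c l))"

lemma finite_msets: "finite (msets h m)"
  unfolding msets_def by (rule finite_multisets_le) simp

lemma quadf_scale: "quadf h q (\<lambda>l. s * c l) = s ^ 2 * quadf h q c"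
  by (simp add: quadf_def sum_distrib_left power2_eq_square mult_ac)

lemma multiset_pigeonhole:
  assumes "\<mu> \<in> msets h m" "h * L < m"
  shows "\<exists>i<h. L < count \<mu> i"
proof (rule ccontr)
  assume "\<not> ?thesis"
  then have "\<And>i. i < h \<Longrightarrow> count \<mu> i \<le> L" by (meson not_less)
  then have "(\<Sum>i\<in>set_mset \<mu>. count \<mu> i) \<le> (\<Sum>i\<in>set_mset \<mu>. L)"
    using assms(1) by (intro sum_mono) (auto simp: msets_def)
  also have "\<dots> \<le> h * L" using assms(1) card_mono[of "{..<h}" "set_mset \<mu>"] by (auto simp: msets_def)
  finally show False using assms by (simp add: msets_def size_multiset_overloaded_eq)
qed

lemma replicate_subset_mset: "L \<le> count \<mu> i \<Longrightarrow> replicate_mset L i \<subseteq># \<mu>"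
  by (auto simp: subseteq_mset_def)

lemma pideal_mmono_superset:
  assumes "pideal I" "mmono \<nu> \<in> I" "\<nu> \<subseteq># \<mu>"
  shows "mmono \<mu> \<in> I"
proof -
  have "\<mu> = \<mu> - \<nu> + \<nu>" using assms(3) by simp
  then have "mmono \<mu> = (\<lambda>z. mmono (\<mu> - \<nu>) z * mmono \<nu> z)"
    by (auto simp: fun_eq_iff mmono_plus[symmetric])
  moreover have "(\<lambda>z. mmono (\<mu> - \<nu>) z * mmono \<nu> z) \<in> I"
    using assms(1,2) unfolding pideal_def by blast
  ultimately show ?thesis by (rule ssubst[where P = "\<lambda>f. f \<in> I"])
qed

lemma mmono_replicate: "mmono (replicate_mset L i) z = z i ^ L"
  by (simp add: mmono_def)

lemma pgen_explicit:
  assumes "f \<in> pgen (F ` Qs)" "finite Qs"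
  shows "\<exists>V \<beta>. finite V \<and> (\<forall>c. f c = (\<Sum>\<nu>\<in>V. \<Sum>q\<in>Qs. \<beta> \<nu> q * (mmono \<nu> c * F q c)))"
  using assms(1) unfolding pgen_def
proof (induction f rule: fvs_span_induct)
  case zero
  show ?case by (rule exI[of _ "{}"]) simp
next
  case (base f)
  then obtain \<nu> q where f: "f = (\<lambda>z. mmono \<nu> z * F q z)" "q \<in> Qs" by auto
  show ?case
    by (rule exI[of _ "{\<nu>}"], rule exI[of _ "\<lambda>_ q'. if q' = q then 1 else 0"])
       (use f assms(2) in \<open>auto simp: if_distrib[of "\<lambda>z. z * _"] cong: if_cong\<close>)
next
  case (add f g)
  then obtain V \<beta> V' \<beta>' where V: "finite V" "\<And>c. f c = (\<Sum>\<nu>\<in>V. \<Sum>q\<in>Qs. \<beta> \<nu> q * (mmono \<nu> c * F q c))"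
    "finite V'" "\<And>c. g c = (\<Sum>\<nu>\<in>V'. \<Sum>q\<in>Qs. \<beta>' \<nu> q * (mmono \<nu> c * F q c))" by blast
  define \<beta>1 where "\<beta>1 = (\<lambda>\<nu> q. (if \<nu> \<in> V then \<beta> \<nu> q else 0) + (if \<nu> \<in> V' then \<beta>' \<nu> q else 0))"
  have "f c + g c = (\<Sum>\<nu>\<in>V \<union> V'. \<Sum>q\<in>Qs. \<beta>1 \<nu> q * (mmono \<nu> c * F q c))" for c
  proof -
    have "f c = (\<Sum>\<nu>\<in>V \<union> V'. \<Sum>q\<in>Qs. (if \<nu> \<in> V then \<beta> \<nu> q else 0) * (mmono \<nu> c * F q c))"
      unfolding V(2) using V(1,3) by - (rule sum.mono_neutral_cong_left, auto)
    moreover have "g c = (\<Sum>\<nu>\<in>V \<union> V'. \<Sum>q\<in>Qs. (if \<nu> \<in> V' then \<beta>' \<nu> q else 0) * (mmono \<nu> c * F q c))"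
      unfolding V(4) using V(1,3) by - (rule sum.mono_neutral_cong_left, auto)
    ultimately show ?thesis by (simp add: \<beta>1_def distrib_right sum.distrib)
  qed
  then show ?case using V(1,3) by (intro exI[of _ "V \<union> V'"] exI[of _ \<beta>1]) simp
next
  case (scale a f)
  then obtain V \<beta> where V: "finite V" "\<And>c. f c = (\<Sum>\<nu>\<in>V. \<Sum>q\<in>Qs. \<beta> \<nu> q * (mmono \<nu> c * F q c))" by blast
  then show ?case
    by (intro exI[of _ V] exI[of _ "\<lambda>\<nu> q. a * \<beta> \<nu> q"]) (simp add: sum_distrib_left mult.assoc)
qed

section \<open>Quadrics that cut out the coordinate points transversally\<close>

context
  fixes h :: nat and Qs :: "'q set" and qc :: "'q \<Rightarrow> nat \<Rightarrow> nat \<Rightarrow> complex"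
  assumes finQ: "finite Qs"
    and diag: "\<And>q i. q \<in> Qs \<Longrightarrow> i < h \<Longrightarrow> qc q i i = 0"
    and zeros: "\<And>c i j. (\<And>q. q \<in> Qs \<Longrightarrow> quadf h (qc q) c = 0) \<Longrightarrow> i < h \<Longrightarrow> j < h \<Longrightarrow> i \<noteq> j \<Longrightarrow> c i * c j = 0"
    and tangent: "\<And>c i j. i < h \<Longrightarrow> (\<And>q. q \<in> Qs \<Longrightarrow> (\<Sum>l<h. (qc q i l + qc q l i) * c l) = 0)
           \<Longrightarrow> j < h \<Longrightarrow> j \<noteq> i \<Longrightarrow> c j = 0"
begin

lemma quadric_ideal: "pideal (pgen ((\<lambda>q. quadf h (qc q)) ` Qs))"
  by (rule pideal_pgen)

lemma quadf_PF: "quadf h q \<in> PF"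
proof -
  have "(\<lambda>c. \<Sum>k<h. \<Sum>l<h. q k l * (c k * c l)) \<in> PF"
    by (intro PF_sum PF_scale PF_mult PF_var)
  then show ?thesis by (simp add: quadf_def[abs_def])
qed

lemma power_in_ideal:
  assumes "i < h" "j < h" "i \<noteq> j"
  shows "\<exists>M. mmono (replicate_mset M i + replicate_mset M j) \<in> pgen ((\<lambda>q. quadf h (qc q)) ` Qs)"
proof -
  have "\<exists>M. (\<lambda>c. (c i * c j) ^ M) \<in> pgen ((\<lambda>q. quadf h (qc q)) ` Qs)"
  proof (rule nullstellensatz)
    show "(\<lambda>q. quadf h (qc q)) ` Qs \<subseteq> PF" using quadf_PF by blast
    show "(\<lambda>c. c i * c j) \<in> (PF :: ((nat \<Rightarrow> complex) \<Rightarrow> complex) set)" by (intro PF_mult PF_var)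
    show "c i * c j = 0" if "\<And>g. g \<in> (\<lambda>q. quadf h (qc q)) ` Qs \<Longrightarrow> g c = 0" for c
      using zeros[of c i j] that assms by blast
  qed
  moreover have "(\<lambda>c :: nat \<Rightarrow> complex. (c i * c j) ^ M) = mmono (replicate_mset M i + replicate_mset M j)" for M
    by (auto simp: fun_eq_iff mmono_plus mmono_replicate power_mult_distrib)
  ultimately show ?thesis by (simp only:)
qed

text \<open>
  The gradients of the quadrics at the \<open>i\<close>-th coordinate point span the forms \<open>c j\<close>, \<open>j \<noteq> i\<close>.
\<close>

lemma linear_term_in_ideal:
  assumes i: "i < h" and j: "j < h" "j \<noteq> i"
  shows "\<exists>r. (\<lambda>c. c i * c j + (\<Sum>k\<in>{..<h} - {i}. \<Sum>l\<in>{..<h} - {i}. r k l * (c k * c l)))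
           \<in> pgen ((\<lambda>q. quadf h (qc q)) ` Qs)"
proof -
  \<comment> \<open>\<open>u l\<close> collects the \<open>l\<close>-th entries of the gradients at
    the \<open>i\<close>-th coordinate point. By \<open>tangent\<close> these columns are
    independent, and a dual family combines the quadrics into one whose gradient is
    \<open>c j\<close>.\<close>
  define u where "u = (\<lambda>l q. if q \<in> Qs then qc q i l + qc q l i else 0)"
  have "findep u ({..<h} - {i})"
  proof (rule findepI)
    fix c j assume c: "\<And>q. (\<Sum>l\<in>{..<h} - {i}. c l * u l q) = 0" and j: "j \<in> {..<h} - {i}"
    have "(\<Sum>l<h. (qc q i l + qc q l i) * c l) = 0" if q: "q \<in> Qs" for q
    proof -
      have "(\<Sum>l<h. (qc q i l + qc q l i) * c l) = (\<Sum>l\<in>{..<h} - {i}. c l * u l q)"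
        using i diag[OF q i] q by (subst sum.remove[of _ i]) (auto simp: u_def mult.commute)
      then show ?thesis using c by simp
    qed
    from tangent[OF i this, of j] j show "c j = 0" by auto
  qed
  moreover have "\<forall>l\<in>{..<h} - {i}. u l \<in> coord_space Qs" by (auto simp: u_def coord_space_def)
  ultimately obtain \<xi> where \<xi>: "\<forall>k\<in>{..<h} - {i}. \<forall>l\<in>{..<h} - {i}. lfun Qs (\<xi> k) (u l) = (if k = l then 1 else 0)"
    using findep_dual[of "{..<h} - {i}" Qs u] finQ by blast
  define r where "r = (\<lambda>k l. \<Sum>q\<in>Qs. \<xi> j q * qc q k l)"
  let ?H = "{..<h} - {i}"
  have lin: "r i l + r l i = (if l = j then 1 else 0)" if "l \<in> ?H" for l
  proof -
    have "r i l + r l i = lfun Qs (\<xi> j) (u l)"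
      unfolding r_def lfun_def sum.distrib[symmetric] by (intro sum.cong) (auto simp: u_def distrib_left)
    then show ?thesis using \<xi> j that by auto
  qed
  have rii: "r i i = 0" unfolding r_def using diag[OF _ i] by (intro sum.neutral) auto
  have "(\<Sum>q\<in>Qs. \<xi> j q * quadf h (qc q) c) = c i * c j + (\<Sum>k\<in>?H. \<Sum>l\<in>?H. r k l * (c k * c l))" for c
  proof -
    have "(\<Sum>q\<in>Qs. \<xi> j q * quadf h (qc q) c) = (\<Sum>q\<in>Qs. \<Sum>k<h. \<Sum>l<h. \<xi> j q * qc q k l * (c k * c l))"
      by (simp add: quadf_def sum_distrib_left mult.assoc)
    also have "\<dots> = (\<Sum>k<h. \<Sum>q\<in>Qs. \<Sum>l<h. \<xi> j q * qc q k l * (c k * c l))" by (rule sum.swap)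
    also have "\<dots> = (\<Sum>k<h. \<Sum>l<h. \<Sum>q\<in>Qs. \<xi> j q * qc q k l * (c k * c l))" by (subst sum.swap[of _ Qs]) (rule refl)
    also have "\<dots> = (\<Sum>k<h. \<Sum>l<h. r k l * (c k * c l))" by (simp add: r_def sum_distrib_right)
    also have "\<dots> = (\<Sum>l<h. r i l * (c i * c l)) + (\<Sum>k\<in>?H. \<Sum>l<h. r k l * (c k * c l))"
      using i by (subst sum.remove[of _ i]) auto
    also have "(\<Sum>l<h. r i l * (c i * c l)) = (\<Sum>l\<in>?H. r i l * (c i * c l))"
      using i rii by (subst sum.remove[of _ i]) auto
    also have "(\<Sum>k\<in>?H. \<Sum>l<h. r k l * (c k * c l)) = (\<Sum>k\<in>?H. r k i * (c k * c i)) + (\<Sum>k\<in>?H. \<Sum>l\<in>?H. r k l * (c k * c l))"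
      using i unfolding sum.distrib[symmetric] by (intro sum.cong refl) (subst sum.remove[of _ i], auto)
    also have "(\<Sum>l\<in>?H. r i l * (c i * c l)) + ((\<Sum>k\<in>?H. r k i * (c k * c i)) + (\<Sum>k\<in>?H. \<Sum>l\<in>?H. r k l * (c k * c l)))
        = (\<Sum>l\<in>?H. (r i l + r l i) * (c i * c l)) + (\<Sum>k\<in>?H. \<Sum>l\<in>?H. r k l * (c k * c l))"
      by (simp add: algebra_simps sum.distrib)
    also have "(\<Sum>l\<in>?H. (r i l + r l i) * (c i * c l)) = (\<Sum>l\<in>?H. if l = j then c i * c j else 0)"
      using lin by (intro sum.cong) auto
    finally show ?thesis using j by simp
  qed
  moreover have "(\<lambda>c. \<Sum>q\<in>Qs. \<xi> j q * quadf h (qc q) c) \<in> pgen ((\<lambda>q. quadf h (qc q)) ` Qs)"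
    by (intro subspace_sumI subspace_scaleI pideal_subspace quadric_ideal pgen_base) auto
  ultimately show ?thesis by (intro exI[of _ r]) simp
qed

text \<open>Nakayama's argument at the \<open>i\<close>-th coordinate point. Up to a power of
  \<open>c i\<close>, all monomials of large degree in the other variables lie in the ideal, and
  \<open>linear_term_in_ideal\<close> trades \<open>c i * c k\<close> for terms of higher degree in
  these variables. Descending induction on this degree \<open>s\<close> ends at 1.\<close>

lemma mixed_power_in_ideal:
  assumes i: "i < h" and j: "j < h" "j \<noteq> i"
  shows "\<exists>L. mmono (add_mset j (replicate_mset L i)) \<in> pgen ((\<lambda>q. quadf h (qc q)) ` Qs)"
proof -
  let ?I = "pgen ((\<lambda>q. quadf h (qc q)) ` Qs)" and ?H = "{..<h} - {i}"
  note I = quadric_ideal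
  have "\<forall>k\<in>?H. \<exists>M. mmono (replicate_mset M i + replicate_mset M k) \<in> ?I"
    using power_in_ideal i by auto
  then obtain Mf where Mf: "\<And>k. k \<in> ?H \<Longrightarrow> mmono (replicate_mset (Mf k) i + replicate_mset (Mf k) k) \<in> ?I"
    by metis
  \<comment> \<open>The sum serves as a common exponent for all \<open>k\<close>.\<close>
  define M where "M = (\<Sum>k\<in>?H. Mf k)"
  have M: "mmono (replicate_mset M i + replicate_mset M k) \<in> ?I" if k: "k \<in> ?H" for k
  proof (rule pideal_mmono_superset[OF I Mf[OF k]])
    have "Mf k \<le> M" unfolding M_def using k by (intro member_le_sum) auto
    then show "replicate_mset (Mf k) i + replicate_mset (Mf k) k \<subseteq># replicate_mset M i + replicate_mset M k"
      by (intro subset_mset.add_mono replicate_subset_mset) auto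
  qed
  have claim: "\<exists>e. \<forall>\<nu>. size \<nu> = s \<longrightarrow> set_mset \<nu> \<subseteq> ?H \<longrightarrow> mmono (replicate_mset e i + \<nu>) \<in> ?I" if "1 \<le> s" "s \<le> h * M + 1" for s
    using that(2,1)
  proof (induction s rule: inc_induct)
    case base
    have "mmono (replicate_mset M i + \<nu>) \<in> ?I" if \<nu>: "size \<nu> = h * M + 1" "set_mset \<nu> \<subseteq> ?H" for \<nu>
    proof -
      obtain k where k: "k < h" "M < count \<nu> k"
        using multiset_pigeonhole[of \<nu> h "h * M + 1" M] \<nu> by (auto simp: msets_def)
      then have "k \<in># \<nu>" by (metis count_inI not_less_zero)
      then have kH: "k \<in> ?H" using \<nu> by blast
      show ?thesis
        by (rule pideal_mmono_superset[OF I M[OF kH]])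
           (use k in \<open>auto intro!: replicate_subset_mset\<close>)
    qed
    then show ?case by blast
  next
    case (step s)
    then obtain e where e: "\<And>\<nu>. size \<nu> = Suc s \<Longrightarrow> set_mset \<nu> \<subseteq> ?H \<Longrightarrow> mmono (replicate_mset e i + \<nu>) \<in> ?I" by auto
    have "mmono (replicate_mset (Suc e) i + \<nu>) \<in> ?I" if \<nu>: "size \<nu> = s" "set_mset \<nu> \<subseteq> ?H" for \<nu>
    proof -
      obtain k \<nu>' where k: "\<nu> = add_mset k \<nu>'" using \<nu>(1) step.prems by (cases \<nu>) auto
      have kH: "k < h" "k \<noteq> i" using \<nu> k by auto
      obtain r where r: "(\<lambda>c. c i * c k + (\<Sum>k\<in>?H. \<Sum>l\<in>?H. r k l * (c k * c l))) \<in> ?I"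
        using linear_term_in_ideal[OF i kH] by blast
      let ?m = "replicate_mset e i + \<nu>'"
      have 1: "(\<lambda>c. mmono ?m c * (c i * c k + (\<Sum>k\<in>?H. \<Sum>l\<in>?H. r k l * (c k * c l)))) \<in> ?I"
        by (rule pideal_PF_mult[OF I r PF_mmono])
      have 2: "(\<lambda>c. \<Sum>k\<in>?H. \<Sum>l\<in>?H. r k l * mmono (replicate_mset e i + add_mset k (add_mset l \<nu>')) c) \<in> ?I"
        using \<nu> k by (intro subspace_sumI subspace_scaleI pideal_subspace I e) auto
      have "(\<lambda>c. mmono ?m c * (c i * c k + (\<Sum>k\<in>?H. \<Sum>l\<in>?H. r k l * (c k * c l)))
          - (\<Sum>k\<in>?H. \<Sum>l\<in>?H. r k l * mmono (replicate_mset e i + add_mset k (add_mset l \<nu>')) c)) \<in> ?I"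
        by (rule subspace_diffI[OF pideal_subspace[OF I] 1 2])
      also have "(\<lambda>c. mmono ?m c * (c i * c k + (\<Sum>k\<in>?H. \<Sum>l\<in>?H. r k l * (c k * c l)))
          - (\<Sum>k\<in>?H. \<Sum>l\<in>?H. r k l * mmono (replicate_mset e i + add_mset k (add_mset l \<nu>')) c))
          = mmono (replicate_mset (Suc e) i + \<nu>)"
        by (auto simp: fun_eq_iff k distrib_left sum_distrib_left mult_ac)
      finally show ?thesis .
    qed
    then show ?case by blast
  qed
  obtain e where "\<And>\<nu>. size \<nu> = 1 \<Longrightarrow> set_mset \<nu> \<subseteq> ?H \<Longrightarrow> mmono (replicate_mset e i + \<nu>) \<in> ?I"
    using claim[of 1] by auto
  from this[of "{#j#}"] j have "mmono (replicate_mset e i + {#j#}) \<in> ?I" by simp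
  then show ?thesis by (intro exI[of _ e]) simp
qed

text \<open>A monomial of degree \<open>h * L + 2\<close> contains some variable \<open>i\<close>
  more than \<open>L\<close> times and, being mixed, another variable \<open>j\<close>; so it is a
  multiple of one from \<open>mixed_power_in_ideal\<close>.\<close>

lemma mixed_in_ideal:
  "\<exists>m\<ge>2. \<forall>\<mu>\<in>msets h m. mixed \<mu> \<longrightarrow> mmono \<mu> \<in> pgen ((\<lambda>q. quadf h (qc q)) ` Qs)"
proof -
  let ?I = "pgen ((\<lambda>q. quadf h (qc q)) ` Qs)"
  have "\<forall>i<h. \<forall>j<h. \<exists>L. j \<noteq> i \<longrightarrow> mmono (add_mset j (replicate_mset L i)) \<in> ?I"
    using mixed_power_in_ideal by blast
  then obtain Lf where Lf: "\<And>i j. i < h \<Longrightarrow> j < h \<Longrightarrow> j \<noteq> i \<Longrightarrow> mmono (add_mset j (replicate_mset (Lf i j) i)) \<in> ?I"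
    by metis
  define L where "L = (\<Sum>i<h. \<Sum>j<h. Lf i j)"
  have LfL: "Lf i j \<le> L" if "i < h" "j < h" for i j
  proof -
    have "Lf i j \<le> (\<Sum>j<h. Lf i j)" using that by (intro member_le_sum) auto
    also have "\<dots> \<le> L" unfolding L_def using that by (intro member_le_sum[of i "{..<h}" "\<lambda>i. \<Sum>j<h. Lf i j"]) auto
    finally show ?thesis .
  qed
  have "mmono \<mu> \<in> ?I" if \<mu>: "\<mu> \<in> msets h (h * L + 2)" "mixed \<mu>" for \<mu>
  proof -
    obtain i where i: "i < h" "L < count \<mu> i" using multiset_pigeonhole[OF \<mu>(1), of L] by auto
    obtain j where j: "j \<noteq> i" "j \<in># \<mu>" using \<mu>(2) unfolding mixed_def by metis
    have jh: "j < h" using j \<mu> by (auto simp: msets_def)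
    have "add_mset j (replicate_mset (Lf i j) i) \<subseteq># \<mu>"
      using LfL[OF i(1) jh] i(2) j
      by (auto simp: subseteq_mset_def Suc_le_eq) 
    then show ?thesis by (rule pideal_mmono_superset[OF quadric_ideal Lf[OF i(1) jh j(1)]])
  qed
  then show ?thesis by (intro exI[of _ "h * L + 2"]) auto
qed

text \<open>Taking the part of degree \<open>m\<close> on both sides restricts the multipliers to
  degree \<open>m - 2\<close>, and setting all variables from \<open>h\<close> on to 0 restricts
  them to the first \<open>h\<close> variables. What remains concerns finitely many
  coefficients.\<close>

lemma mixed_combination:
  "\<exists>m\<ge>2. \<forall>\<mu>\<in>msets h m. mixed \<mu> \<longrightarrow>
     (\<exists>\<beta>. \<forall>c. mmono \<mu> c = (\<Sum>\<nu>\<in>msets h (m - 2). \<Sum>q\<in>Qs. \<beta> \<nu> q * (mmono \<nu> c * quadf h (qc q) c)))"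
proof -
  obtain m where m: "m \<ge> 2" "\<forall>\<mu>\<in>msets h m. mixed \<mu> \<longrightarrow> mmono \<mu> \<in> pgen ((\<lambda>q. quadf h (qc q)) ` Qs)"
    using mixed_in_ideal by blast
  have "\<exists>\<beta>. \<forall>c. mmono \<mu> c = (\<Sum>\<nu>\<in>msets h (m - 2). \<Sum>q\<in>Qs. \<beta> \<nu> q * (mmono \<nu> c * quadf h (qc q) c))"
    if \<mu>: "\<mu> \<in> msets h m" "mixed \<mu>" for \<mu>
  proof -
    obtain V \<beta> where V: "finite V"
      "\<And>c. mmono \<mu> c = (\<Sum>\<nu>\<in>V. \<Sum>q\<in>Qs. \<beta> \<nu> q * (mmono \<nu> c * quadf h (qc q) c))"
      using pgen_explicit[OF _ finQ] m(2) \<mu> by blast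
    have "mmono \<mu> c = (\<Sum>\<nu>\<in>msets h (m - 2). \<Sum>q\<in>Qs. (if \<nu> \<in> V then \<beta> \<nu> q else 0) * (mmono \<nu> c * quadf h (qc q) c))" for c
    proof -
      define c' where "c' = (\<lambda>l. if l < h then c l else 0)"
      have mc': "mmono \<nu> c' = (if set_mset \<nu> \<subseteq> {..<h} then mmono \<nu> c else 0)" for \<nu>
        by (induction \<nu>) (auto simp: c'_def)
      have qc': "quadf h (qc q) c' = quadf h (qc q) c" for q by (simp add: quadf_def c'_def)
      define A where "A = (\<lambda>\<nu>. \<Sum>q\<in>Qs. \<beta> \<nu> q * (mmono \<nu> c' * quadf h (qc q) c'))"
      \<comment> \<open>\<open>P\<close> is the right-hand side along \<open>s * c'\<close> as a
        polynomial in \<open>s\<close>; its coefficient at \<open>s ^ m\<close> is the part of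
        degree \<open>m\<close>.\<close>
      define P where "P = (\<Sum>\<nu>\<in>V. monom (A \<nu>) (size \<nu> + 2))"
      have "poly (monom (mmono \<mu> c') m) s = poly P s" for s
      proof -
        have "poly (monom (mmono \<mu> c') m) s = mmono \<mu> (\<lambda>l. s * c' l)"
          using \<mu>(1) by (simp add: poly_monom mmono_scale msets_def mult.commute)
        also have "\<dots> = (\<Sum>\<nu>\<in>V. \<Sum>q\<in>Qs. s ^ (size \<nu> + 2) * (\<beta> \<nu> q * (mmono \<nu> c' * quadf h (qc q) c')))"
          unfolding V(2) by (simp add: mmono_scale quadf_scale power_add power2_eq_square mult_ac)
        also have "\<dots> = poly P s"
          by (simp add: P_def A_def poly_sum poly_monom sum_distrib_left sum_distrib_right mult_ac)
        finally show ?thesis .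
      qed
      then have "monom (mmono \<mu> c') m = P" by (simp add: poly_eq_poly_eq_iff[symmetric] fun_eq_iff)
      then have "mmono \<mu> c' = coeff P m" by (metis coeff_monom)
      also have "\<dots> = (\<Sum>\<nu>\<in>V. if size \<nu> + 2 = m then A \<nu> else 0)" by (simp add: P_def coeff_sum)
      also have "\<dots> = (\<Sum>\<nu>\<in>V \<inter> msets h (m - 2). A \<nu>)"
      proof (rule sum.mono_neutral_cong_right)
        show "\<forall>\<nu>\<in>V - V \<inter> msets h (m - 2). (if size \<nu> + 2 = m then A \<nu> else 0) = 0"
          by (auto simp: msets_def A_def mc')
      qed (use V(1) m(1) in \<open>auto simp: msets_def\<close>)
      also have "\<dots> = (\<Sum>\<nu>\<in>msets h (m - 2). if \<nu> \<in> V then A \<nu> else 0)"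
        using finite_msets by (intro sum.mono_neutral_cong_left) auto
      also have "\<dots> = (\<Sum>\<nu>\<in>msets h (m - 2). \<Sum>q\<in>Qs. (if \<nu> \<in> V then \<beta> \<nu> q else 0) * (mmono \<nu> c * quadf h (qc q) c))"
        by (intro sum.cong refl) (auto simp: A_def mc' qc' msets_def)
      also have "mmono \<mu> c' = mmono \<mu> c" using \<mu>(1) by (simp add: mc' msets_def)
      finally show ?thesis .
    qed
    then show ?thesis
      by (intro exI[of _ "\<lambda>\<nu> q. if \<nu> \<in> V then \<beta> \<nu> q else 0"] allI)
  qed
  then show ?thesis using m(1) by blast
qed

end

section \<open>From the complex numbers to the ground field\<close>

definition seg_quadf :: "(nat \<Rightarrow> nat multiset) \<times> (nat \<Rightarrow> nat multiset) \<times> (nat \<Rightarrow> nat multiset) \<times> (nat \<Rightarrow> nat multiset)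
    \<Rightarrow> ((nat \<Rightarrow> nat multiset) \<Rightarrow> 'k::comm_ring_1) \<Rightarrow> 'k" where
  "seg_quadf = (\<lambda>(K, L, K', L') y. y K * y L - y K' * y L')"

text \<open>For a fixed degree this is a linear condition on the coefficients \<beta>. Hence it
  passes to a subfield, and its consequence for the independence of forms passes to nearby
  points.\<close>

definition mixed_comb :: "'q set \<Rightarrow> ('q \<Rightarrow> ('x \<Rightarrow> 'k) \<Rightarrow> 'k) \<Rightarrow> (nat \<Rightarrow> 'x \<Rightarrow> 'k::comm_ring_1) \<Rightarrow> nat \<Rightarrow> nat \<Rightarrow> bool" where
  "mixed_comb Qs Q P h m \<longleftrightarrow> (\<forall>\<mu>\<in>msets h m. mixed \<mu> \<longrightarrow>
     (\<exists>\<beta>. \<forall>c. mmono \<mu> c = (\<Sum>\<nu>\<in>msets h (m - 2). \<Sum>q\<in>Qs. \<beta> \<nu> q * (mmono \<nu> c * Q q (\<lambda>x. \<Sum>l<h. c l * P l x)))))"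

lemma generic_points_complex:
  fixes A :: "complex set"
  assumes "h \<le> card (midx p n a)" "card (ztan p n b) + h + 1 \<le> card (midx p n b)"
    and A: "uncountable A" "\<And>m t x. m \<in> \<int> \<Longrightarrow> t \<in> \<nat> \<Longrightarrow> x \<in> A \<Longrightarrow> m + t * x \<in> A" "\<int> \<subseteq> A"
  shows "\<exists>x. (\<forall>e. x e \<in> A) \<and> findep (\<lambda>l. pvec p n a x (l, None)) {..<h} \<and>
           findep (\<lambda>l. pvec p n b x (l, None)) {..<h} \<and>
           (\<exists>m\<ge>2. mixed_comb (seg_quad (midx p n b)) seg_quadf (\<lambda>l. pvec p n b x (l, None)) h m)"
proof -
  obtain x where x: "\<forall>e. x e \<in> A" "generic_at p n b h x" "findep (pvec p n a x) ({..<h} \<times> {None})"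
    using exists_generic[OF assms] by blast
  note g = x(2)
  let ?X = "midx p n b"
  have reidx: "findep (\<lambda>l. u (l, None)) {..<h}" if "findep u ({..<h} \<times> {None})"
    for u :: "nat \<times> (nat \<times> nat) option \<Rightarrow> (nat \<Rightarrow> nat multiset) \<Rightarrow> complex"
  proof (rule findepI)
    fix c i assume c: "\<And>K. (\<Sum>i<h. c i * u (i, None) K) = 0" and i: "i \<in> {..<h}"
    have "{..<h} \<times> {None} = (\<lambda>l. (l, None :: (nat \<times> nat) option)) ` {..<h}" by auto
    then have "(\<Sum>i\<in>{..<h} \<times> {None}. c (fst i) * u i K) = 0" for K
      using c[of K] by (simp add: sum.reindex inj_on_def)
    from findepD[OF that this, of "(i, None)"] i show "c i = 0" by auto
  qed
  define P where "P = (\<lambda>l. pvec p n b x (l, None))"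
  have Pp: "P l = ppt p n b x l" for l by (simp add: P_def ppt_def[OF g])
  define qc where "qc = (\<lambda>(K, L, K', L') k l. P k K * P l L - P k K' * P l L')"
  have quad: "quadf h (qc q) c = seg_quadf q (\<lambda>K. \<Sum>l<h. c l * P l K)" for q c
    by (cases q) (simp add: quadf_def qc_def seg_quadf_def sum_product sum_subtractf[symmetric] algebra_simps)
  have "\<exists>m\<ge>2. \<forall>\<mu>\<in>msets h m. mixed \<mu> \<longrightarrow>
     (\<exists>\<beta>. \<forall>c. mmono \<mu> c = (\<Sum>\<nu>\<in>msets h (m - 2). \<Sum>q\<in>seg_quad ?X. \<beta> \<nu> q * (mmono \<nu> c * quadf h (qc q) c)))"
  proof (rule mixed_combination)
    show "finite (seg_quad ?X)" by (rule finite_seg_quad[OF finite_midx])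
    show "qc q i i = 0" if "q \<in> seg_quad ?X" "i < h" for q i
    proof -
      obtain K L K' L' where q: "q = (K, L, K', L')" by (cases q)
      have "K \<in> ?X" "L \<in> ?X" "K' \<in> ?X" "L' \<in> ?X" using that(1) by (auto simp: q seg_quad_def)
      then show ?thesis using mmono_seg_quad[of K L K' L' ?X p] that(1) by (simp add: qc_def q Pp ppt[OF g])
    qed
    show "c i * c j = 0" if "\<And>q. q \<in> seg_quad ?X \<Longrightarrow> quadf h (qc q) c = 0" "i < h" "j < h" "i \<noteq> j" for c i j
    proof (rule support_on_cone[OF g _ that(2-4)])
      fix K L K' L' assume "(K, L, K', L') \<in> seg_quad ?X"
      from that(1)[OF this] show "(\<Sum>l<h. c l * ppt p n b x l K) * (\<Sum>l<h. c l * ppt p n b x l L)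
          = (\<Sum>l<h. c l * ppt p n b x l K') * (\<Sum>l<h. c l * ppt p n b x l L')"
        by (simp add: quad seg_quadf_def Pp)
    qed
    show "c j = 0" if i: "i < h" and q: "\<And>q. q \<in> seg_quad ?X \<Longrightarrow> (\<Sum>l<h. (qc q i l + qc q l i) * c l) = 0"
      and j: "j < h" "j \<noteq> i" for c i j
    proof (rule support_of_tangent[OF g i _ j])
      fix K L K' L' assume s: "(K, L, K', L') \<in> seg_quad ?X"
      have "(\<Sum>l<h. (qc (K, L, K', L') i l + qc (K, L, K', L') l i) * c l)
          = (P i K * (\<Sum>l<h. c l * P l L) + P i L * (\<Sum>l<h. c l * P l K))
          - (P i K' * (\<Sum>l<h. c l * P l L') + P i L' * (\<Sum>l<h. c l * P l K'))"
        by (simp add: qc_def sum_distrib_left sum_subtractf[symmetric] sum.distrib[symmetric] algebra_simps)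
      then show "ppt p n b x i K * (\<Sum>l<h. c l * ppt p n b x l L) + ppt p n b x i L * (\<Sum>l<h. c l * ppt p n b x l K)
          = ppt p n b x i K' * (\<Sum>l<h. c l * ppt p n b x l L') + ppt p n b x i L' * (\<Sum>l<h. c l * ppt p n b x l K')"
        using q[OF s] by (simp add: Pp)
    qed
  qed
  then have "\<exists>m\<ge>2. mixed_comb (seg_quad ?X) seg_quadf P h m"
    unfolding mixed_comb_def quad .
  moreover have "findep P {..<h}" unfolding P_def using g by (intro reidx) (simp add: generic_at_def)
  ultimately show ?thesis using x(1) reidx[OF x(3)] unfolding P_def by blast
qed

text \<open>The points already have coordinates in the image of \<open>k\<close>, so only the
  coefficients of the combinations are complex. Applying the \<open>k\<close>-linear retraction
  \<rho> to the identities replaces them by elements of \<open>k\<close>.\<close>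

lemma generic_points:
  fixes \<psi> :: "'k::field_char_0 \<Rightarrow> complex" and \<rho> :: "complex \<Rightarrow> 'k"
  assumes hom: "\<And>x y. \<psi> (x + y) = \<psi> x + \<psi> y" "\<And>x y. \<psi> (x * y) = \<psi> x * \<psi> y" "\<psi> 1 = 1"
    and ret: "\<And>x y. \<rho> (x + y) = \<rho> x + \<rho> y" "\<And>x y. \<rho> (\<psi> x * y) = x * \<rho> y" "\<rho> 1 = 1"
    and unc: "uncountable (range \<psi>)"
    and ab: "h \<le> card (midx p n a)" "card (ztan p n b) + h + 1 \<le> card (midx p n b)"
  shows "\<exists>v :: nat \<Rightarrow> nat \<Rightarrow> nat \<Rightarrow> 'k. (\<forall>l c. v l c 0 = 1) \<and>
           findep (\<lambda>l. power_tensor p n a (v l)) {..<h} \<and> findep (\<lambda>l. power_tensor p n b (v l)) {..<h} \<and>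
           (\<exists>m\<ge>2. mixed_comb (seg_quad (midx p n b)) seg_quadf (\<lambda>l. power_tensor p n b (v l)) h m)"
proof -
  have psi0: "\<psi> 0 = 0" using hom(1)[of 0 0] by simp
  have psin: "\<psi> (- x) = - \<psi> x" for x
    using hom(1)[of x "- x"] psi0 by (simp add: eq_neg_iff_add_eq_0 add.commute)
  have rho_psi: "\<rho> (\<psi> x) = x" for x using ret(2)[of x 1] ret(3) by simp
  have rho0: "\<rho> 0 = 0" using ret(1)[of 0 0] by simp
  have psi_sum: "\<psi> (\<Sum>i\<in>S. f i) = (\<Sum>i\<in>S. \<psi> (f i))" for S and f :: "'z \<Rightarrow> 'k"
    by (induction S rule: infinite_finite_induct) (auto simp: psi0 hom)
  have rho_sum: "\<rho> (\<Sum>i\<in>S. f i) = (\<Sum>i\<in>S. \<rho> (f i))" for S and f :: "'z \<Rightarrow> complex"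
    by (induction S rule: infinite_finite_induct) (auto simp: rho0 ret)
  have psi_mm: "\<psi> (mmono \<mu> z) = mmono \<mu> (\<lambda>e. \<psi> (z e))" for \<mu> and z :: "'e \<Rightarrow> 'k"
    by (induction \<mu>) (auto simp: hom)
  have psi_nat: "\<psi> (of_nat m) = of_nat m" for m by (induction m) (auto simp: psi0 hom)
  have psi_int: "\<psi> (of_int m) = of_int m" for m
  proof (cases "m \<ge> 0")
    case True
    then show ?thesis using psi_nat[of "nat m"] by simp
  next
    case False
    then show ?thesis using psi_nat[of "nat (- m)"] psin[of "of_nat (nat (- m))"] by simp
  qed
  have "m + t * x \<in> range \<psi>" if mtx: "m \<in> \<int>" "t \<in> \<nat>" "x \<in> range \<psi>" for m t x
  proof -
    obtain m' where "m = of_int m'" using mtx(1) unfolding Ints_def by blast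
    moreover obtain t' where "t = of_nat t'" using mtx(2) unfolding Nats_def by blast
    moreover obtain x' where "x = \<psi> x'" using mtx(3) by blast
    ultimately have "m + t * x = \<psi> (of_int m' + of_nat t' * x')" by (simp add: hom psi_int psi_nat)
    then show ?thesis by blast
  qed
  moreover have "\<int> \<subseteq> range \<psi>"
    using psi_int by (auto elim!: Ints_cases) (metis rangeI)
  ultimately obtain x where x: "\<forall>e. x e \<in> range \<psi>" "findep (\<lambda>l. pvec p n a x (l, None)) {..<h}"
    "findep (\<lambda>l. pvec p n b x (l, None)) {..<h}"
    "\<exists>m\<ge>2. mixed_comb (seg_quad (midx p n b)) seg_quadf (\<lambda>l. pvec p n b x (l, None)) h m"
    using generic_points_complex[OF ab unc] by blast
  have "\<exists>y. \<forall>e. x e = \<psi> (y e)" by (rule choice) (use x(1) in blast)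
  then obtain y where y: "\<And>e. x e = \<psi> (y e)" by blast
  define v where "v = (\<lambda>l c j. npt p n (\<lambda>e. y (l, e)) (c, j))"
  have npt_psi: "npt p n (\<lambda>e. x (l, e)) e = \<psi> (npt p n (\<lambda>e. y (l, e)) e)" for l e
    by (cases e) (auto simp: npt_def y hom)
  have pv: "pvec p n d x (l, None) K = \<psi> (power_tensor p n d (v l) K)" for d l K
  proof -
    have "(\<lambda>(c, j). v l c j) = npt p n (\<lambda>e. y (l, e))" by (auto simp: v_def fun_eq_iff)
    then show ?thesis
      by (simp add: pvec_def power_tensor_mmono psi_mm psi0 npt_psi[abs_def])
  qed
  have ind: "findep (\<lambda>l. power_tensor p n d (v l)) {..<h}" if f: "findep (\<lambda>l. pvec p n d x (l, None)) {..<h}" for d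
  proof (rule findepI)
    fix c i assume c: "\<And>K. (\<Sum>l<h. c l * power_tensor p n d (v l) K) = 0" and i: "i \<in> {..<h}"
    have "(\<Sum>l<h. \<psi> (c l) * pvec p n d x (l, None) K) = 0" for K
      using arg_cong[OF c[of K], of \<psi>] by (simp add: psi_sum hom psi0 pv)
    from findepD[OF f this i] have "\<psi> (c i) = 0" .
    then show "c i = 0" using rho_psi[of "c i"] rho0 by simp
  qed
  obtain m where m: "m \<ge> 2" "mixed_comb (seg_quad (midx p n b)) seg_quadf (\<lambda>l. pvec p n b x (l, None)) h m"
    using x(4) by blast
  have "mixed_comb (seg_quad (midx p n b)) seg_quadf (\<lambda>l. power_tensor p n b (v l)) h m"
    unfolding mixed_comb_def
  proof (intro ballI impI)
    fix \<mu> assume "\<mu> \<in> msets h m" "mixed \<mu>"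
    then obtain \<beta> where \<beta>: "\<And>c. mmono \<mu> c = (\<Sum>\<nu>\<in>msets h (m - 2). \<Sum>q\<in>seg_quad (midx p n b).
        \<beta> \<nu> q * (mmono \<nu> c * seg_quadf q (\<lambda>K. \<Sum>l<h. c l * pvec p n b x (l, None) K)))"
      using m(2) unfolding mixed_comb_def by blast
    have "mmono \<mu> c = (\<Sum>\<nu>\<in>msets h (m - 2). \<Sum>q\<in>seg_quad (midx p n b).
        \<rho> (\<beta> \<nu> q) * (mmono \<nu> c * seg_quadf q (\<lambda>K. \<Sum>l<h. c l * power_tensor p n b (v l) K)))" for c
    proof -
      have q: "seg_quadf q (\<lambda>K. \<Sum>l<h. \<psi> (c l) * pvec p n b x (l, None) K)
          = \<psi> (seg_quadf q (\<lambda>K. \<Sum>l<h. c l * power_tensor p n b (v l) K))" for q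
        by (cases q) (simp add: seg_quadf_def pv psi_sum hom psin diff_conv_add_uminus del: add_uminus_conv_diff)
      have "\<psi> (mmono \<mu> c) = (\<Sum>\<nu>\<in>msets h (m - 2). \<Sum>q\<in>seg_quad (midx p n b).
          \<psi> (mmono \<nu> c * seg_quadf q (\<lambda>K. \<Sum>l<h. c l * power_tensor p n b (v l) K)) * \<beta> \<nu> q)"
        using \<beta>[of "\<lambda>l. \<psi> (c l)"] by (simp add: psi_mm q hom mult_ac)
      from arg_cong[OF this, of \<rho>] show ?thesis by (simp add: rho_psi rho_sum ret) (simp only: mult_ac)
    qed
    then show "\<exists>\<beta>. \<forall>c. mmono \<mu> c = (\<Sum>\<nu>\<in>msets h (m - 2). \<Sum>q\<in>seg_quad (midx p n b).
        \<beta> \<nu> q * (mmono \<nu> c * seg_quadf q (\<lambda>K. \<Sum>l<h. c l * power_tensor p n b (v l) K)))"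
      by (intro exI[of _ "\<lambda>\<nu> q. \<rho> (\<beta> \<nu> q)"] allI)
  qed
  moreover have "v l c 0 = 1" for l c by (simp add: v_def npt_def)
  ultimately show ?thesis using ind[OF x(2)] ind[OF x(3)] m(1) by blast
qed

text \<open>For the reals the retraction is the real part, which is linear over the reals although
  not multiplicative.\<close>

lemma real_or_complex_retract:
  assumes "is_real_or_complex TYPE('k::field_char_0)"
  obtains \<psi> :: "'k::field_char_0 \<Rightarrow> complex" and \<rho> :: "complex \<Rightarrow> 'k::field_char_0" where
    "\<And>x y. \<psi> (x + y) = \<psi> x + \<psi> y" "\<And>x y. \<psi> (x * y) = \<psi> x * \<psi> y" "\<psi> 1 = 1"
    "\<And>x y. \<rho> (x + y) = \<rho> x + \<rho> y" "\<And>x y. \<rho> (\<psi> x * y) = x * \<rho> y" "\<rho> 1 = 1"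
    "uncountable (range \<psi>)"
  using assms unfolding is_real_or_complex_def
proof (elim disjE exE conjE)
  fix f :: "'k \<Rightarrow> real" assume f: "bij f" "\<forall>x y. f (x + y) = f x + f y \<and> f (x * y) = f x * f y"
  have f1: "f 1 = 1"
  proof -
    have "f 0 = 0" using f(2)[rule_format, of 0 0] by simp
    then have "f 1 \<noteq> 0" using f(1) by (metis bij_pointE zero_neq_one)
    moreover have "f 1 * f 1 = f 1" using f(2)[rule_format, of 1 1] by simp
    ultimately show ?thesis by simp
  qed
  have fi: "f (inv_into UNIV f y) = y" "inv_into UNIV f (f x) = x" for x y
    using f(1) by (auto simp: bij_is_surj surj_f_inv_f bij_is_inj)
  show ?thesis
  proof (rule that[of "\<lambda>x. of_real (f x)" "\<lambda>z. inv_into UNIV f (Re z)"])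
    show "inv_into UNIV f (Re (x + y)) = inv_into UNIV f (Re x) + inv_into UNIV f (Re y)" for x y
      using fi f(2) by (metis plus_complex.sel(1))
    show "inv_into UNIV f (Re (of_real (f x) * y)) = x * inv_into UNIV f (Re y)" for x y
    proof -
      have "Re (of_real (f x) * y) = f (x * inv_into UNIV f (Re y))" using fi f(2) by simp
      then show ?thesis using fi by simp
    qed
    show "inv_into UNIV f (Re 1) = 1" using fi(2)[of 1] f1 by simp
    show "uncountable (range (\<lambda>x. complex_of_real (f x)))"
    proof
      assume c: "countable (range (\<lambda>x. complex_of_real (f x)))"
      have "Re ` range (\<lambda>x. complex_of_real (f x)) = UNIV"
        using f(1) by (auto simp: image_image bij_is_surj)
      then show False using countable_image[OF c, of Re] uncountable_UNIV_real by simp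
    qed
  qed (use f f1 in auto)
next
  fix f :: "'k \<Rightarrow> complex" assume f: "bij f" "\<forall>x y. f (x + y) = f x + f y \<and> f (x * y) = f x * f y"
  have f1: "f 1 = 1"
  proof -
    have "f 0 = 0" using f(2)[rule_format, of 0 0] by simp
    then have "f 1 \<noteq> 0" using f(1) by (metis bij_pointE zero_neq_one)
    moreover have "f 1 * f 1 = f 1" using f(2)[rule_format, of 1 1] by simp
    ultimately show ?thesis by simp
  qed
  have fi: "f (inv_into UNIV f y) = y" "inv_into UNIV f (f x) = x" for x y
    using f(1) by (auto simp: bij_is_surj surj_f_inv_f bij_is_inj)
  show ?thesis
  proof (rule that[of f "inv_into UNIV f"])
    show "inv_into UNIV f (x + y) = inv_into UNIV f x + inv_into UNIV f y" for x y using fi f(2) by metis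
    show "inv_into UNIV f (f x * y) = x * inv_into UNIV f y" for x y using fi f(2) by metis
    show "inv_into UNIV f 1 = 1" using fi(2)[of 1] f1 by simp
    show "uncountable (range f)" using f(1) uncountable_UNIV_complex by (simp add: bij_is_surj)
  qed (use f f1 in auto)
qed

subsection \<open>Closed subschemes of projective space\<close>

definition monv :: "('x \<Rightarrow>\<^sub>0 nat) \<Rightarrow> ('x \<Rightarrow> 'k::comm_ring_1) \<Rightarrow> 'k" where
  "monv m v = (\<Prod>x\<in>Poly_Mapping.keys m. v x ^ Poly_Mapping.lookup m x)"

lemma monv_superset:
  assumes "finite A" "Poly_Mapping.keys m \<subseteq> A"
  shows "monv m v = (\<Prod>x\<in>A. v x ^ Poly_Mapping.lookup m x)"
  unfolding monv_def using assms by (intro prod.mono_neutral_left) (auto simp: in_keys_iff)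

lemma monv_add: "monv (m + m') v = monv m v * monv m' v"
proof -
  let ?A = "Poly_Mapping.keys m \<union> Poly_Mapping.keys m'"
  have "Poly_Mapping.keys (m + m') \<subseteq> ?A" by (rule Poly_Mapping.keys_add)
  then show ?thesis
    by (simp add: monv_superset[of ?A] lookup_add power_add prod.distrib)
qed

lemma monv_0 [simp]: "monv 0 v = 1"
  by (simp add: monv_def)

lemma mdeg_superset:
  assumes "finite A" "Poly_Mapping.keys m \<subseteq> A"
  shows "mdeg m = (\<Sum>x\<in>A. Poly_Mapping.lookup m x)"
  unfolding mdeg_def using assms by (intro sum.mono_neutral_left) (auto simp: in_keys_iff)

lemma monv_scale: "monv m (\<lambda>x. t * v x) = t ^ mdeg m * monv m v"
  by (simp add: monv_def mdeg_def power_mult_distrib prod.distrib power_sum)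

lemma peval_superset:
  assumes "finite A" "Poly_Mapping.keys f \<subseteq> A"
  shows "peval f v = (\<Sum>m\<in>A. Poly_Mapping.lookup f m * monv m v)"
  unfolding peval_def monv_def[symmetric] using assms
  by (intro sum.mono_neutral_left) (auto simp: in_keys_iff)

lemma poly_sum_monomials:
  "f = (\<Sum>m\<in>Poly_Mapping.keys f. Poly_Mapping.single m (Poly_Mapping.lookup f m))"
proof (rule poly_mapping_eqI)
  fix m
  have "(\<Sum>m'\<in>Poly_Mapping.keys f. Poly_Mapping.lookup f m' when m' = m) = Poly_Mapping.lookup f m"
    by (simp add: when_def in_keys_iff)
  then show "Poly_Mapping.lookup f m
      = Poly_Mapping.lookup (\<Sum>m\<in>Poly_Mapping.keys f. Poly_Mapping.single m (Poly_Mapping.lookup f m)) m"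
    by (simp add: lookup_sum lookup_single)
qed

lemma peval_0 [simp]: "peval 0 v = 0"
  by (simp add: peval_def)

lemma peval_add: "peval (f + g) v = peval f v + peval g v"
proof -
  let ?A = "Poly_Mapping.keys f \<union> Poly_Mapping.keys g"
  have "Poly_Mapping.keys (f + g) \<subseteq> ?A" by (rule Poly_Mapping.keys_add)
  then show ?thesis
    by (simp add: peval_superset[of ?A] lookup_add distrib_right sum.distrib)
qed

lemma peval_sum: "peval (\<Sum>i\<in>S. f i) v = (\<Sum>i\<in>S. peval (f i) v)"
  by (induction S rule: infinite_finite_induct) (auto simp: peval_add)

lemma peval_single: "peval (Poly_Mapping.single m c) v = c * monv m v"
  by (simp add: peval_def monv_def)

lemma peval_mult: "peval (f * g) v = peval f v * peval g v"
proof -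
  let ?s = "\<lambda>f m. Poly_Mapping.single m (Poly_Mapping.lookup f m)"
  have "f * g = (\<Sum>m\<in>Poly_Mapping.keys f. ?s f m) * (\<Sum>m\<in>Poly_Mapping.keys g. ?s g m)"
    using poly_sum_monomials[of f] poly_sum_monomials[of g] by simp
  also have "\<dots> = (\<Sum>m\<in>Poly_Mapping.keys f. \<Sum>m'\<in>Poly_Mapping.keys g. ?s f m * ?s g m')"
    by (simp add: sum_product)
  also have "peval \<dots> v = (\<Sum>m\<in>Poly_Mapping.keys f. \<Sum>m'\<in>Poly_Mapping.keys g.
      (Poly_Mapping.lookup f m * monv m v) * (Poly_Mapping.lookup g m' * monv m' v))"
    by (simp add: peval_sum mult_single peval_single monv_add mult_ac)
  also have "\<dots> = peval f v * peval g v"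
    by (simp add: peval_def monv_def[symmetric] sum_product)
  finally show ?thesis .
qed

lemma peval_const [simp]: "peval (Poly_Mapping.single 0 c) v = c"
  by (simp add: peval_single)

lemma peval_1 [simp]: "peval 1 v = 1"
  using peval_const[of 1 v] by (simp add: single_one)

lemma peval_uminus: "peval (- f) v = - peval f v"
  using peval_add[of f "- f" v] by (simp add: eq_neg_iff_add_eq_0 add.commute)

lemma peval_diff: "peval (f - g) v = peval f v - peval g v"
  using peval_add[of f "- g" v] by (simp add: peval_uminus)

lemma peval_pscale: "peval (pscale c f) v = c * peval f v"
  by (simp add: pscale_def peval_mult)

lemma monv_single: "monv (Poly_Mapping.single x n) v = v x ^ n"
  by (simp add: monv_def)

lemma peval_pvar [simp]: "peval (pvar x) v = v x"
  by (simp add: pvar_def peval_single monv_single)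

lemma peval_prod: "peval (\<Prod>i\<in>S. f i) v = (\<Prod>i\<in>S. peval (f i) v)"
  by (induction S rule: infinite_finite_induct) (auto simp: peval_mult)

lemma polys_0 [simp]: "0 \<in> polys X"
  and polys_const [simp]: "Poly_Mapping.single 0 c \<in> polys X"
  by (auto simp: polys_def)

lemma polys_1 [simp]: "1 \<in> polys X"
  using polys_const[of 1] by (simp add: single_one)

lemma polys_pvar: "x \<in> X \<Longrightarrow> pvar x \<in> polys X"
  by (auto simp: polys_def pvar_def)

lemma polys_add: "f \<in> polys X \<Longrightarrow> g \<in> polys X \<Longrightarrow> f + g \<in> polys X"
  using Poly_Mapping.keys_add[of f g] by (auto simp: polys_def)

lemma polys_uminus: "f \<in> polys X \<Longrightarrow> - f \<in> polys X"
  by (auto simp: polys_def)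

lemma polys_diff: "f \<in> polys X \<Longrightarrow> g \<in> polys X \<Longrightarrow> f - g \<in> polys X"
  using polys_add[OF _ polys_uminus] by force

lemma polys_sum: "(\<And>i. i \<in> S \<Longrightarrow> f i \<in> polys X) \<Longrightarrow> (\<Sum>i\<in>S. f i) \<in> polys X"
  by (induction S rule: infinite_finite_induct) (auto intro: polys_add)

lemma polys_prod: "(\<And>i. i \<in> S \<Longrightarrow> f i \<in> polys X) \<Longrightarrow> (\<Prod>i\<in>S. f i) \<in> polys X"
  by (induction S rule: infinite_finite_induct) (auto intro: polys_mult)

lemma polys_power: "f \<in> polys X \<Longrightarrow> f ^ n \<in> polys X"
  by (induction n) (auto intro: polys_mult)

lemma polys_pscale: "f \<in> polys X \<Longrightarrow> pscale c f \<in> polys X"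
  by (auto simp: pscale_def intro: polys_mult)

lemma single_prod_pvar:
  "Poly_Mapping.single m (1::'k::comm_ring_1) = (\<Prod>x\<in>Poly_Mapping.keys m. pvar x ^ Poly_Mapping.lookup m x)"
proof -
  have pow: "pvar x ^ n = Poly_Mapping.single (Poly_Mapping.single x n) (1::'k)" for x :: 'a and n
    by (induction n) (auto simp: pvar_def mult_single single_add[symmetric] single_one)
  have "(\<Prod>x\<in>S. Poly_Mapping.single (u x) (1::'k)) = Poly_Mapping.single (\<Sum>x\<in>S. u x) 1"
    if "finite S" for S :: "'a set" and u :: "'a \<Rightarrow> 'a \<Rightarrow>\<^sub>0 nat"
    using that by (induction S rule: finite_induct) (auto simp: mult_single single_one)
  then have "(\<Prod>x\<in>Poly_Mapping.keys m. pvar x ^ Poly_Mapping.lookup m x)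
      = Poly_Mapping.single (\<Sum>x\<in>Poly_Mapping.keys m. Poly_Mapping.single x (Poly_Mapping.lookup m x)) (1::'k)"
    by (simp add: pow)
  moreover have "(\<Sum>x\<in>Poly_Mapping.keys m. Poly_Mapping.single x (Poly_Mapping.lookup m x)) = m"
  proof (rule poly_mapping_eqI)
    fix x
    have "(\<Sum>x'\<in>Poly_Mapping.keys m. Poly_Mapping.lookup m x' when x' = x) = Poly_Mapping.lookup m x"
      by (simp add: when_def in_keys_iff)
    then show "Poly_Mapping.lookup (\<Sum>x\<in>Poly_Mapping.keys m. Poly_Mapping.single x (Poly_Mapping.lookup m x)) x = Poly_Mapping.lookup m x"
      by (simp add: lookup_sum lookup_single)
  qed
  ultimately show ?thesis by simp
qed

lemma single_factor: "Poly_Mapping.single m (c::'k::comm_ring_1) = Poly_Mapping.single 0 c * Poly_Mapping.single m 1"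
  by (simp add: mult_single)

lemma polys_induct [consumes 1, case_names const var add mult]:
  assumes "f \<in> polys X"
    and const: "\<And>c. Q (Poly_Mapping.single 0 c)" and var: "\<And>x. x \<in> X \<Longrightarrow> Q (pvar x)"
    and add: "\<And>f g. Q f \<Longrightarrow> Q g \<Longrightarrow> Q (f + g)" and mult: "\<And>f g. Q f \<Longrightarrow> Q g \<Longrightarrow> Q (f * g)"
  shows "Q f"
proof -
  have Q0: "Q 0" and Q1: "Q 1" using const[of 0] const[of 1] by (simp_all add: single_one)
  have sum: "Q (\<Sum>i\<in>S. u i)" if "\<And>i. i \<in> S \<Longrightarrow> Q (u i)" for S and u :: "'i \<Rightarrow> _"
    using that by (induction S rule: infinite_finite_induct) (auto intro: add Q0)
  have prod: "Q (\<Prod>i\<in>S. u i)" if "\<And>i. i \<in> S \<Longrightarrow> Q (u i)" for S and u :: "'i \<Rightarrow> _"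
    using that by (induction S rule: infinite_finite_induct) (auto intro: mult Q1)
  have pow: "Q (u ^ n)" if "Q u" for u n using that by (induction n) (auto intro: mult Q1)
  have "Q (\<Sum>m\<in>Poly_Mapping.keys f. Poly_Mapping.single m (Poly_Mapping.lookup f m))"
  proof (rule sum)
    fix m assume "m \<in> Poly_Mapping.keys f"
    then have "Poly_Mapping.keys m \<subseteq> X" using assms(1) by (auto simp: polys_def)
    then have "Q (Poly_Mapping.single m 1)" unfolding single_prod_pvar by (intro prod pow var) auto
    then show "Q (Poly_Mapping.single m (Poly_Mapping.lookup f m))"
      by (subst single_factor) (intro mult const)
  qed
  then show ?thesis using poly_sum_monomials[of f] by simp
qed

lemma peval_polyfun: "polyfun (\<lambda>t. peval f (\<lambda>x. u x t))" if "\<And>x. polyfun (u x)"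
  unfolding peval_def by (intro polyfun_intros that)

lemma hom_component_polys: "f \<in> polys X \<Longrightarrow> hom_component e f \<in> polys X"
  unfolding hom_component_def by (intro polys_sum) (auto simp: polys_def)

lemma peval_hom_component:
  "peval (hom_component e f) v = (\<Sum>m | m \<in> Poly_Mapping.keys f \<and> mdeg m = e. Poly_Mapping.lookup f m * monv m v)"
  by (simp add: hom_component_def peval_sum peval_single)

lemma peval_scale_hom:
  "peval f (\<lambda>x. t * v x) = (\<Sum>e\<in>mdeg ` Poly_Mapping.keys f. t ^ e * peval (hom_component e f) v)"
proof -
  have "(\<Sum>e\<in>mdeg ` Poly_Mapping.keys f. t ^ e * peval (hom_component e f) v)
      = (\<Sum>e\<in>mdeg ` Poly_Mapping.keys f. \<Sum>m | m \<in> Poly_Mapping.keys f \<and> mdeg m = e.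
          Poly_Mapping.lookup f m * (t ^ mdeg m * monv m v))"
    by (simp add: peval_hom_component sum_distrib_left mult_ac)
  also have "\<dots> = (\<Sum>m\<in>Poly_Mapping.keys f. Poly_Mapping.lookup f m * (t ^ mdeg m * monv m v))"
    by (rule sum.image_gen[symmetric]) simp
  finally show ?thesis by (simp add: peval_def monv_def[symmetric] monv_scale)
qed

lemma hom_component_outside: "e \<notin> mdeg ` Poly_Mapping.keys f \<Longrightarrow> hom_component e f = 0"
proof -
  assume "e \<notin> mdeg ` Poly_Mapping.keys f"
  then have "{m. m \<in> Poly_Mapping.keys f \<and> mdeg m = e} = {}" by auto
  then show ?thesis unfolding hom_component_def by (simp only: sum.empty)
qed

lemma sum_hom_components: "f = (\<Sum>e\<in>mdeg ` Poly_Mapping.keys f. hom_component e f)"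
proof -
  have "(\<Sum>e\<in>mdeg ` Poly_Mapping.keys f. hom_component e f)
      = (\<Sum>m\<in>Poly_Mapping.keys f. Poly_Mapping.single m (Poly_Mapping.lookup f m))"
    unfolding hom_component_def by (rule sum.image_gen[symmetric]) simp
  then show ?thesis using poly_sum_monomials[of f] by simp
qed

text \<open>Along the line through \<open>v\<close> the value of \<open>f\<close> is a polynomial in
  \<open>t\<close> whose coefficients are the values of the homogeneous components at
  \<open>v\<close>.\<close>

lemma hom_component_vanish:
  fixes f :: "('x, 'k::field_char_0) mpoly"
  assumes "\<And>t. peval f (\<lambda>x. t * v x) = 0"
  shows "peval (hom_component e f) v = 0"
proof (cases "e \<in> mdeg ` Poly_Mapping.keys f")
  case True
  define p where "p = (\<Sum>e\<in>mdeg ` Poly_Mapping.keys f. monom (peval (hom_component e f) v) e)"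
  have "poly p t = peval f (\<lambda>x. t * v x)" for t
    by (simp add: p_def poly_sum poly_monom peval_scale_hom mult.commute)
  then have "p = 0" using assms by (simp add: poly_eq_poly_eq_iff[symmetric] fun_eq_iff)
  then have "coeff p e = 0" by simp
  then show ?thesis using True by (simp add: p_def coeff_sum)
next
  case False
  then show ?thesis by (simp add: hom_component_outside)
qed

section \<open>Homogeneous ideals and points of schemes\<close>

lemma coord_ring_simps [simp]:
  "carrier (coord_ring X) = polys X" "mult (coord_ring X) = (*)" "one (coord_ring X) = 1"
  "zero (coord_ring X) = 0" "add (coord_ring X) = (+)"
  by (simp_all add: coord_ring_def)

lemma ring_coord_ring: "ring (coord_ring X :: ('x, 'k::comm_ring_1) mpoly ring)"
  using cring_coord_ring by (rule cring.axioms)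

lemma coord_ideal_iff:
  "ideal J (coord_ring X :: ('x, 'k::comm_ring_1) mpoly ring) \<longleftrightarrow>
     J \<subseteq> polys X \<and> 0 \<in> J \<and> (\<forall>f\<in>J. \<forall>g\<in>J. f + g \<in> J) \<and> (\<forall>f\<in>J. \<forall>g\<in>polys X. g * f \<in> J)"
proof
  assume J: "ideal J (coord_ring X :: ('x, 'k) mpoly ring)"
  interpret ideal J "coord_ring X :: ('x, 'k) mpoly ring" by (rule J)
  show "J \<subseteq> polys X \<and> 0 \<in> J \<and> (\<forall>f\<in>J. \<forall>g\<in>J. f + g \<in> J) \<and> (\<forall>f\<in>J. \<forall>g\<in>polys X. g * f \<in> J)"
    using a_subset a_closed I_l_closed additive_subgroup.zero_closed[OF additive_subgroup_axioms]
      additive_subgroup.a_closed[OF additive_subgroup_axioms] by auto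
next
  assume J: "J \<subseteq> polys X \<and> 0 \<in> J \<and> (\<forall>f\<in>J. \<forall>g\<in>J. f + g \<in> J) \<and> (\<forall>f\<in>J. \<forall>g\<in>polys X. g * f \<in> J)"
  interpret cring "coord_ring X :: ('x, 'k) mpoly ring" by (rule cring_coord_ring)
  show "ideal J (coord_ring X :: ('x, 'k) mpoly ring)"
  proof (rule idealI[OF ring_coord_ring])
    show "subgroup J (add_monoid (coord_ring X :: ('x, 'k) mpoly ring))"
    proof (rule add.subgroupI)
      fix f assume f: "f \<in> J"
      then have fX: "f \<in> polys X" using J by blast
      have "- 1 * f \<in> J" using J f polys_uminus[OF polys_1] by blast
      moreover have "\<ominus>\<^bsub>coord_ring X\<^esub> f = - f"
        by (rule minus_equality) (use fX polys_uminus[OF fX] in auto)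
      ultimately show "\<ominus>\<^bsub>coord_ring X\<^esub> f \<in> J" by simp
    qed (use J in auto)
  qed (use J in \<open>auto simp: mult.commute\<close>)
qed

lemma
  assumes "ideal J (coord_ring X :: ('x, 'k::comm_ring_1) mpoly ring)"
  shows coord_ideal_add: "f \<in> J \<Longrightarrow> g \<in> J \<Longrightarrow> f + g \<in> J"
    and coord_ideal_0: "0 \<in> J"
    and coord_ideal_mult: "f \<in> J \<Longrightarrow> g \<in> polys X \<Longrightarrow> g * f \<in> J"
    and coord_ideal_mult': "f \<in> J \<Longrightarrow> g \<in> polys X \<Longrightarrow> f * g \<in> J"
    and coord_ideal_polys: "f \<in> J \<Longrightarrow> f \<in> polys X"
    and coord_ideal_uminus: "f \<in> J \<Longrightarrow> - f \<in> J"
    and coord_ideal_diff: "f \<in> J \<Longrightarrow> g \<in> J \<Longrightarrow> f - g \<in> J"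
proof -
  have J: "J \<subseteq> polys X" "0 \<in> J" "\<And>f g. f \<in> J \<Longrightarrow> g \<in> J \<Longrightarrow> f + g \<in> J"
    "\<And>f g. f \<in> J \<Longrightarrow> g \<in> polys X \<Longrightarrow> g * f \<in> J"
    using assms unfolding coord_ideal_iff by blast+
  have neg: "- f \<in> J" if "f \<in> J" for f using J(4)[OF that polys_uminus[OF polys_1]] by simp
  show "f + g \<in> J" if "f \<in> J" "g \<in> J" using J(3) that .
  show "0 \<in> J" by (rule J)
  show "g * f \<in> J" "f * g \<in> J" if "f \<in> J" "g \<in> polys X" using J(4)[OF that] by (simp_all add: mult.commute)
  show "f \<in> polys X" if "f \<in> J" using J that by blast
  show "- f \<in> J" if "f \<in> J" using neg that .
  show "f - g \<in> J" if "f \<in> J" "g \<in> J" using J(3)[OF that(1) neg[OF that(2)]] by simp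
qed

lemma coord_ideal_sum:
  "ideal J (coord_ring X :: ('x, 'k::comm_ring_1) mpoly ring) \<Longrightarrow> (\<And>i. i \<in> S \<Longrightarrow> f i \<in> J) \<Longrightarrow> (\<Sum>i\<in>S. f i) \<in> J"
  by (induction S rule: infinite_finite_induct) (auto intro: coord_ideal_0 coord_ideal_add)

lemma van_ideal_ideal: "ideal (van_ideal X Z) (coord_ring X)"
  unfolding coord_ideal_iff van_ideal_def by (auto simp: peval_add peval_mult intro: polys_add polys_mult)

lemma van_ideal_antimono: "Z \<subseteq> Z' \<Longrightarrow> van_ideal X Z' \<subseteq> van_ideal X Z"
  by (auto simp: van_ideal_def)

lemma inter_ideal_alt:
  "inter_ideal X Y Z = {f + g | f g. f \<in> van_ideal X Y \<and> g \<in> van_ideal X Z}"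
  unfolding inter_ideal_def set_add_def' by auto

lemma inter_ideal_sub: "van_ideal X Y \<subseteq> inter_ideal X Y Z" "van_ideal X Z \<subseteq> inter_ideal X Y Z"
proof -
  have 0: "0 \<in> van_ideal X Y" "0 \<in> van_ideal X Z" using coord_ideal_0 van_ideal_ideal by blast+
  show "van_ideal X Y \<subseteq> inter_ideal X Y Z"
  proof
    fix f assume "f \<in> van_ideal X Y"
    then show "f \<in> inter_ideal X Y Z" unfolding inter_ideal_alt using 0(2)
      by (intro CollectI exI[of _ f] exI[of _ 0]) simp
  qed
  show "van_ideal X Z \<subseteq> inter_ideal X Y Z"
  proof
    fix f assume "f \<in> van_ideal X Z"
    then show "f \<in> inter_ideal X Y Z" unfolding inter_ideal_alt using 0(1)
      by (intro CollectI exI[of _ 0] exI[of _ f]) simp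
  qed
qed

lemma inter_ideal_polys: "inter_ideal X Y Z \<subseteq> polys X"
  unfolding inter_ideal_alt by (auto simp: van_ideal_def intro: polys_add)

lemma inter_ideal_vanish: "f \<in> inter_ideal X Y Z \<Longrightarrow> v \<in> Y \<Longrightarrow> v \<in> Z \<Longrightarrow> peval f v = 0"
  unfolding inter_ideal_alt van_ideal_def by (auto simp: peval_add)

lemma inter_ideal_add:
  assumes "f \<in> inter_ideal X Y Z" "g \<in> inter_ideal X Y Z"
  shows "f + g \<in> inter_ideal X Y Z"
proof -
  obtain f1 f2 g1 g2 where *: "f = f1 + f2" "g = g1 + g2" "f1 \<in> van_ideal X Y" "f2 \<in> van_ideal X Z"
    "g1 \<in> van_ideal X Y" "g2 \<in> van_ideal X Z" using assms unfolding inter_ideal_alt by blast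
  have "f + g = (f1 + g1) + (f2 + g2)" using * by simp
  then show ?thesis unfolding inter_ideal_alt
    using coord_ideal_add[OF van_ideal_ideal *(3,5)] coord_ideal_add[OF van_ideal_ideal *(4,6)] by blast
qed

text \<open>\<open>irred\<close> expresses that the cone is irreducible and makes the ideal prime,
  \<open>scale\<close> makes it homogeneous, and \<open>nz\<close> separates it from the irrelevant
  ideal. Lines and faces of the Segre-Veronese cone are both treated in this way.\<close>

lemma van_ideal_point:
  fixes Z :: "('x \<Rightarrow> 'k::field_char_0) set"
  assumes scale: "\<And>v t. v \<in> Z \<Longrightarrow> (\<lambda>x. t * v x) \<in> Z"
    and irred: "\<And>f g v w. f \<in> polys X \<Longrightarrow> g \<in> polys X \<Longrightarrow> v \<in> Z \<Longrightarrow> w \<in> Z \<Longrightarrow> peval f v \<noteq> 0 \<Longrightarrow> peval g w \<noteq> 0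
        \<Longrightarrow> \<exists>u\<in>Z. peval f u \<noteq> 0 \<and> peval g u \<noteq> 0"
    and nz: "\<exists>v\<in>Z. \<exists>x\<in>X. v x \<noteq> 0"
    and I: "I \<subseteq> van_ideal X Z"
  shows "van_ideal X Z \<in> proj_points X I"
  unfolding proj_points_def
proof (intro CollectI conjI ballI allI)
  show "primeideal (van_ideal X Z) (coord_ring X)"
  proof (rule primeidealI[OF van_ideal_ideal cring_coord_ring])
    obtain v where "v \<in> Z" using nz by blast
    then have "1 \<notin> van_ideal X Z" by (auto simp: van_ideal_def)
    then show "carrier (coord_ring X) \<noteq> van_ideal X Z" using polys_1 by auto
    fix f g :: "('x, 'k) mpoly" assume fg: "f \<in> carrier (coord_ring X)" "g \<in> carrier (coord_ring X)"
      "f \<otimes>\<^bsub>coord_ring X\<^esub> g \<in> van_ideal X Z"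
    show "f \<in> van_ideal X Z \<or> g \<in> van_ideal X Z"
    proof (rule ccontr)
      assume "\<not> ?thesis"
      then obtain v w where "v \<in> Z" "w \<in> Z" "peval f v \<noteq> 0" "peval g w \<noteq> 0"
        using fg by (auto simp: van_ideal_def)
      then obtain u where "u \<in> Z" "peval f u \<noteq> 0" "peval g u \<noteq> 0" using irred[of f g v w] fg by auto
      then show False using fg(3) by (auto simp: van_ideal_def peval_mult)
    qed
  qed
  show "hom_component e f \<in> van_ideal X Z" if "f \<in> van_ideal X Z" for f e
    using that scale unfolding van_ideal_def by (auto intro: hom_component_polys hom_component_vanish)
  show "I \<subseteq> van_ideal X Z" by (rule I)
  show "\<not> pvar ` X \<subseteq> van_ideal X Z" using nz by (auto simp: van_ideal_def image_subset_iff)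
qed

definition line_through :: "('x \<Rightarrow> 'k::times) \<Rightarrow> ('x \<Rightarrow> 'k) set" where
  "line_through w = range (\<lambda>t x. t * w x)"

lemma line_point:
  fixes w :: "'x \<Rightarrow> 'k::field_char_0"
  assumes "\<exists>x\<in>X. w x \<noteq> 0" "I \<subseteq> van_ideal X (line_through w)"
  shows "van_ideal X (line_through w) \<in> proj_points X I"
proof (rule van_ideal_point)
  show "(\<lambda>x. t * v x) \<in> line_through w" if v: "v \<in> line_through w" for v t
  proof -
    obtain s where "v = (\<lambda>x. s * w x)" using v unfolding line_through_def by blast
    then have "(\<lambda>x. t * v x) = (\<lambda>x. (t * s) * w x)" by (simp add: mult.assoc)
    then show ?thesis by (auto simp: line_through_def)
  qed
  fix f g :: "('x, 'k) mpoly" and v v'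
  assume *: "v \<in> line_through w" "v' \<in> line_through w" "peval f v \<noteq> 0" "peval g v' \<noteq> 0"
  then obtain s s' where s: "v = (\<lambda>x. s * w x)" "v' = (\<lambda>x. s' * w x)" by (auto simp: line_through_def)
  have "\<exists>t\<in>UNIV. \<forall>i\<in>{f, g}. peval i (\<lambda>x. t * w x) \<noteq> 0"
    using * by (intro polyfun_common_nonzero peval_polyfun polyfun_intros) (auto simp: s infinite_UNIV_char_0)
  then show "\<exists>u\<in>line_through w. peval f u \<noteq> 0 \<and> peval g u \<noteq> 0"
    unfolding line_through_def by auto
next
  show "\<exists>v\<in>line_through w. \<exists>x\<in>X. v x \<noteq> 0"
  proof (rule bexI)
    show "w \<in> line_through w" unfolding line_through_def by (rule range_eqI[of _ _ 1]) simp
  qed (rule assms(1))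
qed (rule assms(2))

lemma polys_separate:
  fixes u :: "'i \<Rightarrow> 'x \<Rightarrow> 'k::field"
  assumes "finite S" "i \<in> S" "\<And>j. j \<in> S \<Longrightarrow> j \<noteq> i \<Longrightarrow> \<exists>x\<in>X. u i x \<noteq> u j x"
  shows "\<exists>f\<in>polys X. \<forall>j\<in>S. peval f (u j) = (if j = i then 1 else 0)"
proof -
  have "\<forall>j\<in>S - {i}. \<exists>x\<in>X. u i x \<noteq> u j x" using assms by auto
  then obtain x where x: "\<And>j. j \<in> S - {i} \<Longrightarrow> x j \<in> X \<and> u i (x j) \<noteq> u j (x j)" by metis
  define f where "f = (\<Prod>j\<in>S - {i}. pscale (1 / (u i (x j) - u j (x j))) (pvar (x j) - Poly_Mapping.single 0 (u j (x j))))"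
  have "f \<in> polys X" unfolding f_def using x
    by (intro polys_prod polys_pscale polys_diff polys_pvar) auto
  moreover have "peval f (u l) = (if l = i then 1 else 0)" if l: "l \<in> S" for l
  proof -
    have e: "peval f (u l) = (\<Prod>j\<in>S - {i}. (u l (x j) - u j (x j)) / (u i (x j) - u j (x j)))"
      by (simp add: f_def peval_prod peval_pscale peval_diff)
    show ?thesis
    proof (cases "l = i")
      case True
      then show ?thesis unfolding e using x by (intro trans[OF prod.neutral]) auto
    next
      case False
      then show ?thesis unfolding e using l assms(1) by auto
    qed
  qed
  ultimately show ?thesis by blast
qed

text \<open>Nonproportional vectors become distinct points of the affine chart \<open>l = 1\<close>.
  Evaluation at them factors through the quotient ring of dimension \<open>h\<close> and is onto by
  interpolation.\<close>

lemma scheme_length_bound: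
  fixes W Z :: "('x \<Rightarrow> 'k::field_char_0) set"
  assumes len: "scheme_length X (inter_ideal X W Z) h"
    and WZ: "\<And>v t. v \<in> W \<Longrightarrow> (\<lambda>x. t * v x) \<in> W" "\<And>v t. v \<in> Z \<Longrightarrow> (\<lambda>x. t * v x) \<in> Z"
    and S: "finite S" "\<And>i. i \<in> S \<Longrightarrow> u i \<in> W \<inter> Z" "\<And>i. i \<in> S \<Longrightarrow> \<exists>x\<in>X. u i x \<noteq> 0"
    and np: "\<And>i j. i \<in> S \<Longrightarrow> j \<in> S \<Longrightarrow> i \<noteq> j \<Longrightarrow> \<not> (\<exists>c. \<forall>x\<in>X. u i x = c * u j x)"
  shows "card S \<le> h"
proof -
  let ?I = "inter_ideal X W Z"
  obtain l where l: "l \<in> forms X 1" "\<And>P. P \<in> proj_points X ?I \<Longrightarrow> l \<notin> P"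
    "quot_dim (polys X) (Idl\<^bsub>coord_ring X\<^esub> (insert (l - 1) ?I)) h"
    using len unfolding scheme_length_def by blast
  have lX: "l \<in> polys X" using l(1) by (simp add: forms_def)
  have lin: "peval l (\<lambda>x. t * v x) = t * peval l v" for t v
  proof -
    have "peval l (\<lambda>x. t * v x) = (\<Sum>m\<in>Poly_Mapping.keys l. Poly_Mapping.lookup l m * (t * monv m v))"
      unfolding peval_def monv_def[symmetric] monv_scale using l(1) by (intro sum.cong) (auto simp: forms_def)
    then show ?thesis by (simp add: peval_def monv_def[symmetric] sum_distrib_left mult_ac)
  qed
  \<comment> \<open>Otherwise the ideal of the line through \<open>u i\<close> would be a point of
    the scheme on the hyperplane \<open>l = 0\<close>, which was chosen to miss the scheme.\<close>
  have lu: "peval l (u i) \<noteq> 0" if i: "i \<in> S" for i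
  proof
    assume z: "peval l (u i) = 0"
    have "van_ideal X (line_through (u i)) \<in> proj_points X ?I"
    proof (rule line_point[OF S(3)[OF i]])
      show "?I \<subseteq> van_ideal X (line_through (u i))"
      proof
        fix f assume f: "f \<in> ?I"
        then have "peval f (\<lambda>x. t * u i x) = 0" for t
          using S(2)[OF i] WZ by (intro inter_ideal_vanish[OF f]) auto
        then show "f \<in> van_ideal X (line_through (u i))"
          using f subsetD[OF inter_ideal_polys f] by (auto simp: van_ideal_def line_through_def)
      qed
    qed
    moreover have "l \<in> van_ideal X (line_through (u i))"
      using lX z by (auto simp: van_ideal_def line_through_def lin)
    ultimately show False using l(2) by blast
  qed
  define w where "w = (\<lambda>i x. (1 / peval l (u i)) * u i x)"
  have wl: "peval l (w i) = 1" if "i \<in> S" for i using lu[OF that] unfolding w_def by (subst lin) simp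
  have wWZ: "w i \<in> W" "w i \<in> Z" if "i \<in> S" for i
    using S(2)[OF that] unfolding w_def by (auto intro: WZ simp del: divide_inverse times_divide_eq_left mult_1)
  let ?V = "{f \<in> polys X. \<forall>i\<in>S. peval f (w i) = 0}"
  have "ideal ?V (coord_ring X)"
    unfolding coord_ideal_iff by (auto simp: peval_add peval_mult intro: polys_add polys_mult)
  moreover have "insert (l - 1) ?I \<subseteq> ?V"
  proof (rule insert_subsetI)
    show "l - 1 \<in> ?V" using wl polys_diff[OF lX polys_1] by (simp add: peval_diff)
    show "?I \<subseteq> ?V"
    proof
      fix f assume f: "f \<in> ?I"
      show "f \<in> ?V" using subsetD[OF inter_ideal_polys f] inter_ideal_vanish[OF f wWZ] by simp
    qed
  qed
  ultimately have J: "Idl\<^bsub>coord_ring X\<^esub> (insert (l - 1) ?I) \<subseteq> ?V"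
    by (rule ring.genideal_minimal[OF ring_coord_ring])
  obtain B where B: "B \<subseteq> polys X" "finite B" "card B = h"
    "\<forall>f\<in>polys X. \<exists>c. f - (\<Sum>b\<in>B. pscale (c b) b) \<in> Idl\<^bsub>coord_ring X\<^esub> (insert (l - 1) ?I)"
    using l(3) unfolding quot_dim_def by (elim exE conjE) (rule that)
  \<comment> \<open>The vectors \<open>e b\<close> list the values of a basis of the quotient;
    interpolation writes every unit vector as a combination of them.\<close>
  define e where "e = (\<lambda>b j. if j \<in> S then peval b (w j) else 0)"
  have "(\<lambda>i j. if j = i then 1 else 0 :: 'k) ` S \<subseteq> fvs.span (e ` B)"
  proof
    fix y :: "_ \<Rightarrow> 'k" assume "y \<in> (\<lambda>i j. if j = i then 1 else 0) ` S"
    then obtain i where i: "i \<in> S" "y = (\<lambda>j. if j = i then 1 else 0)" by auto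
    have "\<exists>x\<in>X. w i x \<noteq> w j x" if j: "j \<in> S" "j \<noteq> i" for j
    proof (rule ccontr)
      assume "\<not> ?thesis"
      then have eq: "w i x = w j x" if "x \<in> X" for x using that by blast
      have "u i x = (peval l (u i) / peval l (u j)) * u j x" if "x \<in> X" for x
        using eq[OF that] lu[OF i(1)] lu[OF j(1)] by (simp add: w_def field_simps)
      then show False using np[OF i(1) j(1)] j(2) by blast
    qed
    then obtain f where f: "f \<in> polys X" "\<forall>j\<in>S. peval f (w j) = (if j = i then 1 else 0)"
      using polys_separate[OF S(1) i(1), of X w] by blast
    obtain c where c: "f - (\<Sum>b\<in>B. pscale (c b) b) \<in> ?V" using bspec[OF B(4) f(1)] J by (elim exE) (rule that, erule subsetD)
    have "y j = (\<Sum>b\<in>B. c b * e b j)" for j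
    proof (cases "j \<in> S")
      case True
      then have "peval f (w j) = (\<Sum>b\<in>B. c b * peval b (w j))"
        using c by (simp add: peval_diff peval_sum peval_pscale)
      then show ?thesis using True f(2) i by (simp add: e_def)
    next
      case False
      then show ?thesis using i by (auto simp: e_def)
    qed
    then show "y \<in> fvs.span (e ` B)" unfolding fvs_span_family[OF B(2)] by blast
  qed
  from findep_card_le[OF findep_unit_vectors[OF S(1)] S(1) _ this] B(2)
  have "card S \<le> card (e ` B)" by simp
  also have "\<dots> \<le> h" using card_image_le[OF B(2), of e] B(3) by simp
  finally show ?thesis .
qed

subsection \<open>Schemes of reduced points\<close>

lemma inter_ideal_ideal: "ideal (inter_ideal X Y Z) (coord_ring X :: ('x, 'k::field) mpoly ring)"
  unfolding coord_ideal_iff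
proof (intro conjI ballI)
  show "0 \<in> inter_ideal X Y Z" using coord_ideal_0[OF van_ideal_ideal] inter_ideal_sub(1) by blast
  fix f g :: "('x, 'k) mpoly"
  assume f: "f \<in> inter_ideal X Y Z" and g: "g \<in> polys X"
  obtain f1 f2 where *: "f = f1 + f2" "f1 \<in> van_ideal X Y" "f2 \<in> van_ideal X Z"
    using f unfolding inter_ideal_alt by blast
  have "g * f = g * f1 + g * f2" using * by (simp add: distrib_left)
  then show "g * f \<in> inter_ideal X Y Z" unfolding inter_ideal_alt
    using coord_ideal_mult[OF van_ideal_ideal _ g] * by blast
qed (auto intro: inter_ideal_add dest: subsetD[OF inter_ideal_polys])

lemma coord_ideal_prod_cong:
  assumes J: "ideal J (coord_ring X :: ('x, 'k::comm_ring_1) mpoly ring)"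
    and ab: "\<And>i. i \<in> S \<Longrightarrow> a i \<in> polys X" "\<And>i. i \<in> S \<Longrightarrow> b i \<in> polys X" "\<And>i. i \<in> S \<Longrightarrow> a i - b i \<in> J"
  shows "(\<Prod>i\<in>S. a i) - (\<Prod>i\<in>S. b i) \<in> J"
  using ab
proof (induction S rule: infinite_finite_induct)
  case (insert s S)
  have "(\<Prod>i\<in>insert s S. a i) - (\<Prod>i\<in>insert s S. b i)
      = (a s - b s) * (\<Prod>i\<in>S. a i) + b s * ((\<Prod>i\<in>S. a i) - (\<Prod>i\<in>S. b i))"
    using insert by (simp add: algebra_simps)
  moreover have "(a s - b s) * (\<Prod>i\<in>S. a i) \<in> J"
    using insert.prems by (intro coord_ideal_mult'[OF J] polys_prod) auto
  moreover have "b s * ((\<Prod>i\<in>S. a i) - (\<Prod>i\<in>S. b i)) \<in> J"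
    using insert by (intro coord_ideal_mult[OF J]) auto
  ultimately show ?case using coord_ideal_add[OF J] by metis
qed (auto intro: coord_ideal_0[OF J])

lemma pscale_simps:
  "pscale c (f + g) = pscale c f + pscale c g" "pscale (c + d) f = pscale c f + pscale d f"
  "pscale c (f - g) = pscale c f - pscale c g" "pscale c f * pscale d g = pscale (c * d) (f * g)"
  "pscale c (pscale d f) = pscale (c * d) f" "pscale 0 f = 0" "pscale 1 f = f" "pscale c 0 = 0"
  by (simp_all add: pscale_def algebra_simps single_add mult_single
      flip: mult.assoc)

lemma pscale_sum: "pscale c (\<Sum>i\<in>S. f i) = (\<Sum>i\<in>S. pscale c (f i))"
  by (simp add: pscale_def sum_distrib_left)

lemma pscale_sum_left: "pscale (\<Sum>i\<in>S. c i) f = (\<Sum>i\<in>S. pscale (c i) f)"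
  by (induction S rule: infinite_finite_induct) (auto simp: pscale_simps)

lemma pscale_prod_power:
  "(\<Prod>x\<in>S. pscale (c x) y ^ u x) = pscale (\<Prod>x\<in>S. c x ^ u x) (y ^ (\<Sum>x\<in>S. u x))"
proof -
  have pw: "pscale c y ^ n = pscale (c ^ n) (y ^ n)" for c n
    by (induction n) (auto simp: pscale_simps)
  show ?thesis
    by (induction S rule: infinite_finite_induct) (auto simp: pscale_simps pw power_add)
qed

lemma linear_form: "finite X \<Longrightarrow> (\<Sum>x\<in>X. pscale (c x) (pvar x)) \<in> forms X 1"
proof -
  assume "finite X"
  have "Poly_Mapping.keys (\<Sum>x\<in>X. pscale (c x) (pvar x)) \<subseteq> (\<Union>x\<in>X. Poly_Mapping.keys (pscale (c x) (pvar x)))"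
    by (rule Poly_Mapping.keys_sum)
  also have "\<dots> \<subseteq> (\<lambda>x. Poly_Mapping.single x 1) ` X"
    by (auto simp: pscale_def pvar_def mult_single split: if_splits)
  finally show ?thesis by (fastforce simp: forms_def polys_def mdeg_def)
qed

text \<open>Apart from being stable under scaling and containing the points, \<open>Z\<close> enters
  only through \<open>mon\<close>: restricted to \<open>W\<close>, its ideal contains every mixed
  monomial of degree \<open>m\<close>. This determines the support of the intersection as well as
  its length.\<close>

locale dual_frame =
  fixes X :: "'x set" and P :: "nat \<Rightarrow> 'x \<Rightarrow> 'k::field_char_0" and h m :: nat and W Z
  assumes X: "finite X" and PX: "\<And>l. l < h \<Longrightarrow> P l \<in> coord_space X" and ind: "findep P {..<h}"
    and h: "0 < h" and m: "2 \<le> m"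
    and W: "W = fvs.span (P ` {..<h})"
    and PZ: "\<And>l. l < h \<Longrightarrow> P l \<in> Z" and Zscale: "\<And>v t. v \<in> Z \<Longrightarrow> (\<lambda>x. t * v x) \<in> Z"
    and mon: "\<And>\<mu>. \<mu> \<in> msets h m \<Longrightarrow> mixed \<mu> \<Longrightarrow>
      \<exists>f\<in>van_ideal X Z. \<forall>z. peval f (\<lambda>x. \<Sum>l<h. z l * P l x) = mmono \<mu> z"
begin

abbreviation "II \<equiv> inter_ideal X W Z"

definition xi where "xi = (SOME \<xi>. \<forall>i\<in>{..<h}. \<forall>j\<in>{..<h}. lfun X (\<xi> i) (P j) = (if i = j then 1 else 0))"

definition y where "y l = (\<Sum>x\<in>X. pscale (xi l x) (pvar x))"

definition ym where "ym \<mu> = (\<Prod>l\<in>#\<mu>. y l)"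

lemma xi: "i < h \<Longrightarrow> j < h \<Longrightarrow> lfun X (xi i) (P j) = (if i = j then 1 else 0)"
proof -
  have "\<exists>\<xi>. \<forall>i\<in>{..<h}. \<forall>j\<in>{..<h}. lfun X (\<xi> i) (P j) = (if i = j then 1 else 0)"
    using PX by (intro findep_dual X ind) auto
  from someI_ex[OF this] show "i < h \<Longrightarrow> j < h \<Longrightarrow> ?thesis" unfolding xi_def by blast
qed

lemma y_polys: "y l \<in> polys X"
  unfolding y_def by (intro polys_sum polys_pscale polys_pvar)

lemma y_eval: "peval (y l) v = lfun X (xi l) v"
  by (simp add: y_def lfun_def peval_sum peval_pscale)

lemma y_eval_comb: "i < h \<Longrightarrow> peval (y i) (\<lambda>x. \<Sum>l<h. z l * P l x) = z i"
proof -
  assume i: "i < h"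
  have "peval (y i) (\<lambda>x. \<Sum>l<h. z l * P l x) = (\<Sum>l<h. z l * lfun X (xi i) (P l))"
    by (simp add: y_eval lfun_linear)
  also have "\<dots> = (\<Sum>l<h. if i = l then z l else 0)" using i by (intro sum.cong) (auto simp: xi)
  finally show ?thesis using i by simp
qed

lemma y_eval_P: "i < h \<Longrightarrow> j < h \<Longrightarrow> peval (y i) (P j) = (if i = j then 1 else 0)"
  by (simp add: y_eval xi)

lemma ym_polys: "ym \<mu> \<in> polys X"
  unfolding ym_def by (induction \<mu>) (auto intro: polys_mult y_polys)

lemma ym_eval: "set_mset \<mu> \<subseteq> {..<h} \<Longrightarrow> peval (ym \<mu>) (\<lambda>x. \<Sum>l<h. z l * P l x) = mmono \<mu> z"
  unfolding ym_def mmono_def by (induction \<mu>) (auto simp: peval_mult y_eval_comb)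

lemma in_W: "w \<in> W \<longleftrightarrow> (\<exists>z. w = (\<lambda>x. \<Sum>l<h. z l * P l x))"
  unfolding W fvs_span_family[OF finite_lessThan] by (auto simp: fun_eq_iff)

lemma van_W: "f \<in> polys X \<Longrightarrow> (\<And>z. peval f (\<lambda>x. \<Sum>l<h. z l * P l x) = 0) \<Longrightarrow> f \<in> II"
proof -
  assume f: "f \<in> polys X" "\<And>z. peval f (\<lambda>x. \<Sum>l<h. z l * P l x) = 0"
  have "peval f w = 0" if "w \<in> W" for w
  proof -
    obtain z where "w = (\<lambda>x. \<Sum>l<h. z l * P l x)" using \<open>w \<in> W\<close> unfolding in_W by blast
    then show ?thesis using f(2) by simp
  qed
  then have "f \<in> van_ideal X W" using f(1) by (simp add: van_ideal_def)
  then show ?thesis using inter_ideal_sub(1)[of X W Z] by blast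
qed

text \<open>\<open>ym \<mu>\<close> and the polynomial supplied by \<open>mon\<close> agree on
  \<open>W\<close>, so they differ by an element of the ideal of \<open>W\<close>.\<close>

lemma ym_II: "\<mu> \<in> msets h m \<Longrightarrow> mixed \<mu> \<Longrightarrow> ym \<mu> \<in> II"
proof -
  assume \<mu>: "\<mu> \<in> msets h m" "mixed \<mu>"
  obtain f where f: "f \<in> van_ideal X Z" "\<And>z. peval f (\<lambda>x. \<Sum>l<h. z l * P l x) = mmono \<mu> z"
    using mon[OF \<mu>] by blast
  have fI: "f \<in> II" using f(1) inter_ideal_sub(2) by blast
  have "ym \<mu> - f \<in> II" using f \<mu>(1)
    by (intro van_W polys_diff ym_polys) (auto simp: van_ideal_def msets_def peval_diff ym_eval)
  from coord_ideal_add[OF inter_ideal_ideal this fI] show ?thesis by simp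
qed

lemma pvar_II: "x \<in> X \<Longrightarrow> pvar x - (\<Sum>l<h. pscale (P l x) (y l)) \<in> II"
proof (rule van_W)
  assume x: "x \<in> X"
  then show "pvar x - (\<Sum>l<h. pscale (P l x) (y l)) \<in> polys X"
    by (intro polys_diff polys_pvar polys_sum polys_pscale y_polys)
  fix z
  have "(\<Sum>l<h. P l x * peval (y l) (\<lambda>x. \<Sum>l<h. z l * P l x)) = (\<Sum>l<h. z l * P l x)"
    by (intro sum.cong) (auto simp: y_eval_comb mult.commute)
  then show "peval (pvar x - (\<Sum>l<h. pscale (P l x) (y l))) (\<lambda>x. \<Sum>l<h. z l * P l x) = 0"
    by (simp add: peval_diff peval_sum peval_pscale)
qed

abbreviation "LL i \<equiv> van_ideal X (line_through (P i))"

lemma scaled_P: "i < h \<Longrightarrow> (\<lambda>x. t * P i x) \<in> W \<and> (\<lambda>x. t * P i x) \<in> Z"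
proof -
  assume i: "i < h"
  have "(\<lambda>x. t * P i x) = (\<lambda>x. \<Sum>l<h. (if l = i then t else 0) * P l x)" using i
    by (auto simp: fun_eq_iff if_distrib if_distribR cong: if_cong)
  then have "(\<lambda>x. t * P i x) \<in> W" unfolding in_W by (rule exI[of _ "\<lambda>l. if l = i then t else 0"])
  then show ?thesis using Zscale[OF PZ[OF i]] by blast
qed

lemma LL_point: "i < h \<Longrightarrow> LL i \<in> proj_points X II"
proof -
  assume i: "i < h"
  show ?thesis
  proof (rule line_point)
    obtain x where "P i x \<noteq> 0" using findep_nonzero[OF ind, of i] i by auto
    then show "\<exists>x\<in>X. P i x \<noteq> 0" using PX[OF i] by (auto simp: coord_space_def)
    show "II \<subseteq> LL i"
    proof
      fix f assume f: "f \<in> II"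
      then show "f \<in> LL i" using subsetD[OF inter_ideal_polys f] scaled_P[OF i]
        by (auto simp: van_ideal_def line_through_def intro: inter_ideal_vanish)
    qed
  qed
qed

lemma y_LL: "i < h \<Longrightarrow> j < h \<Longrightarrow> y j \<in> LL i \<longleftrightarrow> i \<noteq> j"
  by (auto simp: van_ideal_def line_through_def y_polys y_eval lfun_linear xi intro!: exI[of _ "1::'k"])

text \<open>A point of the scheme misses some \<open>y i\<close>. The mixed monomial
  \<open>y j * y i ^ (m - 1)\<close> then forces all other \<open>y j\<close> into \<open>Q\<close>,
  so modulo \<open>Q\<close> every coordinate is a multiple of \<open>y i\<close>, just as on the
  line through \<open>P i\<close>.\<close>

lemma point_is_LL:
  assumes Q: "Q \<in> proj_points X II"
  shows "\<exists>i<h. Q = LL i"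
proof -
  interpret Q: primeideal Q "coord_ring X" using Q by (simp add: proj_points_def)
  note id = Q.is_ideal
  have IQ: "II \<subseteq> Q" and Qh: "\<And>f e. f \<in> Q \<Longrightarrow> hom_component e f \<in> Q" and nz: "\<not> pvar ` X \<subseteq> Q"
    using Q by (auto simp: proj_points_def)
  have pr: "f \<in> Q \<or> g \<in> Q" if "f \<in> polys X" "g \<in> polys X" "f * g \<in> Q" for f g
    using Q.I_prime[of f g] that by simp
  have one: "1 \<notin> Q"
  proof
    assume "1 \<in> Q"
    then have "f \<in> Q" if "f \<in> polys X" for f using coord_ideal_mult[OF id _ that, of 1] by simp
    from this[OF polys_pvar] show False using nz by auto
  qed
  have pw: "f \<in> Q" if "f \<in> polys X" "f ^ n \<in> Q" for f n
    using that(2) by (induction n) (use one pr[OF that(1) polys_power[OF that(1)]] in auto)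
  have sc: "pscale c f \<in> Q" if "f \<in> Q" for c f
    unfolding pscale_def by (rule coord_ideal_mult[OF id that polys_const])
  have "\<exists>i<h. y i \<notin> Q"
  proof (rule ccontr)
    assume "\<not> ?thesis"
    then have yQ: "y l \<in> Q" if "l < h" for l using that by blast
    have "pvar x \<in> Q" if x: "x \<in> X" for x
    proof -
      have "(\<Sum>l<h. pscale (P l x) (y l)) \<in> Q" using yQ by (intro coord_ideal_sum[OF id] sc) auto
      moreover have "pvar x - (\<Sum>l<h. pscale (P l x) (y l)) \<in> Q" using pvar_II[OF x] IQ by blast
      ultimately show ?thesis using coord_ideal_add[OF id] by fastforce
    qed
    then show False using nz by blast
  qed
  then obtain i where i: "i < h" "y i \<notin> Q" by blast
  have yj: "y j \<in> Q" if j: "j < h" "j \<noteq> i" for j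
  proof -
    let ?\<mu> = "add_mset j (replicate_mset (m - 1) i)"
    have "?\<mu> \<in> msets h m" using i j m by (auto simp: msets_def)
    moreover have "mixed ?\<mu>" using j m by (unfold mixed_def, intro exI[of _ i] exI[of _ j]) auto
    ultimately have "ym ?\<mu> \<in> Q" using ym_II IQ by blast
    moreover have "ym ?\<mu> = y j * y i ^ (m - 1)" by (simp add: ym_def)
    ultimately show ?thesis using pr[of "y j" "y i ^ (m - 1)"] pw[OF y_polys] i(2)
      by (auto simp: y_polys polys_power)
  qed
  have vr: "pvar x - pscale (P i x) (y i) \<in> Q" if x: "x \<in> X" for x
  proof -
    have "(\<Sum>l\<in>{..<h} - {i}. pscale (P l x) (y l)) \<in> Q" using yj by (intro coord_ideal_sum[OF id] sc) auto
    moreover have "pvar x - (\<Sum>l<h. pscale (P l x) (y l)) \<in> Q" using pvar_II[OF x] IQ by blast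
    moreover have "(\<Sum>l<h. pscale (P l x) (y l)) = pscale (P i x) (y i) + (\<Sum>l\<in>{..<h} - {i}. pscale (P l x) (y l))"
      using i by (simp add: sum.remove)
    ultimately show ?thesis using coord_ideal_add[OF id] by (fastforce simp: algebra_simps)
  qed
  have mm: "Poly_Mapping.single u 1 - pscale (monv u (P i)) (y i ^ mdeg u) \<in> Q"
    if u: "Poly_Mapping.keys u \<subseteq> X" for u
  proof -
    have "(\<Prod>x\<in>Poly_Mapping.keys u. \<Prod>k<Poly_Mapping.lookup u x. pvar x)
        - (\<Prod>x\<in>Poly_Mapping.keys u. \<Prod>k<Poly_Mapping.lookup u x. pscale (P i x) (y i)) \<in> Q"
      using u by (intro coord_ideal_prod_cong[OF id] polys_prod polys_pvar polys_pscale y_polys vr) auto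
    then show ?thesis by (simp add: pscale_prod_power monv_def mdeg_def single_prod_pvar[symmetric])
  qed
  \<comment> \<open>Modulo \<open>Q\<close> a form of degree \<open>e\<close> equals its value at
    \<open>P i\<close> times \<open>y i ^ e\<close>, and no power of \<open>y i\<close> lies in
    \<open>Q\<close>. Both inclusions between \<open>Q\<close> and \<open>LL i\<close>
    follow.\<close>
  have hc: "hom_component e f - pscale (peval (hom_component e f) (P i)) (y i ^ e) \<in> Q"
    if f: "f \<in> polys X" for e f
  proof -
    let ?S = "{u. u \<in> Poly_Mapping.keys f \<and> mdeg u = e}"
    have "(\<Sum>u\<in>?S. pscale (Poly_Mapping.lookup f u) (Poly_Mapping.single u 1 - pscale (monv u (P i)) (y i ^ mdeg u))) \<in> Q"
      using f by (intro coord_ideal_sum[OF id] sc mm) (auto simp: polys_def)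
    moreover have "(\<Sum>u\<in>?S. pscale (Poly_Mapping.lookup f u) (Poly_Mapping.single u 1 - pscale (monv u (P i)) (y i ^ mdeg u)))
       = hom_component e f - pscale (peval (hom_component e f) (P i)) (y i ^ e)"
      by (simp add: peval_hom_component pscale_simps sum_subtractf pscale_sum_left)
        (simp add: hom_component_def pscale_def mult_single)
    ultimately show ?thesis by simp
  qed
  have "LL i \<subseteq> Q"
  proof
    fix f assume f: "f \<in> LL i"
    then have fX: "f \<in> polys X" by (simp add: van_ideal_def)
    have "hom_component e f \<in> Q" for e
    proof -
      have "peval (hom_component e f) (P i) = 0"
        using f by (intro hom_component_vanish) (auto simp: van_ideal_def line_through_def)
      then show ?thesis using hc[OF fX, of e] by (simp add: pscale_simps)
    qed
    then show "f \<in> Q" by (subst sum_hom_components) (intro coord_ideal_sum[OF id])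
  qed
  moreover have "Q \<subseteq> LL i"
  proof
    fix f assume f: "f \<in> Q"
    then have fX: "f \<in> polys X" using coord_ideal_polys[OF id] by blast
    have "peval (hom_component e f) (P i) = 0" for e
    proof (rule ccontr)
      let ?c = "peval (hom_component e f) (P i)"
      assume c: "?c \<noteq> 0"
      have "pscale ?c (y i ^ e) \<in> Q"
        using coord_ideal_diff[OF id Qh[OF f, of e] hc[OF fX, of e]] by simp
      from sc[OF this, of "1 / ?c"] have "y i ^ e \<in> Q" using c by (simp add: pscale_simps)
      then show False using pw[OF y_polys] i(2) by blast
    qed
    then show "f \<in> LL i" using fX by (auto simp: van_ideal_def line_through_def peval_scale_hom)
  qed
  ultimately show ?thesis using i(1) by blast
qed

text \<open>The points \<open>LL i\<close> are pairwise incomparable, since \<open>y j\<close> lies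
  in \<open>LL i\<close> exactly for \<open>i \<noteq> j\<close>. So chains are singletons, and as
  \<open>h\<close> is positive there is one.\<close>

lemma scheme_dim_zero: "scheme_dim X II = 0"
  unfolding scheme_dim_def
proof (rule antisym)
  let ?C = "{C. C \<subseteq> proj_points X II \<and> finite C \<and> C \<noteq> {} \<and> chain\<^sub>\<subseteq> C}"
  show "(SUP C\<in>?C. ereal (real (card C) - 1)) \<le> 0"
  proof (rule SUP_least)
    fix C assume C: "C \<in> ?C"
    have "Q = Q'" if "Q \<in> C" "Q' \<in> C" for Q Q'
    proof -
      have eq: "i = j" if "LL i \<subseteq> LL j" "i < h" "j < h" for i j using y_LL that by blast
      obtain i j where "i < h" "Q = LL i" "j < h" "Q' = LL j" using C \<open>Q \<in> C\<close> \<open>Q' \<in> C\<close> point_is_LL by blast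
      moreover have "Q \<subseteq> Q' \<or> Q' \<subseteq> Q" using C that by (auto simp: chain_subset_def)
      ultimately show ?thesis using eq by blast
    qed
    then have "card C \<le> 1" using C by (auto simp: card_le_Suc0_iff_eq)
    then show "ereal (real (card C) - 1) \<le> 0" by (simp add: zero_ereal_def)
  qed
  have "ereal (real (card {LL 0}) - 1) \<le> (SUP C\<in>?C. ereal (real (card C) - 1))"
    using LL_point[OF h] by (intro SUP_upper) (auto simp: chain_subset_def)
  then show "0 \<le> (SUP C\<in>?C. ereal (real (card C) - 1))" by (simp add: zero_ereal_def)
qed

text \<open>This form has the value 1 at each \<open>P i\<close>: the hyperplane
  \<open>ll = 0\<close> misses all points, and the chart \<open>ll = 1\<close> contains the
  \<open>P i\<close> themselves.\<close>

definition "ll = (\<Sum>l<h. y l)"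

definition "JJ = Idl\<^bsub>coord_ring X\<^esub> (insert (ll - 1) II)"

lemma ll_polys: "ll \<in> polys X"
  unfolding ll_def by (intro polys_sum y_polys)

lemma ll_form: "ll \<in> forms X 1"
proof -
  have "ll = (\<Sum>x\<in>X. pscale (\<Sum>l<h. xi l x) (pvar x))"
    unfolding ll_def y_def by (subst sum.swap) (simp add: pscale_sum_left)
  then show ?thesis using linear_form[OF X] by simp
qed

lemma JJ_ideal: "ideal JJ (coord_ring X)" and JJ_sub: "insert (ll - 1) II \<subseteq> JJ"
proof -
  have *: "insert (ll - 1) II \<subseteq> carrier (coord_ring X)"
    using inter_ideal_polys[of X W Z] polys_diff[OF ll_polys polys_1] by simp
  show "ideal JJ (coord_ring X)" "insert (ll - 1) II \<subseteq> JJ"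
    unfolding JJ_def using ring.genideal_ideal[OF ring_coord_ring *] ring.genideal_self[OF ring_coord_ring *] by blast+
qed

lemma JJ_vanish: "f \<in> JJ \<Longrightarrow> i < h \<Longrightarrow> peval f (P i) = 0"
proof -
  let ?V = "{f \<in> polys X. \<forall>i<h. peval f (P i) = 0}"
  have "ideal ?V (coord_ring X)"
    unfolding coord_ideal_iff by (auto simp: peval_add peval_mult intro: polys_add polys_mult)
  moreover have "insert (ll - 1) II \<subseteq> ?V"
  proof (rule insert_subsetI)
    show "ll - 1 \<in> ?V" using polys_diff[OF ll_polys polys_1] by (simp add: peval_diff ll_def peval_sum y_eval_P)
    show "II \<subseteq> ?V"
    proof
      fix f assume f: "f \<in> II"
      have "peval f (P i) = 0" if "i < h" for i
        using scaled_P[OF that, of 1] by (intro inter_ideal_vanish[OF f]) auto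
      then show "f \<in> ?V" using subsetD[OF inter_ideal_polys f] by simp
    qed
  qed
  ultimately have "JJ \<subseteq> ?V" unfolding JJ_def by (rule ring.genideal_minimal[OF ring_coord_ring])
  then show "f \<in> JJ \<Longrightarrow> i < h \<Longrightarrow> ?thesis" by blast
qed

text \<open>Since \<open>l = 1\<close> modulo \<open>J\<close>, multiplying by \<open>l\<close> brings mixed monomials of lower degree into \<open>J\<close>.\<close>

lemma ym_JJ: "mixed \<mu> \<Longrightarrow> set_mset \<mu> \<subseteq> {..<h} \<Longrightarrow> size \<mu> + d = m \<Longrightarrow> ym \<mu> \<in> JJ"
proof (induction d arbitrary: \<mu>)
  case 0
  then show ?case using ym_II JJ_sub by (auto simp: msets_def)
next
  case (Suc d)
  have "ym (add_mset k \<mu>) \<in> JJ" if "k < h" for k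
    using Suc.prems that by (intro Suc.IH) (auto simp: mixed_def)
  then have "(\<Sum>k<h. ym (add_mset k \<mu>)) \<in> JJ" by (intro coord_ideal_sum[OF JJ_ideal]) auto
  moreover have "ym \<mu> * (ll - 1) \<in> JJ" using JJ_sub by (intro coord_ideal_mult[OF JJ_ideal] ym_polys) auto
  moreover have "(\<Sum>k<h. ym (add_mset k \<mu>)) = ym \<mu> * ll" by (simp add: ym_def ll_def sum_distrib_right mult.commute[of _ "sum y {..<h}"])
  ultimately have "ym \<mu> * ll - ym \<mu> * (ll - 1) \<in> JJ" using coord_ideal_diff[OF JJ_ideal] by metis
  then show ?case by (simp add: algebra_simps)
qed

lemma y_mult_JJ: "i < h \<Longrightarrow> j < h \<Longrightarrow> i \<noteq> j \<Longrightarrow> y i * y j \<in> JJ"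
proof -
  assume ij: "i < h" "j < h" "i \<noteq> j"
  have "mixed {#i, j#}" unfolding mixed_def by (intro exI[of _ i] exI[of _ j]) (use ij in auto)
  then show ?thesis using ym_JJ[of "{#i, j#}" "m - 2"] m ij by (simp add: ym_def)
qed

lemma y_square_JJ: "i < h \<Longrightarrow> y i * y i - y i \<in> JJ"
proof -
  assume i: "i < h"
  have "(\<Sum>j\<in>{..<h} - {i}. y i * y j) \<in> JJ" using i by (intro coord_ideal_sum[OF JJ_ideal] y_mult_JJ) auto
  moreover have "y i * (ll - 1) \<in> JJ" using JJ_sub by (intro coord_ideal_mult[OF JJ_ideal] y_polys) auto
  moreover have "ll = y i + (\<Sum>j\<in>{..<h} - {i}. y j)" unfolding ll_def using i by (simp add: sum.remove)
  ultimately have "y i * (ll - 1) - (\<Sum>j\<in>{..<h} - {i}. y i * y j) \<in> JJ" using coord_ideal_diff[OF JJ_ideal] by metis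
  moreover have "y i * (ll - 1) - (\<Sum>j\<in>{..<h} - {i}. y i * y j) = y i * y i - y i"
    using \<open>ll = _\<close> by (simp add: algebra_simps sum_distrib_left)
  ultimately show ?thesis by simp
qed

text \<open>Modulo \<open>JJ\<close> the forms \<open>y l\<close> are orthogonal idempotents with
  sum 1, so every polynomial is congruent to its Lagrange interpolation at the points
  \<open>P l\<close>. Constants need the sum, variables \<open>pvar_II\<close>, and products the
  orthogonality.\<close>

lemma JJ_span:
  assumes "f \<in> polys X"
  shows "f \<in> polys X \<and> f - (\<Sum>l<h. pscale (peval f (P l)) (y l)) \<in> JJ"
  using assms
proof (induction f rule: polys_induct)
  case (const c)
  have "pscale c (ll - 1) \<in> JJ" unfolding pscale_def
    using JJ_sub by (intro coord_ideal_mult[OF JJ_ideal]) auto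
  then have "- pscale c (ll - 1) \<in> JJ" by (rule coord_ideal_uminus[OF JJ_ideal])
  then show ?case by (simp add: pscale_simps pscale_sum ll_def) (simp add: pscale_def)
next
  case (var x)
  then show ?case using pvar_II JJ_sub by (auto intro: polys_pvar)
next
  case (add f g)
  then show ?case using coord_ideal_add[OF JJ_ideal, of "f - (\<Sum>l<h. pscale (peval f (P l)) (y l))" "g - (\<Sum>l<h. pscale (peval g (P l)) (y l))"]
    by (auto intro: polys_add simp: peval_add pscale_simps sum.distrib algebra_simps)
next
  case (mult f g)
  let ?e = "\<lambda>f. \<Sum>l<h. pscale (peval f (P l)) (y l)"
  have e: "?e f \<in> polys X" for f by (intro polys_sum polys_pscale y_polys)
  have sc: "pscale c f \<in> JJ" if "f \<in> JJ" for c f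
    unfolding pscale_def by (rule coord_ideal_mult[OF JJ_ideal that polys_const])
  have "(\<Sum>l<h. pscale (peval f (P l) * peval g (P l)) (y l * y l - y l)
        + (\<Sum>k\<in>{..<h} - {l}. pscale (peval f (P l) * peval g (P k)) (y l * y k))) \<in> JJ"
    by (intro coord_ideal_sum[OF JJ_ideal] coord_ideal_add[OF JJ_ideal] sc y_square_JJ y_mult_JJ) auto
  also have "(\<Sum>l<h. pscale (peval f (P l) * peval g (P l)) (y l * y l - y l)
        + (\<Sum>k\<in>{..<h} - {l}. pscale (peval f (P l) * peval g (P k)) (y l * y k)))
      = (\<Sum>l<h. (\<Sum>k<h. pscale (peval f (P l) * peval g (P k)) (y l * y k)) - pscale (peval f (P l) * peval g (P l)) (y l))"
    by (intro sum.cong) (auto simp: sum.remove[of "{..<h}"] pscale_simps)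
  also have "\<dots> = ?e f * ?e g - ?e (f * g)"
    by (simp add: sum_product pscale_simps peval_mult sum_subtractf)
  finally have 1: "?e f * ?e g - ?e (f * g) \<in> JJ" .
  have "f * (g - ?e g) + (f - ?e f) * ?e g + (?e f * ?e g - ?e (f * g)) \<in> JJ"
    using mult 1 e by (intro coord_ideal_add[OF JJ_ideal]) (auto intro: coord_ideal_mult[OF JJ_ideal] coord_ideal_mult'[OF JJ_ideal])
  then have "f * g - ?e (f * g) \<in> JJ" by (simp add: algebra_simps)
  then show ?case using mult polys_mult by blast
qed

lemma y_inj: "inj_on y {..<h}"
proof (rule inj_onI)
  fix i j assume "i \<in> {..<h}" "j \<in> {..<h}" "y i = y j"
  then have "peval (y j) (P i) = 1" using y_eval_P[of i i] by simp
  then show "i = j" using \<open>i \<in> _\<close> \<open>j \<in> _\<close> y_eval_P[of j i] by (cases "i = j") auto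
qed

text \<open>The \<open>y l\<close> form a basis of the quotient: they span it by
  \<open>JJ_span\<close>, and evaluation at the points, where all of \<open>JJ\<close> vanishes,
  shows their independence.\<close>

lemma scheme_length_frame: "scheme_length X II h"
  unfolding scheme_length_def
proof (rule bexI[OF _ ll_form], intro conjI ballI)
  fix Q assume "Q \<in> proj_points X II"
  then obtain i where i: "i < h" "Q = LL i" using point_is_LL by blast
  have "peval ll (P i) = 1" using i by (simp add: ll_def peval_sum y_eval_P)
  moreover have "P i \<in> line_through (P i)" unfolding line_through_def by (rule range_eqI[of _ _ 1]) simp
  ultimately show "ll \<notin> Q" unfolding i(2) van_ideal_def by force
next
  have s: "(\<Sum>b\<in>y ` {..<h}. pscale (c b) b) = (\<Sum>l<h. pscale (c (y l)) (y l))" for c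
    by (rule sum.reindex_cong[OF y_inj]) auto
  show "quot_dim (polys X) (Idl\<^bsub>coord_ring X\<^esub> (insert (ll - 1) II)) h"
    unfolding quot_dim_def JJ_def[symmetric]
  proof (intro exI[of _ "y ` {..<h}"] conjI ballI allI impI)
    show "card (y ` {..<h}) = h" using y_inj by (simp add: card_image)
    show "y ` {..<h} \<subseteq> polys X" using y_polys by blast
  next
    fix f :: "('x, 'k) mpoly" assume f: "f \<in> polys X"
    have "(\<Sum>l<h. pscale (peval f (P (inv_into {..<h} y (y l)))) (y l)) = (\<Sum>l<h. pscale (peval f (P l)) (y l))"
      by (intro sum.cong) (auto simp: inv_into_f_f[OF y_inj])
    then show "\<exists>c. f - (\<Sum>b\<in>y ` {..<h}. pscale (c b) b) \<in> JJ"
      using JJ_span[OF f] by (intro exI[of _ "\<lambda>b. peval f (P (inv_into {..<h} y b))"]) (simp add: s)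
  next
    fix c b assume c: "(\<Sum>b\<in>y ` {..<h}. pscale (c b) b) \<in> JJ" and "b \<in> y ` {..<h}"
    then obtain i where i: "i < h" "b = y i" by blast
    have "(\<Sum>l<h. c (y l) * peval (y l) (P i)) = (\<Sum>l<h. if l = i then c (y l) else 0)"
      using i by (intro sum.cong) (auto simp: y_eval_P)
    then show "c b = 0" using JJ_vanish[OF c i(1)] i by (simp add: s peval_sum peval_pscale)
  qed simp
qed

end

text \<open>The case of equality in Steinitz exchange: a redundant \<open>u i\<close> would let
  fewer vectors span \<open>B\<close>, and a \<open>u i\<close> outside \<open>fvs.span B\<close>
  would enlarge \<open>B\<close> to an independent set that is too large.\<close>

lemma independent_exchange:
  fixes u :: "'i \<Rightarrow> 'x \<Rightarrow> 'k::field"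
  assumes B: "\<not> fvs.dependent B" "B \<subseteq> fvs.span (u ` S)" and S: "finite S" "card S \<le> card B"
  shows "findep u S \<and> u ` S \<subseteq> fvs.span B"
proof -
  have fin: "finite (u ` S)" using S by simp
  have le: "finite B" "card B \<le> card C" if "finite C" "B \<subseteq> fvs.span C" for C
    using fvs.independent_span_bound[OF that(1) B(1) that(2)] by auto
  have c: "card (u ` S) = card S"
    using le(2)[OF fin B(2)] S card_image_le[OF S(1), of u] by simp
  then have inj: "inj_on u S" using S(1) eq_card_imp_inj_on by blast
  have "\<not> fvs.dependent (u ` S)"
  proof
    assume "fvs.dependent (u ` S)"
    then obtain a where a: "a \<in> u ` S" "a \<in> fvs.span (u ` S - {a})" unfolding fvs.dependent_def by blast
    have "fvs.span (u ` S - {a}) = fvs.span (insert a (u ` S - {a}))"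
      using a(2) by (rule fvs.span_redundant[symmetric])
    then have "B \<subseteq> fvs.span (u ` S - {a})" using B(2) a(1) by (simp add: insert_absorb)
    from le(2)[OF _ this] fin have "card B \<le> card (u ` S - {a})" by simp
    also have "\<dots> < card (u ` S)" using fin a(1) by (rule card_Diff1_less)
    finally show False using c S(2) by simp
  qed
  moreover have "u ` S \<subseteq> fvs.span B"
  proof (rule ccontr)
    assume "\<not> ?thesis"
    then obtain v where v: "v \<in> u ` S" "v \<notin> fvs.span B" by blast
    then have vB: "v \<notin> B" using fvs.span_base by blast
    have "\<not> fvs.dependent (insert v B)" using B(1) v(2) by (rule fvs.independent_insertI[rotated])
    moreover have "insert v B \<subseteq> fvs.span (u ` S)" using v(1) B(2) fvs.span_base by blast
    ultimately have "card (insert v B) \<le> card (u ` S)"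
      using fvs.independent_span_bound[OF fin] by blast
    then show False using vB le(1)[OF fin B(2)] c S(2) by simp
  qed
  ultimately show ?thesis using findep_iff[OF S(1)] inj by blast
qed

lemma findep_exchange:
  assumes "findep r S'" "finite S'" "r ` S' \<subseteq> fvs.span (u ` S)" "finite S" "card S \<le> card S'"
  shows "findep u S \<and> u ` S \<subseteq> fvs.span (r ` S')"
  using assms findep_iff[OF assms(2), of r] by (intro independent_exchange) (auto simp: card_image)

lemma span_dim_exchange:
  assumes "fvs.subspace V" "V \<subseteq> fvs.span (u ` S)" "finite S" "card S \<le> fvs.dim V"
  shows "findep u S \<and> V = fvs.span (u ` S)"
proof -
  obtain B where B: "B \<subseteq> V" "\<not> fvs.dependent B" "V \<subseteq> fvs.span B" "card B = fvs.dim V"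
    using fvs.basis_exists by blast
  have *: "findep u S \<and> u ` S \<subseteq> fvs.span B"
    using B assms by (intro independent_exchange) auto
  have "fvs.span B \<subseteq> V" using B(1) assms(1) by (rule fvs.span_minimal)
  then have "fvs.span (u ` S) \<subseteq> V" using * assms(1) by (intro fvs.span_minimal) auto
  then show ?thesis using * assms(2) by blast
qed

text \<open>Finitely many arguments detect the independence of functions on an infinite set, which
  brings forms into the reach of \<open>findep_open\<close>. In the induction, the relation on
  \<open>E\<close> that involves \<open>s\<close> is unique up to a factor, and one further argument
  \<open>x0\<close> destroys it.\<close>

lemma findep_finite_support:
  fixes u :: "'i \<Rightarrow> 'x \<Rightarrow> 'k::field"
  assumes "finite S" "findep u S"
  shows "\<exists>E. finite E \<and> findep (\<lambda>i x. if x \<in> E then u i x else 0) S"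
  using assms
proof (induction S rule: finite_induct)
  case empty
  show ?case by (intro exI[of _ "{}"]) (simp add: findep_def)
next
  case (insert s S)
  have "findep u S" using findep_subset[OF insert.prems] insert.hyps by auto
  then obtain E where E: "finite E" "findep (\<lambda>i x. if x \<in> E then u i x else 0) S" using insert.IH by blast
  define v where "v = (\<lambda>E i x. if x \<in> E then u i x else 0)"
  have vE: "findep (v E) S" using E(2) by (simp add: v_def)
  show ?case
  proof (cases "findep (v E) (insert s S)")
    case True
    then show ?thesis using E(1) unfolding v_def by blast
  next
    case False
    then obtain c i where c: "\<And>x. (\<Sum>i\<in>insert s S. c i * v E i x) = 0" "i \<in> insert s S" "c i \<noteq> 0"
      unfolding findep_def by blast
    obtain x0 where x0: "(\<Sum>i\<in>insert s S. c i * u i x0) \<noteq> 0"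
      using findepD[OF insert.prems] c(2,3) by blast
    have cs: "c s \<noteq> 0"
    proof
      assume "c s = 0"
      then have "c j = 0" if "j \<in> S" for j using findepD[OF vE _ that, of c] c(1) insert.hyps by simp
      then show False using \<open>c s = 0\<close> c(2,3) by auto
    qed
    have "findep (v (insert x0 E)) (insert s S)"
    proof (rule findepI)
      fix b j assume b: "\<And>x. (\<Sum>i\<in>insert s S. b i * v (insert x0 E) i x) = 0" and j: "j \<in> insert s S"
      have bE: "(\<Sum>i\<in>insert s S. b i * v E i x) = 0" for x
        using b[of x] by (cases "x \<in> E") (auto simp: v_def)
      define e where "e = (\<lambda>i. c s * b i - b s * c i)"
      have "(\<Sum>i\<in>insert s S. e i * v E i x) = 0" for x
      proof -
        have "(\<Sum>i\<in>insert s S. e i * v E i x)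
          = c s * (\<Sum>i\<in>insert s S. b i * v E i x) - b s * (\<Sum>i\<in>insert s S. c i * v E i x)"
          by (simp only: e_def sum_distrib_left sum_subtractf[symmetric]) (simp add: algebra_simps)
        then show ?thesis using bE c(1) by (simp only: mult_zero_right diff_self)
      qed
      moreover have "e s = 0" by (simp add: e_def)
      ultimately have "e i = 0" if "i \<in> S" for i using findepD[OF vE _ that, of e] insert.hyps by simp
      then have ei: "c s * b i = b s * c i" if "i \<in> insert s S" for i
        using that \<open>e s = 0\<close> by (auto simp: e_def)
      have "b s * (\<Sum>i\<in>insert s S. c i * u i x0) = c s * (\<Sum>i\<in>insert s S. b i * u i x0)"
        unfolding sum_distrib_left using ei by (intro sum.cong) (auto simp: mult.assoc[symmetric])
      also have "(\<Sum>i\<in>insert s S. b i * u i x0) = 0" using b[of x0] by (simp add: v_def)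
      finally have "b s = 0" using x0 by simp
      then show "b j = 0" using ei[OF j] cs by simp
    qed
    then show ?thesis using E(1) unfolding v_def by blast
  qed
qed

lemma mmono_findep:
  fixes S :: "nat multiset set"
  assumes "finite S"
  shows "findep (mmono :: nat multiset \<Rightarrow> (nat \<Rightarrow> 'k::field_char_0) \<Rightarrow> 'k) S"
proof (rule findepI)
  fix c :: "nat multiset \<Rightarrow> 'k" and \<mu>
  assume c: "\<And>z. (\<Sum>\<nu>\<in>S. c \<nu> * mmono \<nu> z) = 0" and \<mu>: "\<mu> \<in> S"
  show "c \<mu> = 0"
  proof (rule characters_independent[OF assms, where G = UNIV and e = "\<lambda>_. 1" and m = "\<lambda>y z l. y l * z l" and ch = mmono])
    show "mmono \<nu> (\<lambda>l. y l * z l) = mmono \<nu> y * mmono \<nu> z" for \<nu> and y z :: "nat \<Rightarrow> 'k"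
      by (induction \<nu>) (auto simp: mult_ac)
    show "mmono \<nu> (\<lambda>_. 1) = (1::'k)" for \<nu> :: "nat multiset" by (simp add: mmono_def)
    show "(\<Sum>\<nu>\<in>S. c \<nu> * mmono \<nu> z) = 0" for z by (rule c)
    fix \<nu> \<nu>' :: "nat multiset" assume "\<nu> \<noteq> \<nu>'"
    then obtain i where i: "count \<nu> i \<noteq> count \<nu>' i" by (meson multiset_eqI)
    define e where "e = (\<lambda>l. if l = i then 2 else 1 :: 'k)"
    have e: "mmono \<nu> e = 2 ^ count \<nu> i" for \<nu> by (induction \<nu>) (auto simp: e_def)
    have "mmono \<nu> e \<noteq> mmono \<nu>' e"
    proof
      assume "mmono \<nu> e = mmono \<nu>' e"
      then have "of_nat (2 ^ count \<nu> i) = (of_nat (2 ^ count \<nu>' i) :: 'k)" by (simp add: e)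
      then have "(2::nat) ^ count \<nu> i = 2 ^ count \<nu>' i" by (simp only: of_nat_eq_iff)
      then show False using i by simp
    qed
    then show "\<exists>z\<in>UNIV. mmono \<nu> z \<noteq> (mmono \<nu>' z :: 'k)" by blast
  qed (use \<mu> in auto)
qed

section \<open>Forms of a given degree as functions\<close>

definition hforms :: "nat \<Rightarrow> nat \<Rightarrow> ((nat \<Rightarrow> 'k::field) \<Rightarrow> 'k) set" where
  "hforms h m = fvs.span (mmono ` msets h m)"

lemma hforms_subspace: "fvs.subspace (hforms h m)"
  unfolding hforms_def by (rule fvs.subspace_span)

lemma hforms_mult:
  assumes "f \<in> hforms h a" "g \<in> hforms h b"
  shows "(\<lambda>z. f z * g z) \<in> hforms h (a + b)"
  using assms(1) unfolding hforms_def
proof (induction f rule: fvs_span_induct)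
  case zero
  then show ?case using subspace_zeroI[OF hforms_subspace] by (simp add: hforms_def)
next
  case (base f)
  then obtain \<mu> where \<mu>: "\<mu> \<in> msets h a" "f = mmono \<mu>" by blast
  show ?case using assms(2) unfolding hforms_def
  proof (induction g rule: fvs_span_induct)
    case zero
    then show ?case using subspace_zeroI[OF hforms_subspace] by (simp add: hforms_def)
  next
    case (base g)
    then obtain \<nu> where "\<nu> \<in> msets h b" "g = mmono \<nu>" by blast
    then have "\<mu> + \<nu> \<in> msets h (a + b)" "(\<lambda>z. f z * g z) = mmono (\<mu> + \<nu>)"
      using \<mu> by (auto simp: msets_def mmono_plus fun_eq_iff)
    then show ?case by (simp add: fvs.span_base del: mmono_plus)
  next
    case (add g g')
    then show ?case using subspace_addI[OF fvs.subspace_span] by (fastforce simp: distrib_left)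
  next
    case (scale c g)
    then show ?case using subspace_scaleI[OF fvs.subspace_span, of _ _ c] by (fastforce simp: mult.left_commute)
  qed
next
  case (add g g')
  then show ?case using subspace_addI[OF fvs.subspace_span] by (fastforce simp: distrib_right)
next
  case (scale c g)
  then show ?case using subspace_scaleI[OF fvs.subspace_span, of _ _ c] by (fastforce simp: mult.assoc)
qed

lemma hforms_linear: "(\<lambda>z. \<Sum>l<h. z l * (c l :: 'k::field)) \<in> hforms h 1"
proof -
  have "(mmono {#l#} :: (nat \<Rightarrow> 'k) \<Rightarrow> 'k) \<in> hforms h 1" if "l < h" for l
    unfolding hforms_def using that by (intro fvs.span_base imageI) (simp add: msets_def)
  then have "(\<lambda>z. \<Sum>l\<in>{..<h}. c l * mmono {#l#} z) \<in> hforms h 1"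
    by (intro subspace_sumI[OF hforms_subspace] subspace_scaleI[OF hforms_subspace]) (simp only: lessThan_iff)
  then show ?thesis by (simp add: mult.commute)
qed

lemma hforms_prod_mset:
  fixes f :: "'j \<Rightarrow> (nat \<Rightarrow> 'k::field) \<Rightarrow> 'k"
  assumes "\<And>j. j \<in># \<nu> \<Longrightarrow> f j \<in> hforms h 1"
  shows "(\<lambda>z. \<Prod>j\<in>#\<nu>. f j z) \<in> hforms h (size \<nu>)"
  using assms
proof (induction \<nu>)
  case empty
  have "(mmono {#} :: (nat \<Rightarrow> 'k) \<Rightarrow> 'k) \<in> hforms h 0" unfolding hforms_def by (intro fvs.span_base imageI) (simp add: msets_def)
  moreover have "(mmono {#} :: (nat \<Rightarrow> 'k) \<Rightarrow> 'k) = (\<lambda>z. \<Prod>j\<in>#{#}. f j z)" by (simp add: fun_eq_iff)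
  ultimately show ?case by simp
next
  case (add j \<nu>)
  then have "(\<lambda>z. f j z * (\<Prod>j\<in>#\<nu>. f j z)) \<in> hforms h (1 + size \<nu>)" by (intro hforms_mult) auto
  then show ?case by simp
qed

definition mixed_msets :: "nat \<Rightarrow> nat \<Rightarrow> nat multiset set" where
  "mixed_msets h m = {\<mu> \<in> msets h m. mixed \<mu>}"

lemma finite_mixed_msets: "finite (mixed_msets h m)"
  unfolding mixed_msets_def using finite_msets by simp

text \<open>The coefficient of a pure power is the value of the form at the corresponding coordinate
  point.\<close>

lemma hforms_vanishing:
  fixes f :: "(nat \<Rightarrow> 'k::field) \<Rightarrow> 'k"
  assumes f: "f \<in> hforms h m" and m: "0 < m" and van: "\<And>i. i < h \<Longrightarrow> f (\<lambda>l. if l = i then 1 else 0) = 0"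
  shows "f \<in> fvs.span (mmono ` mixed_msets h m)"
proof -
  obtain c where c: "\<And>z. f z = (\<Sum>\<mu>\<in>msets h m. c \<mu> * mmono \<mu> z)"
    using f unfolding hforms_def fvs_span_family[OF finite_msets] by blast
  have "c \<mu> = 0" if \<mu>: "\<mu> \<in> msets h m" "\<not> mixed \<mu>" for \<mu>
  proof -
    have "\<mu> \<noteq> {#}" using \<mu>(1) m by (auto simp: msets_def)
    then obtain i where i: "i \<in># \<mu>" by blast
    then have "j = i" if "j \<in># \<mu>" for j using \<mu>(2) that unfolding mixed_def by blast
    then have "\<mu> = replicate_mset (size \<mu>) i" by (rule eq_replicate_mset)
    moreover have "size \<mu> = m" using \<mu>(1) by (simp add: msets_def)
    ultimately have rep: "\<mu> = replicate_mset m i" by simp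
    let ?e = "\<lambda>l. if l = i then 1 else 0 :: 'k"
    have ih: "i < h" using i \<mu> by (auto simp: msets_def)
    have "mmono \<nu> ?e = (if \<nu> = \<mu> then 1 else 0)" if \<nu>: "\<nu> \<in> msets h m" for \<nu>
    proof (cases "\<nu> = \<mu>")
      case True
      then show ?thesis by (simp add: rep mmono_replicate)
    next
      case False
      then obtain j where "j \<in># \<nu>" "j \<noteq> i" using \<nu> rep eq_replicate_mset[of \<nu> i] unfolding msets_def by blast
      then have "0 \<in># image_mset ?e \<nu>" by auto
      then show ?thesis using False by (simp add: mmono_def prod_mset_zero_iff)
    qed
    then have "f ?e = (\<Sum>\<nu>\<in>msets h m. if \<nu> = \<mu> then c \<nu> else 0)"
      unfolding c by (intro sum.cong) auto
    then show ?thesis using van[OF ih] \<mu>(1) finite_msets by simp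
  qed
  then have "f z = (\<Sum>\<mu>\<in>mixed_msets h m. c \<mu> * mmono \<mu> z)" for z
    unfolding c mixed_msets_def by (intro sum.mono_neutral_right finite_msets) auto
  then show ?thesis unfolding fvs_span_family[OF finite_mixed_msets] by blast
qed

subsection \<open>The identifiability criterion\<close>

text \<open>
  The common setting of both cases: the rows of the flattening of \<open>T\<close> are indexed by \<open>A\<close> and have
  entries \<open>\<kappa> I x * T (\<sigma> I x)\<close>, and those of the rank one tensor \<open>pd v\<close> are multiples of \<open>pb v\<close>.
\<close>

locale rank_one_family =
  fixes A :: "'a set" and X :: "'x set" and Y :: "'y set"
    and \<sigma> :: "'a \<Rightarrow> 'x \<Rightarrow> 'y" and \<kappa> :: "'a \<Rightarrow> 'x \<Rightarrow> 'k::field_char_0"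
    and pa :: "'v \<Rightarrow> 'a \<Rightarrow> 'k" and pb :: "'v \<Rightarrow> 'x \<Rightarrow> 'k" and pd :: "'v \<Rightarrow> 'y \<Rightarrow> 'k"
    and R :: "('y \<Rightarrow> 'k) set" and Z :: "('x \<Rightarrow> 'k) set"
    and path :: "'v \<Rightarrow> 'v \<Rightarrow> 'k \<Rightarrow> 'v" and Qs :: "'q set" and Q :: "'q \<Rightarrow> ('x \<Rightarrow> 'k) \<Rightarrow> 'k"
    and \<gamma> :: "'q \<Rightarrow> 'x \<Rightarrow> 'x \<Rightarrow> 'k"
  assumes fin: "finite A" "finite X" "finite Y" "finite Qs"
    and sigma: "\<And>I x. I \<in> A \<Longrightarrow> x \<in> X \<Longrightarrow> \<sigma> I x \<in> Y"
    and sigma_onto: "\<And>y. y \<in> Y \<Longrightarrow> \<exists>I\<in>A. \<exists>x\<in>X. \<sigma> I x = y"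
    and kappa: "\<And>I x. I \<in> A \<Longrightarrow> x \<in> X \<Longrightarrow> \<kappa> I x \<noteq> 0"
    and spaces: "\<And>v. pa v \<in> coord_space A" "\<And>v. pb v \<in> coord_space X" "\<And>v. pd v \<in> coord_space Y"
    and pd_split: "\<And>I x v. I \<in> A \<Longrightarrow> x \<in> X \<Longrightarrow> \<kappa> I x * pd v (\<sigma> I x) = pa v I * pb v x"
    and R_pd: "\<And>v. pd v \<noteq> (\<lambda>_. 0) \<Longrightarrow> pd v \<in> R"
    and R_scaled: "\<And>U. U \<in> R \<Longrightarrow> \<exists>c v. c \<noteq> 0 \<and> pd v \<noteq> (\<lambda>_. 0) \<and> U = (\<lambda>y. c * pd v y)"
    and Z: "Z = {(\<lambda>x. c * pb v x) | c v. pd v \<noteq> (\<lambda>_. 0)}"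
    and path: "\<And>u v y. polyfun (\<lambda>t. pd (path u v t) y)" "\<And>u v. path u v 0 = u" "\<And>u v. path u v 1 = v"
    and Q: "\<And>q y. q \<in> Qs \<Longrightarrow> Q q y = (\<Sum>x\<in>X. \<Sum>x'\<in>X. \<gamma> q x x' * (y x * y x'))"
    and Q_pb: "\<And>q v. q \<in> Qs \<Longrightarrow> Q q (pb v) = 0"
begin

definition Row :: "('y \<Rightarrow> 'k) \<Rightarrow> 'a \<Rightarrow> 'x \<Rightarrow> 'k" where
  "Row T I = (\<lambda>x. if x \<in> X then \<kappa> I x * T (\<sigma> I x) else 0)"

definition WT :: "('y \<Rightarrow> 'k) \<Rightarrow> ('x \<Rightarrow> 'k) set" where
  "WT T = fvs.span (Row T ` A)"

definition criterion :: "nat \<Rightarrow> ('y \<Rightarrow> 'k) \<Rightarrow> bool" where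
  "criterion h T \<longleftrightarrow> lin_pdim (WT T) = int h - 1 \<and> scheme_dim X (inter_ideal X (WT T) Z) = 0 \<and>
     scheme_length X (inter_ideal X (WT T) Z) h"

lemma Row_comb: "I \<in> A \<Longrightarrow> Row (\<lambda>y. \<Sum>l\<in>S. c l * pd (u l) y) I = (\<lambda>x. \<Sum>l\<in>S. (c l * pa (u l) I) * pb (u l) x)"
proof
  fix x assume I: "I \<in> A"
  show "Row (\<lambda>y. \<Sum>l\<in>S. c l * pd (u l) y) I x = (\<Sum>l\<in>S. (c l * pa (u l) I) * pb (u l) x)"
  proof (cases "x \<in> X")
    case True
    have "\<kappa> I x * (\<Sum>l\<in>S. c l * pd (u l) (\<sigma> I x)) = (\<Sum>l\<in>S. c l * (\<kappa> I x * pd (u l) (\<sigma> I x)))"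
      by (simp add: sum_distrib_left mult_ac)
    also have "\<dots> = (\<Sum>l\<in>S. c l * (pa (u l) I * pb (u l) x))" using pd_split[OF I True] by simp
    finally show ?thesis using True by (simp add: Row_def mult.assoc)
  next
    case False
    then show ?thesis using spaces(2) by (simp add: Row_def coord_space_def)
  qed
qed

lemma Row_inj:
  assumes "T \<in> coord_space Y" "T' \<in> coord_space Y" "\<And>I. I \<in> A \<Longrightarrow> Row T I = Row T' I"
  shows "T = T'"
proof
  fix y
  show "T y = T' y"
  proof (cases "y \<in> Y")
    case True
    then obtain I x where I: "I \<in> A" "x \<in> X" "\<sigma> I x = y" using sigma_onto by blast
    have "Row T I x = Row T' I x" using assms(3)[OF I(1)] by simp
    then show ?thesis using I kappa[OF I(1,2)] by (simp add: Row_def)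
  next
    case False
    then show ?thesis using assms by (simp add: coord_space_def)
  qed
qed

lemma pd_nonzero:
  assumes "pd v \<noteq> (\<lambda>_. 0)"
  shows "pa v \<noteq> (\<lambda>_. 0)" "pb v \<noteq> (\<lambda>_. 0)"
proof -
  obtain y where y: "pd v y \<noteq> 0" using assms by auto
  then have "y \<in> Y" using spaces(3)[of v] by (auto simp: coord_space_def)
  then obtain I x where I: "I \<in> A" "x \<in> X" "\<sigma> I x = y" using sigma_onto by blast
  have "pa v I * pb v x \<noteq> 0" using pd_split[OF I(1,2), of v] y I kappa[OF I(1,2)] by (metis mult_eq_0_iff)
  then show "pa v \<noteq> (\<lambda>_. 0)" "pb v \<noteq> (\<lambda>_. 0)" by auto
qed

lemma WT_sub:
  fixes h :: nat
  assumes T: "T = (\<lambda>y. \<Sum>l<h. c l * pd (u l) y)"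
  shows "WT T \<subseteq> fvs.span ((\<lambda>l. pb (u l)) ` {..<h})"
  unfolding WT_def
proof (rule fvs.span_minimal[OF _ fvs.subspace_span], rule image_subsetI)
  fix I assume "I \<in> A"
  note rc = Row_comb[OF this]
  show "Row T I \<in> fvs.span ((\<lambda>l. pb (u l)) ` {..<h})"
    unfolding T fvs_span_family[OF finite_lessThan] by (intro CollectI exI[of _ "\<lambda>l. c l * pa (u l) I"]) (simp add: rc)
qed

lemma decomp_points:
  assumes "rank1_decomp R h T lam U"
  obtains e u where "\<And>l. l < h \<Longrightarrow> lam l \<noteq> 0 \<and> e l \<noteq> 0 \<and> pd (u l) \<noteq> (\<lambda>_. 0) \<and> U l = (\<lambda>y. e l * pd (u l) y)"
    "T = (\<lambda>y. \<Sum>l<h. (lam l * e l) * pd (u l) y)"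
proof -
  have U: "\<forall>l\<in>{..<h}. lam l \<noteq> 0 \<and> U l \<in> R" and T: "T = (\<Sum>l<h. fscale (lam l) (U l))"
    using assms by (auto simp: rank1_decomp_def)
  have "\<forall>l\<in>{..<h}. \<exists>c v. c \<noteq> 0 \<and> pd v \<noteq> (\<lambda>_. 0) \<and> U l = (\<lambda>y. c * pd v y)" using U R_scaled by blast
  from bchoice[OF this] obtain e where "\<forall>l\<in>{..<h}. \<exists>v. e l \<noteq> 0 \<and> pd v \<noteq> (\<lambda>_. 0) \<and> U l = (\<lambda>y. e l * pd v y)" by blast
  from bchoice[OF this] obtain u where u: "\<forall>l\<in>{..<h}. e l \<noteq> 0 \<and> pd (u l) \<noteq> (\<lambda>_. 0) \<and> U l = (\<lambda>y. e l * pd (u l) y)" by blast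
  show thesis
  proof (rule that)
    show "lam l \<noteq> 0 \<and> e l \<noteq> 0 \<and> pd (u l) \<noteq> (\<lambda>_. 0) \<and> U l = (\<lambda>y. e l * pd (u l) y)" if "l < h" for l
      using u U that by blast
    show "T = (\<lambda>y. \<Sum>l<h. (lam l * e l) * pd (u l) y)"
      unfolding T using u by (auto simp: fun_eq_iff sum_fun_apply fscale_def mult.assoc intro!: sum.cong)
  qed
qed

text \<open>All rows lie in the span of the \<open>h\<close> vectors \<open>pb (u l)\<close>, so a
  row space of dimension \<open>h\<close> leaves no room for a relation between them or for a
  smaller space.\<close>

lemma WT_decomp:
  assumes "fvs.dim (WT T) = h" "T = (\<lambda>y. \<Sum>l<h. c l * pd (u l) y)"
  shows "findep (\<lambda>l. pb (u l)) {..<h}" "WT T = fvs.span ((\<lambda>l. pb (u l)) ` {..<h})"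
proof -
  have "findep (\<lambda>l. pb (u l)) {..<h} \<and> WT T = fvs.span ((\<lambda>l. pb (u l)) ` {..<h})"
  proof (rule span_dim_exchange)
    show "fvs.subspace (WT T)" unfolding WT_def by (rule fvs.subspace_span)
    show "WT T \<subseteq> fvs.span ((\<lambda>l. pb (u l)) ` {..<h})" by (rule WT_sub[OF assms(2)])
  qed (use assms(1) in auto)
  then show "findep (\<lambda>l. pb (u l)) {..<h}" "WT T = fvs.span ((\<lambda>l. pb (u l)) ` {..<h})" by auto
qed

lemma findep_nonproportional:
  fixes u :: "nat \<Rightarrow> 'x \<Rightarrow> 'k"
  assumes "findep u {..<h}" "i < h" "j < h" "i \<noteq> j" "\<And>x. u i x = c * u j x"
  shows False
proof -
  let ?b = "\<lambda>l. if l = i then 1 else if l = j then - c else 0"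
  have "(\<Sum>l<h. ?b l * u l x) = (\<Sum>l\<in>{i, j}. ?b l * u l x)" for x
    using assms by (intro sum.mono_neutral_right) auto
  then have "(\<Sum>l<h. ?b l * u l x) = 0" for x using assms(4,5) by simp
  from findepD[OF assms(1) this, of i] assms(2) show False by simp
qed

text \<open>Otherwise \<open>pb w\<close>, which receives the index \<open>h\<close>, would be a
  further point, and a scheme of length \<open>h\<close> would contain \<open>h + 1\<close> distinct
  points.\<close>

lemma points_proportional:
  assumes len: "scheme_length X (inter_ideal X (WT T) Z) h"
    and u: "findep (\<lambda>l. pb (u l)) {..<h}" "\<And>l. l < h \<Longrightarrow> pb (u l) \<in> WT T \<inter> Z"
    and w: "pb w \<in> WT T \<inter> Z" "pb w \<noteq> (\<lambda>_. 0)"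
  shows "\<exists>i<h. \<exists>t. t \<noteq> 0 \<and> pb w = (\<lambda>x. t * pb (u i) x)"
proof (rule ccontr)
  assume no: "\<not> ?thesis"
  define v where "v = (\<lambda>l. if l < h then pb (u l) else pb w)"
  have nz: "pb (u l) \<noteq> (\<lambda>_. 0)" if "l < h" for l using findep_nonzero[OF u(1), of l] that by auto
  have ex: "z = (\<lambda>x. c * z' x)" if "z \<in> coord_space X" "z' \<in> coord_space X" "\<forall>x\<in>X. z x = c * z' x" for z z' :: "'x \<Rightarrow> 'k" and c
  proof
    fix x show "z x = c * z' x" using that by (cases "x \<in> X") (auto simp: coord_space_def)
  qed
  have "card {..h} \<le> h"
  proof (rule scheme_length_bound[OF len, where u = v])
    show "(\<lambda>x. t * y x) \<in> WT T" if "y \<in> WT T" for y t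
      using subspace_scaleI[OF fvs.subspace_span, of y "Row T ` A" t] that by (simp add: WT_def)
    show "(\<lambda>x. t * y x) \<in> Z" if yZ: "y \<in> Z" for y t
    proof -
      obtain c p where "y = (\<lambda>x. c * pb p x)" "pd p \<noteq> (\<lambda>_. 0)" using yZ unfolding Z by blast
      then show ?thesis unfolding Z by (intro CollectI exI[of _ "t * c"] exI[of _ p]) (simp add: mult.assoc)
    qed
    show "v i \<in> WT T \<inter> Z" for i using u(2) w(1) by (simp add: v_def)
    show "\<exists>x\<in>X. v i x \<noteq> 0" for i
    proof -
      have "v i \<noteq> (\<lambda>_. 0)" using nz w(2) by (simp add: v_def)
      moreover have "v i \<in> coord_space X" using spaces(2) by (simp add: v_def)
      ultimately show ?thesis by (auto simp: coord_space_def fun_eq_iff)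
    qed
    fix i j assume ij: "i \<in> {..h}" "j \<in> {..h}" "i \<noteq> j"
    show "\<not> (\<exists>c. \<forall>x\<in>X. v i x = c * v j x)"
    proof
      assume "\<exists>c. \<forall>x\<in>X. v i x = c * v j x"
      then obtain c where "\<forall>x\<in>X. v i x = c * v j x" by blast
      then have c: "v i = (\<lambda>x. c * v j x)" using spaces(2) by (intro ex) (auto simp: v_def)
      have "v i \<noteq> (\<lambda>_. 0)" using nz w(2) by (simp add: v_def)
      then have c0: "c \<noteq> 0" using c by auto
      then have c': "v j = (\<lambda>x. (1 / c) * v i x)" using c by (simp add: fun_eq_iff)
      consider "i < h" "j < h" | "i = h" "j < h" | "i < h" "j = h" using ij by fastforce
      then show False
      proof cases
        case 1
        then show False using findep_nonproportional[OF u(1) 1 ij(3), of c] c by (simp add: v_def fun_eq_iff)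
      next
        case 2
        then show False using no c c0 by (auto simp: v_def)
      next
        case 3
        then have "pb w = (\<lambda>x. (1 / c) * pb (u i) x)" using c' by (simp add: v_def)
        then show False using no c0 3(1) by (metis divide_eq_0_iff one_neq_zero)
      qed
    qed
  qed auto
  then show False by simp
qed

lemma criterion_identifiable:
  assumes T: "has_rank1_decomp R h T" and cond: "criterion h T" and h: "0 < h"
  shows "identifiable R h T"
  unfolding identifiable_def
proof (intro conjI allI impI)
  show "has_rank1_decomp R h T" by (rule T)
  fix lam U mu V assume D: "rank1_decomp R h T lam U \<and> rank1_decomp R h T mu V"
  obtain e u where u: "\<And>l. l < h \<Longrightarrow> lam l \<noteq> 0 \<and> e l \<noteq> 0 \<and> pd (u l) \<noteq> (\<lambda>_. 0) \<and> U l = (\<lambda>y. e l * pd (u l) y)"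
    and Tu: "T = (\<lambda>y. \<Sum>l<h. (lam l * e l) * pd (u l) y)"
    using D decomp_points by blast
  obtain f w where w: "\<And>l. l < h \<Longrightarrow> mu l \<noteq> 0 \<and> f l \<noteq> 0 \<and> pd (w l) \<noteq> (\<lambda>_. 0) \<and> V l = (\<lambda>y. f l * pd (w l) y)"
    and Tw: "T = (\<lambda>y. \<Sum>l<h. (mu l * f l) * pd (w l) y)"
    using D decomp_points by blast
  have dim: "fvs.dim (WT T) = h" using cond by (simp add: criterion_def lin_pdim_def)
  note iu = WT_decomp[OF dim Tu] and iw = WT_decomp[OF dim Tw]
  have inZ: "pb v \<in> Z" if "pd v \<noteq> (\<lambda>_. 0)" for v
    unfolding Z using that by (intro CollectI exI[of _ 1] exI[of _ v]) simp
  have uWZ: "pb (u l) \<in> WT T \<inter> Z" if l: "l < h" for l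
    using inZ[of "u l"] u[OF l] l unfolding iu(2) by (intro IntI fvs.span_base) auto
  have wWZ: "pb (w l) \<in> WT T \<inter> Z" if l: "l < h" for l
    using inZ[of "w l"] w[OF l] l unfolding iw(2) by (intro IntI fvs.span_base) auto
  have len: "scheme_length X (inter_ideal X (WT T) Z) h" using cond by (simp add: criterion_def)
  have "\<forall>j\<in>{..<h}. \<exists>i t. i < h \<and> t \<noteq> 0 \<and> pb (w j) = (\<lambda>x. t * pb (u i) x)"
  proof
    fix j assume "j \<in> {..<h}"
    then have j: "j < h" by simp
    have "pb (w j) \<noteq> (\<lambda>_. 0)" using pd_nonzero(2) w[OF j] by blast
    from points_proportional[OF len iu(1) uWZ wWZ[OF j] this]
    show "\<exists>i t. i < h \<and> t \<noteq> 0 \<and> pb (w j) = (\<lambda>x. t * pb (u i) x)" by blast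
  qed
  from bchoice[OF this] obtain pi0 where "\<forall>j\<in>{..<h}. \<exists>t. pi0 j < h \<and> t \<noteq> 0 \<and> pb (w j) = (\<lambda>x. t * pb (u (pi0 j)) x)" by blast
  from bchoice[OF this] obtain t where pt: "\<And>j. j < h \<Longrightarrow> pi0 j < h \<and> t j \<noteq> 0 \<and> pb (w j) = (\<lambda>x. t j * pb (u (pi0 j)) x)" by auto
  have "inj_on pi0 {..<h}"
  proof (rule inj_onI, rule ccontr)
    fix i j assume ij: "i \<in> {..<h}" "j \<in> {..<h}" "pi0 i = pi0 j" "i \<noteq> j"
    have "pb (w i) x = (t i / t j) * pb (w j) x" for x
      using pt[of i] pt[of j] ij by simp
    from findep_nonproportional[OF iw(1) _ _ ij(4) this] ij show False by simp
  qed
  moreover have "pi0 ` {..<h} \<subseteq> {..<h}" using pt by auto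
  ultimately have bij: "bij_betw pi0 {..<h} {..<h}"
    by (simp add: bij_betw_def endo_inj_surj)
  define \<pi> where "\<pi> = (\<lambda>j. if j < h then pi0 j else j)"
  have "bij_betw \<pi> {..<h} {..<h}" using bij by (rule bij_betw_cong[THEN iffD1, rotated]) (simp add: \<pi>_def)
  then have perm: "\<pi> permutes {..<h}" by (rule bij_imp_permutes) (simp add: \<pi>_def)
  \<comment> \<open>Each row is expanded in the basis \<open>pb (u l)\<close> in two ways. Comparing
    coefficients identifies the rows of corresponding summands, and a tensor is determined by its
    rows.\<close>
  have key: "(\<lambda>y. lam (\<pi> j) * U (\<pi> j) y) = (\<lambda>y. mu j * V j y)" if j: "j < h" for j
  proof (rule Row_inj)
    have pj: "\<pi> j = pi0 j" "pi0 j < h" using j pt by (auto simp: \<pi>_def)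
    note uj = u[OF pj(2)] and wj = w[OF j]
    show "(\<lambda>y. lam (\<pi> j) * U (\<pi> j) y) \<in> coord_space Y" "(\<lambda>y. mu j * V j y) \<in> coord_space Y"
      using spaces(3) uj wj pj by (auto simp: coord_space_def)
    fix I assume I: "I \<in> A"
    have coef: "lam (pi0 j) * e (pi0 j) * pa (u (pi0 j)) I = mu j * f j * pa (w j) I * t j"
    proof -
      have "Row T I = (\<lambda>x. \<Sum>l<h. (lam l * e l * pa (u l) I) * pb (u l) x)"
        by (subst Tu) (rule Row_comb[OF I])
      moreover have "Row T I = (\<lambda>x. \<Sum>l<h. (mu l * f l * pa (w l) I) * pb (w l) x)"
        by (subst Tw) (rule Row_comb[OF I])
      ultimately have row: "(\<Sum>l<h. (lam l * e l * pa (u l) I) * pb (u l) x) = (\<Sum>l<h. (mu l * f l * pa (w l) I) * pb (w l) x)" for x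
        by (simp add: fun_eq_iff)
      define g where "g = (\<lambda>l. mu l * f l * pa (w l) I * t l)"
      have inv: "inv_into {..<h} pi0 (pi0 l) = l" if "l < h" for l
        using bij that by (simp add: bij_betw_def inv_into_f_f)
      have "(\<Sum>l<h. (mu l * f l * pa (w l) I) * pb (w l) x)
          = (\<Sum>l<h. g (inv_into {..<h} pi0 (pi0 l)) * pb (u (pi0 l)) x)" for x
        using pt inv by (intro sum.cong) (auto simp: g_def)
      also have "(\<Sum>l<h. g (inv_into {..<h} pi0 (pi0 l)) * pb (u (pi0 l)) x)
          = (\<Sum>i<h. g (inv_into {..<h} pi0 i) * pb (u i) x)" for x
        by (rule sum.reindex_bij_betw[OF bij])
      finally have "(\<Sum>i<h. (lam i * e i * pa (u i) I - g (inv_into {..<h} pi0 i)) * pb (u i) x) = 0" for x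
        by (simp add: left_diff_distrib sum_subtractf row)
      from findepD[OF iu(1) this, of "pi0 j"] pj(2)
      have "lam (pi0 j) * e (pi0 j) * pa (u (pi0 j)) I = g j" using inv[OF j] by simp
      then show ?thesis by (simp add: g_def)
    qed
    show "Row (\<lambda>y. lam (\<pi> j) * U (\<pi> j) y) I = Row (\<lambda>y. mu j * V j y) I"
    proof -
      have "Row (\<lambda>y. lam (\<pi> j) * U (\<pi> j) y) I = (\<lambda>x. (lam (pi0 j) * e (pi0 j) * pa (u (pi0 j)) I) * pb (u (pi0 j)) x)"
        using Row_comb[OF I, of "\<lambda>_. lam (pi0 j) * e (pi0 j)" "\<lambda>_. u (pi0 j)" "{0}"] uj pj by (simp add: mult.assoc)
      also have "\<dots> = (\<lambda>x. (mu j * f j * pa (w j) I) * pb (w j) x)" using coef pt[OF j] by (simp add: mult.assoc)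
      also have "\<dots> = Row (\<lambda>y. mu j * V j y) I"
        using Row_comb[OF I, of "\<lambda>_. mu j * f j" "\<lambda>_. w j" "{0}"] wj by (simp add: mult.assoc)
      finally show ?thesis .
    qed
  qed
  show "\<exists>\<pi> c. \<pi> permutes {..<h} \<and> (\<forall>i<h. c i \<noteq> 0 \<and> V i = fscale (c i) (U (\<pi> i)) \<and> lam (\<pi> i) = mu i * c i)"
  proof (rule exI[of _ \<pi>], rule exI[of _ "\<lambda>i. lam (\<pi> i) / mu i"], intro conjI allI impI)
    fix i assume i: "i < h"
    have pi: "\<pi> i < h" using permutes_in_image[OF perm, of i] i by simp
    have nz: "lam (\<pi> i) \<noteq> 0" "mu i \<noteq> 0" using u[OF pi] w[OF i] by auto
    then show "lam (\<pi> i) / mu i \<noteq> 0" "lam (\<pi> i) = mu i * (lam (\<pi> i) / mu i)" by auto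
    have "lam (\<pi> i) * U (\<pi> i) y = mu i * V i y" for y using key[OF i] by meson
    then show "V i = fscale (lam (\<pi> i) / mu i) (U (\<pi> i))"
      using nz by (simp add: fscale_def fun_eq_iff)
  qed (rule perm)
qed

end

subsection \<open>Effectivity of the criterion\<close>

text \<open>The principal open sets form a base because \<open>f * g\<close> describes the
  intersection of two of them.\<close>

lemma zariski_principal:
  assumes "openin (zariski Y :: ('y \<Rightarrow> 'k::field) topology) U" "v \<in> U"
  shows "\<exists>f\<in>polys Y. peval f v \<noteq> 0 \<and> {w \<in> coord_space Y. peval f w \<noteq> 0} \<subseteq> U"
proof -
  have "generate_topology_on {{v \<in> coord_space Y. peval f v \<noteq> 0} | f. f \<in> polys Y} U"
    using assms(1) unfolding zariski_def openin_topology_generated_by_iff .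
  then show ?thesis using assms(2)
  proof (induction U rule: generate_topology_on.induct)
    case (Int a b)
    then obtain f g where "f \<in> polys Y" "peval f v \<noteq> 0" "{w \<in> coord_space Y. peval f w \<noteq> 0} \<subseteq> a"
      "g \<in> polys Y" "peval g v \<noteq> 0" "{w \<in> coord_space Y. peval g w \<noteq> 0} \<subseteq> b" by auto
    then show ?case by (intro bexI[of _ "f * g"]) (auto simp: peval_mult intro: polys_mult)
  next
    case (UN K)
    then obtain U where U: "U \<in> K" "v \<in> U" by blast
    from UN.IH[OF U] U(1) show ?case by blast
  next
    case (Basis s)
    then show ?case by blast
  qed simp
qed

lemma topspace_zariski: "topspace (zariski Y :: ('y \<Rightarrow> 'k::field) topology) = coord_space Y"
proof -
  have "coord_space Y \<subseteq> \<Union> {{v \<in> coord_space Y. peval f v \<noteq> (0::'k)} | f. f \<in> polys Y}"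
  proof
    fix v :: "'y \<Rightarrow> 'k" assume "v \<in> coord_space Y"
    then have "v \<in> {v \<in> coord_space Y. peval 1 v \<noteq> (0::'k)}" by simp
    then show "v \<in> \<Union> {{v \<in> coord_space Y. peval f v \<noteq> (0::'k)} | f. f \<in> polys Y}" using polys_1 by blast
  qed
  then show ?thesis unfolding zariski_def topology_generated_by_topspace by blast
qed

text \<open>It is enough to test density on principal open sets. \<open>meet\<close> is a form of
  irreducibility of \<open>S\<close>, to be verified with a curve through \<open>T\<close>.\<close>

lemma zariski_dense_openI:
  fixes S :: "('y \<Rightarrow> 'k::field) set"
  assumes S: "S \<subseteq> coord_space Y" and f0: "f0 \<in> polys Y"
    and meet: "\<And>T f. T \<in> S \<Longrightarrow> f \<in> polys Y \<Longrightarrow> peval f T \<noteq> 0 \<Longrightarrow> \<exists>T'\<in>S. peval f T' \<noteq> 0 \<and> peval f0 T' \<noteq> 0"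
  shows "dense_open_in (zariski Y) S {T \<in> S. peval f0 T \<noteq> 0}"
  unfolding dense_open_in_def
proof
  let ?G = "{T \<in> S. peval f0 T \<noteq> 0}"
  have "openin (zariski Y) {T \<in> coord_space Y. peval f0 T \<noteq> 0}"
    unfolding zariski_def using f0 by (intro topology_generated_by_Basis) blast
  moreover have "?G = {T \<in> coord_space Y. peval f0 T \<noteq> 0} \<inter> S" using S by blast
  ultimately show "openin (subtopology (zariski Y) S) ?G" unfolding openin_subtopology by blast
  show "subtopology (zariski Y) S closure_of ?G = S"
  proof
    show "subtopology (zariski Y) S closure_of ?G \<subseteq> S"
      using closure_of_subset_topspace[of "subtopology (zariski Y) S" ?G] by simp
    show "S \<subseteq> subtopology (zariski Y) S closure_of ?G"
    proof
      fix T assume T: "T \<in> S"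
      show "T \<in> subtopology (zariski Y) S closure_of ?G"
        unfolding in_closure_of
      proof (intro conjI allI impI)
        show "T \<in> topspace (subtopology (zariski Y) S)" using T S by (auto simp: topspace_zariski)
        fix V assume V: "T \<in> V \<and> openin (subtopology (zariski Y) S) V"
        then obtain U where U: "openin (zariski Y) U" "V = U \<inter> S" unfolding openin_subtopology by blast
        then obtain f where f: "f \<in> polys Y" "peval f T \<noteq> 0" "{w \<in> coord_space Y. peval f w \<noteq> 0} \<subseteq> U"
          using zariski_principal[OF U(1), of T] V by blast
        obtain T' where "T' \<in> S" "peval f T' \<noteq> 0" "peval f0 T' \<noteq> 0" using meet[OF T f(1,2)] by blast
        then show "\<exists>y. y \<in> ?G \<and> y \<in> V" using f(3) S U(2) by blast
      qed
    qed
  qed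
qed

context rank_one_family
begin

lemma findep_pd:
  fixes u :: "nat \<Rightarrow> 'v"
  assumes "findep (\<lambda>l. pb (u l)) {..<h}" "\<And>l. l < h \<Longrightarrow> pd (u l) \<noteq> (\<lambda>_. 0)"
  shows "findep (\<lambda>l. pd (u l)) {..<h}"
proof (rule findepI)
  fix c i assume c: "\<And>x. (\<Sum>l<h. c l * pd (u l) x) = 0" and i: "i \<in> {..<h}"
  obtain I where I: "pa (u i) I \<noteq> 0" using pd_nonzero(1)[OF assms(2)[of i]] i by auto
  then have IA: "I \<in> A" using spaces(1)[of "u i"] by (auto simp: coord_space_def)
  have "(\<Sum>l<h. (c l * pa (u l) I) * pb (u l) x) = 0" for x
    using fun_cong[OF Row_comb[OF IA, of c u "{..<h}"], of x] by (simp add: c Row_def split: if_splits)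
  from findepD[OF assms(1) this i] I show "c i = 0" by simp
qed

lemma rank1_decompI:
  assumes "findep (\<lambda>l. pb (u l)) {..<h}" "\<And>l. l < h \<Longrightarrow> pd (u l) \<noteq> (\<lambda>_. 0)" "\<And>l. l < h \<Longrightarrow> c l \<noteq> 0"
  shows "rank1_decomp R h (\<lambda>y. \<Sum>l<h. c l * pd (u l) y) c (\<lambda>l. pd (u l))"
  unfolding rank1_decomp_def
proof (intro conjI allI impI)
  have "findep (\<lambda>l. pd (u l)) {..<h}" using findep_pd assms(1,2) by blast
  then show "inj_on (\<lambda>l. pd (u l)) {..<h}" "\<not> fvs.dependent ((\<lambda>l. pd (u l)) ` {..<h})"
    unfolding findep_iff[OF finite_lessThan] by auto
  show "(\<lambda>y. \<Sum>l<h. c l * pd (u l) y) = (\<Sum>l<h. fscale (c l) (pd (u l)))"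
    by (simp add: fun_eq_iff sum_fun_apply fscale_def)
qed (use assms R_pd in auto)

end

text \<open>The functionals \<xi> exist because the \<open>pa (v1 l)\<close> are independent, for
  which the flattening must have at least \<open>h\<close> rows. They isolate each single point in
  the flattening of the sum of the \<open>pd (v1 l)\<close>.\<close>

locale generic_frame = rank_one_family A X Y \<sigma> \<kappa> pa pb pd R Z path Qs Q \<gamma>
  for A :: "'a set" and X :: "'x set" and Y :: "'y set"
    and \<sigma> :: "'a \<Rightarrow> 'x \<Rightarrow> 'y" and \<kappa> :: "'a \<Rightarrow> 'x \<Rightarrow> 'k::field_char_0"
    and pa :: "'v \<Rightarrow> 'a \<Rightarrow> 'k" and pb :: "'v \<Rightarrow> 'x \<Rightarrow> 'k" and pd :: "'v \<Rightarrow> 'y \<Rightarrow> 'k"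
    and R :: "('y \<Rightarrow> 'k) set" and Z :: "('x \<Rightarrow> 'k) set"
    and path :: "'v \<Rightarrow> 'v \<Rightarrow> 'k \<Rightarrow> 'v" and Qs :: "'q set" and Q :: "'q \<Rightarrow> ('x \<Rightarrow> 'k) \<Rightarrow> 'k"
    and \<gamma> :: "'q \<Rightarrow> 'x \<Rightarrow> 'x \<Rightarrow> 'k" +
  fixes h m :: nat and v1 :: "nat \<Rightarrow> 'v" and \<xi> :: "nat \<Rightarrow> 'a \<Rightarrow> 'k"
    and \<beta> :: "nat multiset \<Rightarrow> nat multiset \<Rightarrow> 'q \<Rightarrow> 'k"
  assumes h: "0 < h" and m: "2 \<le> m" and ind1: "findep (\<lambda>l. pb (v1 l)) {..<h}"
    and xi: "\<And>i j. i < h \<Longrightarrow> j < h \<Longrightarrow> lfun A (\<xi> i) (pa (v1 j)) = (if i = j then 1 else 0)"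
    and beta: "\<And>\<mu> c. \<mu> \<in> mixed_msets h m \<Longrightarrow> mmono \<mu> c = (\<Sum>\<nu>\<in>msets h (m - 2). \<Sum>q\<in>Qs.
      \<beta> \<mu> \<nu> q * (mmono \<nu> c * Q q (\<lambda>x. \<Sum>l<h. c l * pb (v1 l) x)))"
begin

text \<open>
  \<open>RR T l\<close> is a vector in the image of the flattening of \<open>T\<close> that depends linearly on \<open>T\<close> and is the
  \<open>l\<close>-th point for \<open>T = T1\<close>. Correspondingly \<open>g T \<mu>\<close> lies in the ideal of the quadrics and is the
  monomial \<open>\<mu>\<close> for \<open>T = T1\<close>.
\<close>

definition RR :: "('y \<Rightarrow> 'k) \<Rightarrow> nat \<Rightarrow> 'x \<Rightarrow> 'k" where
  "RR T l = (\<lambda>x. \<Sum>I\<in>A. \<xi> l I * Row T I x)"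

definition g :: "('y \<Rightarrow> 'k) \<Rightarrow> nat multiset \<Rightarrow> (nat \<Rightarrow> 'k) \<Rightarrow> 'k" where
  "g T \<mu> z = (\<Sum>\<nu>\<in>msets h (m - 2). \<Sum>q\<in>Qs. \<beta> \<mu> \<nu> q * (mmono \<nu> z * Q q (\<lambda>x. \<Sum>l<h. z l * RR T l x)))"

definition T1 :: "'y \<Rightarrow> 'k" where
  "T1 = (\<lambda>y. \<Sum>k<h. 1 * pd (v1 k) y)"

lemma RR_T1: "l < h \<Longrightarrow> RR T1 l = pb (v1 l)"
proof
  fix x assume l: "l < h"
  have "RR T1 l x = (\<Sum>I\<in>A. \<Sum>k<h. (\<xi> l I * pa (v1 k) I) * pb (v1 k) x)"
    unfolding RR_def T1_def by (intro sum.cong refl) (subst Row_comb, auto simp: sum_distrib_left mult.assoc)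
  also have "\<dots> = (\<Sum>k<h. lfun A (\<xi> l) (pa (v1 k)) * pb (v1 k) x)"
    unfolding lfun_def sum_distrib_right by (rule sum.swap)
  also have "\<dots> = (\<Sum>k<h. if l = k then pb (v1 k) x else 0)" using l by (intro sum.cong) (auto simp: xi)
  finally show "RR T1 l x = pb (v1 l) x" using l by simp
qed

lemma g_T1: "\<mu> \<in> mixed_msets h m \<Longrightarrow> g T1 \<mu> z = mmono \<mu> z"
proof -
  assume \<mu>: "\<mu> \<in> mixed_msets h m"
  have "(\<lambda>x. \<Sum>l<h. z l * RR T1 l x) = (\<lambda>x. \<Sum>l<h. z l * pb (v1 l) x)"
    by (intro ext sum.cong) (auto simp: RR_T1)
  then show ?thesis unfolding g_def by (simp add: beta[OF \<mu>, of z])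
qed

lemma RR_space: "RR T l \<in> coord_space X"
  by (simp add: RR_def Row_def coord_space_def)

lemma RR_WT: "RR T l \<in> WT T"
proof -
  have "(\<lambda>x. \<Sum>I\<in>A. \<xi> l I * Row T I x) \<in> fvs.span (Row T ` A)"
    by (intro subspace_sumI[OF fvs.subspace_span] subspace_scaleI[OF fvs.subspace_span] fvs.span_base) blast
  then show ?thesis by (simp add: RR_def WT_def)
qed

definition FY :: "(('y \<Rightarrow> 'k) \<Rightarrow> 'k) set" where
  "FY = {(\<lambda>T. peval f T) | f. f \<in> polys Y}"

lemma FY_const: "(\<lambda>_. c) \<in> FY"
  unfolding FY_def by (intro CollectI exI[of _ "Poly_Mapping.single 0 c"]) (simp add: fun_eq_iff)

lemma FY_mult: "f \<in> FY \<Longrightarrow> f2 \<in> FY \<Longrightarrow> (\<lambda>T. f T * f2 T) \<in> FY"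
proof -
  assume "f \<in> FY" "f2 \<in> FY"
  then obtain f' g' where *: "f = peval f'" "f2 = peval g'" "f' \<in> polys Y" "g' \<in> polys Y" unfolding FY_def by blast
  then show ?thesis unfolding FY_def by (intro CollectI exI[of _ "f' * g'"]) (simp add: peval_mult polys_mult fun_eq_iff)
qed

lemma FY_add: "f \<in> FY \<Longrightarrow> f2 \<in> FY \<Longrightarrow> (\<lambda>T. f T + f2 T) \<in> FY"
proof -
  assume "f \<in> FY" "f2 \<in> FY"
  then obtain f' g' where *: "f = peval f'" "f2 = peval g'" "f' \<in> polys Y" "g' \<in> polys Y" unfolding FY_def by blast
  then show ?thesis unfolding FY_def by (intro CollectI exI[of _ "f' + g'"]) (simp add: peval_add polys_add fun_eq_iff)
qed

lemma FY_diff: "f \<in> FY \<Longrightarrow> f2 \<in> FY \<Longrightarrow> (\<lambda>T. f T - f2 T) \<in> FY"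
proof -
  assume "f \<in> FY" "f2 \<in> FY"
  then obtain f' g' where *: "f = peval f'" "f2 = peval g'" "f' \<in> polys Y" "g' \<in> polys Y" unfolding FY_def by blast
  then show ?thesis unfolding FY_def by (intro CollectI exI[of _ "f' - g'"]) (simp add: peval_diff polys_diff fun_eq_iff)
qed

lemma FY_sum: "(\<And>i. i \<in> S \<Longrightarrow> f i \<in> FY) \<Longrightarrow> (\<lambda>T. \<Sum>i\<in>S. f i T) \<in> FY"
  by (induction S rule: infinite_finite_induct) (auto intro: FY_const FY_add)

lemma FY_var: "y \<in> Y \<Longrightarrow> (\<lambda>T. T y) \<in> FY"
  unfolding FY_def by (intro CollectI exI[of _ "pvar y"]) (simp add: polys_pvar fun_eq_iff)

lemma FY_RR: "(\<lambda>T. RR T l x) \<in> FY"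
proof (cases "x \<in> X")
  case True
  then show ?thesis unfolding RR_def Row_def
    by (auto intro!: FY_sum FY_mult FY_const FY_var sigma)
next
  case False
  then show ?thesis unfolding RR_def Row_def by (auto intro: FY_const)
qed

lemma FY_g: "(\<lambda>T. g T \<mu> z) \<in> FY"
proof -
  have "(\<lambda>T. Q q (\<lambda>x. \<Sum>l<h. z l * RR T l x)) \<in> FY" if "q \<in> Qs" for q
    unfolding Q[OF that] by (intro FY_sum FY_mult FY_const FY_RR)
  then show ?thesis unfolding g_def by (intro FY_sum FY_mult FY_const)
qed

lemma generic_open:
  "\<exists>f0\<in>polys Y. peval f0 T1 \<noteq> 0 \<and>
     (\<forall>T. peval f0 T \<noteq> 0 \<longrightarrow> findep (RR T) {..<h} \<and> findep (g T) (mixed_msets h m))"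
proof -
  have "\<exists>\<Phi>\<in>FY. \<Phi> T1 \<noteq> 0 \<and> (\<forall>T. \<Phi> T \<noteq> 0 \<longrightarrow> findep (RR T) {..<h})"
  proof (rule findep_open[OF finite_lessThan fin(2)])
    have "findep (RR T1) {..<h} \<longleftrightarrow> findep (\<lambda>l. pb (v1 l)) {..<h}" by (rule findep_cong) (simp add: RR_T1)
    then show "findep (RR T1) {..<h}" using ind1 by simp
  qed (auto intro: FY_const FY_mult FY_diff FY_RR RR_space)
  then obtain f1 where f1: "f1 \<in> polys Y" "peval f1 T1 \<noteq> 0" "\<And>T. peval f1 T \<noteq> 0 \<Longrightarrow> findep (RR T) {..<h}"
    unfolding FY_def by blast
  obtain E where E: "finite E" "findep (\<lambda>\<mu> z. if z \<in> E then mmono \<mu> z else (0::'k)) (mixed_msets h m)"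
    using findep_finite_support[OF finite_mixed_msets mmono_findep[OF finite_mixed_msets]] by blast
  \<comment> \<open>\<open>findep_open\<close> works with vectors on a finite index set, hence the
    restriction of the forms to \<open>E\<close>.\<close>
  define u where "u = (\<lambda>T \<mu> z. if z \<in> E then g T \<mu> z else 0)"
  have "\<exists>\<Phi>\<in>FY. \<Phi> T1 \<noteq> 0 \<and> (\<forall>T. \<Phi> T \<noteq> 0 \<longrightarrow> findep (u T) (mixed_msets h m))"
  proof (rule findep_open[OF finite_mixed_msets E(1)])
    have "findep (u T1) (mixed_msets h m) \<longleftrightarrow> findep (\<lambda>\<mu> z. if z \<in> E then mmono \<mu> z else 0) (mixed_msets h m)"
      by (rule findep_cong) (auto simp: u_def g_T1)
    then show "findep (u T1) (mixed_msets h m)" using E(2) by simp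
    show "\<forall>\<mu>\<in>mixed_msets h m. u T1 \<mu> \<in> coord_space E" by (simp add: u_def coord_space_def)
    show "(\<lambda>T. u T \<mu> z) \<in> FY" for \<mu> z unfolding u_def by (cases "z \<in> E") (auto intro: FY_g FY_const)
  qed (auto intro: FY_const FY_mult FY_diff)
  then obtain f2 where f2: "f2 \<in> polys Y" "peval f2 T1 \<noteq> 0" "\<And>T. peval f2 T \<noteq> 0 \<Longrightarrow> findep (u T) (mixed_msets h m)"
    unfolding FY_def by blast
  have "findep (g T) (mixed_msets h m)" if "findep (u T) (mixed_msets h m)" for T
  proof (rule findepI)
    fix c \<mu> assume c: "\<And>z. (\<Sum>\<mu>\<in>mixed_msets h m. c \<mu> * g T \<mu> z) = 0" and \<mu>: "\<mu> \<in> mixed_msets h m"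
    have "(\<Sum>\<mu>\<in>mixed_msets h m. c \<mu> * u T \<mu> z) = 0" for z
      using c[of z] by (cases "z \<in> E") (simp_all add: u_def)
    from findepD[OF that this \<mu>] show "c \<mu> = 0" .
  qed
  then show ?thesis using f1 f2 by (intro bexI[of _ "f1 * f2"]) (auto simp: peval_mult intro: polys_mult)
qed

text \<open>Read in the coordinates of the actual points \<open>P l\<close>, the forms
  \<open>g T\<close> vanish at the coordinate points, so they are combinations of mixed monomials.
  They are independent and as many as the mixed monomials; hence conversely each mixed monomial is a
  combination of them.\<close>

lemma mixed_equations:
  assumes Pz: "\<And>l. l < h \<Longrightarrow> P l \<in> Z"
    and span: "WT T = fvs.span (P ` {..<h})"
    and RRi: "findep (RR T) {..<h}" and gi: "findep (g T) (mixed_msets h m)"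
    and \<mu>: "\<mu> \<in> msets h m" "mixed \<mu>"
  shows "\<exists>f\<in>van_ideal X Z. \<forall>z. peval f (\<lambda>x. \<Sum>l<h. z l * P l x) = mmono \<mu> z"
proof -
  let ?M = "mixed_msets h m"
  obtain \<eta> where \<eta>: "\<forall>i\<in>{..<h}. \<forall>j\<in>{..<h}. lfun X (\<eta> i) (RR T j) = (if i = j then 1 else 0)"
    using findep_dual[OF finite_lessThan fin(2) RRi] RR_space by blast
  \<comment> \<open>The linear forms dual to \<open>RR T\<close> extend the multipliers from the
    span to the whole space, which makes \<open>Fp\<close> a polynomial in the ideal of
    \<open>Z\<close>.\<close>
  define yp where "yp = (\<lambda>j. \<Sum>x\<in>X. pscale (\<eta> j x) (pvar x))"
  define Qp where "Qp = (\<lambda>q. \<Sum>x\<in>X. \<Sum>x'\<in>X. pscale (\<gamma> q x x') (pvar x * pvar x'))"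
  define Fp where "Fp = (\<lambda>\<mu>. \<Sum>\<nu>\<in>msets h (m - 2). \<Sum>q\<in>Qs. pscale (\<beta> \<mu> \<nu> q) ((\<Prod>j\<in>#\<nu>. yp j) * Qp q))"
  have yp: "yp j \<in> polys X" "peval (yp j) v = lfun X (\<eta> j) v" for j v
    unfolding yp_def by (auto intro!: polys_sum polys_pscale polys_pvar simp: lfun_def peval_sum peval_pscale)
  have ypp: "(\<Prod>j\<in>#\<nu>. yp j) \<in> polys X" "peval (\<Prod>j\<in>#\<nu>. yp j) v = (\<Prod>j\<in>#\<nu>. lfun X (\<eta> j) v)" for \<nu> v
    by (induction \<nu>) (auto intro: polys_mult yp simp: peval_mult yp)
  have Qp: "Qp q \<in> polys X" for q unfolding Qp_def by (intro polys_sum polys_pscale polys_mult polys_pvar)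
  have Qpe: "peval (Qp q) v = Q q v" if "q \<in> Qs" for q v
    unfolding Q[OF that] Qp_def by (simp add: peval_sum peval_pscale peval_mult)
  have Fpe: "peval (Fp \<mu>) v = (\<Sum>\<nu>\<in>msets h (m - 2). \<Sum>q\<in>Qs. \<beta> \<mu> \<nu> q * ((\<Prod>j\<in>#\<nu>. lfun X (\<eta> j) v) * Q q v))" for \<mu> v
    unfolding Fp_def by (simp add: peval_sum peval_pscale peval_mult ypp Qpe)
  have QZ: "Q q v = 0" if q: "q \<in> Qs" and v: "v \<in> Z" for q v
  proof -
    obtain c p where v: "v = (\<lambda>x. c * pb p x)" using v unfolding Z by blast
    have "Q q v = (c * c) * Q q (pb p)" unfolding Q[OF q] v by (simp add: sum_distrib_left mult_ac)
    then show ?thesis using Q_pb[OF q] by simp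
  qed
  have Fpi: "Fp \<mu> \<in> polys X" for \<mu> unfolding Fp_def by (intro polys_sum polys_pscale polys_mult ypp Qp)
  have FpZ: "Fp \<mu> \<in> van_ideal X Z" for \<mu> using Fpi by (simp add: van_ideal_def Fpe QZ)
  \<comment> \<open>\<open>G\<close> and \<open>g T\<close> are the same restricted polynomials in
    two coordinate systems: \<open>G\<close> refers to the vectors \<open>P l\<close> and
    \<open>g T\<close> to the vectors \<open>RR T l\<close>.\<close>
  define G where "G = (\<lambda>\<mu> w. peval (Fp \<mu>) (\<lambda>x. \<Sum>i<h. w i * P i x))"
  have Gh: "G \<mu> \<in> hforms h m" for \<mu>
  proof -
    have lf: "(\<lambda>w. \<Prod>j\<in>#\<nu>. lfun X (\<eta> j) (\<lambda>x. \<Sum>i<h. w i * P i x)) \<in> hforms h (m - 2)"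
      if "\<nu> \<in> msets h (m - 2)" for \<nu>
    proof -
      have "(\<lambda>w. \<Prod>j\<in>#\<nu>. lfun X (\<eta> j) (\<lambda>x. \<Sum>i<h. w i * P i x)) \<in> hforms h (size \<nu>)"
        unfolding lfun_linear by (intro hforms_prod_mset hforms_linear)
      then show ?thesis using that by (simp add: msets_def)
    qed
    have qf: "(\<lambda>w. Q q (\<lambda>x. \<Sum>i<h. w i * P i x)) \<in> hforms h 2" if q: "q \<in> Qs" for q
    proof -
      have "(\<lambda>w. \<Sum>x\<in>X. \<Sum>x'\<in>X. \<gamma> q x x' * ((\<Sum>i<h. w i * P i x) * (\<Sum>i<h. w i * P i x'))) \<in> hforms h (1 + 1)"
        by (intro subspace_sumI[OF hforms_subspace] subspace_scaleI[OF hforms_subspace] hforms_mult hforms_linear)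
      then show ?thesis unfolding Q[OF q] one_add_one .
    qed
    have "G \<mu> \<in> hforms h (m - 2 + 2)"
      unfolding G_def Fpe
      by (intro subspace_sumI[OF hforms_subspace] subspace_scaleI[OF hforms_subspace] hforms_mult lf qf)
    moreover have "m - 2 + 2 = m" using m by simp
    ultimately show ?thesis by (simp only:)
  qed
  have GM: "G ` ?M \<subseteq> fvs.span (mmono ` ?M)"
  proof (rule image_subsetI, rule hforms_vanishing[OF Gh])
    fix \<mu> i assume i: "i < h"
    have "(\<lambda>x. \<Sum>l<h. (if l = i then 1 else 0) * P l x) = P i"
      using i by (auto simp: fun_eq_iff if_distrib if_distribR cong: if_cong)
    then show "G \<mu> (\<lambda>l. if l = i then 1 else 0) = 0"
      using FpZ[of \<mu>] Pz[OF i] by (simp add: G_def van_ideal_def)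
  qed (use m in simp)
  have Gi: "findep G ?M"
  proof (rule findepI)
    fix c \<nu> assume c: "\<And>w. (\<Sum>\<mu>\<in>?M. c \<mu> * G \<mu> w) = 0" and \<nu>: "\<nu> \<in> ?M"
    have "(\<Sum>\<mu>\<in>?M. c \<mu> * g T \<mu> z) = 0" for z
    proof -
      have "(\<lambda>x. \<Sum>l\<in>{..<h}. z l * RR T l x) \<in> WT T"
        using RR_WT unfolding WT_def by (intro subspace_sumI[OF fvs.subspace_span] subspace_scaleI[OF fvs.subspace_span])
      then obtain w where w: "(\<lambda>x. \<Sum>l<h. z l * RR T l x) = (\<lambda>x. \<Sum>i<h. w i * P i x)"
        unfolding span fvs_span_family[OF finite_lessThan] by (auto simp: fun_eq_iff)
      have "lfun X (\<eta> j) (\<lambda>x. \<Sum>l<h. z l * RR T l x) = z j" if "j < h" for j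
      proof -
        have "(\<Sum>l<h. z l * lfun X (\<eta> j) (RR T l)) = (\<Sum>l<h. if j = l then z l else 0)"
          using \<eta> that by (intro sum.cong) auto
        then show ?thesis using that by (simp add: lfun_linear)
      qed
      then have mm: "(\<Prod>j\<in>#\<nu>. lfun X (\<eta> j) (\<lambda>x. \<Sum>l<h. z l * RR T l x)) = mmono \<nu> z" if "\<nu> \<in> msets h (m - 2)" for \<nu>
        using that unfolding mmono_def msets_def by (intro arg_cong[where f = prod_mset] image_mset_cong) auto
      have "G \<mu> w = g T \<mu> z" for \<mu> unfolding G_def w[symmetric] Fpe g_def by (simp add: mm)
      then show ?thesis using c[of w] by simp
    qed
    from findepD[OF gi this \<nu>] show "c \<nu> = 0" .
  qed
  have "mmono ` ?M \<subseteq> fvs.span (G ` ?M)"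
    using findep_exchange[OF Gi finite_mixed_msets GM finite_mixed_msets] by blast
  moreover have "\<mu> \<in> ?M" using \<mu> by (simp add: mixed_msets_def)
  ultimately have "mmono \<mu> \<in> fvs.span (G ` ?M)" by blast
  then obtain \<theta> where \<theta>: "\<And>w. mmono \<mu> w = (\<Sum>\<nu>\<in>?M. \<theta> \<nu> * G \<nu> w)"
    unfolding fvs_span_family[OF finite_mixed_msets] by blast
  have "(\<Sum>\<nu>\<in>?M. pscale (\<theta> \<nu>) (Fp \<nu>)) \<in> van_ideal X Z"
    unfolding pscale_def by (intro coord_ideal_sum[OF van_ideal_ideal] coord_ideal_mult[OF van_ideal_ideal FpZ] polys_const)
  then show ?thesis
    by (intro bexI[of _ "\<Sum>\<nu>\<in>?M. pscale (\<theta> \<nu>) (Fp \<nu>)"]) (simp_all add: peval_sum peval_pscale \<theta> G_def)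
qed

text \<open>The row space lies between the span of the \<open>h\<close> independent vectors
  \<open>RR T l\<close> and the span of the \<open>h\<close> vectors \<open>pb (u l)\<close>; by
  exchange all three coincide.\<close>

lemma points_of_RR:
  assumes T: "T = (\<lambda>y. \<Sum>l<h. c l * pd (u l) y)" and RRi: "findep (RR T) {..<h}"
  shows "findep (\<lambda>l. pb (u l)) {..<h}" "WT T = fvs.span ((\<lambda>l. pb (u l)) ` {..<h})"
proof -
  have sub: "RR T ` {..<h} \<subseteq> WT T" using RR_WT by blast
  then have "RR T ` {..<h} \<subseteq> fvs.span ((\<lambda>l. pb (u l)) ` {..<h})" using WT_sub[OF T] by blast
  from findep_exchange[OF RRi _ this] have *: "findep (\<lambda>l. pb (u l)) {..<h}"
    "(\<lambda>l. pb (u l)) ` {..<h} \<subseteq> fvs.span (RR T ` {..<h})" by auto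
  have "fvs.subspace (WT T)" unfolding WT_def by (rule fvs.subspace_span)
  then have "fvs.span (RR T ` {..<h}) \<subseteq> WT T" "fvs.span ((\<lambda>l. pb (u l)) ` {..<h}) \<subseteq> WT T"
    using sub *(2) by (meson fvs.span_minimal subset_trans)+
  then show "WT T = fvs.span ((\<lambda>l. pb (u l)) ` {..<h})" using WT_sub[OF T] by blast
  show "findep (\<lambda>l. pb (u l)) {..<h}" by (rule *(1))
qed

lemma criterion_generic:
  assumes T: "T = (\<lambda>y. \<Sum>l<h. c l * pd (u l) y)" and nz: "\<And>l. l < h \<Longrightarrow> pd (u l) \<noteq> (\<lambda>_. 0)"
    and RRi: "findep (RR T) {..<h}" and gi: "findep (g T) (mixed_msets h m)"
  shows "criterion h T"
proof -
  note u = points_of_RR[OF T RRi]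
  have uZ: "pb (u l) \<in> Z" if "l < h" for l
    unfolding Z using nz[OF that] by (intro CollectI exI[of _ 1] exI[of _ "u l"]) simp
  interpret dual_frame X "\<lambda>l. pb (u l)" h m "WT T" Z
  proof
    show "(\<lambda>x. t * y x) \<in> Z" if yZ: "y \<in> Z" for y t
    proof -
      obtain c p where "y = (\<lambda>x. c * pb p x)" "pd p \<noteq> (\<lambda>_. 0)" using yZ unfolding Z by blast
      then show ?thesis unfolding Z by (intro CollectI exI[of _ "t * c"] exI[of _ p]) (simp add: mult.assoc)
    qed
    show "\<exists>f\<in>van_ideal X Z. \<forall>z. peval f (\<lambda>x. \<Sum>l<h. z l * pb (u l) x) = mmono \<mu> z"
      if "\<mu> \<in> msets h m" "mixed \<mu>" for \<mu>
      by (rule mixed_equations[OF uZ u(2) RRi gi that])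
  qed (use fin spaces u uZ h m in auto)
  have "fvs.dim (WT T) = h" unfolding u(2) using findep_dim_span[OF u(1)] by simp
  then show ?thesis unfolding criterion_def lin_pdim_def using scheme_dim_zero scheme_length_frame by simp
qed

lemma criterion_dense:
  defines "\<Sigma> \<equiv> {T \<in> coord_space Y. has_rank1_decomp R h T}"
  shows "\<exists>G. dense_open_in (zariski Y) \<Sigma> G \<and> (\<forall>T\<in>G. criterion h T)"
proof -
  obtain f0 where f0: "f0 \<in> polys Y" "peval f0 T1 \<noteq> 0"
    "\<And>T. peval f0 T \<noteq> 0 \<Longrightarrow> findep (RR T) {..<h} \<and> findep (g T) (mixed_msets h m)"
    using generic_open by blast
  have "dense_open_in (zariski Y) \<Sigma> {T \<in> \<Sigma>. peval f0 T \<noteq> 0}"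
  proof (rule zariski_dense_openI[OF _ f0(1)])
    show "\<Sigma> \<subseteq> coord_space Y" by (auto simp: \<Sigma>_def)
    fix T f assume T: "T \<in> \<Sigma>" and f: "f \<in> polys Y" "peval f T \<noteq> 0"
    obtain lam U where "rank1_decomp R h T lam U" using T unfolding \<Sigma>_def has_rank1_decomp_def by blast
    then obtain e u where u: "\<And>l. l < h \<Longrightarrow> lam l \<noteq> 0 \<and> e l \<noteq> 0 \<and> pd (u l) \<noteq> (\<lambda>_. 0) \<and> U l = (\<lambda>y. e l * pd (u l) y)"
      and Tu: "T = (\<lambda>y. \<Sum>l<h. (lam l * e l) * pd (u l) y)" using decomp_points by blast
    \<comment> \<open>The curve \<open>Tt\<close> moves coefficients and points simultaneously from
      \<open>T\<close> to \<open>T1\<close>. For a common good parameter the coefficients, the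
      chosen entries of the summands and \<open>f\<close> are nonzero at 0, and \<open>f0\<close> is
      nonzero at 1.\<close>
    define cc where "cc = (\<lambda>l t. (1 - t) * (lam l * e l) + t)"
    define vv where "vv = (\<lambda>l. path (u l) (v1 l))"
    define Tt where "Tt = (\<lambda>t y. \<Sum>l<h. cc l t * pd (vv l t) y)"
    have Tpoly: "polyfun (\<lambda>t. peval F (\<lambda>y. Tt t y))" for F
      unfolding Tt_def cc_def vv_def by (intro peval_polyfun polyfun_intros path(1))
    have T0: "Tt 0 = T" unfolding Tt_def Tu cc_def vv_def by (simp add: path)
    have T1: "Tt 1 = T1" unfolding Tt_def T1_def cc_def vv_def by (simp add: path)
    have "\<forall>l\<in>{..<h}. \<exists>y. pd (u l) y \<noteq> 0" using u by (fastforce simp: fun_eq_iff)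
    then obtain y where y: "\<And>l. l < h \<Longrightarrow> pd (u l) (y l) \<noteq> 0" using bchoice[of "{..<h}"] by (metis lessThan_iff)
    define SS where "SS = {\<lambda>t. peval f (Tt t), \<lambda>t. peval f0 (Tt t)} \<union> cc ` {..<h} \<union> (\<lambda>l t. pd (vv l t) (y l)) ` {..<h}"
    have "\<exists>t\<in>UNIV. \<forall>s\<in>SS. s t \<noteq> 0"
    proof (rule polyfun_common_nonzero)
      show "finite SS" by (simp add: SS_def)
      show "infinite (UNIV :: 'k set)" by (rule infinite_UNIV_char_0)
      fix s assume s: "s \<in> SS"
      then consider "s = (\<lambda>t. peval f (Tt t))" | "s = (\<lambda>t. peval f0 (Tt t))" | l where "l < h" "s = cc l"
        | l where "l < h" "s = (\<lambda>t. pd (vv l t) (y l))" unfolding SS_def by blast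
      then have "polyfun s \<and> (\<exists>a. s a \<noteq> 0)"
      proof cases
        case 1
        have "s 0 \<noteq> 0" using f(2) by (simp add: 1 T0)
        then show ?thesis using Tpoly[of f] unfolding 1 by blast
      next
        case 2
        have "s 1 \<noteq> 0" using f0(2) by (simp add: 2 T1)
        then show ?thesis using Tpoly[of f0] unfolding 2 by blast
      next
        case 3
        have "s 0 \<noteq> 0" using u[OF 3(1)] by (simp add: 3 cc_def)
        moreover have "polyfun s" unfolding 3 cc_def by (intro polyfun_intros)
        ultimately show ?thesis by blast
      next
        case 4
        have "s 0 \<noteq> 0" using y[OF 4(1)] by (simp add: 4 vv_def path)
        moreover have "polyfun s" unfolding 4 vv_def by (rule path(1))
        ultimately show ?thesis by blast
      qed
      then show "polyfun s" "\<exists>a. s a \<noteq> 0" by auto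
    qed
    then obtain t where t: "\<And>s. s \<in> SS \<Longrightarrow> s t \<noteq> 0" by blast
    have tf: "peval f (Tt t) \<noteq> 0" "peval f0 (Tt t) \<noteq> 0" using t unfolding SS_def by auto
    have tc: "cc l t \<noteq> 0" "pd (vv l t) (y l) \<noteq> 0" if "l < h" for l using t that unfolding SS_def by auto
    have "findep (\<lambda>l. pb (vv l t)) {..<h}"
      by (rule points_of_RR(1)[of "Tt t" "\<lambda>l. cc l t"]) (use f0(3)[OF tf(2)] in \<open>simp_all add: Tt_def\<close>)
    then have "rank1_decomp R h (\<lambda>y. \<Sum>l<h. cc l t * pd (vv l t) y) (\<lambda>l. cc l t) (\<lambda>l. pd (vv l t))"
      by (rule rank1_decompI) (use tc in \<open>metis\<close>)+
    then have "has_rank1_decomp R h (Tt t)" unfolding has_rank1_decomp_def Tt_def by blast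
    moreover have "Tt t \<in> coord_space Y" using spaces(3) by (simp add: Tt_def coord_space_def)
    ultimately show "\<exists>T'\<in>\<Sigma>. peval f T' \<noteq> 0 \<and> peval f0 T' \<noteq> 0" using tf unfolding \<Sigma>_def by blast
  qed
  moreover have "criterion h T" if T: "T \<in> \<Sigma>" "peval f0 T \<noteq> 0" for T
  proof -
    obtain lam U where "rank1_decomp R h T lam U" using T(1) unfolding \<Sigma>_def has_rank1_decomp_def by blast
    then obtain e u where u: "\<And>l. l < h \<Longrightarrow> lam l \<noteq> 0 \<and> e l \<noteq> 0 \<and> pd (u l) \<noteq> (\<lambda>_. 0) \<and> U l = (\<lambda>y. e l * pd (u l) y)"
      and Tu: "T = (\<lambda>y. \<Sum>l<h. (lam l * e l) * pd (u l) y)" using decomp_points by blast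
    show ?thesis by (rule criterion_generic[OF Tu]) (use u f0(3)[OF T(2)] in auto)
  qed
  ultimately show ?thesis by blast
qed

end

context rank_one_family
begin

theorem criterion_effective:
  assumes h: "0 < h"
    and v1: "findep (\<lambda>l. pa (v1 l)) {..<h}" "findep (\<lambda>l. pb (v1 l)) {..<h}"
    and m: "2 \<le> m" "mixed_comb Qs Q (\<lambda>l. pb (v1 l)) h m"
  defines "\<Sigma> \<equiv> {T \<in> coord_space Y. has_rank1_decomp R h T}"
  shows "(\<forall>T\<in>\<Sigma>. criterion h T \<longrightarrow> identifiable R h T) \<and>
    (\<exists>G. dense_open_in (zariski Y) \<Sigma> G \<and> (\<forall>T\<in>G. criterion h T))"
proof
  show "\<forall>T\<in>\<Sigma>. criterion h T \<longrightarrow> identifiable R h T"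
    using criterion_identifiable h by (auto simp: \<Sigma>_def)
  obtain \<xi> where \<xi>: "\<forall>i\<in>{..<h}. \<forall>j\<in>{..<h}. lfun A (\<xi> i) (pa (v1 j)) = (if i = j then 1 else 0)"
    using findep_dual[OF finite_lessThan fin(1) v1(1)] spaces(1) by blast
  have "\<forall>\<mu>\<in>mixed_msets h m. \<exists>\<beta>. \<forall>c. mmono \<mu> c = (\<Sum>\<nu>\<in>msets h (m - 2). \<Sum>q\<in>Qs.
      \<beta> \<nu> q * (mmono \<nu> c * Q q (\<lambda>x. \<Sum>l<h. c l * pb (v1 l) x)))"
    using m(2) unfolding mixed_comb_def mixed_msets_def by simp
  from bchoice[OF this] obtain \<beta> where \<beta>: "\<forall>\<mu>\<in>mixed_msets h m. \<forall>c. mmono \<mu> c = (\<Sum>\<nu>\<in>msets h (m - 2). \<Sum>q\<in>Qs.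
      \<beta> \<mu> \<nu> q * (mmono \<nu> c * Q q (\<lambda>x. \<Sum>l<h. c l * pb (v1 l) x)))" by blast
  interpret generic_frame A X Y \<sigma> \<kappa> pa pb pd R Z path Qs Q \<gamma> h m v1 \<xi> \<beta>
    by unfold_locales (use h m v1 \<xi> \<beta> in auto)
  show "\<exists>G. dense_open_in (zariski Y) \<Sigma> G \<and> (\<forall>T\<in>G. criterion h T)"
    unfolding \<Sigma>_def by (rule criterion_dense)
qed

end

subsection \<open>The dimension of the Segre-Veronese variety\<close>

lemma midx_card: "card (midx p n b) = (\<Prod>i<p. (n i + b i) choose n i)"
proof -
  let ?S = "PiE {..<p} (\<lambda>a. multisets_of_size {..n a} (b a))"
  have "bij_betw (\<lambda>K. restrict K {..<p}) (midx p n b) ?S"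
  proof (rule bij_betwI[where g = "\<lambda>f a. if a < p then f a else {#}"])
    show "(\<lambda>K. restrict K {..<p}) \<in> midx p n b \<rightarrow> ?S"
      by (auto simp: midx_def multisets_of_size_def)
    show "(\<lambda>f a. if a < p then f a else {#}) \<in> ?S \<rightarrow> midx p n b"
      by (auto simp: midx_def multisets_of_size_def PiE_def Pi_def)
    show "(\<lambda>a. if a < p then restrict K {..<p} a else {#}) = K" if "K \<in> midx p n b" for K
      using that by (auto simp: midx_def fun_eq_iff)
    show "restrict (\<lambda>a. if a < p then f a else {#}) {..<p} = f" if "f \<in> ?S" for f
    proof
      fix a show "restrict (\<lambda>a. if a < p then f a else {#}) {..<p} a = f a"
        using PiE_arb[OF that, of a] by auto
    qed
  qed
  then have "card (midx p n b) = card ?S" by (rule bij_betw_same_card)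
  also have "\<dots> = (\<Prod>a<p. card (multisets_of_size {..n a} (b a)))" by (simp add: card_PiE)
  also have "\<dots> = (\<Prod>a<p. (n a + b a) choose n a)"
  proof (rule prod.cong[OF refl])
    fix a
    have "card (multisets_of_size {..n a} (b a)) = (card {..n a} + b a - 1) choose b a"
      by (rule card_multisets_of_size) auto
    also have "\<dots> = (n a + b a) choose b a" by simp
    also have "\<dots> = (n a + b a) choose n a" by (subst binomial_symmetric) auto
    finally show "card (multisets_of_size {..n a} (b a)) = (n a + b a) choose n a" .
  qed
  finally show ?thesis .
qed

section \<open>Dual spaces in coordinates\<close>

definition unit_fun :: "'x \<Rightarrow> 'x \<Rightarrow> 'k::zero_neq_one" where
  "unit_fun x = (\<lambda>y. if y = x then 1 else 0)"

lemma dual_space_eval: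
  fixes \<phi> :: "('x \<Rightarrow> 'k::field) \<Rightarrow> 'k"
  assumes X: "finite X" and \<phi>: "\<phi> \<in> dual_space (coord_space X)" and v: "v \<in> coord_space X"
  shows "\<phi> v = (\<Sum>x\<in>X. \<phi> (unit_fun x) * v x)"
proof -
  have u: "fscale c (unit_fun x) \<in> coord_space X" if "x \<in> X" for c x
    using that by (auto simp: coord_space_def unit_fun_def fscale_def)
  have u1: "unit_fun x \<in> (coord_space X :: ('x \<Rightarrow> 'k) set)" if "x \<in> X" for x
    using that by (auto simp: coord_space_def unit_fun_def)
  have add: "\<phi> (u + v) = \<phi> u + \<phi> v" if "u \<in> coord_space X" "v \<in> coord_space X" for u v
    using \<phi> that by (simp add: dual_space_def)
  have scale: "\<phi> (fscale c v) = c * \<phi> v" if "v \<in> coord_space X" for c v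
    using \<phi> that by (simp add: dual_space_def)
  have z: "\<phi> 0 = 0" using scale[of 0 0] by (simp add: coord_space_def fscale_def zero_fun_def)
  have "(\<Sum>x\<in>S. fscale (v x) (unit_fun x)) \<in> coord_space X \<and>
      \<phi> (\<Sum>x\<in>S. fscale (v x) (unit_fun x)) = (\<Sum>x\<in>S. \<phi> (unit_fun x) * v x)" if "S \<subseteq> X" for S
    using finite_subset[OF that X] that
  proof (induction S rule: finite_induct)
    case empty
    show ?case unfolding sum.empty using z z[unfolded zero_fun_def] by (auto simp: coord_space_def)
  next
    case (insert s S)
    then have IH: "(\<Sum>x\<in>S. fscale (v x) (unit_fun x)) \<in> coord_space X"
      "\<phi> (\<Sum>x\<in>S. fscale (v x) (unit_fun x)) = (\<Sum>x\<in>S. \<phi> (unit_fun x) * v x)" and s: "s \<in> X" by auto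
    have "fscale (v s) (unit_fun s) + (\<Sum>x\<in>S. fscale (v x) (unit_fun x)) \<in> coord_space X"
      using u[OF s, of "v s"] IH(1) by (simp add: coord_space_def)
    moreover have "\<phi> (fscale (v s) (unit_fun s) + (\<Sum>x\<in>S. fscale (v x) (unit_fun x)))
        = \<phi> (unit_fun s) * v s + (\<Sum>x\<in>S. \<phi> (unit_fun x) * v x)"
      unfolding add[OF u[OF s] IH(1)] scale[OF u1[OF s]] IH(2) by (simp add: mult.commute)
    ultimately show ?case unfolding sum.insert[OF insert.hyps] by (intro conjI)
  qed
  moreover have "v = (\<Sum>x\<in>X. fscale (v x) (unit_fun x))"
    using v X by (auto simp: fun_eq_iff sum_fun_apply fscale_def unit_fun_def coord_space_def if_distrib cong: if_cong)
  ultimately show ?thesis by (metis subset_refl)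
qed

definition coord_functional :: "'x set \<Rightarrow> ('x \<Rightarrow> 'k::field) \<Rightarrow> ('x \<Rightarrow> 'k) \<Rightarrow> 'k" where
  "coord_functional X c v = (if v \<in> coord_space X then \<Sum>x\<in>X. c x * v x else 0)"

lemma coord_functional_dual: "coord_functional X c \<in> dual_space (coord_space X)"
  unfolding dual_space_def coord_functional_def
  by (auto simp: coord_space_def fscale_def distrib_left sum.distrib sum_distrib_left mult_ac)

lemma dim_dual_space:
  assumes "finite X"
  shows "fvs.dim (dual_space (coord_space X :: ('x \<Rightarrow> 'k::field) set)) \<le> card X"
proof -
  let ?e = "\<lambda>x. coord_functional X (unit_fun x) :: ('x \<Rightarrow> 'k) \<Rightarrow> 'k"
  have "dual_space (coord_space X) \<subseteq> fvs.span (?e ` X)"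
  proof
    fix \<phi> :: "('x \<Rightarrow> 'k) \<Rightarrow> 'k" assume \<phi>: "\<phi> \<in> dual_space (coord_space X)"
    have e: "\<phi> v = (\<Sum>x\<in>X. \<phi> (unit_fun x) * ?e x v)" for v
    proof (cases "v \<in> coord_space X")
      case True
      have "(\<Sum>y\<in>X. unit_fun x y * v y) = v x" if "x \<in> X" for x
        using that assms by (simp add: unit_fun_def if_distrib[where f = "\<lambda>c. c * _"] cong: if_cong)
      then show ?thesis using True dual_space_eval[OF assms \<phi> True] by (simp add: coord_functional_def)
    next
      case False
      then show ?thesis using \<phi> by (simp add: coord_functional_def dual_space_def)
    qed
    show "\<phi> \<in> fvs.span (?e ` X)" unfolding fvs_span_family[OF assms]
      by (intro CollectI exI[of _ "\<lambda>x. \<phi> (unit_fun x)"] allI e)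
  qed
  then have "fvs.dim (dual_space (coord_space X :: ('x \<Rightarrow> 'k) set)) \<le> card (?e ` X)"
    by (rule fvs_dim_le_card) (use assms in simp)
  also have "\<dots> \<le> card X" by (rule card_image_le[OF assms])
  finally show ?thesis .
qed

definition face_point :: "(nat \<times> nat) set \<Rightarrow> (nat \<times> nat \<Rightarrow> 'k::field) \<Rightarrow> nat \<Rightarrow> nat \<Rightarrow> 'k" where
  "face_point B s = (\<lambda>a j. if j = 0 then 1 else if (a, j) \<in> B then s (a, j) else 0)"

text \<open>Only the affine coordinates in \<open>B\<close> vary. Enlarging \<open>B\<close> by one
  element at a time gives a chain of irreducible closed subsets, which bounds the dimension of the
  variety from below.\<close>

definition face_cone :: "nat \<Rightarrow> (nat \<Rightarrow> nat) \<Rightarrow> (nat \<Rightarrow> nat) \<Rightarrow> (nat \<times> nat) set \<Rightarrow> ((nat \<Rightarrow> nat multiset) \<Rightarrow> 'k::field) set" where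
  "face_cone p n b B = {fscale c (power_tensor p n b (face_point B s)) | c s. True}"

lemma face_cone_mono: "B \<subseteq> B' \<Longrightarrow> face_cone p n b B \<subseteq> (face_cone p n b B' :: (_ \<Rightarrow> 'k::field) set)"
proof
  fix v :: "(nat \<Rightarrow> nat multiset) \<Rightarrow> 'k"
  assume B: "B \<subseteq> B'" and "v \<in> face_cone p n b B"
  then obtain c s where v: "v = fscale c (power_tensor p n b (face_point B s))" unfolding face_cone_def by blast
  have "face_point B s = face_point B' (\<lambda>e. if e \<in> B then s e else 0)"
    using B by (auto simp: face_point_def fun_eq_iff)
  then show "v \<in> face_cone p n b B'" unfolding v face_cone_def by auto
qed

lemma face_cone_sub: "face_cone p n b B \<subseteq> segre_veronese_cone p n b"
  unfolding face_cone_def segre_veronese_cone_def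
proof (intro subsetI)
  fix v :: "(nat \<Rightarrow> nat multiset) \<Rightarrow> 'a"
  assume "v \<in> {fscale c (power_tensor p n b (face_point B s)) | c s. True}"
  then obtain c s where v: "v = fscale c (power_tensor p n b (face_point B s))" by blast
  have "\<forall>i<p. \<exists>j\<le>n i. face_point B s i j \<noteq> 0" by (auto simp: face_point_def intro!: exI[of _ 0])
  then show "v \<in> {fscale c (power_tensor p n b v) |c v. \<forall>i<p. \<exists>j\<le>n i. v i j \<noteq> 0}" unfolding v by blast
qed

lemma polyfun_power_tensor:
  assumes "\<And>a j. polyfun (\<lambda>t. v t a j)"
  shows "polyfun (\<lambda>t. power_tensor p n b (v t) K)"
  unfolding power_tensor_def by (intro polyfun_intros assms)

text \<open>A face is parametrised by scalars and affine coordinates, and two of its points are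
  joined by a polynomial curve of parameters; so it is irreducible.\<close>

lemma face_cone_point:
  assumes I: "I \<subseteq> van_ideal (midx p n b) (face_cone p n b B :: (_ \<Rightarrow> 'k::field_char_0) set)"
  shows "van_ideal (midx p n b) (face_cone p n b B :: (_ \<Rightarrow> 'k) set) \<in> proj_points (midx p n b) I"
proof (rule van_ideal_point[OF _ _ _ I])
  let ?X = "midx p n b"
  show "(\<lambda>x. t * v x) \<in> face_cone p n b B" if v: "v \<in> face_cone p n b B" for v :: "_ \<Rightarrow> 'k" and t
  proof -
    obtain c s where "v = fscale c (power_tensor p n b (face_point B s))" using v unfolding face_cone_def by blast
    then have "(\<lambda>x. t * v x) = fscale (t * c) (power_tensor p n b (face_point B s))"
      by (simp add: fscale_def mult.assoc)
    then show ?thesis unfolding face_cone_def by blast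
  qed
  have "power_tensor p n b (face_point B (\<lambda>_. 0)) (pure_idx p b (\<lambda>_. 0)) = (1 :: 'k)"
    using pure_idx_midx[of p "\<lambda>_. 0" n b] by (simp add: power_tensor_def pure_idx_def face_point_def)
  moreover have "pure_idx p b (\<lambda>_. 0) \<in> ?X" by (rule pure_idx_midx) simp
  moreover have "power_tensor p n b (face_point B (\<lambda>_. 0)) \<in> (face_cone p n b B :: (_ \<Rightarrow> 'k) set)"
    unfolding face_cone_def by (intro CollectI exI[of _ 1] exI[of _ "\<lambda>_. 0"]) (simp add: fscale_def)
  ultimately show "\<exists>v\<in>face_cone p n b B. \<exists>x\<in>?X. v x \<noteq> (0 :: 'k)"
    by (metis one_neq_zero)
  fix f g :: "(nat \<Rightarrow> nat multiset, 'k) mpoly" and v w :: "(nat \<Rightarrow> nat multiset) \<Rightarrow> 'k"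
  assume vw: "v \<in> face_cone p n b B" "w \<in> face_cone p n b B" "peval f v \<noteq> 0" "peval g w \<noteq> 0"
  obtain c s where v: "v = fscale c (power_tensor p n b (face_point B s))" using vw unfolding face_cone_def by blast
  obtain c' s' where w: "w = fscale c' (power_tensor p n b (face_point B s'))" using vw unfolding face_cone_def by blast
  define r where "r = (\<lambda>t. fscale ((1 - t) * c + t * c') (power_tensor p n b (face_point B (\<lambda>e. (1 - t) * s e + t * s' e))))"
  have r01: "r 0 = v" "r 1 = w" by (simp_all add: r_def v w)
  have rp: "polyfun (\<lambda>t. r t K)" for K
  proof -
    have "polyfun (\<lambda>t. power_tensor p n b (face_point B (\<lambda>e. (1 - t) * s e + t * s' e)) K)"
      by (rule polyfun_power_tensor) (auto simp: face_point_def intro!: polyfun_intros)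
    then show ?thesis unfolding r_def fscale_def by (intro polyfun_intros)
  qed
  have "\<exists>t\<in>UNIV. \<forall>i\<in>{f, g}. peval i (\<lambda>K. r t K) \<noteq> 0"
  proof (intro polyfun_common_nonzero peval_polyfun rp)
    fix i assume "i \<in> {f, g}"
    then show "\<exists>a. peval i (\<lambda>K. r a K) \<noteq> 0" using vw(3,4) r01 by (metis insertE singletonD)
  qed (auto simp: infinite_UNIV_char_0)
  then obtain t where "peval f (r t) \<noteq> 0" "peval g (r t) \<noteq> 0" by auto
  moreover have "r t \<in> face_cone p n b B" unfolding r_def face_cone_def by blast
  ultimately show "\<exists>u\<in>face_cone p n b B. peval f u \<noteq> 0 \<and> peval g u \<noteq> 0" by blast
qed

text \<open>The entry \<open>K\<close>, with a single \<open>j\<close> in the factor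
  \<open>a\<close> and zeros otherwise, contains the coordinate \<open>(a, j)\<close> as a factor.
  It vanishes on the face of \<open>B\<close>, and it is 1 at the point of the face of
  \<open>B'\<close> whose free coordinates are all 1.\<close>

lemma face_cone_strict:
  assumes z: "(a, j) \<in> ztan p n b" "(a, j) \<notin> B" "(a, j) \<in> B'"
  shows "van_ideal (midx p n b) (face_cone p n b B :: (_ \<Rightarrow> 'k::field_char_0) set)
     \<noteq> van_ideal (midx p n b) (face_cone p n b B')"
proof -
  have aj: "a < p" "0 < b a" "j \<le> n a" "j \<noteq> 0" using z(1) by (auto simp: tan_idx_def)
  define K where "K = repl_idx (pure_idx p b (\<lambda>_. 0)) a 0 j"
  have "pure_idx p b (\<lambda>_. 0) \<in> midx p n b" by (rule pure_idx_midx) simp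
  then have KX: "K \<in> midx p n b" unfolding K_def
    by (rule repl_idx_midx) (use aj in \<open>auto simp: pure_idx_def\<close>)
  have jK: "j \<in># K a" by (simp add: K_def repl_idx_def)
  have "power_tensor p n b (face_point B s) K = 0" for s :: "_ \<Rightarrow> 'k"
  proof -
    have "face_point B s a j = 0" using aj z(2) by (simp add: face_point_def)
    then have "(\<Prod>j\<in>#K a. face_point B s a j) = 0" using jK by (auto simp: prod_mset_zero_iff intro!: image_eqI)
    then show ?thesis using KX aj(1) by (auto simp: power_tensor_def intro!: prod_zero)
  qed
  then have "pvar K \<in> van_ideal (midx p n b) (face_cone p n b B :: (_ \<Rightarrow> 'k) set)"
    using KX by (auto simp: van_ideal_def face_cone_def fscale_def polys_pvar)
  moreover have "pvar K \<notin> van_ideal (midx p n b) (face_cone p n b B' :: (_ \<Rightarrow> 'k) set)"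
  proof
    assume c: "pvar K \<in> van_ideal (midx p n b) (face_cone p n b B' :: (_ \<Rightarrow> 'k) set)"
    let ?s = "\<lambda>_. 1 :: 'k"
    have "fscale 1 (power_tensor p n b (face_point B' ?s)) \<in> face_cone p n b B'" unfolding face_cone_def by blast
    then have "power_tensor p n b (face_point B' ?s) K = 0" using c by (auto simp: van_ideal_def fscale_def)
    moreover have "face_point B' ?s i l = 1" if "i < p" "l \<in># K i" for i l
      using that aj z(3) by (auto simp: K_def repl_idx_def pure_idx_def face_point_def split: if_splits dest: in_diffD)
    ultimately have "(\<Prod>i<p. \<Prod>l\<in>#K i. 1 :: 'k) = 0"
      using KX by (simp add: power_tensor_def cong: prod.cong image_mset_cong)
    then show False by simp
  qed
  ultimately show ?thesis by blast
qed

text \<open>The faces belonging to the initial segments of an enumeration of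
  \<open>ztan p n b\<close> form a chain of \<open>card (ztan p n b) + 1\<close> points. A lower
  bound is what turns the numerical hypothesis into the inequality between cardinalities.\<close>

lemma scheme_dim_segre_veronese:
  "ereal (real (card (ztan p n b)))
     \<le> scheme_dim (midx p n b) (van_ideal (midx p n b) (segre_veronese_cone p n b :: (_ \<Rightarrow> 'k::field_char_0) set))"
proof -
  let ?X = "midx p n b" and ?N = "card (ztan p n b)"
  let ?I = "van_ideal ?X (segre_veronese_cone p n b :: (_ \<Rightarrow> 'k) set)"
  obtain f where f: "bij_betw f {0..<?N} (ztan p n b)" using ex_bij_betw_nat_finite[OF finite_tan_idx] by blast
  define V where "V = (\<lambda>s. van_ideal ?X (face_cone p n b (f ` {0..<s}) :: (_ \<Rightarrow> 'k) set))"
  have anti: "V s' \<subseteq> V s" if "s \<le> s'" for s s'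
    unfolding V_def by (intro van_ideal_antimono face_cone_mono image_mono) (use that in auto)
  have strict: "V s \<noteq> V s'" if s: "s < s'" "s' \<le> ?N" for s s'
  proof -
    have fs: "f s \<in> ztan p n b" using f s by (auto simp: bij_betw_def)
    moreover have "f s \<notin> f ` {0..<s}"
    proof
      assume "f s \<in> f ` {0..<s}"
      then obtain s2 where "s2 < s" "f s = f s2" by auto
      then show False using f s inj_onD[of f "{0..<?N}" s s2] by (auto simp: bij_betw_def)
    qed
    moreover have "f s \<in> f ` {0..<s'}" using s by auto
    moreover obtain a j where "f s = (a, j)" by (cases "f s")
    ultimately show ?thesis unfolding V_def by (intro face_cone_strict[of a j]) auto
  qed
  have inj: "inj_on V {..?N}"
    by (rule linorder_inj_onI) (use strict in auto)
  have "V ` {..?N} \<subseteq> proj_points ?X ?I"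
    unfolding V_def by (auto intro!: face_cone_point van_ideal_antimono face_cone_sub)
  moreover have "chain\<^sub>\<subseteq> (V ` {..?N})"
    unfolding chain_subset_def using anti by (metis imageE nat_le_linear)
  ultimately have "ereal (real (card (V ` {..?N})) - 1) \<le> scheme_dim ?X ?I"
    unfolding scheme_dim_def by (intro SUP_upper) auto
  then show ?thesis using inj by (simp add: card_image)
qed

subsection \<open>The mixed symmetric case\<close>

definition seg_coeff :: "(nat \<Rightarrow> nat multiset) \<times> (nat \<Rightarrow> nat multiset) \<times> (nat \<Rightarrow> nat multiset) \<times> (nat \<Rightarrow> nat multiset)
    \<Rightarrow> (nat \<Rightarrow> nat multiset) \<Rightarrow> (nat \<Rightarrow> nat multiset) \<Rightarrow> 'k::comm_ring_1" where
  "seg_coeff = (\<lambda>(K, L, K', L') x x'. (if x = K \<and> x' = L then 1 else 0) - (if x = K' \<and> x' = L' then 1 else 0))"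

lemma sum_two_deltas:
  assumes "finite X" "K \<in> X" "L \<in> X"
  shows "(\<Sum>x\<in>X. \<Sum>x'\<in>X. (if x = K \<and> x' = L then c else 0) * f x x') = (c * f K L :: 'k::comm_ring_1)"
proof -
  have "(\<Sum>x'\<in>X. (if x = K \<and> x' = L then c else 0) * f x x') = (if x = K then c * f x L else 0)" for x
    using assms by (cases "x = K") (auto simp: if_distrib[where f = "\<lambda>c. c * _"] cong: if_cong)
  then show ?thesis using assms by simp
qed

lemma seg_quadf_coeff:
  assumes "finite X" "q \<in> seg_quad X"
  shows "seg_quadf q y = (\<Sum>x\<in>X. \<Sum>x'\<in>X. seg_coeff q x x' * (y x * y x'))"
proof -
  obtain K L K' L' where q: "q = (K, L, K', L')" "K \<in> X" "L \<in> X" "K' \<in> X" "L' \<in> X"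
    using assms(2) by (auto simp: seg_quad_def)
  show ?thesis
    unfolding q(1) seg_coeff_def seg_quadf_def prod.case left_diff_distrib sum_subtractf
      sum_two_deltas[OF assms(1) q(2,3)] sum_two_deltas[OF assms(1) q(4,5)] by simp
qed

lemma power_tensor_plus:
  assumes "I \<in> midx p n a" "J \<in> midx p n b" "\<And>i. i < p \<Longrightarrow> a i + b i = d i"
  shows "(\<lambda>i. I i + J i) \<in> midx p n d"
    and "power_tensor p n d v (\<lambda>i. I i + J i) = power_tensor p n a v I * power_tensor p n b v J"
proof -
  show *: "(\<lambda>i. I i + J i) \<in> midx p n d" using assms by (auto simp: midx_def)
  show "power_tensor p n d v (\<lambda>i. I i + J i) = power_tensor p n a v I * power_tensor p n b v J"
    using * assms by (simp add: power_tensor_def prod.distrib)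
qed

lemma midx_split:
  assumes K: "K \<in> midx p n d" and ab: "\<And>i. i < p \<Longrightarrow> a i + b i = d i"
  shows "\<exists>I\<in>midx p n a. \<exists>J\<in>midx p n b. (\<lambda>i. I i + J i) = K"
proof -
  have "\<exists>N. N \<subseteq># M \<and> size N = k" if "k \<le> size M" for k and M :: "nat multiset"
  proof -
    obtain xs where "mset xs = M" using ex_mset by blast
    moreover have "mset (take k xs) + mset (drop k xs) = mset xs"
      by (metis append_take_drop_id mset_append)
    ultimately have "mset (take k xs) \<subseteq># M" by (metis mset_subset_eq_add_left)
    moreover have "length xs = size M" using \<open>mset xs = M\<close> by auto
    ultimately show ?thesis using \<open>k \<le> size M\<close> by (intro exI[of _ "mset (take k xs)"]) simp
  qed
  moreover have "a i \<le> size (K i)" if "i < p" for i using midxD(1)[OF K that] ab[OF that] by simp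
  ultimately have "\<forall>i\<in>{..<p}. \<exists>N. N \<subseteq># K i \<and> size N = a i" by simp
  from bchoice[OF this] obtain N where N: "\<And>i. i < p \<Longrightarrow> N i \<subseteq># K i \<and> size (N i) = a i" by auto
  define I where "I = (\<lambda>i. if i < p then N i else {#})"
  have "set_mset (N i) \<subseteq> {..n i}" if "i < p" for i
    using set_mset_mono[of "N i" "K i"] N[OF that] midxD(2)[OF K that] by auto
  then have "I \<in> midx p n a" using N by (simp add: I_def midx_def)
  moreover have "(\<lambda>i. K i - I i) \<in> midx p n b"
  proof -
    have "size (K i - I i) = b i" if "i < p" for i
      using N[OF that] midxD(1)[OF K that] ab[OF that] that by (simp add: I_def size_Diff_submset)
    moreover have "set_mset (K i - I i) \<subseteq> {..n i}" if "i < p" for i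
      using midxD(2)[OF K that] by (auto dest: in_diffD)
    ultimately show ?thesis using midxD(3)[OF K] by (simp add: midx_def)
  qed
  moreover have "(\<lambda>i. I i + (K i - I i)) = K" using N midxD(3)[OF K] by (auto simp: I_def fun_eq_iff)
  ultimately show ?thesis by (intro bexI[of _ I] bexI[of _ "\<lambda>i. K i - I i"])
qed

text \<open>As all degrees are positive, a zero vector among the factors kills every entry.
  Conversely, nonzero coordinates \<open>j i\<close> of the factors give a nonzero entry at
  \<open>pure_idx p d j\<close>.\<close>

lemma power_tensor_nonzero:
  assumes "\<And>i. i < p \<Longrightarrow> 0 < d i"
  shows "power_tensor p n d v \<noteq> (\<lambda>_. 0 :: 'k::field) \<longleftrightarrow> (\<forall>i<p. \<exists>j\<le>n i. v i j \<noteq> 0)"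
proof
  assume "power_tensor p n d v \<noteq> (\<lambda>_. 0)"
  then obtain K where K: "power_tensor p n d v K \<noteq> 0" by auto
  then have KX: "K \<in> midx p n d" and nz: "\<And>i. i < p \<Longrightarrow> (\<Prod>j\<in>#K i. v i j) \<noteq> 0"
    by (auto simp: power_tensor_def split: if_splits)
  show "\<forall>i<p. \<exists>j\<le>n i. v i j \<noteq> 0"
  proof (intro allI impI)
    fix i assume i: "i < p"
    have "K i \<noteq> {#}" using midxD(1)[OF KX i] assms[OF i] by auto
    then obtain j where j: "j \<in># K i" by blast
    then have "v i j \<noteq> 0" using nz[OF i] by (auto simp: prod_mset_zero_iff)
    then show "\<exists>j\<le>n i. v i j \<noteq> 0" using midxD(2)[OF KX i j] by blast
  qed
next
  assume "\<forall>i<p. \<exists>j\<le>n i. v i j \<noteq> 0"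
  then have "\<forall>i\<in>{..<p}. \<exists>j. j \<le> n i \<and> v i j \<noteq> 0" by simp
  from bchoice[OF this] obtain j where j: "\<And>i. i < p \<Longrightarrow> j i \<le> n i \<and> v i (j i) \<noteq> 0" by auto
  have "pure_idx p d j \<in> midx p n d" by (rule pure_idx_midx) (use j in auto)
  then have "power_tensor p n d v (pure_idx p d j) \<noteq> 0" using j by (simp add: power_tensor_def pure_idx_def)
  then show "power_tensor p n d v \<noteq> (\<lambda>_. 0)" by auto
qed

lemma seg_quadf_power_tensor:
  assumes "q \<in> seg_quad (midx p n b)"
  shows "seg_quadf q (power_tensor p n b v) = (0 :: 'k::field)"
proof -
  obtain K L K' L' where q: "q = (K, L, K', L')" by (cases q)
  have "K \<in> midx p n b" "L \<in> midx p n b" "K' \<in> midx p n b" "L' \<in> midx p n b"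
    using assms by (auto simp: q seg_quad_def)
  then show ?thesis using mmono_seg_quad[of K L K' L' "midx p n b" p] assms
    by (simp add: q seg_quadf_def power_tensor_mmono)
qed

text \<open>All scalars \<kappa> are 1 because the entries of symmetric tensors carry no multinomial
  factors, so an entry of a power tensor splits as a plain product.\<close>

lemma mixed_rank_one_family:
  assumes ab: "\<And>i. i < p \<Longrightarrow> 0 < d i \<and> a i + b i = d i"
  shows "rank_one_family (midx p n a) (midx p n b) (midx p n d) (\<lambda>I J i. I i + J i) (\<lambda>_ _. 1 :: 'k::field_char_0)
     (power_tensor p n a) (power_tensor p n b) (power_tensor p n d) (rank1_tensors p n d) (segre_veronese_cone p n b)
     (\<lambda>u v t i j. (1 - t) * u i j + t * v i j) (seg_quad (midx p n b)) seg_quadf seg_coeff"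
proof
  have nz: "power_tensor p n d v \<noteq> (\<lambda>_. 0 :: 'k) \<longleftrightarrow> (\<forall>i<p. \<exists>j\<le>n i. v i j \<noteq> 0)" for v
    using power_tensor_nonzero ab by blast
  show "power_tensor p n d v \<in> rank1_tensors p n d" if "power_tensor p n d v \<noteq> (\<lambda>_. 0 :: 'k)" for v
    unfolding rank1_tensors_def using that[unfolded nz]
    by (intro CollectI exI[of _ 1] exI[of _ v]) (simp add: fscale_def)
  show "\<exists>c v. c \<noteq> 0 \<and> power_tensor p n d v \<noteq> (\<lambda>_. 0 :: 'k) \<and> U = (\<lambda>y. c * power_tensor p n d v y)"
    if "U \<in> rank1_tensors p n d" for U
    using that unfolding rank1_tensors_def nz by (auto simp: fscale_def)
  show "segre_veronese_cone p n b = {(\<lambda>x. c * power_tensor p n b v x) | c v. power_tensor p n d v \<noteq> (\<lambda>_. 0 :: 'k)}"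
    unfolding segre_veronese_cone_def nz by (simp add: fscale_def)
  show "\<exists>I\<in>midx p n a. \<exists>x\<in>midx p n b. (\<lambda>i. I i + x i) = y" if "y \<in> midx p n d" for y
    using midx_split[OF that] ab by blast
  show "(\<lambda>i. I i + x i) \<in> midx p n d" if "I \<in> midx p n a" "x \<in> midx p n b" for I x
    using power_tensor_plus(1)[OF that] ab by blast
  show "1 * power_tensor p n d v (\<lambda>i. I i + x i) = power_tensor p n a v I * power_tensor p n b v x"
    if "I \<in> midx p n a" "x \<in> midx p n b" for I x and v :: "nat \<Rightarrow> nat \<Rightarrow> 'k"
    using power_tensor_plus(2)[OF that, of d v] ab by simp
  show "polyfun (\<lambda>t. power_tensor p n d (\<lambda>i j. (1 - t) * u i j + t * v i j) y)" for u v y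
    by (intro polyfun_power_tensor polyfun_intros)
  show "seg_quadf q y = (\<Sum>x\<in>midx p n b. \<Sum>x'\<in>midx p n b. seg_coeff q x x' * (y x * y x'))"
    if "q \<in> seg_quad (midx p n b)" for q y
    using seg_quadf_coeff[OF finite_midx that] .
  show "seg_quadf q (power_tensor p n b v) = (0 :: 'k)" if "q \<in> seg_quad (midx p n b)" for q v
    using seg_quadf_power_tensor[OF that] .
qed (auto simp: finite_midx finite_seg_quad coord_space_def power_tensor_def)

lemma generic_points_exist:
  assumes k: "is_real_or_complex TYPE('k::field_char_0)"
    and "h \<le> card (midx p n a)" "card (ztan p n b) + h + 1 \<le> card (midx p n b)"
  obtains v :: "nat \<Rightarrow> nat \<Rightarrow> nat \<Rightarrow> 'k::field_char_0" and m where "findep (\<lambda>l. power_tensor p n a (v l)) {..<h}"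
    "findep (\<lambda>l. power_tensor p n b (v l)) {..<h}" "2 \<le> m"
    "mixed_comb (seg_quad (midx p n b)) seg_quadf (\<lambda>l. power_tensor p n b (v l)) h m"
proof -
  obtain \<psi> :: "'k \<Rightarrow> complex" and \<rho> where r: "\<And>x y. \<psi> (x + y) = \<psi> x + \<psi> y" "\<And>x y. \<psi> (x * y) = \<psi> x * \<psi> y" "\<psi> 1 = 1"
    "\<And>x y. \<rho> (x + y) = \<rho> x + \<rho> y" "\<And>x y. \<rho> (\<psi> x * y) = x * \<rho> y" "\<rho> 1 = 1" "uncountable (range \<psi>)"
    using real_or_complex_retract[OF k] by metis
  show ?thesis using generic_points[OF r assms(2,3)] that by blast
qed

text \<open>A functional on a coordinate space is given by its values at the unit vectors, and these
  are the coefficients with which the rows of the flattening are combined.\<close>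

lemma flattening_image:
  assumes fam: "rank_one_family (midx p n a) (midx p n b) (midx p n d) (\<lambda>I J i. I i + J i) (\<lambda>_ _. 1 :: 'k::field_char_0)
     pa pb pd R Z pth Qs Q \<gamma>"
  shows "rank_one_family.WT (midx p n a) (midx p n b) (\<lambda>I J i. I i + J i) (\<lambda>_ _. 1 :: 'k) T
     = flattening p n a b T ` dual_space (sym_tensors p n a)"
proof -
  interpret rank_one_family "midx p n a" "midx p n b" "midx p n d" "\<lambda>I J i. I i + J i" "\<lambda>_ _. 1 :: 'k"
    pa pb pd R Z pth Qs Q \<gamma> by (rule fam)
  let ?A = "midx p n a"
  let ?col = "\<lambda>J I. if I \<in> ?A then T (\<lambda>i. I i + J i) else 0"
  have col: "?col J \<in> coord_space ?A" for J by (simp add: coord_space_def)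
  have ev: "(\<Sum>I\<in>?A. c I * ?col J I) = (\<Sum>I\<in>?A. c I * Row T I J)" if "J \<in> midx p n b" for c J
    using that by (intro sum.cong) (auto simp: Row_def)
  have WT: "y \<in> WT T \<longleftrightarrow> (\<exists>c. y = (\<lambda>J. \<Sum>I\<in>?A. c I * Row T I J))" for y
    unfolding WT_def fvs_span_family[OF finite_midx] by (auto simp: fun_eq_iff)
  have out: "(\<Sum>I\<in>?A. c I * Row T I J) = 0" if "J \<notin> midx p n b" for c J
    using that by (simp add: Row_def)
  show ?thesis
  proof (intro equalityI subsetI)
    fix y assume "y \<in> WT T"
    then obtain c where c: "y = (\<lambda>J. \<Sum>I\<in>?A. c I * Row T I J)" unfolding WT by blast
    have "flattening p n a b T (coord_functional ?A c) J = y J" for J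
      unfolding flattening_def c using ev out by (simp add: coord_functional_def col)
    then have "y = flattening p n a b T (coord_functional ?A c)" by (simp add: fun_eq_iff)
    then show "y \<in> flattening p n a b T ` dual_space (sym_tensors p n a)"
      using coord_functional_dual unfolding sym_tensors_def by blast
  next
    fix y assume "y \<in> flattening p n a b T ` dual_space (sym_tensors p n a)"
    then obtain \<phi> where \<phi>: "\<phi> \<in> dual_space (coord_space ?A)" "y = flattening p n a b T \<phi>"
      unfolding sym_tensors_def by blast
    have e: "y J = (\<Sum>I\<in>?A. \<phi> (unit_fun I) * Row T I J)" for J
    proof (cases "J \<in> midx p n b")
      case True
      then show ?thesis unfolding \<phi>(2) flattening_def
        using dual_space_eval[OF finite_midx \<phi>(1) col[of J]] ev[OF True] by simp
    next
      case False
      then show ?thesis unfolding \<phi>(2) flattening_def using out by simp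
    qed
    show "y \<in> WT T" unfolding WT by (intro exI[of _ "\<lambda>I. \<phi> (unit_fun I)"] ext e)
  qed
qed

theorem mixed_symmetric_effective:
  assumes k: "is_real_or_complex TYPE('k::field_char_0)"
    and h: "0 < h" and ab: "\<And>i. i < p \<Longrightarrow> 0 < d i \<and> a i + b i = d i"
    and ha: "h \<le> fvs.dim (dual_space (sym_tensors p n a :: ((nat \<Rightarrow> nat multiset) \<Rightarrow> 'k) set))"
    and N: "ereal (real (\<Prod>i<p. (n i + b i) choose n i)) >
          ereal (real h) + scheme_dim (midx p n b)
            (van_ideal (midx p n b) (segre_veronese_cone p n b :: ((nat \<Rightarrow> nat multiset) \<Rightarrow> 'k) set))"
  defines "W \<equiv> (\<lambda>T. flattening p n a b T ` dual_space (sym_tensors p n a :: ((nat \<Rightarrow> nat multiset) \<Rightarrow> 'k) set))"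
  defines "cond \<equiv> (\<lambda>T. lin_pdim (W T) = int h - 1 \<and>
     scheme_dim (midx p n b) (inter_ideal (midx p n b) (W T) (segre_veronese_cone p n b)) = 0 \<and>
     scheme_length (midx p n b) (inter_ideal (midx p n b) (W T) (segre_veronese_cone p n b)) h)"
  defines "\<Sigma> \<equiv> {T \<in> sym_tensors p n d. has_rank1_decomp (rank1_tensors p n d) h T}"
  shows "(\<forall>T\<in>\<Sigma>. cond T \<longrightarrow> identifiable (rank1_tensors p n d) h T) \<and>
    (\<exists>G. dense_open_in (zariski (midx p n d)) \<Sigma> G \<and> (\<forall>T\<in>G. cond T))"
proof -
  have "h \<le> card (midx p n a)" using ha dim_dual_space[OF finite_midx, of p n a] unfolding sym_tensors_def by (meson le_trans)
  \<comment> \<open>The strict inequality of the hypothesis holds between natural numbers and so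
    provides the additional 1.\<close>
  moreover have "card (ztan p n b) + h + 1 \<le> card (midx p n b)"
  proof -
    have "ereal (real h) + ereal (real (card (ztan p n b))) < ereal (real (card (midx p n b)))"
      unfolding midx_card using N add_left_mono[OF scheme_dim_segre_veronese[where 'k = 'k], of "ereal (real h)" p n b]
      by (rule le_less_trans[rotated])
    then have "real h + real (card (ztan p n b)) < real (card (midx p n b))" by simp
    then show ?thesis by linarith
  qed
  ultimately obtain v :: "nat \<Rightarrow> nat \<Rightarrow> nat \<Rightarrow> 'k" and m where v: "findep (\<lambda>l. power_tensor p n a (v l)) {..<h}"
    "findep (\<lambda>l. power_tensor p n b (v l)) {..<h}" "2 \<le> m"
    "mixed_comb (seg_quad (midx p n b)) seg_quadf (\<lambda>l. power_tensor p n b (v l)) h m"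
    using generic_points_exist[OF k] by metis
  note fam = mixed_rank_one_family[OF ab, where 'k = 'k and n = n, of p]
  interpret rank_one_family "midx p n a" "midx p n b" "midx p n d" "\<lambda>I J i. I i + J i" "\<lambda>_ _. 1 :: 'k"
     "power_tensor p n a" "power_tensor p n b" "power_tensor p n d" "rank1_tensors p n d" "segre_veronese_cone p n b"
     "\<lambda>u v t i j. (1 - t) * u i j + t * v i j" "seg_quad (midx p n b)" seg_quadf seg_coeff
    by (rule fam)
  have "WT T = W T" for T unfolding W_def by (rule flattening_image[OF fam])
  then have "criterion h = cond" by (simp add: fun_eq_iff criterion_def cond_def)
  then show ?thesis
    using criterion_effective[OF h v] unfolding \<Sigma>_def sym_tensors_def by simp
qed

subsection \<open>The symmetric case\<close>

lemma single_times: "Poly_Mapping.single a c * f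
    = (\<Sum>m\<in>Poly_Mapping.keys f. Poly_Mapping.single (a + m) (c * Poly_Mapping.lookup f m))"
  for f :: "('x, 'k::comm_ring_1) mpoly"
proof -
  have "Poly_Mapping.single a c * (\<Sum>m\<in>Poly_Mapping.keys f. Poly_Mapping.single m (Poly_Mapping.lookup f m))
      = (\<Sum>m\<in>Poly_Mapping.keys f. Poly_Mapping.single (a + m) (c * Poly_Mapping.lookup f m))"
    by (simp add: sum_distrib_left mult_single)
  then show ?thesis using poly_sum_monomials[of f] by simp
qed

lemma lookup_sum_single:
  "finite S \<Longrightarrow> Poly_Mapping.lookup (\<Sum>m\<in>S. Poly_Mapping.single (u m) (c m)) k = (\<Sum>m\<in>S. if u m = k then c m else 0)"
  by (simp add: lookup_sum lookup_single when_def)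

lemma lookup_pscale: "Poly_Mapping.lookup (pscale c f) m = c * Poly_Mapping.lookup f m"
  unfolding pscale_def single_times by (simp add: lookup_sum_single in_keys_iff)

lemma lookup_pvar_mult:
  "Poly_Mapping.lookup (pvar j * f) m
     = (if Poly_Mapping.lookup m j = 0 then 0 else Poly_Mapping.lookup f (m - Poly_Mapping.single j 1))"
proof -
  have *: "Poly_Mapping.lookup (pvar j * f) m
      = (\<Sum>m'\<in>Poly_Mapping.keys f. if Poly_Mapping.single j 1 + m' = m then Poly_Mapping.lookup f m' else 0)"
    unfolding pvar_def single_times by (simp add: lookup_sum_single)
  show ?thesis
  proof (cases "Poly_Mapping.lookup m j = 0")
    case True
    have "Poly_Mapping.single j 1 + m' \<noteq> m" for m'
      using True by (auto simp: lookup_add)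
    then show ?thesis unfolding * using True by simp
  next
    case False
    have "Poly_Mapping.single j 1 + m' = m \<longleftrightarrow> m' = m - Poly_Mapping.single j 1" for m'
    proof
      assume "m' = m - Poly_Mapping.single j 1"
      then show "Poly_Mapping.single j 1 + m' = m"
        using False by (intro poly_mapping_eqI) (auto simp: lookup_add lookup_minus lookup_single when_def)
    qed (auto simp: add.commute)
    then show ?thesis unfolding * using False by (simp add: in_keys_iff)
  qed
qed

text \<open>The product of the factorials of the exponents, the common denominator of multinomial
  coefficients and the source of the factors in iterated derivatives.\<close>

definition mfac :: "('x \<Rightarrow>\<^sub>0 nat) \<Rightarrow> 'k::field_char_0" where
  "mfac m = (\<Prod>x\<in>Poly_Mapping.keys m. fact (Poly_Mapping.lookup m x))"

lemma mfac_nonzero [simp]: "mfac m \<noteq> 0"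
  by (simp add: mfac_def)

lemma mfac_superset:
  assumes "finite A" "Poly_Mapping.keys m \<subseteq> A"
  shows "mfac m = (\<Prod>x\<in>A. fact (Poly_Mapping.lookup m x))"
  unfolding mfac_def using assms by (intro prod.mono_neutral_left) (auto simp: in_keys_iff)

lemma mfac_add_single:
  "mfac (m + Poly_Mapping.single i 1) = of_nat (Poly_Mapping.lookup m i + 1) * (mfac m :: 'k::field_char_0)"
proof -
  let ?A = "insert i (Poly_Mapping.keys m)" and ?m = "m + Poly_Mapping.single i 1"
  have k: "Poly_Mapping.keys ?m \<subseteq> ?A" using Poly_Mapping.keys_add[of m "Poly_Mapping.single i 1"] by auto
  have "(mfac ?m :: 'k) = fact (Poly_Mapping.lookup ?m i) * (\<Prod>x\<in>?A - {i}. fact (Poly_Mapping.lookup ?m x))"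
    by (subst mfac_superset[OF _ k], simp, rule prod.remove) auto
  also have "(\<Prod>x\<in>?A - {i}. fact (Poly_Mapping.lookup ?m x)) = (\<Prod>x\<in>?A - {i}. fact (Poly_Mapping.lookup m x) :: 'k)"
    by (intro prod.cong) (auto simp: lookup_add lookup_single)
  also have "fact (Poly_Mapping.lookup ?m i) = of_nat (Poly_Mapping.lookup m i + 1) * (fact (Poly_Mapping.lookup m i) :: 'k)"
    by (simp add: lookup_add)
  finally have "(mfac ?m :: 'k) = of_nat (Poly_Mapping.lookup m i + 1)
      * (fact (Poly_Mapping.lookup m i) * (\<Prod>x\<in>?A - {i}. fact (Poly_Mapping.lookup m x)))"
    by (simp only: mult.assoc)
  also have "fact (Poly_Mapping.lookup m i) * (\<Prod>x\<in>?A - {i}. fact (Poly_Mapping.lookup m x)) = (mfac m :: 'k)"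
    by (subst mfac_superset[of ?A], simp, blast, rule prod.remove[symmetric]) auto
  finally show ?thesis .
qed

lemma mdeg_add: "mdeg (m + m') = mdeg m + mdeg m'"
proof -
  let ?A = "Poly_Mapping.keys m \<union> Poly_Mapping.keys m'"
  have "Poly_Mapping.keys (m + m') \<subseteq> ?A" by (rule Poly_Mapping.keys_add)
  then show ?thesis by (simp add: mdeg_superset[of ?A] lookup_add sum.distrib)
qed

lemma keys_add_nat: "Poly_Mapping.keys (m + m') = Poly_Mapping.keys m \<union> Poly_Mapping.keys (m' :: 'x \<Rightarrow>\<^sub>0 nat)"
  by (auto simp: in_keys_iff lookup_add)

lemma mdeg_single [simp]: "mdeg (Poly_Mapping.single j e) = e"
  by (simp add: mdeg_def)

lemma mdeg_eq_0: "mdeg m = 0 \<longleftrightarrow> m = 0"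
  by (auto simp: mdeg_def in_keys_iff intro!: poly_mapping_eqI)

lemma mons_add: "m \<in> mons n e \<Longrightarrow> m' \<in> mons n e' \<Longrightarrow> m + m' \<in> mons n (e + e')"
  by (auto simp: mons_def keys_add_nat mdeg_add)

lemma mons_single: "j \<le> n \<Longrightarrow> Poly_Mapping.single j e \<in> mons n e"
  by (auto simp: mons_def)

lemma mons_addD: "m + m' \<in> mons n e \<Longrightarrow> m' \<in> mons n e' \<Longrightarrow> m \<in> mons n (e - e')"
  by (auto simp: mons_def keys_add_nat mdeg_add)

lemma mons_0: "mons n 0 = {0}"
  by (auto simp: mons_def mdeg_eq_0)

lemma split_single:
  assumes "Poly_Mapping.lookup m j \<noteq> (0::nat)"
  shows "m = (m - Poly_Mapping.single j 1) + Poly_Mapping.single j 1"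
  using assms by (intro poly_mapping_eqI) (auto simp: lookup_add lookup_minus lookup_single when_def)

lemma mons_Suc:
  assumes "m \<in> mons n (Suc e)"
  obtains m' j where "m' \<in> mons n e" "j \<le> n" "m = m' + Poly_Mapping.single j 1"
proof -
  have "m \<noteq> 0" using assms by (auto simp: mons_def mdeg_def)
  then obtain j where j: "Poly_Mapping.lookup m j \<noteq> 0" by (metis poly_mapping_eqI lookup_zero)
  then have "j \<in> Poly_Mapping.keys m" by (simp add: in_keys_iff)
  then have "j \<le> n" using assms by (auto simp: mons_def)
  moreover have "m - Poly_Mapping.single j 1 \<in> mons n e"
    using mons_addD[of "m - Poly_Mapping.single j 1" "Poly_Mapping.single j 1" n "Suc e" 1]
      assms split_single[OF j] mons_single[OF \<open>j \<le> n\<close>, of 1] by simp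
  ultimately show thesis using that split_single[OF j] by blast
qed

lemma mons_split:
  assumes "m \<in> mons n d" "s \<le> d"
  shows "\<exists>\<alpha>\<in>mons n s. \<exists>\<beta>\<in>mons n (d - s). \<alpha> + \<beta> = m"
  using assms
proof (induction s)
  case 0
  then show ?case by (intro bexI[of _ 0] bexI[of _ m]) (auto simp: mons_0)
next
  case (Suc s)
  then obtain \<alpha> \<beta> where *: "\<alpha> \<in> mons n s" "\<beta> \<in> mons n (d - s)" "\<alpha> + \<beta> = m" by auto
  have "d - s = Suc (d - Suc s)" using Suc.prems by simp
  then obtain \<beta>' j where b: "\<beta>' \<in> mons n (d - Suc s)" "j \<le> n" "\<beta> = \<beta>' + Poly_Mapping.single j 1"
    using mons_Suc[of \<beta> n "d - Suc s"] *(2) by metis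
  show ?case
    using mons_add[OF *(1) mons_single[OF b(2), of 1]] b *(3)
    by (intro bexI[of _ "\<alpha> + Poly_Mapping.single j 1"] bexI[of _ \<beta>']) (auto simp: add_ac)
qed

section \<open>Powers of linear forms and their derivatives\<close>

definition linform :: "nat \<Rightarrow> (nat \<Rightarrow> 'k::comm_ring_1) \<Rightarrow> (nat, 'k) mpoly" where
  "linform n w = (\<Sum>j\<le>n. pscale (w j) (pvar j))"

text \<open>The multinomial theorem. After splitting off one factor, the variable \<open>j\<close>
  contributes \<open>Poly_Mapping.lookup m j\<close> times a value common to all \<open>j\<close>,
  and these exponents add up to \<open>e + 1\<close>.\<close>

lemma lookup_linform_power:
  fixes w :: "nat \<Rightarrow> 'k::field_char_0"
  shows "Poly_Mapping.lookup (linform n w ^ e) m = (if m \<in> mons n e then fact e / mfac m * monv m w else 0)"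
proof (induction e arbitrary: m)
  case 0
  show ?case by (auto simp: mons_0 mfac_def lookup_one when_def)
next
  case (Suc e)
  let ?e = "\<lambda>j. Poly_Mapping.single j (1::nat)"
  have "linform n w * linform n w ^ e = (\<Sum>j\<le>n. pscale (w j) (pvar j * linform n w ^ e))"
    by (simp add: linform_def sum_distrib_right pscale_def mult.assoc)
  then have *: "Poly_Mapping.lookup (linform n w ^ Suc e) m = (\<Sum>j\<le>n. w j * (if Poly_Mapping.lookup m j = 0 then 0
      else Poly_Mapping.lookup (linform n w ^ e) (m - ?e j)))"
    by (simp add: lookup_sum lookup_pscale lookup_pvar_mult)
  show ?case
  proof (cases "m \<in> mons n (Suc e)")
    case True
    have t: "w j * (if Poly_Mapping.lookup m j = 0 then 0 else Poly_Mapping.lookup (linform n w ^ e) (m - ?e j))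
        = fact e / mfac m * monv m w * of_nat (Poly_Mapping.lookup m j)" if j: "j \<le> n" for j
    proof (cases "Poly_Mapping.lookup m j = 0")
      case False
      define m' where "m' = m - ?e j"
      have m: "m = m' + ?e j" unfolding m'_def by (rule split_single[OF False])
      have "m' \<in> mons n e" using mons_addD[of m' "?e j" n "Suc e" 1] True mons_single[OF j, of 1] m by simp
      moreover have "(mfac m :: 'k) = of_nat (Poly_Mapping.lookup m j) * mfac m'"
        unfolding m mfac_add_single by (simp add: lookup_add)
      moreover have "monv m w = monv m' w * w j" unfolding m by (simp add: monv_add monv_single)
      ultimately show ?thesis using False unfolding m'_def[symmetric] by (simp add: Suc.IH field_simps)
    qed simp
    have "(\<Sum>j\<le>n. Poly_Mapping.lookup m j) = Suc e"
      using mdeg_superset[of "{..n}" m] True by (simp add: mons_def)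
    then have "(\<Sum>j\<le>n. of_nat (Poly_Mapping.lookup m j)) = (of_nat (Suc e) :: 'k)" by (simp only: of_nat_sum[symmetric])
    moreover have "Poly_Mapping.lookup (linform n w ^ Suc e) m
        = fact e / mfac m * monv m w * (\<Sum>j\<le>n. of_nat (Poly_Mapping.lookup m j))"
      unfolding * sum_distrib_left by (intro sum.cong refl t) simp
    moreover have "fact (Suc e) = (fact e * of_nat (Suc e) :: 'k)" by simp
    ultimately show ?thesis using True by (simp only: if_True) (simp del: of_nat_Suc fact_Suc)
  next
    case False
    have "m - ?e j \<notin> mons n e" if "j \<le> n" "Poly_Mapping.lookup m j \<noteq> 0" for j
    proof
      assume "m - ?e j \<in> mons n e"
      from mons_add[OF this mons_single[OF that(1), of 1]] show False
        using False split_single[OF that(2)] by simp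
    qed
    then show ?thesis unfolding * using False by (auto simp: Suc.IH intro!: sum.neutral)
  qed
qed

lemma linform_forms: "linform n w \<in> forms {..n} 1"
  unfolding linform_def by (rule linear_form) simp

lemma forms_1_linform:
  fixes L :: "(nat, 'k::field_char_0) mpoly"
  assumes L: "L \<in> forms {..n} 1"
  shows "L = linform n (\<lambda>j. Poly_Mapping.lookup L (Poly_Mapping.single j 1))"
proof (rule poly_mapping_eqI)
  fix m
  let ?w = "\<lambda>j. Poly_Mapping.lookup L (Poly_Mapping.single j 1)"
  have l: "Poly_Mapping.lookup (linform n ?w) m = (if m \<in> mons n 1 then 1 / mfac m * monv m ?w else 0)"
    using lookup_linform_power[of n ?w 1 m] by simp
  show "Poly_Mapping.lookup L m = Poly_Mapping.lookup (linform n ?w) m"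
  proof (cases "m \<in> mons n 1")
    case True
    then obtain m' j where "m' \<in> mons n 0" "j \<le> n" "m = m' + Poly_Mapping.single j 1"
      using mons_Suc[of m n 0] by auto
    then have "m = Poly_Mapping.single j 1" by (simp add: mons_0)
    then show ?thesis unfolding l using True by (simp add: mfac_def monv_single)
  next
    case False
    then show ?thesis unfolding l using L by (auto simp: forms_def polys_def mons_def in_keys_iff)
  qed
qed

lemma linform_power_nonzero:
  fixes w :: "nat \<Rightarrow> 'k::field_char_0"
  assumes "0 < d"
  shows "Poly_Mapping.lookup (linform n w ^ d) \<noteq> (\<lambda>_. 0) \<longleftrightarrow> linform n w \<noteq> 0"
proof
  assume "Poly_Mapping.lookup (linform n w ^ d) \<noteq> (\<lambda>_. 0)"
  then show "linform n w \<noteq> 0" using assms by (auto simp: fun_eq_iff power_0_left)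
next
  assume "linform n w \<noteq> 0"
  then obtain j where j: "j \<le> n" "w j \<noteq> 0" unfolding linform_def
    by (metis (no_types, lifting) atMost_iff pscale_simps(6) sum.neutral)
  have "Poly_Mapping.lookup (linform n w ^ d) (Poly_Mapping.single j d) = w j ^ d"
    using mons_single[OF j(1), of d] assms by (simp add: lookup_linform_power monv_single mfac_def)
  then show "Poly_Mapping.lookup (linform n w ^ d) \<noteq> (\<lambda>_. 0)" using j(2) by (auto dest: fun_cong[of _ _ "Poly_Mapping.single j d"])
qed

lemma linear_powers_alt:
  "linear_powers n d = {Poly_Mapping.lookup (linform n w ^ d) | w :: nat \<Rightarrow> 'k::field_char_0. linform n w \<noteq> 0}"
  unfolding linear_powers_def
proof (intro equalityI subsetI)
  fix y assume "y \<in> {Poly_Mapping.lookup (L ^ d) | L :: (nat, 'k) mpoly. L \<in> forms {..n} 1 \<and> L \<noteq> 0}"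
  then obtain L :: "(nat, 'k) mpoly" where L: "y = Poly_Mapping.lookup (L ^ d)" "L \<in> forms {..n} 1" "L \<noteq> 0" by blast
  define w where "w = (\<lambda>j. Poly_Mapping.lookup L (Poly_Mapping.single j 1))"
  have "L = linform n w" unfolding w_def by (rule forms_1_linform[OF L(2)])
  then show "y \<in> {Poly_Mapping.lookup (linform n w ^ d) | w. linform n w \<noteq> 0}" using L by blast
next
  fix y assume "y \<in> {Poly_Mapping.lookup (linform n w ^ d) | w :: nat \<Rightarrow> 'k. linform n w \<noteq> 0}"
  then show "y \<in> {Poly_Mapping.lookup (L ^ d) | L. L \<in> forms {..n} 1 \<and> L \<noteq> 0}" using linform_forms by blast
qed

lemma lookup_partial_deriv:
  "Poly_Mapping.lookup (partial_deriv i F) m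
     = of_nat (Poly_Mapping.lookup m i + 1) * Poly_Mapping.lookup F (m + Poly_Mapping.single i 1)"
proof -
  let ?c = "\<lambda>m'. of_nat (Poly_Mapping.lookup m' i) * Poly_Mapping.lookup F m'" and ?e = "Poly_Mapping.single i (1::nat)"
  have "Poly_Mapping.lookup (partial_deriv i F) m = (\<Sum>m'\<in>Poly_Mapping.keys F. if m' - ?e = m then ?c m' else 0)"
    unfolding partial_deriv_def by (simp add: lookup_sum_single)
  also have "\<dots> = (\<Sum>m'\<in>Poly_Mapping.keys F. if m' = m + ?e then ?c m' else 0)"
  proof (rule sum.cong[OF refl])
    fix m'
    show "(if m' - ?e = m then ?c m' else 0) = (if m' = m + ?e then ?c m' else 0)"
    proof (cases "Poly_Mapping.lookup m' i = 0")
      case False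
      then show ?thesis using split_single[OF False] by auto
    qed simp
  qed
  also have "\<dots> = ?c (m + ?e)" by (simp add: in_keys_iff)
  finally show ?thesis by (simp add: lookup_add)
qed

text \<open>Differentiating \<alpha> times multiplies the coefficient of \<alpha> + \<beta> by
  (\<alpha> + \<beta>)! / \<beta>!. So the derivatives of order \<open>s\<close> are the rows of a
  flattening, up to these nonzero factors.\<close>

lemma partial_derivs_lookup:
  fixes F :: "(nat, 'k::field_char_0) mpoly"
  shows "Poly_Mapping.lookup ` partial_derivs n s F
    = (\<lambda>\<alpha> \<beta>. mfac (\<alpha> + \<beta>) / mfac \<beta> * Poly_Mapping.lookup F (\<alpha> + \<beta>)) ` mons n s"
proof (induction s)
  case 0
  show ?case by (simp add: mons_0 fun_eq_iff)
next
  case (Suc s)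
  let ?r = "\<lambda>\<alpha> \<beta>. mfac (\<alpha> + \<beta>) / mfac \<beta> * Poly_Mapping.lookup F (\<alpha> + \<beta>)"
  have step: "Poly_Mapping.lookup (partial_deriv i D) = ?r (\<alpha> + Poly_Mapping.single i 1)"
    if D: "Poly_Mapping.lookup D = ?r \<alpha>" for i D \<alpha>
  proof
    fix \<beta>
    have c: "\<alpha> + (\<beta> + Poly_Mapping.single i 1) = \<alpha> + Poly_Mapping.single i 1 + \<beta>" by (simp add: add_ac)
    have nz: "of_nat (Poly_Mapping.lookup \<beta> i + 1) \<noteq> (0 :: 'k)" by (simp only: of_nat_eq_0_iff)
    have "Poly_Mapping.lookup (partial_deriv i D) \<beta>
        = of_nat (Poly_Mapping.lookup \<beta> i + 1) * ?r \<alpha> (\<beta> + Poly_Mapping.single i 1)"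
      unfolding lookup_partial_deriv D ..
    also have "\<dots> = ?r (\<alpha> + Poly_Mapping.single i 1) \<beta>"
      unfolding c mfac_add_single[of \<beta>] using nz by (simp add: field_simps del: of_nat_add of_nat_1 of_nat_Suc)
    finally show "Poly_Mapping.lookup (partial_deriv i D) \<beta> = ?r (\<alpha> + Poly_Mapping.single i 1) \<beta>" .
  qed
  show ?case
  proof (intro equalityI subsetI)
    fix y assume "y \<in> Poly_Mapping.lookup ` partial_derivs n (Suc s) F"
    then obtain i D where i: "i \<le> n" "D \<in> partial_derivs n s F" "y = Poly_Mapping.lookup (partial_deriv i D)" by auto
    then obtain \<alpha> where "\<alpha> \<in> mons n s" "Poly_Mapping.lookup D = ?r \<alpha>" using Suc.IH by blast
    then show "y \<in> ?r ` mons n (Suc s)"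
      using step[of D \<alpha> i] i(3) mons_add[of \<alpha> n s "Poly_Mapping.single i 1" 1] mons_single[OF i(1), of 1] by auto
  next
    fix y assume "y \<in> ?r ` mons n (Suc s)"
    then obtain \<alpha>' where a': "\<alpha>' \<in> mons n (Suc s)" "y = ?r \<alpha>'" by blast
    obtain \<alpha> i where a: "\<alpha> \<in> mons n s" "i \<le> n" "\<alpha>' = \<alpha> + Poly_Mapping.single i 1"
      using a'(1) by (rule mons_Suc)
    have "?r \<alpha> \<in> Poly_Mapping.lookup ` partial_derivs n s F" unfolding Suc.IH using a(1) by (rule imageI)
    then obtain D where "D \<in> partial_derivs n s F" "Poly_Mapping.lookup D = ?r \<alpha>" by force
    then have "partial_deriv i D \<in> partial_derivs n (Suc s) F" "y = Poly_Mapping.lookup (partial_deriv i D)"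
      using step[of D \<alpha> i] a a'(2) by auto
    then show "y \<in> Poly_Mapping.lookup ` partial_derivs n (Suc s) F" by blast
  qed
qed

text \<open>Identifies the indices of symmetric tensors with one factor with monomials, so that the
  generic points found for tensors also serve for polynomials.\<close>

definition mon_of :: "nat \<Rightarrow> (nat \<Rightarrow> nat multiset) \<Rightarrow> nat \<Rightarrow>\<^sub>0 nat" where
  "mon_of n J = (\<Sum>j\<le>n. Poly_Mapping.single j (count (J 0) j))"

abbreviation vidx :: "nat \<Rightarrow> nat \<Rightarrow> (nat \<Rightarrow> nat multiset) set" where
  "vidx n e \<equiv> midx 1 (\<lambda>_. n) (\<lambda>_. e)"

lemma lookup_mon_of: "Poly_Mapping.lookup (mon_of n J) j = (if j \<le> n then count (J 0) j else 0)"
  unfolding mon_of_def by (simp add: lookup_sum lookup_single when_def)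

lemma mon_of_mons: "J \<in> vidx n e \<Longrightarrow> mon_of n J \<in> mons n e"
proof -
  assume J: "J \<in> vidx n e"
  have k: "Poly_Mapping.keys (mon_of n J) \<subseteq> {..n}" by (auto simp: in_keys_iff lookup_mon_of split: if_splits)
  have "mdeg (mon_of n J) = (\<Sum>j\<le>n. count (J 0) j)"
    by (subst mdeg_superset[OF _ k]) (auto simp: lookup_mon_of)
  also have "\<dots> = size (J 0)" using J by (intro size_eq_sum_count[symmetric]) (auto simp: midx_def)
  also have "\<dots> = e" using J by (simp add: midx_def)
  finally show ?thesis using k by (simp add: mons_def)
qed

lemma mon_of_onto: "m \<in> mons n e \<Longrightarrow> \<exists>J\<in>vidx n e. mon_of n J = m"
proof
  assume m: "m \<in> mons n e"
  define J where "J = (\<lambda>i::nat. if i = 0 then \<Sum>j\<le>n. replicate_mset (Poly_Mapping.lookup m j) j else {#})"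
  have c: "count (J 0) j = (if j \<le> n then Poly_Mapping.lookup m j else 0)" for j
    by (simp add: J_def count_sum)
  show "mon_of n J = m"
  proof (rule poly_mapping_eqI)
    fix j show "Poly_Mapping.lookup (mon_of n J) j = Poly_Mapping.lookup m j"
      using m by (auto simp: lookup_mon_of c mons_def in_keys_iff)
  qed
  have s: "set_mset (J 0) \<subseteq> {..n}"
    by (auto simp: c count_greater_zero_iff[symmetric] simp del: count_greater_zero_iff split: if_splits)
  have "size (J 0) = e" unfolding size_eq_sum_count[OF s] using m mdeg_superset[of "{..n}" m] by (simp add: c mons_def)
  then show "J \<in> vidx n e" using s by (simp add: midx_def J_def)
qed

lemma finite_mons: "finite (mons n e)"
proof -
  have "mons n e \<subseteq> mon_of n ` vidx n e" using mon_of_onto by blast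
  then show ?thesis using finite_midx finite_surj by blast
qed

lemma power_tensor_monv:
  assumes "J \<in> vidx n e"
  shows "power_tensor 1 (\<lambda>_. n) (\<lambda>_. e) v J = monv (mon_of n J) (v 0)"
proof -
  have s: "set_mset (J 0) \<subseteq> {..n}" using assms by (auto simp: midx_def)
  have "power_tensor 1 (\<lambda>_. n) (\<lambda>_. e) v J = (\<Prod>j\<in>set_mset (J 0). v 0 j ^ count (J 0) j)"
    using assms by (simp add: power_tensor_def image_prod_mset_multiplicity)
  also have "\<dots> = (\<Prod>j\<le>n. v 0 j ^ count (J 0) j)"
    using s by (intro prod.mono_neutral_left) (auto simp: not_in_iff)
  also have "\<dots> = monv (mon_of n J) (v 0)"
    by (subst monv_superset[of "{..n}"]) (auto simp: lookup_mon_of in_keys_iff split: if_splits)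
  finally show ?thesis .
qed

definition multinom :: "nat \<Rightarrow> ('x \<Rightarrow>\<^sub>0 nat) \<Rightarrow> 'k::field_char_0" where
  "multinom e m = fact e / mfac m"

text \<open>Dividing the coefficients by the multinomials turns powers of linear forms into power tensors.\<close>

definition ver_quadf where
  "ver_quadf n e q y = seg_quadf q (\<lambda>J. y (mon_of n J) / multinom e (mon_of n J))"

definition ver_coeff :: "nat \<Rightarrow> nat \<Rightarrow> _ \<Rightarrow> (nat \<Rightarrow>\<^sub>0 nat) \<Rightarrow> (nat \<Rightarrow>\<^sub>0 nat) \<Rightarrow> 'k::field_char_0" where
  "ver_coeff n e = (\<lambda>(K, L, K', L') x x'.
     (if x = mon_of n K \<and> x' = mon_of n L then 1 / (multinom e (mon_of n K) * multinom e (mon_of n L)) else 0)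
     - (if x = mon_of n K' \<and> x' = mon_of n L' then 1 / (multinom e (mon_of n K') * multinom e (mon_of n L')) else 0))"

lemma ver_quadf_coeff:
  assumes "q \<in> seg_quad (vidx n e)"
  shows "ver_quadf n e q y = (\<Sum>x\<in>mons n e. \<Sum>x'\<in>mons n e. ver_coeff n e q x x' * (y x * y x'))"
proof -
  obtain K L K' L' where q: "q = (K, L, K', L')" "mon_of n K \<in> mons n e" "mon_of n L \<in> mons n e"
    "mon_of n K' \<in> mons n e" "mon_of n L' \<in> mons n e"
    using assms mon_of_mons by (auto simp: seg_quad_def)
  show ?thesis
    unfolding q(1) ver_coeff_def ver_quadf_def seg_quadf_def prod.case left_diff_distrib sum_subtractf
      sum_two_deltas[OF finite_mons q(2,3)] sum_two_deltas[OF finite_mons q(4,5)] by simp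
qed

lemma linform_power_tensor:
  assumes "J \<in> vidx n e"
  shows "Poly_Mapping.lookup (linform n w ^ e) (mon_of n J) / multinom e (mon_of n J)
     = power_tensor 1 (\<lambda>_. n) (\<lambda>_. e) (\<lambda>_. w) J"
  using mon_of_mons[OF assms] by (simp add: lookup_linform_power power_tensor_monv[OF assms] multinom_def del: One_nat_def)

lemma ver_quadf_comb:
  fixes h :: nat
  assumes "q \<in> seg_quad (vidx n e)"
  shows "ver_quadf n e q (\<lambda>x. \<Sum>l<h. c l * Poly_Mapping.lookup (linform n (w l) ^ e) x)
     = seg_quadf q (\<lambda>J. \<Sum>l<h. c l * power_tensor 1 (\<lambda>_. n) (\<lambda>_. e) (\<lambda>_. w l) J)"
proof -
  obtain K L K' L' where q: "q = (K, L, K', L')" "K \<in> vidx n e" "L \<in> vidx n e" "K' \<in> vidx n e" "L' \<in> vidx n e"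
    using assms by (auto simp: seg_quad_def)
  have "(\<Sum>l<h. c l * Poly_Mapping.lookup (linform n (w l) ^ e) (mon_of n J)) / multinom e (mon_of n J)
      = (\<Sum>l<h. c l * power_tensor 1 (\<lambda>_. n) (\<lambda>_. e) (\<lambda>_. w l) J)" if "J \<in> vidx n e" for J
    unfolding linform_power_tensor[OF that, symmetric] by (simp add: sum_divide_distrib)
  then show ?thesis using q by (simp add: ver_quadf_def seg_quadf_def)
qed

text \<open>For a linear form \<open>L\<close> with coefficients \<open>w\<close>, the derivative of
  order \<alpha> of \<open>L ^ d\<close> is \<open>fact d / fact (d - s)\<close> times the monomial
  \<alpha> at \<open>w\<close> times \<open>L ^ (d - s)\<close>. This is the splitting into a row
  factor and a point, and the scalars \<kappa> are the factors produced by differentiation.\<close>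

lemma veronese_family:
  assumes "0 < d" "s \<le> d"
  shows "rank_one_family (mons n s) (mons n (d - s)) (mons n d) (+)
     (\<lambda>\<alpha> \<beta>. mfac (\<alpha> + \<beta>) / mfac \<beta> :: 'k::field_char_0)
     (\<lambda>w \<alpha>. if \<alpha> \<in> mons n s then fact d / fact (d - s) * monv \<alpha> w else 0)
     (\<lambda>w. Poly_Mapping.lookup (linform n w ^ (d - s))) (\<lambda>w. Poly_Mapping.lookup (linform n w ^ d))
     (linear_powers n d) (veronese_cone n (d - s)) (\<lambda>u v t j. (1 - t) * u j + t * v j)
     (seg_quad (vidx n (d - s))) (ver_quadf n (d - s)) (ver_coeff n (d - s))"
proof
  let ?p = "\<lambda>w e. Poly_Mapping.lookup (linform n (w :: nat \<Rightarrow> 'k) ^ e)"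
  note nz = linform_power_nonzero[OF assms(1)]
  show "\<exists>I\<in>mons n s. \<exists>x\<in>mons n (d - s). I + x = y" if "y \<in> mons n d" for y
    by (rule mons_split[OF that assms(2)])
  show pl: "I + x \<in> mons n d" if "I \<in> mons n s" "x \<in> mons n (d - s)" for I x
    using mons_add[OF that] assms(2) by simp
  show "mfac (I + x) / mfac x * ?p v d (I + x)
      = (if I \<in> mons n s then fact d / fact (d - s) * monv I v else 0) * ?p v (d - s) x"
    if "I \<in> mons n s" "x \<in> mons n (d - s)" for I x v
    using that pl[OF that] by (simp add: lookup_linform_power monv_add)
  show "?p v d \<in> linear_powers n d" if "?p v d \<noteq> (\<lambda>_. 0)" for v
    using that unfolding nz linear_powers_alt by blast
  show "\<exists>c v. c \<noteq> 0 \<and> ?p v d \<noteq> (\<lambda>_. 0) \<and> U = (\<lambda>y. c * ?p v d y)" if U: "U \<in> linear_powers n d" for U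
  proof -
    obtain w where "U = ?p w d" "linform n w \<noteq> 0" using U unfolding linear_powers_alt by blast
    then show ?thesis unfolding nz by (intro exI[of _ 1] exI[of _ w]) simp
  qed
  show "veronese_cone n (d - s) = {(\<lambda>x. c * ?p v (d - s) x) | c v. ?p v d \<noteq> (\<lambda>_. 0)}"
    unfolding veronese_cone_def linear_powers_alt nz fscale_def by blast
  show "polyfun (\<lambda>t. ?p (\<lambda>j. (1 - t) * u j + t * v j) d y)" for u v y
    unfolding lookup_linform_power monv_def by (intro polyfun_intros)
  show "ver_quadf n (d - s) q y
      = (\<Sum>x\<in>mons n (d - s). \<Sum>x'\<in>mons n (d - s). ver_coeff n (d - s) q x x' * (y x * y x'))"
    if "q \<in> seg_quad (vidx n (d - s))" for q and y :: "_ \<Rightarrow> 'k"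
    by (rule ver_quadf_coeff[OF that])
  show "ver_quadf n (d - s) q (?p v (d - s)) = 0" if "q \<in> seg_quad (vidx n (d - s))" for q v
    using ver_quadf_comb[OF that, where h = 1 and c = "\<lambda>_. 1" and w = "\<lambda>_. v"] seg_quadf_power_tensor[OF that]
    by (simp del: One_nat_def)
qed (auto simp: finite_mons finite_midx finite_seg_quad coord_space_def lookup_linform_power)

text \<open>Entries of tensors and coefficients of polynomials differ by multinomial factors
  depending only on the position; such rescalings preserve independence.\<close>

lemma findep_transfer:
  assumes "findep u S" "\<And>x. \<exists>y t. \<forall>i\<in>S. u i x = t * v i y"
  shows "findep v S"
proof (rule findepI)
  fix c i assume c: "\<And>y. (\<Sum>i\<in>S. c i * v i y) = 0" and i: "i \<in> S"
  have "(\<Sum>i\<in>S. c i * u i x) = 0" for x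
  proof -
    obtain y t where "\<forall>i\<in>S. u i x = t * v i y" using assms(2) by blast
    then have "(\<Sum>i\<in>S. c i * u i x) = t * (\<Sum>i\<in>S. c i * v i y)"
      by (simp add: sum_distrib_left mult.left_commute)
    then show ?thesis using c by simp
  qed
  from findepD[OF assms(1) this i] show "c i = 0" .
qed

lemma vidx_card: "card (vidx n e) = (n + e) choose n"
  unfolding midx_card by simp

theorem symmetric_effective:
  assumes k: "is_real_or_complex TYPE('k::field_char_0)"
    and d: "0 < d" and h: "0 < h" and hs: "h \<le> (n + s) choose n" "h > (n + s - 1) choose n"
    and N: "(n + d - s) choose n > h + n"
  defines "I \<equiv> (\<lambda>F. inter_ideal (mons n (d - s)) (deriv_span n s F) (veronese_cone n (d - s)))"
  defines "cond \<equiv> (\<lambda>F :: (nat, 'k) mpoly. lin_pdim (deriv_span n s F) = int h - 1 \<and>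
     scheme_dim (mons n (d - s)) (I F) = 0 \<and> scheme_length (mons n (d - s)) (I F) h)"
  defines "\<Sigma> \<equiv> {F \<in> forms {..n} d. has_rank1_decomp (linear_powers n d) h (Poly_Mapping.lookup F)}"
  shows "(\<forall>F\<in>\<Sigma>. cond F \<longrightarrow> identifiable (linear_powers n d) h (Poly_Mapping.lookup F)) \<and>
    (\<exists>G \<subseteq> \<Sigma>. dense_open_in (zariski (mons n d)) (Poly_Mapping.lookup ` \<Sigma>) (Poly_Mapping.lookup ` G) \<and>
       (\<forall>F\<in>G. cond F))"
proof -
  \<comment> \<open>For \<open>s > d\<close> the truncated difference makes the binomial coefficient
    at most 1: either \<open>n = 0\<close>, or the upper entry falls below \<open>n\<close>.\<close>
  have sd: "s \<le> d"
  proof (rule ccontr)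
    assume "\<not> s \<le> d"
    then have "n = 0 \<or> n + d - s < n" by auto
    then have "(n + d - s) choose n \<le> 1" by (auto simp: binomial_eq_0)
    then show False using N h by simp
  qed
  let ?e = "d - s"
  have "h \<le> card (vidx n s)" using hs(1) by (simp add: vidx_card del: One_nat_def)
  \<comment> \<open>The cardinality is \<open>n\<close> if \<open>d - s\<close> is positive and 0
    otherwise.\<close>
  moreover have "card (ztan 1 (\<lambda>_. n) (\<lambda>_. ?e)) \<le> n"
    by (subst card_tan_idx) auto
  then have "card (ztan 1 (\<lambda>_. n) (\<lambda>_. ?e)) + h + 1 \<le> card (vidx n ?e)"
    using N sd by (simp add: vidx_card del: One_nat_def)
  ultimately obtain v :: "nat \<Rightarrow> nat \<Rightarrow> nat \<Rightarrow> 'k" and m where v: "findep (\<lambda>l. power_tensor 1 (\<lambda>_. n) (\<lambda>_. s) (v l)) {..<h}"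
    "findep (\<lambda>l. power_tensor 1 (\<lambda>_. n) (\<lambda>_. ?e) (v l)) {..<h}" "2 \<le> m"
    "mixed_comb (seg_quad (vidx n ?e)) seg_quadf (\<lambda>l. power_tensor 1 (\<lambda>_. n) (\<lambda>_. ?e) (v l)) h m"
    using generic_points_exist[OF k] by metis
  define w where "w = (\<lambda>l. v l 0)"
  have pt: "power_tensor 1 (\<lambda>_. n) (\<lambda>_. e) (v l) = power_tensor 1 (\<lambda>_. n) (\<lambda>_. e) (\<lambda>_. w l)" for l e
    by (simp add: power_tensor_def w_def fun_eq_iff)
  let ?pa = "\<lambda>w \<alpha>. if \<alpha> \<in> mons n s then fact d / fact ?e * monv \<alpha> w else 0 :: 'k"
  let ?pb = "\<lambda>w. Poly_Mapping.lookup (linform n (w :: nat \<Rightarrow> 'k) ^ ?e)"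
  interpret rank_one_family "mons n s" "mons n ?e" "mons n d" "(+)"
     "\<lambda>\<alpha> \<beta>. mfac (\<alpha> + \<beta>) / mfac \<beta> :: 'k" ?pa ?pb "\<lambda>w. Poly_Mapping.lookup (linform n w ^ d)"
     "linear_powers n d" "veronese_cone n ?e" "\<lambda>u v t j. (1 - t) * u j + t * v j"
     "seg_quad (vidx n ?e)" "ver_quadf n ?e" "ver_coeff n ?e"
    by (rule veronese_family[OF d sd])
  have ia: "findep (\<lambda>l. ?pa (w l)) {..<h}"
  proof (rule findep_transfer[OF v(1)])
    fix J
    show "\<exists>\<alpha> t. \<forall>l\<in>{..<h}. power_tensor 1 (\<lambda>_. n) (\<lambda>_. s) (v l) J = t * ?pa (w l) \<alpha>"
    proof (cases "J \<in> vidx n s")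
      case True
      then show ?thesis using mon_of_mons[OF True]
        by (intro exI[of _ "mon_of n J"] exI[of _ "fact ?e / fact d"]) (simp add: power_tensor_monv w_def del: One_nat_def)
    next
      case False
      then show ?thesis by (intro exI[of _ 0] exI[of _ 0]) (simp add: power_tensor_def)
    qed
  qed
  have ib: "findep (\<lambda>l. ?pb (w l)) {..<h}"
  proof (rule findep_transfer[OF v(2)])
    fix J
    show "\<exists>\<alpha> t. \<forall>l\<in>{..<h}. power_tensor 1 (\<lambda>_. n) (\<lambda>_. ?e) (v l) J = t * ?pb (w l) \<alpha>"
    proof (cases "J \<in> vidx n ?e")
      case True
      show ?thesis unfolding pt linform_power_tensor[OF True, symmetric]
        by (intro exI[of _ "mon_of n J"] exI[of _ "1 / multinom ?e (mon_of n J)"]) simp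
    next
      case False
      then show ?thesis by (intro exI[of _ 0] exI[of _ 0]) (simp add: power_tensor_def)
    qed
  qed
  have mc: "mixed_comb (seg_quad (vidx n ?e)) (ver_quadf n ?e) (\<lambda>l. ?pb (w l)) h m"
    using v(4) unfolding mixed_comb_def pt by (simp add: ver_quadf_comb cong: sum.cong)
  define S' where "S' = {T \<in> coord_space (mons n d). has_rank1_decomp (linear_powers n d) h (T :: _ \<Rightarrow> 'k)}"
  have eff: "\<forall>T\<in>S'. criterion h T \<longrightarrow> identifiable (linear_powers n d) h T"
    "\<exists>G. dense_open_in (zariski (mons n d)) S' G \<and> (\<forall>T\<in>G. criterion h T)"
    using criterion_effective[where ?v1.0 = w, OF h ia ib v(3) mc] unfolding S'_def by blast+
  have forms_space: "Poly_Mapping.lookup F \<in> coord_space (mons n d)" if "F \<in> forms {..n} d" for F :: "(nat, 'k) mpoly"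
    using that by (auto simp: forms_def polys_def coord_space_def mons_def in_keys_iff)
  have S: "S' = Poly_Mapping.lookup ` \<Sigma>"
  proof (intro equalityI subsetI)
    fix T assume T: "T \<in> S'"
    \<comment> \<open>A vector supported on the finitely many monomials of degree \<open>d\<close>
      is the lookup function of a polynomial, so coordinate vectors and forms correspond
      exactly.\<close>
    have "finite {x. T x \<noteq> 0}" using T finite_subset[OF _ finite_mons, of "{x. T x \<noteq> 0}" n d]
      by (auto simp: S'_def coord_space_def)
    then have F: "Poly_Mapping.lookup (Abs_poly_mapping T) = T" by simp
    have "Abs_poly_mapping T \<in> forms {..n} d"
      using T F by (auto simp: forms_def polys_def S'_def coord_space_def mons_def in_keys_iff)
    then have "Abs_poly_mapping T \<in> \<Sigma>" using T F by (simp add: \<Sigma>_def S'_def)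
    then show "T \<in> Poly_Mapping.lookup ` \<Sigma>" using F by (metis imageI)
  next
    fix T assume "T \<in> Poly_Mapping.lookup ` \<Sigma>"
    then show "T \<in> S'" using forms_space by (auto simp: \<Sigma>_def S'_def)
  qed
  have WT_deriv: "WT (Poly_Mapping.lookup F) = deriv_span n s F" if F: "F \<in> forms {..n} d" for F
  proof -
    have "Row (Poly_Mapping.lookup F) \<alpha> = (\<lambda>\<beta>. mfac (\<alpha> + \<beta>) / mfac \<beta> * Poly_Mapping.lookup F (\<alpha> + \<beta>))"
      if \<alpha>: "\<alpha> \<in> mons n s" for \<alpha>
    proof
      fix \<beta>
      \<comment> \<open>\<open>Row\<close> is cut off outside the monomials of degree
        \<open>d - s\<close>; the derivative vanishes there by itself because \<open>F\<close> is a
        form of degree \<open>d\<close>.\<close>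
      have "Poly_Mapping.lookup F (\<alpha> + \<beta>) = 0" if "\<beta> \<notin> mons n ?e"
      proof -
        have "\<alpha> + \<beta> \<notin> mons n d" using mons_addD[of \<beta> \<alpha> n d s] \<alpha> that by (auto simp: add.commute)
        then show ?thesis using forms_space[OF F] by (simp add: coord_space_def)
      qed
      then show "Row (Poly_Mapping.lookup F) \<alpha> \<beta> = mfac (\<alpha> + \<beta>) / mfac \<beta> * Poly_Mapping.lookup F (\<alpha> + \<beta>)"
        by (simp add: Row_def)
    qed
    then show ?thesis unfolding WT_def deriv_span_def partial_derivs_lookup by (simp cong: image_cong)
  qed
  have cond: "criterion h (Poly_Mapping.lookup F) \<longleftrightarrow> cond F" if "F \<in> \<Sigma>" for F
    using that WT_deriv[of F] by (simp add: criterion_def cond_def I_def \<Sigma>_def)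
  have "\<exists>G \<subseteq> \<Sigma>. dense_open_in (zariski (mons n d)) (Poly_Mapping.lookup ` \<Sigma>) (Poly_Mapping.lookup ` G) \<and> (\<forall>F\<in>G. cond F)"
  proof -
    obtain G' where G': "dense_open_in (zariski (mons n d)) S' G'" "\<And>T. T \<in> G' \<Longrightarrow> criterion h T"
      using eff(2) by blast
    have "G' \<subseteq> S'" using G'(1) openin_subset by (fastforce simp: dense_open_in_def)
    define G where "G = {F \<in> \<Sigma>. Poly_Mapping.lookup F \<in> G'}"
    have "Poly_Mapping.lookup ` G = G'" using \<open>G' \<subseteq> S'\<close> unfolding G_def S by blast
    then show ?thesis using G' cond unfolding S by (intro exI[of _ G]) (auto simp: G_def)
  qed
  moreover have "\<forall>F\<in>\<Sigma>. cond F \<longrightarrow> identifiable (linear_powers n d) h (Poly_Mapping.lookup F)"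
    using eff(1) cond unfolding S by blast
  ultimately show ?thesis by blast
qed

theorem proposition3p2:
  assumes k: "is_real_or_complex TYPE('k::field_char_0)"
  shows
    "(\<forall>p n a b d h.
        0 < p \<and> 0 < h \<and> (\<forall>i<p. 0 < d i \<and> a i + b i = d i) \<and>
        h \<le> fvs.dim (dual_space (sym_tensors p n a :: ((nat \<Rightarrow> nat multiset) \<Rightarrow> 'k) set)) \<and>
        ereal (real (\<Prod>i<p. (n i + b i) choose n i)) >
          ereal (real h) + scheme_dim (midx p n b)
            (van_ideal (midx p n b) (segre_veronese_cone p n b :: ((nat \<Rightarrow> nat multiset) \<Rightarrow> 'k) set))
        \<longrightarrow>
        (let \<Sigma> = {T \<in> sym_tensors p n d :: ((nat \<Rightarrow> nat multiset) \<Rightarrow> 'k) set.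
                    has_rank1_decomp (rank1_tensors p n d) h T};
             W = (\<lambda>T. flattening p n a b T ` dual_space (sym_tensors p n a));
             I = (\<lambda>T. inter_ideal (midx p n b) (W T) (segre_veronese_cone p n b));
             cond = (\<lambda>T. lin_pdim (W T) = int h - 1 \<and>
                         scheme_dim (midx p n b) (I T) = 0 \<and>
                         scheme_length (midx p n b) (I T) h)
         in (\<forall>T\<in>\<Sigma>. cond T \<longrightarrow> identifiable (rank1_tensors p n d) h T) \<and>
            (\<exists>G. dense_open_in (zariski (midx p n d)) \<Sigma> G \<and> (\<forall>T\<in>G. cond T))))
     \<and>
     (\<forall>n d s h.
        0 < d \<and> 0 < h \<and>
        (n + s) choose n \<ge> h \<and> h > (n + s - 1) choose n \<and>
        (n + d - s) choose n > h + n
        \<longrightarrow>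
        (let \<Sigma> = {F \<in> forms {..n} d :: (nat, 'k) mpoly set.
                    has_rank1_decomp (linear_powers n d) h (Poly_Mapping.lookup F)};
             I = (\<lambda>F. inter_ideal (mons n (d - s)) (deriv_span n s F) (veronese_cone n (d - s)));
             cond = (\<lambda>F. lin_pdim (deriv_span n s F) = int h - 1 \<and>
                         scheme_dim (mons n (d - s)) (I F) = 0 \<and>
                         scheme_length (mons n (d - s)) (I F) h)
         in (\<forall>F\<in>\<Sigma>. cond F \<longrightarrow> identifiable (linear_powers n d) h (Poly_Mapping.lookup F)) \<and>
            (\<exists>G \<subseteq> \<Sigma>. dense_open_in (zariski (mons n d)) (Poly_Mapping.lookup ` \<Sigma>)
                        (Poly_Mapping.lookup ` G) \<and> (\<forall>F\<in>G. cond F))))"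
proof -
  have mixed: "let \<Sigma> = {T \<in> sym_tensors p n d :: ((nat \<Rightarrow> nat multiset) \<Rightarrow> 'k) set.
                    has_rank1_decomp (rank1_tensors p n d) h T};
             W = (\<lambda>T. flattening p n a b T ` dual_space (sym_tensors p n a));
             I = (\<lambda>T. inter_ideal (midx p n b) (W T) (segre_veronese_cone p n b));
             cond = (\<lambda>T. lin_pdim (W T) = int h - 1 \<and>
                         scheme_dim (midx p n b) (I T) = 0 \<and>
                         scheme_length (midx p n b) (I T) h)
         in (\<forall>T\<in>\<Sigma>. cond T \<longrightarrow> identifiable (rank1_tensors p n d) h T) \<and>
            (\<exists>G. dense_open_in (zariski (midx p n d)) \<Sigma> G \<and> (\<forall>T\<in>G. cond T))"
    if "0 < p \<and> 0 < h \<and> (\<forall>i<p. 0 < d i \<and> a i + b i = d i) \<and>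
        h \<le> fvs.dim (dual_space (sym_tensors p n a :: ((nat \<Rightarrow> nat multiset) \<Rightarrow> 'k) set)) \<and>
        ereal (real (\<Prod>i<p. (n i + b i) choose n i)) >
          ereal (real h) + scheme_dim (midx p n b)
            (van_ideal (midx p n b) (segre_veronese_cone p n b :: ((nat \<Rightarrow> nat multiset) \<Rightarrow> 'k) set))"
    for p n a b d h
    unfolding Let_def by (rule mixed_symmetric_effective[OF k]) (use that in auto)
  have symmetric: "let \<Sigma> = {F \<in> forms {..n} d :: (nat, 'k) mpoly set.
                    has_rank1_decomp (linear_powers n d) h (Poly_Mapping.lookup F)};
             I = (\<lambda>F. inter_ideal (mons n (d - s)) (deriv_span n s F) (veronese_cone n (d - s)));
             cond = (\<lambda>F. lin_pdim (deriv_span n s F) = int h - 1 \<and>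
                         scheme_dim (mons n (d - s)) (I F) = 0 \<and>
                         scheme_length (mons n (d - s)) (I F) h)
         in (\<forall>F\<in>\<Sigma>. cond F \<longrightarrow> identifiable (linear_powers n d) h (Poly_Mapping.lookup F)) \<and>
            (\<exists>G \<subseteq> \<Sigma>. dense_open_in (zariski (mons n d)) (Poly_Mapping.lookup ` \<Sigma>)
                        (Poly_Mapping.lookup ` G) \<and> (\<forall>F\<in>G. cond F))"
    if "0 < d \<and> 0 < h \<and> (n + s) choose n \<ge> h \<and> h > (n + s - 1) choose n \<and> (n + d - s) choose n > h + n"
    for n d s h
    unfolding Let_def by (rule symmetric_effective[OF k]) (use that in auto)
  show ?thesis using mixed symmetric by blast
qed

end
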